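(* Let $N$ be a positive integer, let $Q=(-1/2,1/2)^N\subset\mathbb{R}^N$, let $p>1$, and let $A,B\in\mathbb{R}^{N\times N}$. Then $$\inf\left\{\int_{J(u)}|[u](x)\cdot\nu(x)|\,d\mathcal{H}^{N-1}(x)\;:\;u\in SBV(Q;\mathbb{R}^N),\ u=0\text{ on }\partial Q,\ \nabla u=B-A\ \text{a.e. in }Q\right\}\le|\operatorname{tr}(A-B)|,$$ and consequently the following two infima both equal $|\operatorname{tr}(A-B)|$: $$\inf\left\{\int_{J(u)}|[u](x)\cdot\nu(x)|\,d\mathcal{H}^{N-1}(x)\;:\;u\in SBV(Q;\mathbb{R}^N),\ u(x)=Ax\text{ on }\partial Q,\ \nabla u\in L^p(Q;\mathbb{R}^{N\times N}),\ \int_Q\nabla u\,d\mathcal{L}^N=B\right\}$$ $$=\inf\left\{\int_{J(u)}|[u](x)\cdot\nu(x)|\,d\mathcal{H}^{N-1}(x)\;:\;u\in SBV(Q;\mathbb{R}^N),\ u=0\text{ on }\partial Q,\ \nabla u=B-A\ \text{a.e. in }Q\right\}=|\operatorname{tr}(A-B)|.$$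
   Context: $SBV(Q;\mathbb{R}^N)$ is the space of special functions of bounded variation on $Q$ with values in $\mathbb{R}^N$: functions $u\in BV(Q;\mathbb{R}^N)$ whose distributional derivative has zero Cantor part, so that $Du=\nabla u\,\mathcal{L}^N+[u]\otimes\nu\,\mathcal{H}^{N-1}\llcorner J(u)$. Here $\nabla u$ is the density of the absolutely continuous part of $Du$ with respect to the $N$-dimensional Lebesgue measure $\mathcal{L}^N$, $J(u)\subset Q$ is the jump set of $u$, $[u]$ is the jump of $u$ across $J(u)$, $\nu$ is the unit normal to $J(u)$ (the quantity $|[u]\cdot\nu|$ does not depend on the choice of orientation), and $\mathcal{H}^{N-1}$ is the $(N-1)$-dimensional Hausdorff measure. Boundary conditions on $\partial Q$ are understood in the sense of traces of $BV$ functions. $\operatorname{tr}$ denotes the trace of a matrix. *)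

theory Defs
  imports "HOL-Analysis.Analysis"
begin

section \<open>Hausdorff measure\<close>

text \<open>
  The contribution of one covering set. The separate case of the empty set matters only for
  \<open>k = 0\<close>: a nonempty set counts \<open>1\<close> there (by \<open>0 ^ 0 = 1\<close>), so that \<open>0\<close>-dimensional Hausdorff
  measure is the counting measure.
\<close>

definition hausdorff_weight :: "nat \<Rightarrow> 'a::metric_space set \<Rightarrow> ennreal" where
  "hausdorff_weight k C =
     (if C = {} then 0 else ennreal (unit_ball_vol (real k) * (diameter C / 2) ^ k))"

definition hausdorff_pre :: "nat \<Rightarrow> real \<Rightarrow> 'a::metric_space set \<Rightarrow> ennreal" where
  "hausdorff_pre k \<delta> E =
     (INF C \<in> {C :: nat \<Rightarrow> 'a set. E \<subseteq> (\<Union>i. C i) \<and> (\<forall>i. bounded (C i) \<and> diameter (C i) \<le> \<delta>)}.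
        \<Sum>i. hausdorff_weight k (C i))"

definition hausdorff_outer :: "nat \<Rightarrow> 'a::metric_space set \<Rightarrow> ennreal" where
  "hausdorff_outer k E = (SUP \<delta>\<in>{0<..}. hausdorff_pre k \<delta> E)"

definition hausdorff_measure :: "nat \<Rightarrow> 'a::metric_space measure" where
  "hausdorff_measure k = measure_of UNIV (sets borel) (hausdorff_outer k)"

text \<open>
  The remainder of this section shows that \<open>hausdorff_outer k\<close> is countably additive on the Borel
  sets, so that \<open>measure_of\<close> does not fall back to the zero measure.
\<close>

lemma hausdorff_weight_mono:
  assumes "C \<subseteq> C'" "bounded C'"
  shows "hausdorff_weight k C \<le> hausdorff_weight k C'"
proof (cases "C = {}")
  case False
  then have "C' \<noteq> {}" using assms by auto
  moreover have "diameter C \<le> diameter C'" using assms diameter_subset by blast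
  moreover have "0 \<le> diameter C" using assms bounded_subset diameter_ge_0 by blast
  ultimately show ?thesis using False unfolding hausdorff_weight_def
    by (auto intro!: ennreal_leI mult_left_mono power_mono divide_right_mono)
qed (simp add: hausdorff_weight_def)

lemma hausdorff_pre_le:
  assumes "E \<subseteq> (\<Union>i. C i)" "\<And>i. bounded (C i)" "\<And>i. diameter (C i) \<le> \<delta>"
  shows "hausdorff_pre k \<delta> E \<le> (\<Sum>i. hausdorff_weight k (C i))"
  unfolding hausdorff_pre_def using assms by (intro INF_lower) auto

lemma hausdorff_pre_antimono:
  assumes "\<delta> \<le> \<delta>'"
  shows "hausdorff_pre k \<delta>' E \<le> hausdorff_pre k \<delta> E"
  unfolding hausdorff_pre_def
proof (rule INF_superset_mono[OF _ order_refl])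
  show "{C. E \<subseteq> (\<Union>i. C i) \<and> (\<forall>i. bounded (C i) \<and> diameter (C i) \<le> \<delta>)}
      \<subseteq> {C. E \<subseteq> (\<Union>i. C i) \<and> (\<forall>i. bounded (C i) \<and> diameter (C i) \<le> \<delta>')}"
    using assms order_trans by blast
qed

lemma hausdorff_pre_mono:
  assumes "E \<subseteq> F"
  shows "hausdorff_pre k \<delta> E \<le> hausdorff_pre k \<delta> F"
  unfolding hausdorff_pre_def using assms by (intro INF_superset_mono) force+

lemma hausdorff_pre_empty: "\<delta> > 0 \<Longrightarrow> hausdorff_pre k \<delta> {} = 0"
  using hausdorff_pre_le[of "{}" "\<lambda>_. {}" \<delta> k] by (simp add: hausdorff_weight_def)

lemma hausdorff_pre_subadd:
  "hausdorff_pre k \<delta> (\<Union>i. A i) \<le> (\<Sum>n. hausdorff_pre k \<delta> (A n))"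
proof (rule ennreal_le_epsilon)
  let ?O = "hausdorff_pre k \<delta>"
  fix e :: real assume "0 < e" "(\<Sum>n. ?O (A n)) < top"
  then have *: "\<And>n. ?O (A n) < ?O (A n) + e * (1/2)^Suc n"
    by (auto simp add: less_top dest!: ennreal_suminf_lessD)
  have "\<exists>B. A n \<subseteq> (\<Union>i. B i) \<and> (\<forall>i. bounded (B i) \<and> diameter (B i) \<le> \<delta>) \<and>
          (\<Sum>i. hausdorff_weight k (B i)) \<le> ?O (A n) + e * (1/2)^(Suc n)" for n
    using *[of n] unfolding hausdorff_pre_def INF_less_iff by (auto intro: less_imp_le)
  then obtain B where sbB: "\<And>n. A n \<subseteq> (\<Union>i. B n i)"
      and B: "\<And>n i. bounded (B n i)" "\<And>n i. diameter (B n i) \<le> \<delta>"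
      and Ble: "\<And>n. (\<Sum>i. hausdorff_weight k (B n i)) \<le> ?O (A n) + e * (1/2)^(Suc n)"
    by metis
  define C where "C = case_prod B o prod_decode"
  have A_C: "(\<Union>i. A i) \<subseteq> (\<Union>i. C i)"
    using sbB by (auto simp add: C_def subset_eq) (metis prod.case prod_encode_inverse)
  have "?O (\<Union>i. A i) \<le> (\<Sum>i. hausdorff_weight k (C i))"
    using A_C B by (intro hausdorff_pre_le) (auto simp: C_def split: prod.splits)
  also have "\<dots> = (\<Sum>n. \<Sum>i. hausdorff_weight k (B n i))"
    unfolding C_def comp_def
    by (rule suminf_ennreal_2dimen[where f="\<lambda>x. hausdorff_weight k (case_prod B x)"]) auto
  also have "\<dots> \<le> (\<Sum>n. ?O (A n) + e * (1/2) ^ Suc n)"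
    by (intro suminf_le allI Ble) auto
  also have "... = (\<Sum>n. ?O (A n)) + (\<Sum>n. ennreal e * ennreal ((1/2) ^ Suc n))"
    using \<open>0 < e\<close> by (subst suminf_add[symmetric])
                     (auto simp del: ennreal_suminf_cmult simp add: ennreal_mult[symmetric])
  also have "\<dots> = (\<Sum>n. ?O (A n)) + e"
    unfolding ennreal_suminf_cmult
    by (subst suminf_ennreal_eq[OF zero_le_power power_half_series]) auto
  finally show "?O (\<Union>i. A i) \<le> (\<Sum>n. ?O (A n)) + e" .
qed

lemma hausdorff_outer_empty [simp]: "hausdorff_outer k {} = 0"
  unfolding hausdorff_outer_def by (auto simp: hausdorff_pre_empty)

lemma hausdorff_outer_mono: "E \<subseteq> F \<Longrightarrow> hausdorff_outer k E \<le> hausdorff_outer k F"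
  unfolding hausdorff_outer_def by (intro SUP_mono) (auto intro: hausdorff_pre_mono)

lemma hausdorff_outer_subadd:
  "hausdorff_outer k (\<Union>i. A i) \<le> (\<Sum>n. hausdorff_outer k (A n))"
  unfolding hausdorff_outer_def[of k "\<Union>i. A i"]
proof (rule SUP_least)
  fix \<delta> :: real assume "\<delta> \<in> {0<..}"
  then have "hausdorff_pre k \<delta> (A n) \<le> hausdorff_outer k (A n)" for n
    unfolding hausdorff_outer_def by (rule SUP_upper)
  then show "hausdorff_pre k \<delta> (\<Union>i. A i) \<le> (\<Sum>n. hausdorff_outer k (A n))"
    by (intro order_trans[OF hausdorff_pre_subadd] suminf_le) auto
qed

lemma hausdorff_outer_Un_le:
  "hausdorff_outer k (S \<union> T) \<le> hausdorff_outer k S + hausdorff_outer k T"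
proof -
  let ?A = "\<lambda>i::nat. if i = 0 then S else if i = 1 then T else {}"
  have "S \<union> T \<subseteq> (\<Union>i. ?A i)"
    by (auto split: if_splits intro: exI[of _ 0] exI[of _ 1])
  then have "hausdorff_outer k (S \<union> T) \<le> (\<Sum>i. hausdorff_outer k (?A i))"
    by (rule order_trans[OF hausdorff_outer_mono hausdorff_outer_subadd])
  also have "\<dots> = (\<Sum>i\<in>{0,1}. hausdorff_outer k (?A i))"
    by (rule suminf_finite) auto
  finally show ?thesis by simp
qed

lemma hausdorff_pre_separated:
  assumes d: "\<And>x y. x \<in> S \<Longrightarrow> y \<in> T \<Longrightarrow> dist x y > \<delta>"
  shows "hausdorff_pre k \<delta> S + hausdorff_pre k \<delta> T \<le> hausdorff_pre k \<delta> (S \<union> T)"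
  unfolding hausdorff_pre_def[of k \<delta> "S \<union> T"]
proof (rule INF_greatest, clarify)
  fix C :: "nat \<Rightarrow> 'a set"
  assume C: "S \<union> T \<subseteq> (\<Union>i. C i)" "\<forall>i. bounded (C i) \<and> diameter (C i) \<le> \<delta>"
  have sub: "hausdorff_pre k \<delta> X \<le> (\<Sum>i. hausdorff_weight k (C i \<inter> X))" if "X \<subseteq> S \<union> T" for X
  proof (rule hausdorff_pre_le)
    show "bounded (C i \<inter> X)" for i using C bounded_subset by blast
    show "diameter (C i \<inter> X) \<le> \<delta>" for i
      using C by (meson diameter_subset inf_le1 order_trans)
  qed (use C that in auto)
  have "hausdorff_pre k \<delta> S + hausdorff_pre k \<delta> T
      \<le> (\<Sum>i. hausdorff_weight k (C i \<inter> S)) + (\<Sum>i. hausdorff_weight k (C i \<inter> T))"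
    by (intro add_mono sub) auto
  also have "\<dots> = (\<Sum>i. hausdorff_weight k (C i \<inter> S) + hausdorff_weight k (C i \<inter> T))"
    by (rule suminf_add) auto
  also have "\<dots> \<le> (\<Sum>i. hausdorff_weight k (C i))"
  proof (rule suminf_le)
    fix i
    have "C i \<inter> S = {} \<or> C i \<inter> T = {}"
    proof (rule ccontr)
      assume "\<not> ?thesis"
      then obtain x y where xy: "x \<in> C i" "x \<in> S" "y \<in> C i" "y \<in> T" by auto
      then have "dist x y \<le> diameter (C i)" using C diameter_bounded_bound by blast
      also have "\<dots> \<le> \<delta>" using C by auto
      finally show False using d xy by force
    qed
    then show "hausdorff_weight k (C i \<inter> S) + hausdorff_weight k (C i \<inter> T) \<le> hausdorff_weight k (C i)"
      using hausdorff_weight_mono[of "C i \<inter> S" "C i" k] hausdorff_weight_mono[of "C i \<inter> T" "C i" k] C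
      by (auto simp: hausdorff_weight_def[of k "{}"])
  qed auto
  finally show "hausdorff_pre k \<delta> S + hausdorff_pre k \<delta> T \<le> (\<Sum>i. hausdorff_weight k (C i))" .
qed

lemma ennreal_SUP_add_le:
  fixes f g :: "'b \<Rightarrow> ennreal"
  assumes "I \<noteq> {}" and le: "\<And>x y. x \<in> I \<Longrightarrow> y \<in> I \<Longrightarrow> f x + g y \<le> c"
  shows "(SUP x\<in>I. f x) + (SUP y\<in>I. g y) \<le> c"
proof -
  have "(SUP x\<in>I. f x) + g y = (SUP x\<in>I. f x + g y)" for y
    using ennreal_SUP_add_left[OF \<open>I \<noteq> {}\<close>] by simp
  then have 1: "(SUP x\<in>I. f x) + g y \<le> c" if "y \<in> I" for y
    using le that by (simp add: SUP_le_iff)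
  have "(SUP x\<in>I. f x) + (SUP y\<in>I. g y) = (SUP y\<in>I. (SUP x\<in>I. f x) + g y)"
    using ennreal_SUP_add_right[OF \<open>I \<noteq> {}\<close>] by simp
  then show ?thesis using 1 by (simp add: SUP_le_iff)
qed

lemma hausdorff_outer_separated:
  assumes "d > 0" and d: "\<And>x y. x \<in> S \<Longrightarrow> y \<in> T \<Longrightarrow> dist x y \<ge> d"
  shows "hausdorff_outer k (S \<union> T) = hausdorff_outer k S + hausdorff_outer k T"
proof (rule antisym[OF hausdorff_outer_Un_le])
  have "hausdorff_pre k \<delta> S + hausdorff_pre k \<delta>' T \<le> hausdorff_outer k (S \<union> T)"
    if "\<delta> > 0" "\<delta>' > 0" for \<delta> \<delta>'
  proof -
    define e where "e = min (d/2) (min \<delta> \<delta>')"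
    have e: "e > 0" "e \<le> \<delta>" "e \<le> \<delta>'" "e < d" using that \<open>d > 0\<close> by (auto simp: e_def)
    have "hausdorff_pre k \<delta> S + hausdorff_pre k \<delta>' T \<le> hausdorff_pre k e S + hausdorff_pre k e T"
      using e by (intro add_mono hausdorff_pre_antimono)
    also have "\<dots> \<le> hausdorff_pre k e (S \<union> T)"
      using d e by (intro hausdorff_pre_separated) force
    also have "\<dots> \<le> hausdorff_outer k (S \<union> T)"
      unfolding hausdorff_outer_def using e by (intro SUP_upper) auto
    finally show ?thesis .
  qed
  then show "hausdorff_outer k S + hausdorff_outer k T \<le> hausdorff_outer k (S \<union> T)"
    unfolding hausdorff_outer_def[of k S] hausdorff_outer_def[of k T]
    by (intro ennreal_SUP_add_le) auto
qed

lemma hausdorff_outer_sum_separated: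
  fixes R :: "nat \<Rightarrow> 'a::metric_space set"
  assumes "\<And>n. \<exists>d>0. \<forall>m<n. \<forall>x\<in>R m. \<forall>y\<in>R n. dist x y \<ge> d"
  shows "(\<Sum>i. hausdorff_outer k (R i)) \<le> hausdorff_outer k (\<Union>i. R i)"
proof (rule suminf_le_const[OF summableI])
  fix n
  have "(\<Sum>i<n. hausdorff_outer k (R i)) = hausdorff_outer k (\<Union>i<n. R i)"
  proof (induction n)
    case (Suc n)
    obtain d where d: "d > 0" "\<And>m x y. m < n \<Longrightarrow> x \<in> R m \<Longrightarrow> y \<in> R n \<Longrightarrow> dist x y \<ge> d"
      using assms[of n] by metis
    have "hausdorff_outer k ((\<Union>i<n. R i) \<union> R n) = hausdorff_outer k (\<Union>i<n. R i) + hausdorff_outer k (R n)"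
      by (rule hausdorff_outer_separated[OF d(1)]) (auto intro: d(2))
    moreover have "(\<Union>i<n. R i) \<union> R n = (\<Union>i<Suc n. R i)"
      by (auto simp: less_Suc_eq)
    ultimately show ?case by (simp only: sum.lessThan_Suc Suc.IH)
  qed simp
  also have "\<dots> \<le> hausdorff_outer k (\<Union>i. R i)" by (intro hausdorff_outer_mono) auto
  finally show "(\<Sum>i<n. hausdorff_outer k (R i)) \<le> hausdorff_outer k (\<Union>i. R i)" .
qed

lemma hausdorff_outer_closed_split:
  fixes F :: "'a::metric_space set"
  assumes F: "closed F"
  shows "hausdorff_outer k (A \<inter> F) + hausdorff_outer k (A - F) \<le> hausdorff_outer k A"
proof (cases "F = {} \<or> hausdorff_outer k A = \<infinity>")
  case True then show ?thesis by auto
next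
  case False
  let ?\<mu> = "hausdorff_outer k"
  have F0: "F \<noteq> {}" and fin: "?\<mu> A < \<infinity>" using False by (auto simp: less_top)
  define S where "S n = {x \<in> A. infdist x F \<ge> 1 / real (Suc n)}" for n
  define R where "R n = {x \<in> A. 1 / real (Suc (Suc n)) \<le> infdist x F \<and> infdist x F < 1 / real (Suc n)}" for n
  have tri: "infdist x F \<le> infdist y F + dist x y" for x y
    by (simp add: infdist_triangle)
  have sepR: "\<exists>d>0. \<forall>m<n. \<forall>x\<in>R (2*m + p). \<forall>y\<in>R (2*n + p). dist x y \<ge> d" for n p
  proof (cases n)
    case (Suc n')
    define q where "q = 2*n + p"
    have q: "q > 0" by (simp add: q_def Suc)
    have "dist x y \<ge> 1 / real q - 1 / real (Suc q)" if "m < n" "x \<in> R (2*m + p)" "y \<in> R q" for m x y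
    proof -
      have "1 / real q \<le> 1 / real (Suc (Suc (2*m + p)))"
        using q \<open>m < n\<close> by (intro divide_left_mono) (auto simp: q_def)
      then show ?thesis using that(2,3) tri[of x y] by (auto simp: R_def)
    qed
    moreover have "1 / real q - 1 / real (Suc q) > 0"
      using q by (simp add: frac_less2)
    ultimately show ?thesis unfolding q_def by blast
  qed (auto intro: exI[of _ 1])
  have RA: "(\<Sum>m. ?\<mu> (R (2*m + p))) \<le> ?\<mu> A" for p
  proof -
    have "(\<Sum>m. ?\<mu> (R (2*m + p))) \<le> ?\<mu> (\<Union>m. R (2*m + p))"
      by (rule hausdorff_outer_sum_separated[OF sepR])
    also have "\<dots> \<le> ?\<mu> A" by (rule hausdorff_outer_mono) (auto simp: R_def)
    finally show ?thesis .
  qed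
  have "(\<Sum>i. ?\<mu> (R i)) \<le> ?\<mu> A + ?\<mu> A"
  proof (rule suminf_le_const[OF summableI])
    fix n
    have "(\<Sum>i<n. ?\<mu> (R i)) \<le> (\<Sum>i<2*n. ?\<mu> (R i))" by (intro sum_mono2) auto
    also have "\<dots> = (\<Sum>m<n. ?\<mu> (R (2*m + 0))) + (\<Sum>m<n. ?\<mu> (R (2*m + 1)))"
      by (induction n) (auto simp: algebra_simps)
    also have "\<dots> \<le> (\<Sum>m. ?\<mu> (R (2*m + 0))) + (\<Sum>m. ?\<mu> (R (2*m + 1)))"
      by (intro add_mono sum_le_suminf) auto
    also have "\<dots> \<le> ?\<mu> A + ?\<mu> A" by (intro add_mono RA)
    finally show "(\<Sum>i<n. ?\<mu> (R i)) \<le> ?\<mu> A + ?\<mu> A" .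
  qed
  also have "\<dots> < top" using fin by simp
  finally have sumfin: "(\<Sum>i. ?\<mu> (R i)) < top" .
  define r where "r i = enn2real (?\<mu> (R i))" for i
  have r: "?\<mu> (R i) = ennreal (r i)" "r i \<ge> 0" for i
    using ennreal_suminf_lessD[OF sumfin, of i] by (auto simp: r_def)
  have summ: "summable r"
    using sumfin r by (intro summable_suminf_not_top) auto
  show ?thesis
  proof (rule ennreal_le_epsilon)
    fix e :: real assume e: "e > 0"
    obtain n where n: "norm (\<Sum>i. r (i + n)) < e"
      using suminf_exist_split[OF e summ] by blast
    have "(\<Sum>i. ?\<mu> (R (i + n))) = ennreal (\<Sum>i. r (i + n))"
      using r summ by (simp add: suminf_ennreal2 summable_ignore_initial_segment)
    also have "\<dots> \<le> e" using n by (intro ennreal_leI) auto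
    finally have tail: "(\<Sum>i. ?\<mu> (R (i + n))) \<le> e" .
    have "A - F \<subseteq> S n \<union> (\<Union>i. R (i + n))"
    proof
      fix x assume x: "x \<in> A - F"
      then have pos: "infdist x F > 0"
        using F F0 by (simp add: infdist_pos_not_in_closed)
      show "x \<in> S n \<union> (\<Union>i. R (i + n))"
      proof (cases "1 / real (Suc n) \<le> infdist x F")
        case True then show ?thesis using x by (auto simp: S_def)
      next
        case False
        define P where "P j \<longleftrightarrow> 1 / real (Suc j) \<le> infdist x F" for j
        obtain j0 where "P j0" using nat_approx_posE[OF pos] unfolding P_def by (metis less_imp_le)
        define j where "j = (LEAST j. P j)"
        have Pj: "P j" unfolding j_def by (rule LeastI[of P, OF \<open>P j0\<close>])
        have nj: "n < j"
        proof (rule ccontr)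
          assume "\<not> n < j"
          then have "1 / real (Suc n) \<le> 1 / real (Suc j)" by (intro divide_left_mono) auto
          then show False using Pj False by (simp add: P_def)
        qed
        then have "\<not> P (j - 1)" unfolding j_def by (intro not_less_Least) auto
        then have "x \<in> R ((j - 1 - n) + n)"
          using x Pj nj by (auto simp: R_def P_def)
        then show ?thesis by blast
      qed
    qed
    then have "?\<mu> (A - F) \<le> ?\<mu> (S n) + ?\<mu> (\<Union>i. R (i + n))"
      by (meson hausdorff_outer_mono hausdorff_outer_Un_le order_trans)
    also have "\<dots> \<le> ?\<mu> (S n) + e"
      by (intro add_left_mono order_trans[OF hausdorff_outer_subadd tail])
    finally have "?\<mu> (A \<inter> F) + ?\<mu> (A - F) \<le> (?\<mu> (A \<inter> F) + ?\<mu> (S n)) + e"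
      by (simp add: add.assoc add_left_mono)
    also have "?\<mu> (A \<inter> F) + ?\<mu> (S n) = ?\<mu> ((A \<inter> F) \<union> S n)"
    proof (rule hausdorff_outer_separated[symmetric])
      show "1 / real (Suc n) \<le> dist x y" if "x \<in> A \<inter> F" "y \<in> S n" for x y
        using that tri[of y x] by (auto simp: S_def dist_commute)
    qed auto
    also have "?\<mu> ((A \<inter> F) \<union> S n) \<le> ?\<mu> A"
      by (rule hausdorff_outer_mono) (auto simp: S_def)
    finally show "?\<mu> (A \<inter> F) + ?\<mu> (A - F) \<le> ?\<mu> A + e" by (simp add: add_right_mono)
  qed
qed

lemma measure_space_hausdorff_outer:
  "measure_space UNIV (sets borel) (hausdorff_outer k :: 'a::metric_space set \<Rightarrow> ennreal)"
proof -
  let ?\<mu> = "hausdorff_outer k :: 'a set \<Rightarrow> ennreal"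
  let ?L = "lambda_system UNIV UNIV ?\<mu>"
  interpret P: sigma_algebra "UNIV :: 'a set" UNIV
    using sigma_algebra_Pow[of "UNIV :: 'a set"] unfolding Pow_UNIV .
  have "outer_measure_space UNIV ?\<mu>"
    unfolding outer_measure_space_def positive_def increasing_def countably_subadditive_def
    by (simp add: hausdorff_outer_mono hausdorff_outer_subadd)
  then have ms: "measure_space UNIV ?L ?\<mu>"
    by (rule P.caratheodory_lemma)
  then interpret L: sigma_algebra UNIV ?L by (simp add: measure_space_def)
  have "F \<in> ?L" if "closed F" for F
  proof -
    have "?\<mu> (x \<inter> F) + ?\<mu> (x - F) = ?\<mu> x" for x
      using hausdorff_outer_closed_split[OF that, of k x]
        hausdorff_outer_Un_le[of k "x \<inter> F" "x - F"]
      by (intro antisym) (simp_all only: Int_Diff_Un)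
    then show ?thesis unfolding P.lambda_system_eq by blast
  qed
  then have "sigma_sets UNIV (Collect closed) \<subseteq> ?L"
    by (intro L.sigma_sets_subset) auto
  then have "sets borel \<subseteq> ?L"
    by (simp add: borel_eq_closed)
  moreover have "sigma_algebra (UNIV :: 'a set) (sets borel)"
    using sets.sigma_algebra_axioms[of "borel :: 'a measure"] unfolding space_borel .
  ultimately show ?thesis
    using ms unfolding measure_space_def positive_def countably_additive_def
    by (meson order_trans subsetD)
qed

lemma space_hausdorff_measure [simp]: "space (hausdorff_measure k :: 'a::metric_space measure) = UNIV"
  and sets_hausdorff_measure [simp, measurable_cong]: "sets (hausdorff_measure k :: 'a measure) = sets borel"
proof -
  have "sigma_sets UNIV (sets (borel :: 'a measure)) = sets borel"
    using sets.sigma_sets_eq[of "borel :: 'a measure"] unfolding space_borel .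
  then show "space (hausdorff_measure k :: 'a measure) = UNIV"
    and "sets (hausdorff_measure k :: 'a measure) = sets borel"
    unfolding hausdorff_measure_def space_measure_of_conv sets_measure_of_conv by simp_all
qed

lemma emeasure_hausdorff_measure:
  assumes "E \<in> sets borel"
  shows "emeasure (hausdorff_measure k) E = hausdorff_outer k E"
proof -
  note ms = measure_space_hausdorff_outer[of k, unfolded measure_space_def]
  show ?thesis
    unfolding hausdorff_measure_def
    by (rule emeasure_measure_of_sigma[OF ms[THEN conjunct1] ms[THEN conjunct2, THEN conjunct1]
        ms[THEN conjunct2, THEN conjunct2] assms])
qed

section \<open>Functions of bounded variation\<close>

text \<open>Throughout, the entry \<open>$ i $ j\<close> of a derivative belongs to the \<open>j\<close>-th partial derivative of the
  \<open>i\<close>-th component.\<close>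

definition test_functions :: "(real^'n) set \<Rightarrow> (real^'n \<Rightarrow> real) set" where
  "test_functions Q =
     {\<phi>. (\<forall>x. \<phi> differentiable (at x)) \<and>
         (\<forall>j. continuous_on UNIV (\<lambda>x. frechet_derivative \<phi> (at x) (axis j 1))) \<and>
         (\<exists>K. compact K \<and> K \<subseteq> Q \<and> (\<forall>x. x \<notin> K \<longrightarrow> \<phi> x = 0))}"

text \<open>
  A finite matrix-valued measure on \<open>Q\<close> is given as \<open>E \<mapsto> \<integral>\<^sub>E \<sigma> dM\<close> with a finite positive Borel
  measure \<open>M\<close> on \<open>Q\<close> and an \<open>M\<close>-integrable matrix field \<open>\<sigma>\<close> (every such measure has this form, with
  \<open>M\<close> its total variation).
\<close>

definition has_distributional_derivative ::
  "(real^'n) set \<Rightarrow> (real^'n \<Rightarrow> real^'m) \<Rightarrow> ((real^'n) set \<Rightarrow> real^'n^'m) \<Rightarrow> bool" where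
  "has_distributional_derivative Q u D \<longleftrightarrow>
     (\<exists>(M::(real^'n) measure) (\<sigma>::real^'n \<Rightarrow> real^'n^'m).
        finite_measure M \<and> sets M = sets (restrict_space borel Q) \<and> integrable M \<sigma> \<and>
        (\<forall>E\<in>sets M. D E = (LINT x:E|M. \<sigma> x)) \<and>
        (\<forall>\<phi>\<in>test_functions Q. \<forall>i j.
           (LINT x:Q|lebesgue. u x $ i * frechet_derivative \<phi> (at x) (axis j 1))
             = - (LINT x|M. \<phi> x * \<sigma> x $ i $ j)))"

definition BV :: "(real^'n) set \<Rightarrow> (real^'n \<Rightarrow> real^'m) set" where
  "BV Q = {u. set_integrable lebesgue Q u \<and> (\<exists>D. has_distributional_derivative Q u D)}"

definition distr_deriv ::
  "(real^'n) set \<Rightarrow> (real^'n \<Rightarrow> real^'m) \<Rightarrow> (real^'n) set \<Rightarrow> real^'n^'m" where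
  "distr_deriv Q u = (SOME D. has_distributional_derivative Q u D)"

text \<open>
  The density of the absolutely continuous part in the Lebesgue decomposition of \<open>distr_deriv Q u\<close>;
  the singular part is the restriction of \<open>distr_deriv Q u\<close> to the null set \<open>Z\<close>.
\<close>

definition ac_gradient :: "(real^'n) set \<Rightarrow> (real^'n \<Rightarrow> real^'m) \<Rightarrow> real^'n \<Rightarrow> real^'n^'m" where
  "ac_gradient Q u =
     (SOME G. set_integrable lebesgue Q G \<and>
        (\<exists>Z\<in>null_sets lborel. \<forall>E\<in>sets borel. E \<subseteq> Q - Z \<longrightarrow>
           distr_deriv Q u E = (LINT x:E|lebesgue. G x)))"

section \<open>Jump set, special functions of bounded variation, traces\<close>

definition half_ball :: "'a::euclidean_space \<Rightarrow> real \<Rightarrow> 'a \<Rightarrow> 'a set" where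
  "half_ball x r \<nu> = {y \<in> ball x r. (y - x) \<bullet> \<nu> > 0}"

definition one_sided_limit ::
  "('a::euclidean_space \<Rightarrow> 'b::euclidean_space) \<Rightarrow> 'a \<Rightarrow> 'a \<Rightarrow> 'b \<Rightarrow> bool" where
  "one_sided_limit u x \<nu> a \<longleftrightarrow>
     ((\<lambda>r. (LINT y:half_ball x r \<nu>|lebesgue. norm (u y - a)) / measure lebesgue (half_ball x r \<nu>))
        \<longlongrightarrow> 0) (at_right 0)"

definition is_jump_triple ::
  "('a::euclidean_space \<Rightarrow> 'b::euclidean_space) \<Rightarrow> 'a \<Rightarrow> 'b \<times> 'b \<times> 'a \<Rightarrow> bool" where
  "is_jump_triple u x = (\<lambda>(a, b, \<nu>).
     a \<noteq> b \<and> norm \<nu> = 1 \<and> one_sided_limit u x \<nu> a \<and> one_sided_limit u x (- \<nu>) b)"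

definition jump_set ::
  "'a set \<Rightarrow> ('a::euclidean_space \<Rightarrow> 'b::euclidean_space) \<Rightarrow> 'a set" where
  "jump_set Q u = {x \<in> Q. \<exists>t. is_jump_triple u x t}"

text \<open>
  The triple is unique up to exchanging \<open>(a, b, \<nu>)\<close> with \<open>(b, a, - \<nu>)\<close>. Jump and normal are read off
  from the same choice, so \<open>[u] \<otimes> \<nu>\<close> and \<open>|[u] \<bullet> \<nu>|\<close> do not depend on it.
\<close>

definition jump_triple ::
  "('a::euclidean_space \<Rightarrow> 'b::euclidean_space) \<Rightarrow> 'a \<Rightarrow> 'b \<times> 'b \<times> 'a" where
  "jump_triple u x = (SOME t. is_jump_triple u x t)"

definition jump :: "('a::euclidean_space \<Rightarrow> 'b::euclidean_space) \<Rightarrow> 'a \<Rightarrow> 'b" where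
  "jump u x = (case jump_triple u x of (a, b, \<nu>) \<Rightarrow> a - b)"

definition jump_normal :: "('a::euclidean_space \<Rightarrow> 'b::euclidean_space) \<Rightarrow> 'a \<Rightarrow> 'a" where
  "jump_normal u x = (case jump_triple u x of (a, b, \<nu>) \<Rightarrow> \<nu>)"

definition jump_tensor :: "(real^'n \<Rightarrow> real^'m) \<Rightarrow> real^'n \<Rightarrow> real^'n^'m" where
  "jump_tensor u x = (\<chi> i j. jump u x $ i * jump_normal u x $ j)"

text \<open>
  The Cantor part is what the absolutely continuous part and the jump part leave over. For \<open>BV\<close>
  functions the jump set is Borel and \<open>[u] \<otimes> \<nu>\<close> is integrable over it; the integrability condition in
  \<open>SBV\<close> only keeps the Bochner integral from taking its default value.
\<close>

definition cantor_part ::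
  "(real^'n) set \<Rightarrow> (real^'n \<Rightarrow> real^'m) \<Rightarrow> (real^'n) set \<Rightarrow> real^'n^'m" where
  "cantor_part Q u E =
     distr_deriv Q u E
       - (LINT x:E|lebesgue. ac_gradient Q u x)
       - (LINT x:E \<inter> jump_set Q u|hausdorff_measure (CARD('n) - 1). jump_tensor u x)"

definition SBV :: "(real^'n) set \<Rightarrow> (real^'n \<Rightarrow> real^'m) set" where
  "SBV Q =
     {u \<in> BV Q.
        set_integrable (hausdorff_measure (CARD('n) - 1)) (jump_set Q u) (jump_tensor u) \<and>
        (\<forall>E\<in>sets borel. E \<subseteq> Q \<longrightarrow> cantor_part Q u E = 0)}"

definition has_trace ::
  "(real^'n) set \<Rightarrow> (real^'n \<Rightarrow> real^'m) \<Rightarrow> (real^'n \<Rightarrow> real^'m) \<Rightarrow> bool" where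
  "has_trace Q u g \<longleftrightarrow>
     (AE x in hausdorff_measure (CARD('n) - 1). x \<in> frontier Q \<longrightarrow>
        ((\<lambda>r. (LINT y:Q \<inter> ball x r|lebesgue. norm (u y - g x)) / r ^ CARD('n)) \<longlongrightarrow> 0)
          (at_right 0))"

section \<open>The relaxation problem\<close>

definition unit_cube :: "(real^'n) set" where
  "unit_cube = box (\<chi> i. - 1/2) (\<chi> i. 1/2)"

definition jump_energy :: "(real^'n) set \<Rightarrow> (real^'n \<Rightarrow> real^'n) \<Rightarrow> ennreal" where
  "jump_energy Q u =
     (\<integral>\<^sup>+ x\<in>jump_set Q u. ennreal \<bar>jump u x \<bullet> jump_normal u x\<bar> \<partial>hausdorff_measure (CARD('n) - 1))"

definition admissible_average ::
  "real \<Rightarrow> real^'n^'n \<Rightarrow> real^'n^'n \<Rightarrow> (real^'n \<Rightarrow> real^'n) set" where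
  "admissible_average p A B =
     {u \<in> SBV unit_cube.
        has_trace unit_cube u (\<lambda>x. A *v x) \<and>
        set_integrable lebesgue unit_cube (\<lambda>x. norm (ac_gradient unit_cube u x) powr p) \<and>
        (LINT x:unit_cube|lebesgue. ac_gradient unit_cube u x) = B}"

definition admissible_pointwise ::
  "real^'n^'n \<Rightarrow> real^'n^'n \<Rightarrow> (real^'n \<Rightarrow> real^'n) set" where
  "admissible_pointwise A B =
     {u \<in> SBV unit_cube.
        has_trace unit_cube u (\<lambda>x. 0) \<and>
        (AE x in lebesgue. x \<in> unit_cube \<longrightarrow> ac_gradient unit_cube u x = B - A)}"

end

theory Submission
  imports Defs
begin

text \<open>
  Lower bound. If \<open>u\<close> has trace \<open>C x\<close> on the boundary of the cube \<open>Q\<close>, then \<open>Du(Q) = C\<close> by the Gauss--Green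
  formula. Without Cantor part, \<open>C\<close> minus the integral of \<open>\<nabla>u\<close> is thus the integral of \<open>[u] \<otimes> \<nu>\<close> over the jump
  set, and its trace is bounded by the energy. Both classes give \<open>\<bar>tr (A - B)\<bar>\<close>.

  Upper bound. To reach trace \<open>C x\<close> and gradient \<open>G\<close>, write \<open>C - G\<close> as a sum of matrices \<open>a \<otimes> b\<close> with
  \<open>a \<bullet> b = 0\<close> except for one summand with \<open>a \<bullet> b = tr (C - G)\<close>. Replace each \<open>b \<bullet> x\<close> by a step function, with
  steps that get finer on dyadic cubical shells towards the boundary, and add \<open>G x\<close>. On the planes where
  the steps jump, \<open>[u] \<bullet> \<nu>\<close> has the sign of \<open>tr (C - G)\<close>, so by the Gauss--Green formula these
  jumps cost \<open>\<bar>tr (C - G)\<bar>\<close>, up to the jumps across the faces of the shells. The latter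
  are bounded by the step width, which is as small as desired.

  The Hausdorff measure of a piece of a hyperplane is identified with the volume of the cylinder of height
  one over it, by means of the isodiametric inequality; this allows slicing along lines.
\<close>

section \<open>Slicing Lebesgue measure along a direction\<close>

text \<open>Both bounds rest on one identity for the total derivative of a function with trace
  \<open>C x\<close>. Its difficulty is that the trace is an averaged condition holding only almost
  everywhere on the boundary, so no pointwise boundary value is available. A thin layer near a face
  is split: foot points with a large mean nearby form an open set, over which the layer is compared
  with a fixed thicker one through the mass of the derivative; the other foot points are handled by
  counting grid cells. For the upper bound, a staircase with fixed steps would miss the trace. Steps
  that shrink with the shells restore it but create infinitely many jump planes. Their total
  variation stays finite because jump height times area is the volume of a layer one step thick;
  finiteness is enough, since the energy itself is read off from the identity. Membership in
  \<open>SBV\<close> is checked by hand: the functions are constant up to a linear part along short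
  rays from each point, so approximate one-sided limits become plain a.e. equalities, and the
  derivative is found by crossing planes along coordinate lines.\<close>

lemma nn_integral_lborel_translate:
  fixes f :: "'a::euclidean_space \<Rightarrow> ennreal"
  assumes "f \<in> borel_measurable borel"
  shows "(\<integral>\<^sup>+x. f (x + c) \<partial>lborel) = (\<integral>\<^sup>+x. f x \<partial>lborel)"
proof -
  have "(\<integral>\<^sup>+x. f x \<partial>lborel) = (\<integral>\<^sup>+x. f x \<partial>distr lborel borel ((+) c))"
    by (simp add: lborel_distr_plus)
  also have "\<dots> = (\<integral>\<^sup>+x. f (c + x) \<partial>lborel)" using assms by (intro nn_integral_distr) auto
  finally show ?thesis by (simp add: add.commute)
qed

text \<open>A line in a direction \<open>v\<close> with \<open>n \<bullet> v = 1\<close> spends a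
  parameter interval of length exactly 1 in this half-open slab. Integrating over it therefore
  counts every such line once, which replaces a choice of coordinates on a transversal
  hyperplane.\<close>

definition strip :: "'a::real_inner \<Rightarrow> real \<Rightarrow> 'a set" where
  "strip n c = {x. c \<le> n \<bullet> x \<and> n \<bullet> x < c + 1}"

lemma strip_borel [measurable]: "strip (n::'a::euclidean_space) c \<in> sets borel"
  unfolding strip_def by measurable

text \<open>Tonelli and translation invariance move the shift along \<open>v\<close> from
  \<open>f\<close> to the indicator of the strip; what remains of the inner integral is the length 1
  of a half-open interval.\<close>

lemma nn_integral_slice:
  fixes v n :: "'a::euclidean_space" and f :: "'a \<Rightarrow> ennreal"
  assumes f [measurable]: "f \<in> borel_measurable borel" and nv: "n \<bullet> v = 1"
  shows "(\<integral>\<^sup>+x. (\<integral>\<^sup>+t. f (x + t *\<^sub>R v) \<partial>lborel) * indicator (strip n c) x \<partial>lborel) = (\<integral>\<^sup>+x. f x \<partial>lborel)"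
proof -
  have "(\<integral>\<^sup>+x. (\<integral>\<^sup>+t. f (x + t *\<^sub>R v) \<partial>lborel) * indicator (strip n c) x \<partial>lborel)
      = (\<integral>\<^sup>+x. \<integral>\<^sup>+t. f (x + t *\<^sub>R v) * indicator (strip n c) x \<partial>lborel \<partial>lborel)"
    by (subst nn_integral_multc) auto
  also have "\<dots> = (\<integral>\<^sup>+t. \<integral>\<^sup>+x. f (x + t *\<^sub>R v) * indicator (strip n c) x \<partial>lborel \<partial>lborel)"
    by (rule lborel_pair.Fubini') measurable
  also have "\<dots> = (\<integral>\<^sup>+t. \<integral>\<^sup>+x. f x * indicator (strip n c) (x - t *\<^sub>R v) \<partial>lborel \<partial>lborel)"
  proof (rule nn_integral_cong)
    fix t :: real
    show "(\<integral>\<^sup>+x. f (x + t *\<^sub>R v) * indicator (strip n c) x \<partial>lborel)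
        = (\<integral>\<^sup>+x. f x * indicator (strip n c) (x - t *\<^sub>R v) \<partial>lborel)"
      using nn_integral_lborel_translate[of "\<lambda>x. f x * indicator (strip n c) (x - t *\<^sub>R v)" "t *\<^sub>R v"]
      by simp
  qed
  also have "\<dots> = (\<integral>\<^sup>+x. \<integral>\<^sup>+t. f x * indicator (strip n c) (x - t *\<^sub>R v) \<partial>lborel \<partial>lborel)"
    by (rule lborel_pair.Fubini') measurable
  also have "\<dots> = (\<integral>\<^sup>+x. f x * 1 \<partial>lborel)"
  proof (rule nn_integral_cong)
    fix x :: 'a
    have "(\<integral>\<^sup>+t. f x * indicator (strip n c) (x - t *\<^sub>R v) \<partial>lborel)
        = f x * (\<integral>\<^sup>+t. indicator {n \<bullet> x - c - 1 <.. n \<bullet> x - c} t \<partial>lborel)"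
      by (subst nn_integral_cmult[symmetric])
         (auto intro!: nn_integral_cong simp: strip_def indicator_def inner_diff_right nv)
    then show "(\<integral>\<^sup>+t. f x * indicator (strip n c) (x - t *\<^sub>R v) \<partial>lborel) = f x * 1" by simp
  qed
  finally show ?thesis by simp
qed

text \<open>The slicing identity with \<open>t\<close> shifted so that it becomes the height of the
  point in direction \<open>n\<close>. The outer integral then runs over parallel hyperplanes, each
  section being measured by the unit cylinder over it.\<close>

lemma nn_integral_cavalieri:
  fixes v n :: "'a::euclidean_space" and f :: "'a \<Rightarrow> ennreal"
  assumes f [measurable]: "f \<in> borel_measurable borel" and nv: "n \<bullet> v = 1"
  shows "(\<integral>\<^sup>+t. \<integral>\<^sup>+x. f (x + (t - n \<bullet> x) *\<^sub>R v) * indicator (strip n c) x \<partial>lborel \<partial>lborel) = (\<integral>\<^sup>+x. f x \<partial>lborel)"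
proof -
  have "(\<integral>\<^sup>+t. f (x + (t - n \<bullet> x) *\<^sub>R v) \<partial>lborel) = (\<integral>\<^sup>+t. f (x + t *\<^sub>R v) \<partial>lborel)" for x
    using nn_integral_lborel_translate[of "\<lambda>t. f (x + t *\<^sub>R v)" "- (n \<bullet> x)"] by simp
  then have "(\<integral>\<^sup>+x. f x \<partial>lborel)
      = (\<integral>\<^sup>+x. (\<integral>\<^sup>+t. f (x + (t - n \<bullet> x) *\<^sub>R v) \<partial>lborel) * indicator (strip n c) x \<partial>lborel)"
    using nn_integral_slice[OF assms, of c] by simp
  also have "\<dots> = (\<integral>\<^sup>+x. \<integral>\<^sup>+t. f (x + (t - n \<bullet> x) *\<^sub>R v) * indicator (strip n c) x \<partial>lborel \<partial>lborel)"
    by (subst nn_integral_multc) auto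
  also have "\<dots> = (\<integral>\<^sup>+t. \<integral>\<^sup>+x. f (x + (t - n \<bullet> x) *\<^sub>R v) * indicator (strip n c) x \<partial>lborel \<partial>lborel)"
    by (rule lborel_pair.Fubini') measurable
  finally show ?thesis by simp
qed

lemma integral_slice:
  fixes v n :: "'a::euclidean_space" and f :: "'a \<Rightarrow> real"
  assumes f: "integrable lborel f" and nv: "n \<bullet> v = 1"
  shows "(\<integral>x. indicator (strip n c) x * (\<integral>t. f (x + t *\<^sub>R v) \<partial>lborel) \<partial>lborel) = (\<integral>x. f x \<partial>lborel)"
proof -
  have [measurable]: "f \<in> borel_measurable borel" using f by auto
  define g where "g = (\<lambda>(x, t). indicator (strip n c) x * f (x + t *\<^sub>R v))"
  have [measurable]: "g \<in> borel_measurable (lborel \<Otimes>\<^sub>M lborel)" unfolding g_def by measurable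
  \<comment> \<open>The absolute value, the identity and the negation are inserted for
    \<open>h\<close>: they give integrability and the positive and negative parts. The condition
    \<open>h 0 = 0\<close> lets \<open>h\<close> pass through the indicator in
    \<open>g\<close>.\<close>
  have nn: "(\<integral>\<^sup>+p. ennreal (h (g p)) \<partial>(lborel \<Otimes>\<^sub>M lborel)) = (\<integral>\<^sup>+x. ennreal (h (f x)) \<partial>lborel)"
    if [measurable]: "h \<in> borel_measurable borel" and h0: "h 0 = 0" for h :: "real \<Rightarrow> real"
  proof -
    have "(\<integral>\<^sup>+p. ennreal (h (g p)) \<partial>(lborel \<Otimes>\<^sub>M lborel)) = (\<integral>\<^sup>+x. \<integral>\<^sup>+t. ennreal (h (g (x, t))) \<partial>lborel \<partial>lborel)"
      by (rule lborel.nn_integral_fst[symmetric]) measurable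
    also have "\<dots> = (\<integral>\<^sup>+x. (\<integral>\<^sup>+t. ennreal (h (f (x + t *\<^sub>R v))) \<partial>lborel) * indicator (strip n c) x \<partial>lborel)"
      by (intro nn_integral_cong) (auto simp: g_def indicator_def h0)
    also have "\<dots> = (\<integral>\<^sup>+x. ennreal (h (f x)) \<partial>lborel)" by (rule nn_integral_slice) (use nv in auto)
    finally show ?thesis .
  qed
  have gi: "integrable (lborel \<Otimes>\<^sub>M lborel) g"
    using f nn[of abs] by (auto simp: integrable_iff_bounded)
  have "(\<integral>x. f x \<partial>lborel) = (\<integral>p. g p \<partial>(lborel \<Otimes>\<^sub>M lborel))"
    using nn[of "\<lambda>x. x"] nn[of "\<lambda>x. - x"] by (simp add: real_lebesgue_integral_def f gi)
  also have "\<dots> = (\<integral>x. \<integral>t. g (x, t) \<partial>lborel \<partial>lborel)"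
    by (rule lborel_pair.integral_fst'[symmetric, OF gi])
  finally show ?thesis by (simp add: g_def)
qed

section \<open>Steiner symmetrization and the isodiametric inequality\<close>

definition fibre_length :: "'a::euclidean_space \<Rightarrow> 'a set \<Rightarrow> 'a \<Rightarrow> ennreal" where
  "fibre_length i S x = (\<integral>\<^sup>+t. indicator S (x + t *\<^sub>R i) \<partial>lborel)"

text \<open>For a unit vector \<open>i\<close>, each fibre becomes a centred open interval of the
  same length. The strict inequality removes fibres of length zero, so a point of the result
  guarantees a nonempty fibre of \<open>S\<close>.\<close>

definition steiner :: "'a::euclidean_space \<Rightarrow> 'a set \<Rightarrow> 'a set" where
  "steiner i S = {x. ennreal (2 * \<bar>x \<bullet> i\<bar>) < fibre_length i S x}"

lemma fibre_length_measurable [measurable]: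
  assumes [measurable]: "S \<in> sets borel"
  shows "fibre_length i S \<in> borel_measurable borel"
  unfolding fibre_length_def by measurable

lemma steiner_borel [measurable]:
  assumes [measurable]: "S \<in> sets borel"
  shows "steiner i S \<in> sets borel"
proof -
  have "{x \<in> space borel. ennreal (2 * \<bar>x \<bullet> i\<bar>) < fibre_length i S x} \<in> sets borel" by measurable
  then show ?thesis by (simp add: steiner_def)
qed

lemma fibre_length_translate:
  assumes [measurable]: "S \<in> sets borel"
  shows "fibre_length i S (x + t *\<^sub>R i) = fibre_length i S x"
  using nn_integral_lborel_translate[of "\<lambda>s. indicator S (x + s *\<^sub>R i)" t]
  by (simp add: fibre_length_def algebra_simps)

lemma emeasure_abs_less:
  fixes m :: ennreal
  shows "(\<integral>\<^sup>+t. indicator {t. ennreal (2 * \<bar>t\<bar>) < m} t \<partial>lborel) = m"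
proof (cases m rule: ennreal_cases)
  case (real r)
  have "{t. ennreal (2 * \<bar>t\<bar>) < m} = {- r / 2 <..< r / 2}"
    using real by (auto simp: ennreal_less_iff)
  then show ?thesis using real by simp
next
  case top
  then have "{t::real. ennreal (2 * \<bar>t\<bar>) < m} = UNIV" by auto
  then show ?thesis using top by simp
qed

text \<open>Slicing along \<open>i\<close> reduces volume to fibre lengths, and symmetrization
  preserves those.\<close>

lemma emeasure_steiner:
  assumes [measurable]: "S \<in> sets borel" and i: "norm i = 1"
  shows "emeasure lborel (steiner i S) = emeasure lborel S"
proof -
  have ii: "i \<bullet> i = 1" using i by (simp add: norm_eq_1)
  have "fibre_length i (steiner i S) x = fibre_length i S x" for x
  proof -
    have "fibre_length i (steiner i S) x
        = (\<integral>\<^sup>+t. indicator {t. ennreal (2 * \<bar>t\<bar>) < fibre_length i S x} (t + x \<bullet> i) \<partial>lborel)"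
      unfolding fibre_length_def[of i "steiner i S"]
      by (intro nn_integral_cong)
         (simp add: steiner_def indicator_def fibre_length_translate inner_add_left ii add.commute)
    also have "\<dots> = fibre_length i S x"
      by (subst nn_integral_lborel_translate) (auto simp: emeasure_abs_less)
    finally show ?thesis .
  qed
  then show ?thesis
    using nn_integral_slice[of "indicator (steiner i S)" i i 0] nn_integral_slice[of "indicator S" i i 0] ii
    by (simp add: fibre_length_def)
qed

text \<open>With \<open>Sup F - Inf G\<close> and \<open>Sup G - Inf F\<close> both at most
  \<open>e\<close>, regrouping the four endpoints bounds the sum of the lengths of the two hulls by
  \<open>2 * e\<close>.\<close>

lemma emeasure_add_le_of_dist:
  fixes F G :: "real set"
  assumes F: "F \<noteq> {}" "F \<in> sets borel" and G: "G \<noteq> {}" "G \<in> sets borel"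
    and d: "\<And>s t. s \<in> F \<Longrightarrow> t \<in> G \<Longrightarrow> \<bar>s - t\<bar> \<le> e"
  shows "emeasure lborel F + emeasure lborel G \<le> ennreal (2 * e)"
proof -
  obtain f g where fg: "f \<in> F" "g \<in> G" using F G by auto
  have bF: "bdd_above F" "bdd_below F"
    using d[OF _ fg(2)] by (auto intro!: bdd_aboveI[of _ "g + e"] bdd_belowI[of _ "g - e"] simp: abs_le_iff) fastforce+
  have bG: "bdd_above G" "bdd_below G"
    using d[OF fg(1)] by (auto intro!: bdd_aboveI[of _ "f + e"] bdd_belowI[of _ "f - e"] simp: abs_le_iff) fastforce+
  have "Sup F \<le> t + e" if "t \<in> G" for t
    using d[OF _ that] F by (intro cSup_least) (auto simp: abs_le_iff algebra_simps)
  then have "Sup F - e \<le> Inf G" using G by (intro cInf_greatest) (auto simp: algebra_simps)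
  moreover have "Sup G \<le> s + e" if "s \<in> F" for s
    using d[OF that] G by (intro cSup_least) (auto simp: abs_le_iff algebra_simps)
  then have "Sup G - e \<le> Inf F" using F by (intro cInf_greatest) (auto simp: algebra_simps)
  moreover have "F \<subseteq> {Inf F..Sup F}" "G \<subseteq> {Inf G..Sup G}"
    using bF bG by (auto intro: cInf_lower cSup_upper)
  then have "emeasure lborel F \<le> ennreal (Sup F - Inf F)" "emeasure lborel G \<le> ennreal (Sup G - Inf G)"
    using emeasure_mono[of F "{Inf F..Sup F}" lborel] emeasure_mono[of G "{Inf G..Sup G}" lborel] F G
      fg bF bG by (auto simp: cInf_le_cSup)
  moreover have "Inf F \<le> Sup F" "Inf G \<le> Sup G" using F G bF bG by (auto intro: cInf_le_cSup)
  ultimately have "emeasure lborel F + emeasure lborel G \<le> ennreal ((Sup F - Inf F) + (Sup G - Inf G))"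
    by (subst ennreal_plus) (auto intro: add_mono)
  also have "\<dots> \<le> ennreal (2 * e)"
    using \<open>Sup F - e \<le> Inf G\<close> \<open>Sup G - e \<le> Inf F\<close> by (intro ennreal_leI) linarith
  finally show ?thesis .
qed

text \<open>For a unit vector \<open>n\<close> this is the projection onto its orthogonal
  complement. Diameters are measured after it, so that a cylinder in direction \<open>n\<close> has
  the diameter of its base.\<close>

definition flat :: "'a::real_inner \<Rightarrow> 'a \<Rightarrow> 'a" where
  "flat n x = x - (n \<bullet> x) *\<^sub>R n"

text \<open>By Pythagoras, points on the two fibres at parameters \<open>s\<close> and
  \<open>t\<close> have squared projected distance \<open>(norm q)^2 + (s - t)^2\<close>. Hence
  parameters on the two fibres differ by at most \<open>e\<close>, the fibre lengths add up to at
  most \<open>2 * e\<close>, and the centred intervals of these lengths keep the bound.\<close>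

lemma steiner_transverse_diameter:
  assumes S [measurable]: "S \<in> sets borel" and i: "norm i = 1" "i \<bullet> n = 0" and d0: "0 \<le> d"
    and d: "\<And>x y. x \<in> S \<Longrightarrow> y \<in> S \<Longrightarrow> norm (flat n (x - y)) \<le> d"
    and xy: "x \<in> steiner i S" "y \<in> steiner i S"
  shows "norm (flat n (x - y)) \<le> d"
proof -
  have ii: "i \<bullet> i = 1" using i by (simp add: norm_eq_1)
  define x0 where "x0 = x - (x \<bullet> i) *\<^sub>R i"
  define y0 where "y0 = y - (y \<bullet> i) *\<^sub>R i"
  define q where "q = flat n (x0 - y0)"
  have "x0 \<bullet> i = 0" "y0 \<bullet> i = 0" "n \<bullet> i = 0"
    using i ii by (simp_all add: x0_def y0_def inner_diff_left inner_commute[of n])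
  then have qi: "q \<bullet> i = 0" by (simp add: q_def flat_def inner_diff_left)
  have flat: "flat n ((x0 + s *\<^sub>R i) - (y0 + t *\<^sub>R i)) = q + (s - t) *\<^sub>R i" for s t
    using i by (simp add: q_def flat_def inner_diff_right inner_add_right inner_commute algebra_simps)
  have nrm: "(norm (flat n ((x0 + s *\<^sub>R i) - (y0 + t *\<^sub>R i))))\<^sup>2 = (norm q)\<^sup>2 + (s - t)\<^sup>2" for s t
    unfolding flat power2_norm_eq_inner using qi ii
    by (simp add: inner_add_left inner_add_right inner_commute power2_eq_square)
  define F where "F = {t. x0 + t *\<^sub>R i \<in> S}"
  define G where "G = {t. y0 + t *\<^sub>R i \<in> S}"
  have [measurable]: "F \<in> sets borel" "G \<in> sets borel"
    unfolding F_def G_def by measurable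
  define e where "e = sqrt (d\<^sup>2 - (norm q)\<^sup>2)"
  have sq: "(norm q)\<^sup>2 + (s - t)\<^sup>2 \<le> d\<^sup>2" if "s \<in> F" "t \<in> G" for s t
    unfolding nrm[symmetric] using that d d0 by (intro power_mono) (auto simp: F_def G_def)
  have fl: "fibre_length i S x = emeasure lborel F" "fibre_length i S y = emeasure lborel G"
    using fibre_length_translate[of S i x "- (x \<bullet> i)"] fibre_length_translate[of S i y "- (y \<bullet> i)"]
      nn_integral_indicator[of F lborel] nn_integral_indicator[of G lborel]
    by (simp_all add: x0_def[symmetric] y0_def[symmetric] fibre_length_def F_def G_def indicator_def[abs_def])
  have lt: "ennreal (2 * \<bar>x \<bullet> i\<bar>) < emeasure lborel F" "ennreal (2 * \<bar>y \<bullet> i\<bar>) < emeasure lborel G"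
    using xy fl by (auto simp: steiner_def)
  then have ne: "F \<noteq> {}" "G \<noteq> {}" by auto
  then obtain f g where fg: "f \<in> F" "g \<in> G" by auto
  have eq: "e\<^sup>2 = d\<^sup>2 - (norm q)\<^sup>2"
    unfolding e_def using sq[OF fg] zero_le_power2[of "f - g"]
    by (subst real_sqrt_pow2) linarith+
  have "emeasure lborel F + emeasure lborel G \<le> ennreal (2 * e)"
  proof (rule emeasure_add_le_of_dist)
    show "\<bar>s - t\<bar> \<le> e" if "s \<in> F" "t \<in> G" for s t
      unfolding e_def using sq[OF that] by (intro real_le_rsqrt) simp
  qed (use ne in auto)
  moreover have "ennreal (2 * \<bar>x \<bullet> i\<bar>) + ennreal (2 * \<bar>y \<bullet> i\<bar>) \<le> emeasure lborel F + emeasure lborel G"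
    using lt by (intro add_mono) auto
  ultimately have "ennreal (2 * \<bar>x \<bullet> i\<bar> + 2 * \<bar>y \<bullet> i\<bar>) \<le> ennreal (2 * e)"
    by (subst ennreal_plus) auto
  moreover have "0 \<le> e"
    unfolding e_def using sq[OF fg] zero_le_power2[of "f - g"] by (intro real_sqrt_ge_zero) linarith
  ultimately have "\<bar>x \<bullet> i\<bar> + \<bar>y \<bullet> i\<bar> \<le> e" by (subst (asm) ennreal_le_iff) auto
  then have "\<bar>x \<bullet> i - y \<bullet> i\<bar> \<le> \<bar>e\<bar>" by linarith
  then have "(x \<bullet> i - y \<bullet> i)\<^sup>2 \<le> e\<^sup>2" by (simp add: abs_le_square_iff)
  then have "(norm (flat n (x - y)))\<^sup>2 \<le> d\<^sup>2"
    using nrm[of "x \<bullet> i" "y \<bullet> i"] eq by (simp add: x0_def y0_def)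
  then show ?thesis using d0 power2_le_imp_le by blast
qed

definition reflect :: "'a::real_inner \<Rightarrow> 'a \<Rightarrow> 'a" where
  "reflect i x = x - (2 * (x \<bullet> i)) *\<^sub>R i"

lemma steiner_reflect_self:
  assumes [measurable]: "S \<in> sets borel" and i: "norm i = 1" and x: "x \<in> steiner i S"
  shows "reflect i x \<in> steiner i S"
proof -
  have "i \<bullet> i = 1" using i by (simp add: norm_eq_1)
  then have "reflect i x \<bullet> i = - (x \<bullet> i)" by (simp add: reflect_def inner_diff_left)
  moreover have "fibre_length i S (reflect i x) = fibre_length i S x"
    using fibre_length_translate[of S i x "- 2 * (x \<bullet> i)"] by (simp add: reflect_def)
  ultimately show ?thesis using x by (simp add: steiner_def)
qed

text \<open>The reflection in \<open>j\<close> carries fibres in direction \<open>i\<close> to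
  fibres of the same length. Symmetries gained earlier therefore survive later symmetrizations in
  orthogonal directions.\<close>

lemma steiner_reflect_orthogonal:
  assumes [measurable]: "S \<in> sets borel" and ij: "i \<bullet> j = 0" "norm j = 1"
    and sym: "\<And>x. x \<in> S \<Longrightarrow> reflect j x \<in> S" and x: "x \<in> steiner i S"
  shows "reflect j x \<in> steiner i S"
proof -
  have jj: "j \<bullet> j = 1" using ij by (simp add: norm_eq_1)
  have rr: "reflect j (reflect j z) = z" for z
    using jj by (simp add: reflect_def inner_diff_left algebra_simps)
  have iff: "reflect j z \<in> S \<longleftrightarrow> z \<in> S" for z using sym[of z] sym[of "reflect j z"] rr by auto
  have "reflect j (z + t *\<^sub>R i) = reflect j z + t *\<^sub>R i" for z t
    using ij by (simp add: reflect_def inner_add_left)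
  then have "fibre_length i S (reflect j x) = fibre_length i S x"
    unfolding fibre_length_def by (intro nn_integral_cong) (metis iff indicator_simps)
  moreover have "reflect j x \<bullet> i = x \<bullet> i" using ij by (simp add: reflect_def inner_diff_left inner_commute[of j i])
  ultimately show ?thesis using x by (simp add: steiner_def)
qed

text \<open>Symmetrizes successively in the directions of \<open>B\<close>. Each step keeps volume,
  projected diameter and the symmetries gained before; it stays in the strip because it moves points
  only orthogonally to \<open>n\<close>.\<close>

lemma symmetrization_exists:
  fixes S :: "'a::euclidean_space set"
  assumes "finite B" "S \<in> sets borel" "0 \<le> d"
    "\<And>x y. x \<in> S \<Longrightarrow> y \<in> S \<Longrightarrow> norm (flat n (x - y)) \<le> d"
    "S \<subseteq> strip n c" "pairwise orthogonal B" "\<And>i. i \<in> B \<Longrightarrow> norm i = 1 \<and> i \<bullet> n = 0"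
  shows "\<exists>T. T \<in> sets borel \<and> emeasure lborel T = emeasure lborel S \<and>
    (\<forall>x\<in>T. \<forall>y\<in>T. norm (flat n (x - y)) \<le> d) \<and> T \<subseteq> strip n c \<and> (\<forall>i\<in>B. \<forall>x\<in>T. reflect i x \<in> T)"
  using assms(1,6,7)
proof (induction B)
  case empty
  then show ?case using assms by auto
next
  case (insert i B)
  then have "pairwise orthogonal B" by (auto simp: pairwise_insert)
  with insert obtain T where [measurable]: "T \<in> sets borel" and T: "emeasure lborel T = emeasure lborel S"
    "\<And>x y. x \<in> T \<Longrightarrow> y \<in> T \<Longrightarrow> norm (flat n (x - y)) \<le> d" "T \<subseteq> strip n c"
    "\<And>i x. i \<in> B \<Longrightarrow> x \<in> T \<Longrightarrow> reflect i x \<in> T"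
    by (metis insertCI)
  have i: "norm i = 1" "i \<bullet> n = 0" using insert by auto
  have sub: "steiner i T \<subseteq> strip n c"
  proof
    fix x assume "x \<in> steiner i T"
    then have "fibre_length i T x \<noteq> 0" by (auto simp: steiner_def)
    then have "\<exists>t. x + t *\<^sub>R i \<in> T" by (rule contrapos_np) (simp add: fibre_length_def)
    then obtain t where "x + t *\<^sub>R i \<in> T" by blast
    then show "x \<in> strip n c" using T(3) i by (auto simp: strip_def inner_add_right inner_commute)
  qed
  show ?case
  proof (intro exI[of _ "steiner i T"] conjI ballI)
    show "norm (flat n (x - y)) \<le> d" if "x \<in> steiner i T" "y \<in> steiner i T" for x y
      using T(2) i assms(3) that by (intro steiner_transverse_diameter[of T i n d x y]) auto
    fix j x assume "j \<in> insert i B" and x: "x \<in> steiner i T"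
    then consider "j = i" | "j \<in> B" "j \<noteq> i" by auto
    then show "reflect j x \<in> steiner i T"
    proof cases
      case 2
      then have "i \<bullet> j = 0" "norm j = 1" using insert.prems by (auto simp: pairwise_def orthogonal_def)
      then show ?thesis using 2 x T(4) by (intro steiner_reflect_orthogonal) auto
    qed (use x i in \<open>auto intro: steiner_reflect_self\<close>)
  qed (use T i sub in \<open>auto simp: emeasure_steiner\<close>)
qed

text \<open>Along each line in direction \<open>v\<close> the function is constant and the slab
  takes parameter length \<open>b - a\<close>. The two normals may differ, since both sides only
  count lines in direction \<open>v\<close>; this later converts between orthogonal and oblique
  projections.\<close>

lemma nn_integral_slab:
  fixes v n n' :: "'a::euclidean_space" and f :: "'a \<Rightarrow> ennreal"
  assumes f [measurable]: "f \<in> borel_measurable borel" and inv: "\<And>x t. f (x + t *\<^sub>R v) = f x"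
    and nv: "n \<bullet> v = 1" "n' \<bullet> v = 1" and "a \<le> b"
  shows "(\<integral>\<^sup>+x. f x * indicator {x. a \<le> n \<bullet> x \<and> n \<bullet> x < b} x \<partial>lborel)
    = ennreal (b - a) * (\<integral>\<^sup>+x. f x * indicator (strip n' c) x \<partial>lborel)"
proof -
  have [measurable]: "{x. a \<le> n \<bullet> x \<and> n \<bullet> x < b} \<in> sets borel" by measurable
  have "(\<integral>\<^sup>+t. f (x + t *\<^sub>R v) * indicator {x. a \<le> n \<bullet> x \<and> n \<bullet> x < b} (x + t *\<^sub>R v) \<partial>lborel)
      = f x * ennreal (b - a)" for x
  proof -
    have "(\<integral>\<^sup>+t. f (x + t *\<^sub>R v) * indicator {x. a \<le> n \<bullet> x \<and> n \<bullet> x < b} (x + t *\<^sub>R v) \<partial>lborel)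
      = (\<integral>\<^sup>+t. f x * indicator {a - n \<bullet> x ..< b - n \<bullet> x} t \<partial>lborel)"
      by (intro nn_integral_cong) (auto simp: inv indicator_def inner_add_right nv)
    also have "\<dots> = f x * ennreal (b - a)" using \<open>a \<le> b\<close> by (subst nn_integral_cmult) auto
    finally show ?thesis .
  qed
  then have "(\<integral>\<^sup>+x. f x * indicator {x. a \<le> n \<bullet> x \<and> n \<bullet> x < b} x \<partial>lborel)
    = (\<integral>\<^sup>+x. f x * ennreal (b - a) * indicator (strip n' c) x \<partial>lborel)"
    by (subst nn_integral_slice[symmetric, OF _ nv(2), of _ c]) auto
  also have "\<dots> = (\<integral>\<^sup>+x. ennreal (b - a) * (f x * indicator (strip n' c) x) \<partial>lborel)"
    by (simp add: ac_simps)
  also have "\<dots> = ennreal (b - a) * (\<integral>\<^sup>+x. f x * indicator (strip n' c) x \<partial>lborel)"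
    by (rule nn_integral_cmult) measurable
  finally show ?thesis .
qed

lemma nn_integral_lborel_scale:
  fixes f :: "'a::euclidean_space \<Rightarrow> ennreal"
  assumes [measurable]: "f \<in> borel_measurable borel" and "0 < c"
  shows "(\<integral>\<^sup>+x. f x \<partial>lborel) = ennreal (c ^ DIM('a)) * (\<integral>\<^sup>+x. f (c *\<^sub>R x) \<partial>lborel)"
  using \<open>0 < c\<close>
  by (subst lborel_affine[of c 0], simp)
     (subst nn_integral_density, simp_all add: nn_integral_distr nn_integral_cmult)

text \<open>A cylinder of height one over an (N-1)-dimensional ball of radius \<open>r\<close>; its
  volume stands for the (N-1)-dimensional volume of that ball.\<close>

definition cyl_disc :: "'a::euclidean_space \<Rightarrow> real \<Rightarrow> real \<Rightarrow> 'a set" where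
  "cyl_disc n c r = {x \<in> strip n c. norm (flat n x) \<le> r}"

lemma flat_measurable [measurable]: "flat (n::'a::euclidean_space) \<in> borel_measurable borel"
  unfolding flat_def[abs_def] by measurable

lemma cyl_disc_borel [measurable]: "cyl_disc (n::'a::euclidean_space) c r \<in> sets borel"
proof -
  have "{x \<in> space borel. x \<in> strip n c \<and> norm (flat n x) \<le> r} \<in> sets borel" by measurable
  then show ?thesis by (simp add: cyl_disc_def)
qed

lemma flat_simps:
  assumes "norm n = 1"
  shows "flat n (x + t *\<^sub>R n) = flat n x" "flat n (t *\<^sub>R x) = t *\<^sub>R flat n x" "n \<bullet> flat n x = 0"
  using assms by (simp_all add: flat_def inner_add_right inner_diff_right norm_eq_1 algebra_simps)

text \<open>A cylinder of radius and height \<open>r\<close> is a dilation of the unit one, with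
  volume factor \<open>r ^ N\<close>. The slab identity takes out the height \<open>r\<close>, which
  leaves the exponent \<open>N - 1\<close>.\<close>

lemma emeasure_cyl_disc_scale:
  fixes n :: "'a::euclidean_space"
  assumes n: "norm n = 1" and r: "0 < r"
  shows "emeasure lborel (cyl_disc n c r) = ennreal (r ^ (DIM('a) - 1)) * emeasure lborel (cyl_disc n 0 1)"
proof -
  have nn: "n \<bullet> n = 1" using n by (simp add: norm_eq_1)
  have N: "DIM('a) = Suc (DIM('a) - 1)" using DIM_positive[where 'a='a] by simp
  define f :: "real \<Rightarrow> 'a \<Rightarrow> ennreal" where "f = (\<lambda>r. indicator {x. norm (flat n x) \<le> r})"
  have [measurable]: "f r \<in> borel_measurable borel" for r unfolding f_def by measurable
  have disc: "emeasure lborel (cyl_disc n c r) = (\<integral>\<^sup>+x. f r x * indicator (strip n c) x \<partial>lborel)" for c r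
  proof -
    have "emeasure lborel (cyl_disc n c r) = (\<integral>\<^sup>+x. indicator (cyl_disc n c r) x \<partial>lborel)" by simp
    also have "\<dots> = (\<integral>\<^sup>+x. f r x * indicator (strip n c) x \<partial>lborel)"
      by (intro nn_integral_cong) (auto simp: f_def cyl_disc_def indicator_def)
    finally show ?thesis .
  qed
  have "ennreal (r - 0) * (\<integral>\<^sup>+x. f r x * indicator (strip n c) x \<partial>lborel)
      = (\<integral>\<^sup>+x. f r x * indicator {x. 0 \<le> n \<bullet> x \<and> n \<bullet> x < r} x \<partial>lborel)"
    using r by (intro nn_integral_slab[symmetric, of _ n]) (auto simp: nn f_def flat_simps[OF n] indicator_def)
  also have "\<dots> = ennreal (r ^ DIM('a)) *
      (\<integral>\<^sup>+x. f r (r *\<^sub>R x) * indicator {x. 0 \<le> n \<bullet> x \<and> n \<bullet> x < r} (r *\<^sub>R x) \<partial>lborel)"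
    by (rule nn_integral_lborel_scale) (use r in measurable)
  also have "(\<integral>\<^sup>+x. f r (r *\<^sub>R x) * indicator {x. 0 \<le> n \<bullet> x \<and> n \<bullet> x < r} (r *\<^sub>R x) \<partial>lborel)
      = (\<integral>\<^sup>+x. f 1 x * indicator (strip n 0) x \<partial>lborel)"
    using r by (intro nn_integral_cong)
      (auto simp: f_def indicator_def flat_simps[OF n] strip_def zero_le_mult_iff)
  finally have "ennreal r * emeasure lborel (cyl_disc n c r)
      = ennreal (r ^ DIM('a)) * emeasure lborel (cyl_disc n 0 1)"
    unfolding disc by simp
  also have "r ^ DIM('a) = r * r ^ (DIM('a) - 1)" using N by (metis power_Suc)
  also have "ennreal \<dots> * emeasure lborel (cyl_disc n 0 1)
      = ennreal r * (ennreal (r ^ (DIM('a) - 1)) * emeasure lborel (cyl_disc n 0 1))"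
    using r by (simp add: ennreal_mult mult.assoc)
  finally show ?thesis using r by (subst (asm) ennreal_mult_cancel_left) auto
qed

lemma flat_eq_0_of_DIM_1:
  fixes n :: "'a::euclidean_space"
  assumes n: "norm n = 1" and "DIM('a) = 1"
  shows "flat n x = 0"
proof -
  obtain B where B: "n \<in> B" "pairwise orthogonal B" "\<And>x. x \<in> B \<Longrightarrow> norm x = 1"
    "independent B" "card B = DIM('a)" "span B = UNIV"
    using vector_in_orthonormal_basis[OF n] by blast
  then have "B = {n}" using assms by (metis card_1_singletonE singletonD)
  then have "(\<Sum>i\<in>{n}. (x \<bullet> i) *\<^sub>R i) = x" using B by (intro orthonormal_basis_expand) auto
  then show ?thesis by (simp add: flat_def inner_commute)
qed

text \<open>The sections of the unit ball at height \<open>t\<close> are discs of radius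
  \<open>sqrt (1 - t^2)\<close>, so its volume is the unknown constant \<open>?K\<close> times a
  Beta integral. The same Beta value links \<open>unit_ball_vol\<close> in consecutive dimensions,
  and cancelling it identifies \<open>?K\<close>.\<close>

lemma emeasure_cyl_disc:
  fixes n :: "'a::euclidean_space"
  assumes n: "norm n = 1" and r: "0 \<le> r"
  shows "emeasure lborel (cyl_disc n c r) = ennreal (unit_ball_vol (real (DIM('a) - 1)) * r ^ (DIM('a) - 1))"
proof -
  let ?k = "DIM('a) - 1" and ?K = "emeasure lborel (cyl_disc n 0 1)"
  have nn: "n \<bullet> n = 1" using n by (simp add: norm_eq_1)
  have N: "DIM('a) = Suc ?k" using DIM_positive[where 'a='a] by simp
  have "0 < Beta (1 / 2) y" if "0 < y" for y :: real
    using that by (auto simp: Beta_def intro!: divide_pos_pos mult_pos_pos Gamma_real_pos)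
  moreover have "0 < real ?k / 2 + 1" by (intro add_nonneg_pos) auto
  ultimately have Bpos: "0 < Beta (1 / 2) (real ?k / 2 + 1)" by blast
  have "ennreal (unit_ball_vol (real DIM('a))) = emeasure lborel (cball (0::'a) 1)"
    by (simp add: emeasure_cball)
  also have "\<dots> = (\<integral>\<^sup>+t. \<integral>\<^sup>+x. indicator (cball 0 1) (x + (t - n \<bullet> x) *\<^sub>R n) * indicator (strip n 0) x \<partial>lborel \<partial>lborel)"
    by (subst nn_integral_cavalieri) (auto simp: nn intro!: borel_measurable_indicator)
  also have "\<dots> = (\<integral>\<^sup>+t. ?K * (indicator {-1..1} t * sqrt (1 - t\<^sup>2) ^ ?k) \<partial>lborel)"
  proof (intro nn_integral_cong_AE)
    \<comment> \<open>At \<open>t = -1\<close> and \<open>t = 1\<close> the radius vanishes, and the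
      scaling rule covers positive radii only.\<close>
    have "AE t in lborel. t \<notin> {-1, 1::real}"
      by (intro AE_not_in countable_imp_null_set_lborel) auto
    then show "AE t in lborel. (\<integral>\<^sup>+x. indicator (cball 0 1) (x + (t - n \<bullet> x) *\<^sub>R n) * indicator (strip n 0) x \<partial>lborel)
        = ?K * ennreal (indicator {-1..1} t * sqrt (1 - t\<^sup>2) ^ ?k)"
    proof eventually_elim
      case (elim t)
      have nrm: "(norm (x + (t - n \<bullet> x) *\<^sub>R n))\<^sup>2 = (norm (flat n x))\<^sup>2 + t\<^sup>2" for x
      proof -
        have "x + (t - n \<bullet> x) *\<^sub>R n = flat n x + t *\<^sub>R n" by (simp add: flat_def algebra_simps)
        then show ?thesis unfolding power2_norm_eq_inner using flat_simps(3)[OF n, of x] nn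
          by (simp add: inner_add_left inner_add_right inner_commute power2_eq_square)
      qed
      have mem: "x + (t - n \<bullet> x) *\<^sub>R n \<in> cball 0 1 \<longleftrightarrow> (norm (flat n x))\<^sup>2 \<le> 1 - t\<^sup>2" for x
        using nrm[of x] abs_le_square_iff[of "norm (x + (t - n \<bullet> x) *\<^sub>R n)" 1] by auto
      show ?case
      proof (cases "t \<in> {-1..1}")
        case True
        then have t: "t\<^sup>2 < 1" using elim by (auto simp: abs_square_less_1)
        have "(norm (flat n x))\<^sup>2 \<le> 1 - t\<^sup>2 \<longleftrightarrow> norm (flat n x) \<le> sqrt (1 - t\<^sup>2)" for x
          by (metis norm_ge_zero real_le_rsqrt real_sqrt_le_iff real_sqrt_unique)
        then have "(\<integral>\<^sup>+x. indicator (cball 0 1) (x + (t - n \<bullet> x) *\<^sub>R n) * indicator (strip n 0) x \<partial>lborel)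
            = (\<integral>\<^sup>+x. indicator (cyl_disc n 0 (sqrt (1 - t\<^sup>2))) x \<partial>lborel)"
          unfolding indicator_def mem by (intro nn_integral_cong) (auto simp: cyl_disc_def)
        then show ?thesis using True t emeasure_cyl_disc_scale[OF n, of "sqrt (1 - t\<^sup>2)" 0]
          by (simp add: mult.commute)
      next
        case False
        then have "1 - t\<^sup>2 < 0" using abs_square_le_1[of t] by auto
        then have "\<not> (norm (flat n x))\<^sup>2 \<le> 1 - t\<^sup>2" for x
          using zero_le_power2[of "norm (flat n x)"] by linarith
        then show ?thesis using False unfolding indicator_def mem by auto
      qed
    qed
  qed
  also have "\<dots> = ?K * ennreal (Beta (1 / 2) (real ?k / 2 + 1))"
    by (subst nn_integral_cmult) (auto simp: emeasure_cball_aux_integral)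
  finally have "?K * ennreal (Beta (1 / 2) (real ?k / 2 + 1)) = ennreal (unit_ball_vol (real (Suc ?k)))"
    using N by simp
  also have "unit_ball_vol (real (Suc ?k)) = unit_ball_vol (real ?k) * Beta (1 / 2) (real ?k / 2 + 1)"
    by (auto simp: unit_ball_vol_def Beta_def Gamma_eq_zero_iff field_simps
          Gamma_one_half_real powr_half_sqrt [symmetric] powr_add [symmetric])
  also have "ennreal \<dots> = ennreal (unit_ball_vol (real ?k)) * ennreal (Beta (1 / 2) (real ?k / 2 + 1))"
    using Bpos by (intro ennreal_mult) auto
  finally have K: "?K = ennreal (unit_ball_vol (real ?k))"
    using Bpos ennreal_mult_cancel_left[of "ennreal (Beta (1 / 2) (real ?k / 2 + 1))" ?K "ennreal (unit_ball_vol (real ?k))"]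
    by (simp only: mult.commute[of _ "ennreal (Beta (1 / 2) (real ?k / 2 + 1))"])
       (auto simp: ennreal_eq_0_iff)
  show ?thesis
  proof (cases "r = 0")
    case False
    then show ?thesis using r emeasure_cyl_disc_scale[OF n, of r c]
      by (simp add: K ennreal_mult[symmetric] mult.commute)
  next
    case r0: True
    \<comment> \<open>Radius zero. In dimension one the power is \<open>0 ^ 0 = 1\<close> and every
      disc is the whole strip; in higher dimensions small positive radii squeeze the volume to
      zero.\<close>
    show ?thesis
    proof (cases "?k = 0")
      case True
      then have "cyl_disc n c r = cyl_disc n c 1"
        using flat_eq_0_of_DIM_1[OF n] r0 N by (auto simp: cyl_disc_def)
      then show ?thesis using True emeasure_cyl_disc_scale[OF n, of 1 c] by (simp add: K)
    next
      case False
      have le: "emeasure lborel (cyl_disc n c 0) \<le> ennreal (unit_ball_vol (real ?k) * e ^ ?k)" if "0 < e" for e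
      proof -
        have "emeasure lborel (cyl_disc n c 0) \<le> emeasure lborel (cyl_disc n c e)"
          using that by (intro emeasure_mono) (auto simp: cyl_disc_def)
        also have "\<dots> = ennreal (e ^ ?k) * ennreal (unit_ball_vol (real ?k))"
          unfolding emeasure_cyl_disc_scale[OF n that] K ..
        also have "\<dots> = ennreal (e ^ ?k * unit_ball_vol (real ?k))"
          using that by (subst ennreal_mult) auto
        finally show ?thesis by (simp only: mult.commute)
      qed
      have "((\<lambda>e. ennreal (unit_ball_vol (real ?k) * e ^ ?k)) \<longlongrightarrow> ennreal (unit_ball_vol (real ?k) * 0 ^ ?k)) (at_right 0)"
        by (intro tendsto_intros)
      moreover have "\<forall>\<^sub>F e in at_right 0. emeasure lborel (cyl_disc n c 0) \<le> ennreal (unit_ball_vol (real ?k) * e ^ ?k)"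
        by (rule eventually_at_right_less[THEN eventually_mono]) (rule le)
      ultimately have "emeasure lborel (cyl_disc n c 0) \<le> ennreal (unit_ball_vol (real ?k) * 0 ^ ?k)"
        by (rule tendsto_lowerbound) (rule trivial_limit_at_right_real)
      moreover have "(0::real) ^ ?k = 0" using False by (rule power_0_left[THEN trans, OF if_not_P])
      ultimately show ?thesis unfolding r0 by (simp only: mult_zero_right ennreal_0 le_zero_eq)
    qed
  qed
qed

text \<open>After symmetrizing in an orthonormal basis of the complement of \<open>n\<close>, the
  set is invariant under the composition of all reflections, which subtracts
  \<open>2 flat n x\<close> from \<open>x\<close>. A point and its image are
  \<open>2 * norm (flat n x)\<close> apart after projection, so the symmetrized set lies in the
  cylinder of radius \<open>d / 2\<close>.\<close>

theorem isodiametric_cylinder: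
  fixes n :: "'a::euclidean_space"
  assumes n: "norm n = 1" and S: "S \<in> sets borel" "S \<subseteq> strip n c" and d0: "0 \<le> d"
    and d: "\<And>x y. x \<in> S \<Longrightarrow> y \<in> S \<Longrightarrow> norm (flat n (x - y)) \<le> d"
  shows "emeasure lborel S \<le> ennreal (unit_ball_vol (real (DIM('a) - 1)) * (d / 2) ^ (DIM('a) - 1))"
proof -
  obtain B where B: "n \<in> B" "pairwise orthogonal B" "\<And>x. x \<in> B \<Longrightarrow> norm x = 1"
    "independent B" "card B = DIM('a)" "span B = UNIV"
    using vector_in_orthonormal_basis[OF n] by blast
  have finB: "finite B" using B by (metis DIM_positive card.infinite less_irrefl)
  have orth: "i \<bullet> j = 0" if "i \<in> B" "j \<in> B" "i \<noteq> j" for i j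
    using B(2) that by (auto simp: pairwise_def orthogonal_def)
  have "pairwise orthogonal (B - {n})" using B(2) by (rule pairwise_subset) auto
  then obtain T where [measurable]: "T \<in> sets borel" and T: "emeasure lborel T = emeasure lborel S"
    "\<And>x y. x \<in> T \<Longrightarrow> y \<in> T \<Longrightarrow> norm (flat n (x - y)) \<le> d" "T \<subseteq> strip n c"
    "\<And>i x. i \<in> B - {n} \<Longrightarrow> x \<in> T \<Longrightarrow> reflect i x \<in> T"
    using symmetrization_exists[of "B - {n}" S d n c] S d0 d finB B(1,3) orth by (metis Diff_iff finite_Diff insertCI)
  \<comment> \<open>Orthogonality lets the reflections act on separate coordinates, so composing
    those in \<open>F\<close> subtracts twice the component of \<open>x\<close> in the span of
    \<open>F\<close>.\<close>
  have refl: "x - 2 *\<^sub>R (\<Sum>i\<in>F. (x \<bullet> i) *\<^sub>R i) \<in> T" if "finite F" "F \<subseteq> B - {n}" "x \<in> T" for F x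
    using that
  proof (induction F)
    case (insert j F)
    then have "(\<Sum>i\<in>F. (x \<bullet> i) * (i \<bullet> j)) = 0"
      using orth by (intro sum.neutral) fastforce
    then have "reflect j (x - 2 *\<^sub>R (\<Sum>i\<in>F. (x \<bullet> i) *\<^sub>R i)) = x - 2 *\<^sub>R (\<Sum>i\<in>insert j F. (x \<bullet> i) *\<^sub>R i)"
      using insert.hyps by (simp add: reflect_def inner_diff_left inner_sum_left algebra_simps)
    then show ?case using T(4)[of j] insert by (metis insert_subset)
  qed simp
  have "T \<subseteq> cyl_disc n c (d / 2)"
  proof
    fix x assume x: "x \<in> T"
    have "(\<Sum>i\<in>B. (x \<bullet> i) *\<^sub>R i) = x" using B finB by (intro orthonormal_basis_expand) auto
    then have fl: "(\<Sum>i\<in>B - {n}. (x \<bullet> i) *\<^sub>R i) = flat n x"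
      using B(1) finB by (subst sum_diff1) (auto simp: flat_def inner_commute)
    have "norm (flat n (x - (x - 2 *\<^sub>R flat n x))) \<le> d"
      using refl[of "B - {n}" x] finB x fl by (intro T(2)) auto
    moreover have "flat n (x - (x - 2 *\<^sub>R flat n x)) = 2 *\<^sub>R flat n x"
      using flat_simps[OF n] by (simp add: flat_def[of n "flat n x"])
    ultimately show "x \<in> cyl_disc n c (d / 2)" using x T(3) by (auto simp: cyl_disc_def)
  qed
  then have "emeasure lborel S \<le> emeasure lborel (cyl_disc n c (d / 2))"
    unfolding T(1)[symmetric] by (intro emeasure_mono) auto
  then show ?thesis using d0 by (simp add: emeasure_cyl_disc[OF n])
qed

section \<open>Hausdorff measure on a hyperplane\<close>

lemma norm_sq_plus_orthogonal:
  fixes n :: "'a::real_inner"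
  assumes "norm n = 1" "n \<bullet> q = 0"
  shows "(norm (q + t *\<^sub>R n))\<^sup>2 = (norm q)\<^sup>2 + t\<^sup>2"
  unfolding power2_norm_eq_inner using assms
  by (simp add: inner_add_left inner_add_right inner_commute[of q n] norm_eq_1 power2_eq_square)

definition hyper :: "'a::real_inner \<Rightarrow> real \<Rightarrow> 'a set" where
  "hyper n s = {x. n \<bullet> x = s}"

definition onto_hyper :: "'a::real_inner \<Rightarrow> real \<Rightarrow> 'a \<Rightarrow> 'a" where
  "onto_hyper n s x = x + (s - n \<bullet> x) *\<^sub>R n"

lemma hyper_closed: "closed (hyper (n::'a::euclidean_space) s)"
  unfolding hyper_def by (rule closed_hyperplane)

lemma hyper_borel [measurable]: "hyper (n::'a::euclidean_space) s \<in> sets borel"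
  by (rule borel_closed[OF hyper_closed])

lemma onto_hyper_measurable [measurable]: "onto_hyper (n::'a::euclidean_space) s \<in> borel_measurable borel"
  unfolding onto_hyper_def[abs_def] by measurable

lemma onto_hyper_in: "norm n = 1 \<Longrightarrow> onto_hyper n s x \<in> hyper n s"
  by (simp add: onto_hyper_def hyper_def inner_add_right norm_eq_1)

lemma flat_diff_onto_hyper: "flat n (x - y) = onto_hyper n s x - onto_hyper n s y"
  by (simp add: flat_def onto_hyper_def inner_diff_right algebra_simps)

definition cyl :: "'a::real_inner \<Rightarrow> real \<Rightarrow> 'a set \<Rightarrow> 'a set" where
  "cyl n s E = {x \<in> strip n s. onto_hyper n s x \<in> E}"

lemma cyl_borel [measurable]:
  assumes [measurable]: "E \<in> sets borel"
  shows "cyl (n::'a::euclidean_space) s E \<in> sets borel"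
proof -
  have "{x \<in> space borel. x \<in> strip n s \<and> onto_hyper n s x \<in> E} \<in> sets borel" by measurable
  then show ?thesis by (simp add: cyl_def)
qed

text \<open>The isodiametric inequality bounds the cylinder over each covering set by its Hausdorff
  weight. Passing to closures makes the covering sets Borel without changing diameters; the single
  scale \<open>1\<close> suffices because \<open>hausdorff_outer\<close> is a supremum over all
  scales.\<close>

lemma emeasure_cyl_le_hausdorff_outer:
  fixes n :: "'a::euclidean_space"
  assumes n: "norm n = 1" and E: "E \<in> sets borel" "E \<subseteq> hyper n s"
  shows "emeasure lborel (cyl n s E) \<le> hausdorff_outer (DIM('a) - 1) E"
proof -
  let ?k = "DIM('a) - 1"
  have "emeasure lborel (cyl n s E) \<le> hausdorff_pre ?k 1 E"
    unfolding hausdorff_pre_def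
  proof (rule INF_greatest, clarify)
    fix C :: "nat \<Rightarrow> 'a set"
    assume C: "E \<subseteq> (\<Union>i. C i)" "\<forall>i. bounded (C i) \<and> diameter (C i) \<le> 1"
    define K where "K i = closure (C i) \<inter> hyper n s" for i
    have K [measurable]: "K i \<in> sets borel" for i unfolding K_def by measurable
    have le: "emeasure lborel (cyl n s (K i)) \<le> hausdorff_weight ?k (C i)" for i
    proof (cases "C i = {}")
      case True
      then show ?thesis by (simp add: K_def cyl_def)
    next
      case False
      have bd: "bounded (C i)" using C by blast
      have "emeasure lborel (cyl n s (K i)) \<le> ennreal (unit_ball_vol (real ?k) * (diameter (C i) / 2) ^ ?k)"
      proof (rule isodiametric_cylinder[OF n])
        show "cyl n s (K i) \<subseteq> strip n s" by (auto simp: cyl_def)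
        show "0 \<le> diameter (C i)" using bd by (rule diameter_ge_0)
        fix x y assume "x \<in> cyl n s (K i)" "y \<in> cyl n s (K i)"
        then have "onto_hyper n s x \<in> closure (C i)" "onto_hyper n s y \<in> closure (C i)"
          by (auto simp: cyl_def K_def)
        then have "dist (onto_hyper n s x) (onto_hyper n s y) \<le> diameter (closure (C i))"
          using bd by (intro diameter_bounded_bound) auto
        then show "norm (flat n (x - y)) \<le> diameter (C i)"
          using bd by (simp add: diameter_closure dist_norm flat_diff_onto_hyper[of n x y s])
      qed measurable
      then show ?thesis using False by (simp add: hausdorff_weight_def)
    qed
    have "cyl n s E \<subseteq> (\<Union>i. cyl n s (K i))"
    proof
      fix x assume x: "x \<in> cyl n s E"
      then have y: "onto_hyper n s x \<in> E" by (simp add: cyl_def)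
      then obtain i where "onto_hyper n s x \<in> C i" using C(1) by blast
      then have "onto_hyper n s x \<in> K i"
        using y E(2) closure_subset unfolding K_def by blast
      then show "x \<in> (\<Union>i. cyl n s (K i))" using x by (auto simp: cyl_def)
    qed
    then have "emeasure lborel (cyl n s E) \<le> emeasure lborel (\<Union>i. cyl n s (K i))"
      by (intro emeasure_mono) auto
    also have "\<dots> \<le> (\<Sum>i. emeasure lborel (cyl n s (K i)))"
      by (rule emeasure_subadditive_countably) auto
    also have "\<dots> \<le> (\<Sum>i. hausdorff_weight ?k (C i))" by (intro suminf_le le) auto
    finally show "emeasure lborel (cyl n s E) \<le> (\<Sum>i. hausdorff_weight ?k (C i))" .
  qed
  also have "\<dots> \<le> hausdorff_outer ?k E" unfolding hausdorff_outer_def by (intro SUP_upper) auto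
  finally show ?thesis .
qed

text \<open>The padding balls of radius \<open>-1\<close> are empty.\<close>

lemma countable_balls_sequence:
  fixes C :: "('a::euclidean_space \<times> real) set"
  assumes C: "countable C" "pairwise (\<lambda>i j. disjnt (cball (fst i) (snd i)) (cball (fst j) (snd j))) C"
    and O: "\<And>i. i \<in> C \<Longrightarrow> cball (fst i) (snd i) \<subseteq> U" "U \<in> sets borel"
  obtains c :: "nat \<Rightarrow> 'a" and r :: "nat \<Rightarrow> real"
  where "\<And>i. r i = - 1 \<or> (c i, r i) \<in> C" "\<And>p. p \<in> C \<Longrightarrow> \<exists>i. p = (c i, r i)"
    "(\<Sum>i. emeasure lborel (cball (c i) (r i))) \<le> emeasure lborel U"
proof -
  define f where "f i = (if i \<in> to_nat_on C ` C then from_nat_into C i else (0, -1))" for i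
  have fC: "f i = (0, -1) \<or> f i \<in> C" for i using C(1) by (auto simp: f_def)
  have fsurj: "\<exists>i. p = f i" if "p \<in> C" for p
    using that C(1) by (intro exI[of _ "to_nat_on C p"]) (auto simp: f_def)
  have inj: "i = j" if "f i = f j" "f i \<noteq> (0, -1)" for i j
    using that C(1) by (auto simp: f_def split: if_splits)
  have disj: "disjoint_family (\<lambda>i. cball (fst (f i)) (snd (f i)))"
    unfolding disjoint_family_on_def
  proof (intro ballI impI)
    fix i j :: nat assume "i \<noteq> j"
    show "cball (fst (f i)) (snd (f i)) \<inter> cball (fst (f j)) (snd (f j)) = {}"
    proof (cases "f i = (0,-1) \<or> f j = (0,-1)")
      case False
      then have "f i \<in> C" "f j \<in> C" "f i \<noteq> f j" using fC inj \<open>i \<noteq> j\<close> by metis+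
      then show ?thesis using C(2) by (auto simp: pairwise_def disjnt_def)
    qed auto
  qed
  have "(\<Sum>i. emeasure lborel (cball (fst (f i)) (snd (f i)))) = emeasure lborel (\<Union>i. cball (fst (f i)) (snd (f i)))"
    by (rule suminf_emeasure[OF _ disj]) auto
  also have "(\<Union>i. cball (fst (f i)) (snd (f i))) \<subseteq> U"
  proof -
    have "cball (fst (f i)) (snd (f i)) \<subseteq> U" for i
      using fC[of i] by (elim disjE) (simp, rule O(1))
    then show ?thesis by blast
  qed
  then have "emeasure lborel (\<Union>i. cball (fst (f i)) (snd (f i))) \<le> emeasure lborel U"
    using O by (intro emeasure_mono) auto
  finally show ?thesis using fC fsurj by (intro that[of "\<lambda>i. snd (f i)" "\<lambda>i. fst (f i)"]) (auto, metis snd_conv)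
qed

lemma outer_open_lborel:
  assumes "A \<in> sets borel" "0 < e"
  obtains U where "open U" "A \<subseteq> U" "emeasure lborel U \<le> emeasure lborel A + ennreal e"
proof -
  obtain U where U: "open U" "A \<subseteq> U" "emeasure lebesgue (U - A) < ennreal e"
  proof (rule sets_lebesgue_outer_open[of A e])
    show "A \<in> sets lebesgue" "0 < e" using assms by auto
  qed (rule that)
  have "emeasure lborel U = emeasure lborel (A \<union> (U - A))" using U(2) by (simp add: Un_absorb1)
  also have "\<dots> \<le> emeasure lborel A + emeasure lborel (U - A)"
    using assms U by (intro emeasure_subadditive) auto
  also have "emeasure lborel (U - A) \<le> ennreal e" using U assms by (simp add: less_imp_le)
  finally show ?thesis using U that by (simp add: add_left_mono)
qed

text \<open>Vitali gives disjoint balls inside an open superset of nearly the measure of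
  \<open>W\<close>, covering that superset up to a null set. The null set costs little as well: it
  has an open superset of tiny measure, and disjoint balls in that superset cover the null set once
  their radii are multiplied by five.\<close>

lemma efficient_ball_cover:
  fixes W :: "'a::euclidean_space set"
  assumes W: "W \<in> sets borel" and pos: "0 < e" "0 < \<delta>"
  obtains c :: "nat \<Rightarrow> 'a" and r :: "nat \<Rightarrow> real"
  where "\<And>i. r i < \<delta>" "W \<subseteq> (\<Union>i. cball (c i) (r i))"
    "(\<Sum>i. emeasure lborel (cball (c i) (r i))) \<le> emeasure lborel W + ennreal e"
proof -
  let ?N = "DIM('a)"
  obtain U where U: "open U" "W \<subseteq> U" "emeasure lborel U \<le> emeasure lborel W + ennreal (e/2)"
    by (rule outer_open_lborel[OF W half_gt_zero[OF pos(1)]])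
  define K where "K = {p::'a \<times> real. 0 < snd p \<and> snd p < \<delta> \<and> cball (fst p) (snd p) \<subseteq> U}"
  have fine: "\<exists>i. i \<in> K \<and> x \<in> cball (fst i) (snd i) \<and> snd i < d" if "x \<in> U" "0 < d" for x d
  proof -
    obtain \<rho> where "0 < \<rho>" "cball x \<rho> \<subseteq> U" using U(1) \<open>x \<in> U\<close> open_contains_cball by blast
    moreover define q where "q = min \<rho> (min (d/2) (\<delta>/2))"
    ultimately have "(x, q) \<in> K" "q < d" "0 < q" using that pos by (auto simp: K_def q_def)
    then show ?thesis by (intro exI[of _ "(x, q)"]) auto
  qed
  obtain C where C: "countable C" "C \<subseteq> K"
    "pairwise (\<lambda>i j. disjnt (cball (fst i) (snd i)) (cball (fst j) (snd j))) C"
    "negligible (U - (\<Union>i\<in>C. cball (fst i) (snd i)))"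
    by (rule Vitali_covering_theorem_cballs[of K snd U fst, OF _ fine]) (auto simp: K_def)
  have "\<And>i. i \<in> C \<Longrightarrow> cball (fst i) (snd i) \<subseteq> U" using C(2) by (auto simp: K_def)
  then obtain r and c :: "nat \<Rightarrow> 'a" where cr: "\<And>i. r i = - 1 \<or> (c i, r i) \<in> C"
    "\<And>p. p \<in> C \<Longrightarrow> \<exists>i. p = (c i, r i)"
    "(\<Sum>i. emeasure lborel (cball (c i) (r i))) \<le> emeasure lborel U"
    by (rule countable_balls_sequence[OF C(1,3) _ borel_open[OF U(1)]]) (assumption, rule that)
  define R where "R = U - (\<Union>i\<in>C. cball (fst i) (snd i))"
  have RB: "R \<in> sets borel"
    unfolding R_def using C(1) U(1) by (intro sets.Diff sets.countable_UN') auto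
  then have R0: "emeasure lborel R = 0"
    using C(4) by (simp add: R_def negligible_iff_null_sets null_sets_def)
  \<comment> \<open>The factor \<open>5 ^ ?N\<close> compensates the growth of volume under the
    enlargement of the radii.\<close>
  obtain V where V: "open V" "R \<subseteq> V" "emeasure lborel V \<le> 0 + ennreal (e / 2 / 5 ^ ?N)"
  proof (rule outer_open_lborel[OF RB])
    show "0 < e / 2 / 5 ^ ?N" using pos by simp
  qed (rule that, simp_all only: R0)
  define K' where "K' = {p::'a \<times> real. 0 < snd p \<and> snd p < \<delta> / 5 \<and> cball (fst p) (snd p) \<subseteq> V}"
  have "R \<subseteq> (\<Union>i\<in>K'. cball (fst i) (snd i))"
  proof
    fix x assume "x \<in> R"
    then obtain \<rho> where "0 < \<rho>" "cball x \<rho> \<subseteq> V" using V open_contains_cball by blast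
    then have "(x, min \<rho> (\<delta>/10)) \<in> K'" using pos by (auto simp: K'_def)
    moreover have "x \<in> cball x (min \<rho> (\<delta>/10))" using \<open>0 < \<rho>\<close> pos by auto
    ultimately show "x \<in> (\<Union>i\<in>K'. cball (fst i) (snd i))" by force
  qed
  then obtain C' where C': "countable C'" "C' \<subseteq> K'"
    "pairwise (\<lambda>i j. disjnt (cball (fst i) (snd i)) (cball (fst j) (snd j))) C'"
    "R \<subseteq> (\<Union>i\<in>C'. cball (fst i) (5 * snd i))"
    by (rule Vitali_covering_lemma_cballs[of R fst snd K' \<delta>]) (use pos in \<open>auto simp: K'_def\<close>)
  have "\<And>i. i \<in> C' \<Longrightarrow> cball (fst i) (snd i) \<subseteq> V" using C'(2) by (auto simp: K'_def)
  then obtain r' and c' :: "nat \<Rightarrow> 'a" where cr': "\<And>i. r' i = - 1 \<or> (c' i, r' i) \<in> C'"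
    "\<And>p. p \<in> C' \<Longrightarrow> \<exists>i. p = (c' i, r' i)"
    "(\<Sum>i. emeasure lborel (cball (c' i) (r' i))) \<le> emeasure lborel V"
    by (rule countable_balls_sequence[OF C'(1,3) _ borel_open[OF V(1)]]) (assumption, rule that)
  have five: "emeasure lborel (cball x (5 * \<rho>)) = ennreal (5 ^ ?N) * emeasure lborel (cball x \<rho>)" for x :: 'a and \<rho>
    by (cases "0 \<le> \<rho>") (simp_all add: emeasure_cball ennreal_mult[symmetric] power_mult_distrib mult_ac)
  have sum': "(\<Sum>i. emeasure lborel (cball (c' i) (5 * r' i))) \<le> ennreal (e / 2)"
  proof -
    have "(\<Sum>i. emeasure lborel (cball (c' i) (5 * r' i))) \<le> ennreal (5 ^ ?N) * ennreal (e / 2 / 5 ^ ?N)"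
      unfolding five ennreal_suminf_cmult using cr'(3) V(3) by (intro mult_left_mono) auto
    also have "\<dots> = ennreal (e / 2)" using pos by (simp add: ennreal_mult[symmetric])
    finally show ?thesis .
  qed
  \<comment> \<open>Row 0 holds the disjoint balls, row 1 the enlarged ones, all further rows empty
    balls; \<open>prod_decode\<close> merges the rows into one sequence.\<close>
  define B where "B m i = (if m = 0 then (c i, r i) else if m = 1 then (c' i, 5 * r' i) else (0, -1))"
    for m i :: nat
  define D where "D = case_prod B o prod_decode"
  have cov: "W \<subseteq> (\<Union>i. cball (fst (D i)) (snd (D i)))"
  proof
    fix x assume "x \<in> W"
    then have "x \<in> U" using U by auto
    have "\<exists>m i. x \<in> cball (fst (B m i)) (snd (B m i))"
    proof (cases "x \<in> R")
      case True
      then obtain p where "p \<in> C'" "x \<in> cball (fst p) (5 * snd p)" using C'(4) by auto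
      then obtain i where "x \<in> cball (c' i) (5 * r' i)" using cr'(2) by fastforce
      then show ?thesis by (intro exI[of _ 1] exI[of _ i]) (simp add: B_def)
    next
      case False
      then obtain p where "p \<in> C" "x \<in> cball (fst p) (snd p)" using \<open>x \<in> U\<close> by (auto simp: R_def)
      then obtain i where "x \<in> cball (c i) (r i)" using cr(2) by fastforce
      then show ?thesis by (intro exI[of _ 0] exI[of _ i]) (simp add: B_def)
    qed
    then obtain m i where "x \<in> cball (fst (B m i)) (snd (B m i))" by blast
    then show "x \<in> (\<Union>i. cball (fst (D i)) (snd (D i)))"
      by (auto simp: D_def intro!: exI[of _ "prod_encode (m, i)"])
  qed
  have "(\<Sum>i. emeasure lborel (cball (fst (D i)) (snd (D i))))
      = (\<Sum>m. \<Sum>i. emeasure lborel (cball (fst (B m i)) (snd (B m i))))"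
    unfolding D_def comp_def
    by (rule suminf_ennreal_2dimen[where f="\<lambda>x. emeasure lborel (cball (fst (case_prod B x)) (snd (case_prod B x)))"]) auto
  also have "\<dots> = (\<Sum>m\<in>{0,1}. \<Sum>i. emeasure lborel (cball (fst (B m i)) (snd (B m i))))"
    by (rule suminf_finite) (auto simp: B_def)
  also have "\<dots> = (\<Sum>i. emeasure lborel (cball (c i) (r i))) + (\<Sum>i. emeasure lborel (cball (c' i) (5 * r' i)))"
    by (simp add: B_def)
  also have "\<dots> \<le> (emeasure lborel W + ennreal (e/2)) + ennreal (e/2)"
    using cr(3) U(3) sum' by (intro add_mono) auto
  also have "\<dots> = emeasure lborel W + ennreal e"
    using pos by (simp add: add.assoc flip: ennreal_plus)
  finally have sum: "(\<Sum>i. emeasure lborel (cball (fst (D i)) (snd (D i)))) \<le> emeasure lborel W + ennreal e" .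
  have "r i < \<delta>" for i using cr(1)[of i] C(2) pos by (auto simp: K_def)
  moreover have "5 * r' i < \<delta>" for i using cr'(1)[of i] C'(2) pos by (auto simp: K'_def)
  ultimately have "snd (D i) < \<delta>" for i
    using pos by (auto simp: D_def B_def split: prod.splits)
  then show ?thesis using cov sum by (rule that)
qed

text \<open>
  A cover of \<open>E + [0,1)n\<close> by balls is cut at height \<open>z\<close> into a cover of \<open>E\<close> by discs. The discs have, on
  average over \<open>z\<close>, total \<open>(N-1)\<close>-volume at most the total volume of the balls.
\<close>

lemma hausdorff_outer_le_emeasure_cyl:
  fixes n :: "'a::euclidean_space"
  assumes n: "norm n = 1" and E: "E \<in> sets borel" "E \<subseteq> hyper n s"
  shows "hausdorff_outer (DIM('a) - 1) E \<le> emeasure lborel (cyl n s E)"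
  unfolding hausdorff_outer_def
proof (rule SUP_least, rule ennreal_le_epsilon)
  let ?k = "DIM('a) - 1"
  fix \<delta> e :: real assume "\<delta> \<in> {0<..}" "0 < e" and fin: "emeasure lborel (cyl n s E) < top"
  then have pos: "0 < \<delta>" by auto
  have nn: "n \<bullet> n = 1" using n by (simp add: norm_eq_1)
  obtain c :: "nat \<Rightarrow> 'a" and r where r: "\<And>i. r i < \<delta> / 2" and cov: "cyl n s E \<subseteq> (\<Union>i. cball (c i) (r i))"
    and sum: "(\<Sum>i. emeasure lborel (cball (c i) (r i))) \<le> emeasure lborel (cyl n s E) + ennreal (e/2)"
    by (rule efficient_ball_cover[OF cyl_borel[OF E(1), of n s] half_gt_zero[OF \<open>0 < e\<close>] half_gt_zero[OF pos]]) (rule that)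
  define a where "a i z = (\<integral>\<^sup>+x. indicator (cball (c i) (r i)) (x + (z - n \<bullet> x) *\<^sub>R n) * indicator (strip n s) x \<partial>lborel)"
    for i z
  have [measurable]: "cball (c i) (r i) \<in> sets borel" for i by simp
  have [measurable]: "a i \<in> borel_measurable lborel" for i
    unfolding a_def[abs_def] by (rule lborel.borel_measurable_nn_integral) measurable
  have inta: "(\<integral>\<^sup>+z. a i z \<partial>lborel) = emeasure lborel (cball (c i) (r i))" for i
    unfolding a_def by (subst nn_integral_cavalieri) (auto simp: nn intro!: borel_measurable_indicator)
  \<comment> \<open>Averaging: if every height cost more than the volume plus \<open>e\<close>,
    integrating over a unit interval would exceed the total volume of the balls, which is within
    \<open>e/2\<close> of the volume.\<close>
  have "\<exists>z\<in>{s..<s+1}. (\<Sum>i. a i z) \<le> emeasure lborel (cyl n s E) + ennreal e"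
  proof (rule ccontr)
    assume "\<not> ?thesis"
    then have gt: "\<And>z. z \<in> {s..<s+1} \<Longrightarrow> emeasure lborel (cyl n s E) + ennreal e < (\<Sum>i. a i z)"
      by (auto simp: not_le)
    have "emeasure lborel (cyl n s E) + ennreal e
        = (\<integral>\<^sup>+z. (emeasure lborel (cyl n s E) + ennreal e) * indicator {s..<s+1} z \<partial>lborel)"
      by (simp add: nn_integral_cmult)
    also have "\<dots> \<le> (\<integral>\<^sup>+z. (\<Sum>i. a i z) \<partial>lborel)"
      using gt by (intro nn_integral_mono) (auto simp: indicator_def less_imp_le)
    also have "\<dots> = (\<Sum>i. \<integral>\<^sup>+z. a i z \<partial>lborel)"
      by (rule nn_integral_suminf) auto
    also have "\<dots> \<le> emeasure lborel (cyl n s E) + ennreal (e/2)" using sum by (simp add: inta)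
    finally show False using fin \<open>0 < e\<close> by (simp add: ennreal_add_left_cancel_le)
  qed
  then obtain z where z: "z \<in> {s..<s+1}" "(\<Sum>i. a i z) \<le> emeasure lborel (cyl n s E) + ennreal e" by blast
  \<comment> \<open>The section of the \<open>i\<close>-th ball at height \<open>z\<close>, moved
    down to the hyperplane of \<open>E\<close>. By Pythagoras it is a disc about the projected
    centre \<open>p i\<close>.\<close>
  define D where "D i = {y \<in> hyper n s. y + (z - s) *\<^sub>R n \<in> cball (c i) (r i)}" for i
  define p where "p i = onto_hyper n s (c i)" for i
  have dec: "(norm (y + (z - s) *\<^sub>R n - c i))\<^sup>2 = (norm (y - p i))\<^sup>2 + (z - n \<bullet> c i)\<^sup>2" if "y \<in> hyper n s" for y i
  proof -
    have eq: "y + (z - s) *\<^sub>R n - c i = (y - p i) + (z - n \<bullet> c i) *\<^sub>R n"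
      by (simp add: p_def onto_hyper_def algebra_simps)
    have "n \<bullet> (y - p i) = 0"
      using that onto_hyper_in[OF n, of s "c i"] by (simp add: p_def hyper_def inner_diff_right)
    then show ?thesis unfolding eq by (rule norm_sq_plus_orthogonal[OF n])
  qed
  have wle: "hausdorff_weight ?k (D i) \<le> a i z" and bdD: "bounded (D i)" "diameter (D i) \<le> \<delta>" for i
  proof -
    consider "D i = {}" | "D i \<noteq> {}" by blast
    then have "hausdorff_weight ?k (D i) \<le> a i z \<and> bounded (D i) \<and> diameter (D i) \<le> \<delta>"
    proof cases
      case 1
      then show ?thesis using pos by (simp add: hausdorff_weight_def)
    next
      case 2
      then obtain y0 where y0: "y0 \<in> hyper n s" "norm (y0 + (z - s) *\<^sub>R n - c i) \<le> r i"
        by (auto simp: D_def dist_norm norm_minus_commute)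
      then have r0: "0 \<le> r i" using norm_ge_zero order_trans by blast
      define q where "q = (r i)\<^sup>2 - (z - n \<bullet> c i)\<^sup>2"
      have "(norm (y0 + (z - s) *\<^sub>R n - c i))\<^sup>2 \<le> (r i)\<^sup>2" using y0 by (intro power_mono) auto
      then have q0: "0 \<le> q" using dec[OF y0(1), of i] zero_le_power2[of "norm (y0 - p i)"]
        unfolding q_def by linarith
      have qr: "sqrt q \<le> r i" unfolding q_def by (rule real_le_lsqrt) (auto simp: r0)
      have iff: "y + (z - s) *\<^sub>R n \<in> cball (c i) (r i) \<longleftrightarrow> norm (y - p i) \<le> sqrt q" if "y \<in> hyper n s" for y
      proof -
        have "y + (z - s) *\<^sub>R n \<in> cball (c i) (r i) \<longleftrightarrow> (norm (y + (z - s) *\<^sub>R n - c i))\<^sup>2 \<le> (r i)\<^sup>2"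
          using r0 by (simp add: dist_norm norm_minus_commute abs_le_square_iff[symmetric])
        also have "\<dots> \<longleftrightarrow> (norm (y - p i))\<^sup>2 \<le> q" using dec[OF that, of i] by (auto simp: q_def)
        also have "\<dots> \<longleftrightarrow> norm (y - p i) \<le> sqrt q"
          using q0 by (metis norm_ge_zero real_le_rsqrt real_sqrt_le_iff real_sqrt_unique)
        finally show ?thesis .
      qed
      have Dsub: "D i \<subseteq> cball (p i) (sqrt q)" using iff by (auto simp: D_def dist_norm norm_minus_commute)
      then have bd: "bounded (D i)" using bounded_cball bounded_subset by blast
      have dia: "diameter (D i) \<le> 2 * sqrt q"
        using diameter_subset[OF Dsub] q0 by simp
      \<comment> \<open>The section integral is the volume of the unit cylinder over the disc, and
        this is the Hausdorff weight belonging to the diameter \<open>2 * sqrt q\<close>.\<close>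
      have "a i z = emeasure lborel (cyl_disc n (s - n \<bullet> c i) (sqrt q))"
      proof -
        have "a i z = (\<integral>\<^sup>+x. indicator (cyl_disc n (s - n \<bullet> c i) (sqrt q)) (x + (- c i)) \<partial>lborel)"
          unfolding a_def
        proof (rule nn_integral_cong)
          fix x
          have "x + (z - n \<bullet> x) *\<^sub>R n = onto_hyper n s x + (z - s) *\<^sub>R n"
            by (simp add: onto_hyper_def algebra_simps)
          then have "x + (z - n \<bullet> x) *\<^sub>R n \<in> cball (c i) (r i) \<longleftrightarrow> norm (flat n (x - c i)) \<le> sqrt q"
            using iff[OF onto_hyper_in[OF n, of s x]] by (simp add: p_def flat_diff_onto_hyper[of n x "c i" s])
          then show "indicator (cball (c i) (r i)) (x + (z - n \<bullet> x) *\<^sub>R n) * indicator (strip n s) x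
              = (indicator (cyl_disc n (s - n \<bullet> c i) (sqrt q)) (x + (- c i)) :: ennreal)"
            by (auto simp: indicator_def cyl_disc_def strip_def inner_diff_right)
        qed
        also have "\<dots> = emeasure lborel (cyl_disc n (s - n \<bullet> c i) (sqrt q))"
          by (subst nn_integral_lborel_translate) auto
        finally show ?thesis .
      qed
      then have az: "a i z = ennreal (unit_ball_vol (real ?k) * sqrt q ^ ?k)"
        using q0 by (simp add: emeasure_cyl_disc[OF n])
      have "hausdorff_weight ?k (D i) \<le> a i z"
        unfolding az hausdorff_weight_def using dia diameter_ge_0[OF bd]
        by (auto intro!: ennreal_leI mult_left_mono power_mono)
      then show ?thesis using bd dia qr r[of i] by auto
    qed
    then show "hausdorff_weight ?k (D i) \<le> a i z" "bounded (D i)" "diameter (D i) \<le> \<delta>" by auto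
  qed
  have "E \<subseteq> (\<Union>i. D i)"
  proof
    fix y assume y: "y \<in> E"
    then have yh: "y \<in> hyper n s" using E by auto
    then have "y + (z - s) *\<^sub>R n \<in> cyl n s E"
      using y z by (auto simp: cyl_def strip_def hyper_def onto_hyper_def inner_add_right nn algebra_simps)
    then obtain i where "y + (z - s) *\<^sub>R n \<in> cball (c i) (r i)" using cov by blast
    then show "y \<in> (\<Union>i. D i)" using yh by (auto simp: D_def)
  qed
  then have "hausdorff_pre ?k \<delta> E \<le> (\<Sum>i. hausdorff_weight ?k (D i))"
    using bdD by (intro hausdorff_pre_le)
  also have "\<dots> \<le> (\<Sum>i. a i z)" by (intro suminf_le wle) auto
  finally show "hausdorff_pre ?k \<delta> E \<le> emeasure lborel (cyl n s E) + ennreal e" using z(2) by simp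
qed

theorem hausdorff_outer_hyper:
  fixes n :: "'a::euclidean_space"
  assumes "norm n = 1" "E \<in> sets borel" "E \<subseteq> hyper n s"
  shows "hausdorff_outer (DIM('a) - 1) E = emeasure lborel (cyl n s E)"
  using emeasure_cyl_le_hausdorff_outer[OF assms] hausdorff_outer_le_emeasure_cyl[OF assms] by (rule antisym[rotated])

lemma emeasure_hausdorff_hyper:
  fixes n :: "'a::euclidean_space"
  assumes "norm n = 1" "E \<in> sets borel" "E \<subseteq> hyper n s"
  shows "emeasure (hausdorff_measure (DIM('a) - 1)) E = emeasure lborel (cyl n s E)"
  unfolding emeasure_hausdorff_measure[OF assms(2)] by (rule hausdorff_outer_hyper[OF assms])

lemma hausdorff_hyper_eq_distr:
  fixes n :: "'a::euclidean_space"
  assumes n: "norm n = 1"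
  shows "density (hausdorff_measure (DIM('a) - 1)) (indicator (hyper n s))
    = distr (density lborel (indicator (strip n s))) borel (onto_hyper n s)"
    (is "?L = ?R")
proof (rule measure_eqI)
  fix A assume "A \<in> sets ?L"
  then have [measurable]: "A \<in> sets borel" by simp
  have "emeasure ?L A = emeasure (hausdorff_measure (DIM('a) - 1)) (hyper n s \<inter> A)"
    by (subst emeasure_density) (auto simp flip: nn_integral_indicator indicator_inter_arith)
  also have "\<dots> = emeasure lborel (cyl n s (hyper n s \<inter> A))"
    by (rule emeasure_hausdorff_hyper[OF n]) auto
  also have "cyl n s (hyper n s \<inter> A) = onto_hyper n s -` A \<inter> strip n s"
    using onto_hyper_in[OF n] by (auto simp: cyl_def)
  also have "emeasure lborel \<dots> = (\<integral>\<^sup>+x. indicator (onto_hyper n s -` A \<inter> strip n s) x \<partial>lborel)"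
    by (rule nn_integral_indicator[symmetric]) (use measurable_sets_borel[OF onto_hyper_measurable \<open>A \<in> sets borel\<close>] in auto)
  also have "\<dots> = (\<integral>\<^sup>+x. indicator (strip n s) x * indicator A (onto_hyper n s x) \<partial>lborel)"
    by (intro nn_integral_cong) (auto simp: indicator_def)
  also have "\<dots> = (\<integral>\<^sup>+x. indicator A x \<partial>?R)"
    by (subst nn_integral_distr) (auto simp: nn_integral_density)
  also have "\<dots> = emeasure ?R A" by simp
  finally show "emeasure ?L A = emeasure ?R A" .
qed simp

lemma nn_integral_hausdorff_hyper:
  fixes n :: "'a::euclidean_space" and f :: "'a \<Rightarrow> ennreal"
  assumes n: "norm n = 1" and f [measurable]: "f \<in> borel_measurable borel"
  shows "(\<integral>\<^sup>+x. f x * indicator (hyper n s) x \<partial>hausdorff_measure (DIM('a) - 1))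
    = (\<integral>\<^sup>+x. f (onto_hyper n s x) * indicator (strip n s) x \<partial>lborel)"
proof -
  have "(\<integral>\<^sup>+x. f x * indicator (hyper n s) x \<partial>hausdorff_measure (DIM('a) - 1))
      = (\<integral>\<^sup>+x. f x \<partial>density (hausdorff_measure (DIM('a) - 1)) (indicator (hyper n s)))"
    by (subst nn_integral_density) (auto simp: mult.commute)
  also have "\<dots> = (\<integral>\<^sup>+x. f (onto_hyper n s x) * indicator (strip n s) x \<partial>lborel)"
    unfolding hausdorff_hyper_eq_distr[OF n]
    by (subst nn_integral_distr) (auto simp: nn_integral_density mult.commute)
  finally show ?thesis .
qed

text \<open>Since \<open>n \<bullet> w = 0\<close>, the shear slides every line in direction
  \<open>w\<close> along itself; slicing along \<open>w\<close> reduces the claim to translation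
  invariance on the real line.\<close>

lemma nn_integral_lborel_shear:
  fixes n w :: "'a::euclidean_space" and g :: "'a \<Rightarrow> ennreal"
  assumes [measurable]: "g \<in> borel_measurable borel" and nw: "n \<bullet> w = 0"
  shows "(\<integral>\<^sup>+x. g (x + (n \<bullet> x - s) *\<^sub>R w) \<partial>lborel) = (\<integral>\<^sup>+x. g x \<partial>lborel)"
proof (cases "w = 0")
  case False
  define m where "m = w /\<^sub>R (w \<bullet> w)"
  have mw: "m \<bullet> w = 1" using False by (simp add: m_def)
  have "(\<integral>\<^sup>+t. g (x + t *\<^sub>R w + (n \<bullet> (x + t *\<^sub>R w) - s) *\<^sub>R w) \<partial>lborel) = (\<integral>\<^sup>+t. g (x + t *\<^sub>R w) \<partial>lborel)" for x
    using nn_integral_lborel_translate[of "\<lambda>t. g (x + t *\<^sub>R w)" "n \<bullet> x - s"]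
    by (simp add: inner_add_right nw algebra_simps)
  then show ?thesis
    using nn_integral_slice[of "\<lambda>x. g (x + (n \<bullet> x - s) *\<^sub>R w)" m w 0] nn_integral_slice[of g m w 0] mw
    by simp
qed simp

text \<open>The crossing point of the hyperplane with the line through \<open>x\<close> in direction
  \<open>v\<close>. For \<open>n \<bullet> v = 0\<close> division by zero makes it \<open>x\<close>
  itself; the integral formulas concern transversal directions.\<close>

definition hit :: "'a::real_inner \<Rightarrow> real \<Rightarrow> 'a \<Rightarrow> 'a \<Rightarrow> 'a" where
  "hit n s v x = x + ((s - n \<bullet> x) / (n \<bullet> v)) *\<^sub>R v"

lemma hit_measurable [measurable]: "hit (n::'a::euclidean_space) s v \<in> borel_measurable borel"
  unfolding hit_def[abs_def] by measurable

lemma hit_line: "n \<bullet> v \<noteq> 0 \<Longrightarrow> hit n s v (x + t *\<^sub>R v) = hit n s v x"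
  by (simp add: hit_def inner_add_right algebra_simps diff_divide_distrib add_divide_distrib)

text \<open>A shear turns orthogonal projection into projection along \<open>v\<close>. Measured
  along \<open>v\<close>, the unit strip of \<open>n\<close> has length
  \<open>1 / (n \<bullet> v)\<close>; this is where the density factor comes from.\<close>

lemma nn_integral_hit_pos:
  fixes n v m :: "'a::euclidean_space" and f :: "'a \<Rightarrow> ennreal"
  assumes n: "norm n = 1" and nv: "0 < n \<bullet> v" and mv: "m \<bullet> v = 1"
    and f [measurable]: "f \<in> borel_measurable borel"
  shows "(\<integral>\<^sup>+x. f (hit n s v x) * indicator (strip m c) x \<partial>lborel)
    = ennreal (n \<bullet> v) * (\<integral>\<^sup>+x. f x * indicator (hyper n s) x \<partial>hausdorff_measure (DIM('a) - 1))"
proof -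
  define \<alpha> where "\<alpha> = n \<bullet> v"
  have \<alpha>: "0 < \<alpha>" using nv by (simp add: \<alpha>_def)
  \<comment> \<open>The difference of two ways to change the height by one, along \<open>n\<close>
    and along the rescaled \<open>v\<close>; adding multiples of it converts one projection into the
    other.\<close>
  define w where "w = n - v /\<^sub>R \<alpha>"
  have nw: "n \<bullet> w = 0" using n \<alpha> by (simp add: w_def inner_diff_right \<alpha>_def[symmetric] norm_eq_1)
  have sh: "onto_hyper n s (x + (n \<bullet> x - s) *\<^sub>R w) = hit n s v x" for x
    using \<alpha> by (simp add: onto_hyper_def hit_def inner_add_right nw \<alpha>_def[symmetric])
      (simp add: w_def algebra_simps divide_inverse)
  have "(\<integral>\<^sup>+x. f x * indicator (hyper n s) x \<partial>hausdorff_measure (DIM('a) - 1))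
      = (\<integral>\<^sup>+x. f (onto_hyper n s x) * indicator (strip n s) x \<partial>lborel)"
    by (rule nn_integral_hausdorff_hyper[OF n f])
  also have "\<dots> = (\<integral>\<^sup>+x. f (onto_hyper n s (x + (n \<bullet> x - s) *\<^sub>R w)) * indicator (strip n s) (x + (n \<bullet> x - s) *\<^sub>R w) \<partial>lborel)"
    by (rule nn_integral_lborel_shear[OF _ nw, symmetric]) measurable
  also have "\<dots> = (\<integral>\<^sup>+x. f (hit n s v x) * indicator (strip n s) x \<partial>lborel)"
    unfolding sh by (simp add: strip_def indicator_def inner_add_right nw)
  also have "\<dots> = (\<integral>\<^sup>+x. f (hit n s v x) * indicator {x. s / \<alpha> \<le> (n /\<^sub>R \<alpha>) \<bullet> x \<and> (n /\<^sub>R \<alpha>) \<bullet> x < (s + 1) / \<alpha>} x \<partial>lborel)"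
    using \<alpha> by (intro nn_integral_cong) (simp add: strip_def indicator_def field_simps)
  also have "\<dots> = ennreal ((s + 1) / \<alpha> - s / \<alpha>) * (\<integral>\<^sup>+x. f (hit n s v x) * indicator (strip m c) x \<partial>lborel)"
    by (rule nn_integral_slab[where v = v])
       (use \<alpha> nv mv in \<open>auto simp: hit_line divide_right_mono \<alpha>_def[symmetric]\<close>)
  finally have "ennreal \<alpha> * (\<integral>\<^sup>+x. f x * indicator (hyper n s) x \<partial>hausdorff_measure (DIM('a) - 1))
      = (ennreal \<alpha> * ennreal (1 / \<alpha>)) * (\<integral>\<^sup>+x. f (hit n s v x) * indicator (strip m c) x \<partial>lborel)"
    by (simp add: add_divide_distrib mult.assoc)
  also have "ennreal \<alpha> * ennreal (1 / \<alpha>) = 1" using \<alpha> by (simp flip: ennreal_mult)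
  finally show ?thesis by (simp add: \<alpha>_def)
qed

lemma nn_integral_hit:
  fixes n v m :: "'a::euclidean_space" and f :: "'a \<Rightarrow> ennreal"
  assumes n: "norm n = 1" and nv: "n \<bullet> v \<noteq> 0" and mv: "m \<bullet> v = 1"
    and f: "f \<in> borel_measurable borel"
  shows "(\<integral>\<^sup>+x. f (hit n s v x) * indicator (strip m c) x \<partial>lborel)
    = ennreal \<bar>n \<bullet> v\<bar> * (\<integral>\<^sup>+x. f x * indicator (hyper n s) x \<partial>hausdorff_measure (DIM('a) - 1))"
proof (cases "0 < n \<bullet> v")
  case True
  then show ?thesis using nn_integral_hit_pos[OF n True mv f] by simp
next
  case False
  then have "0 < (- n) \<bullet> v" "norm (- n) = 1" using nv n by auto
  \<comment> \<open>Reversing the normal together with the height keeps the hyperplane and the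
    crossing points.\<close>
  moreover have "hit (- n) (- s) v = hit n s v"
  proof
    fix x
    have "- s - (- n) \<bullet> x = - (s - n \<bullet> x)" "(- n) \<bullet> v = - (n \<bullet> v)" by simp_all
    then show "hit (- n) (- s) v x = hit n s v x" by (simp only: hit_def minus_divide_divide)
  qed
  moreover have "hyper (- n) (- s) = hyper n s" by (auto simp: hyper_def)
  ultimately show ?thesis using nn_integral_hit_pos[of "- n" v m f "- s" c] mv f False by simp
qed

text \<open>The transported measure and the weighted surface measure coincide as measures, so the
  Bochner integrals agree whether or not \<open>f\<close> is integrable.\<close>

lemma integral_hit:
  fixes n v m :: "'a::euclidean_space" and f :: "'a \<Rightarrow> real"
  assumes n: "norm n = 1" and nv: "n \<bullet> v \<noteq> 0" and mv: "m \<bullet> v = 1"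
    and f [measurable]: "f \<in> borel_measurable borel"
  shows "(\<integral>x. indicator (strip m c) x * f (hit n s v x) \<partial>lborel)
    = \<bar>n \<bullet> v\<bar> * (\<integral>x. indicator (hyper n s) x * f x \<partial>hausdorff_measure (DIM('a) - 1))"
proof -
  let ?H = "hausdorff_measure (DIM('a) - 1) :: 'a measure"
  have eq: "distr (density lborel (\<lambda>x. ennreal (indicator (strip m c) x))) borel (hit n s v)
      = density ?H (\<lambda>x. ennreal (\<bar>n \<bullet> v\<bar> * indicator (hyper n s) x))" (is "?L = ?R")
  proof (rule measure_eqI)
    fix A assume "A \<in> sets ?L"
    then have [measurable]: "A \<in> sets borel" by simp
    have "emeasure ?L A = (\<integral>\<^sup>+x. indicator A x \<partial>?L)" by simp
    also have "\<dots> = (\<integral>\<^sup>+x. indicator A (hit n s v x) * indicator (strip m c) x \<partial>lborel)"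
      by (subst nn_integral_distr) (auto simp: nn_integral_density ennreal_indicator mult.commute)
    also have "\<dots> = ennreal \<bar>n \<bullet> v\<bar> * (\<integral>\<^sup>+x. indicator A x * indicator (hyper n s) x \<partial>?H)"
      by (rule nn_integral_hit[OF n nv mv]) measurable
    also have "\<dots> = (\<integral>\<^sup>+x. ennreal \<bar>n \<bullet> v\<bar> * (indicator A x * indicator (hyper n s) x) \<partial>?H)"
      by (rule nn_integral_cmult[symmetric]) measurable
    also have "\<dots> = emeasure ?R A"
      by (subst emeasure_density) (auto intro!: nn_integral_cong simp: indicator_def)
    finally show "emeasure ?L A = emeasure ?R A" .
  qed simp
  have "(\<integral>x. indicator (strip m c) x * f (hit n s v x) \<partial>lborel) = (\<integral>x. f x \<partial>?L)"
    by (subst integral_distr) (auto simp: integral_density)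
  also have "\<dots> = (\<integral>x. \<bar>n \<bullet> v\<bar> * (indicator (hyper n s) x * f x) \<partial>?H)"
    unfolding eq by (subst integral_density) (auto simp: mult.assoc)
  also have "\<dots> = \<bar>n \<bullet> v\<bar> * (\<integral>x. indicator (hyper n s) x * f x \<partial>?H)" by simp
  finally show ?thesis .
qed

text \<open>The cylinder over the intersection lies in a hyperplane whose normal \<open>q\<close> is
  the part of \<open>n'\<close> orthogonal to \<open>n\<close>. For unit vectors that are neither
  equal nor opposite this part is nonzero, so the cylinder is Lebesgue null.\<close>

lemma hausdorff_null_hyper_Int:
  fixes n :: "'a::euclidean_space"
  assumes n: "norm n = 1" "norm n' = 1" "n \<noteq> n'" "n \<noteq> - n'"
  shows "emeasure (hausdorff_measure (DIM('a) - 1)) (hyper n s \<inter> hyper n' s') = 0"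
proof -
  define q where "q = n' - (n' \<bullet> n) *\<^sub>R n"
  have "q \<noteq> 0"
  proof
    assume "q = 0"
    then have eq: "n' = (n' \<bullet> n) *\<^sub>R n" by (simp add: q_def)
    then have "norm n' = \<bar>n' \<bullet> n\<bar> * norm n" by (metis norm_scaleR)
    then have "n' \<bullet> n = 1 \<or> n' \<bullet> n = -1" using n by (auto simp: abs_if split: if_splits)
    then show False using eq n by auto
  qed
  have "cyl n s (hyper n s \<inter> hyper n' s') \<subseteq> {x. q \<bullet> x = s' - s * (n' \<bullet> n)}"
    by (auto simp: cyl_def hyper_def onto_hyper_def q_def inner_add_right inner_diff_left algebra_simps inner_commute)
  then have "emeasure lborel (cyl n s (hyper n s \<inter> hyper n' s'))
      \<le> emeasure lborel {x. q \<bullet> x = s' - s * (n' \<bullet> n)}"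
    by (intro emeasure_mono) auto
  also have "\<dots> = 0"
    using negligible_hyperplane[of q "s' - s * (n' \<bullet> n)"] \<open>q \<noteq> 0\<close>
    by (simp add: negligible_iff_null_sets null_sets_def)
  finally have "emeasure lborel (cyl n s (hyper n s \<inter> hyper n' s')) = 0" by simp
  moreover have "emeasure (hausdorff_measure (DIM('a) - 1)) (hyper n s \<inter> hyper n' s')
      = emeasure lborel (cyl n s (hyper n s \<inter> hyper n' s'))"
    by (rule emeasure_hausdorff_hyper[OF n(1)]) auto
  ultimately show ?thesis by simp
qed

section \<open>Test functions\<close>

text \<open>The gradient is carried as an explicit vector field, so that products and compositions
  yield usable formulas and vanishing directional derivatives can be tracked.\<close>

definition C1 :: "('a::euclidean_space \<Rightarrow> real) \<Rightarrow> ('a \<Rightarrow> 'a) \<Rightarrow> bool" where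
  "C1 f g \<longleftrightarrow> (\<forall>x. (f has_derivative (\<lambda>h. g x \<bullet> h)) (at x)) \<and> continuous_on UNIV g"

lemma C1_continuous: "C1 f g \<Longrightarrow> continuous_on UNIV f"
  unfolding C1_def by (meson continuous_at_imp_continuous_on has_derivative_continuous)

lemma C1_const: "C1 (\<lambda>x. c) (\<lambda>x. 0)"
  by (simp add: C1_def)

lemma C1_mult:
  assumes "C1 f g" "C1 f' g'"
  shows "C1 (\<lambda>x. f x * f' x) (\<lambda>x. f x *\<^sub>R g' x + f' x *\<^sub>R g x)"
  using assms C1_continuous[OF assms(1)] C1_continuous[OF assms(2)] unfolding C1_def
  by (auto intro!: derivative_eq_intros continuous_intros simp: inner_add_left algebra_simps)

lemma C1_diff:
  assumes "C1 f g" "C1 f' g'"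
  shows "C1 (\<lambda>x. f x - f' x) (\<lambda>x. g x - g' x)"
  using assms unfolding C1_def
  by (auto intro!: derivative_eq_intros continuous_intros simp: inner_diff_left)

lemma C1_linear:
  assumes h: "\<And>t. (h has_real_derivative h' t) (at t)" and h': "continuous_on UNIV h'"
  shows "C1 (\<lambda>x. h (a \<bullet> x + b)) (\<lambda>x. h' (a \<bullet> x + b) *\<^sub>R a)"
  unfolding C1_def
proof (intro conjI allI)
  fix x
  have "((\<lambda>x. h (a \<bullet> x + b)) has_derivative (\<lambda>y. h' (a \<bullet> x + b) * (a \<bullet> y))) (at x)"
    by (rule has_derivative_compose[where f = "\<lambda>x. a \<bullet> x + b", OF _ h[THEN has_field_derivative_imp_has_derivative]])
       (auto intro!: derivative_eq_intros)
  then show "((\<lambda>x. h (a \<bullet> x + b)) has_derivative (\<lambda>y. (h' (a \<bullet> x + b) *\<^sub>R a) \<bullet> y)) (at x)" by simp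
  show "continuous_on UNIV (\<lambda>x. h' (a \<bullet> x + b) *\<^sub>R a)"
    by (intro continuous_intros continuous_on_compose2[OF h']) auto
qed

text \<open>Gradients orthogonal to \<open>d\<close> mean that the functions do not vary in
  direction \<open>d\<close>; the Leibniz rule passes this on to products.\<close>

lemma C1_prod:
  assumes "finite I" "\<And>i. i \<in> I \<Longrightarrow> C1 (f i) (g i)" "\<And>i x. i \<in> I \<Longrightarrow> g i x \<bullet> d = 0"
  shows "\<exists>G. C1 (\<lambda>x. \<Prod>i\<in>I. f i x) G \<and> (\<forall>x. G x \<bullet> d = 0)"
  using assms
proof (induction I)
  case empty
  then show ?case by (auto intro!: exI[of _ "\<lambda>_. 0"] C1_const)
next
  case (insert i I)
  then obtain G where G: "C1 (\<lambda>x. \<Prod>i\<in>I. f i x) G" "\<And>x. G x \<bullet> d = 0" by blast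
  have "C1 (f i) (g i)" "\<And>x. g i x \<bullet> d = 0" using insert by auto
  then show ?case
    using C1_mult[of "f i" "g i", OF _ G(1)] G(2) insert.hyps
    by (auto intro!: exI[of _ "\<lambda>x. f i x *\<^sub>R G x + (\<Prod>i\<in>I. f i x) *\<^sub>R g i x"] simp: inner_add_left)
qed

lemma C1_frechet: "C1 f g \<Longrightarrow> frechet_derivative f (at x) h = g x \<bullet> h"
  unfolding C1_def using frechet_derivative_at by metis

lemma C1_zero_outside:
  assumes "C1 f g" "closed K" "\<And>x. x \<notin> K \<Longrightarrow> f x = 0" "x \<notin> K"
  shows "g x = 0"
proof -
  have "(f has_derivative (\<lambda>h. 0)) (at x)"
  proof (rule has_derivative_transform_within_open)
    show "((\<lambda>_. 0) has_derivative (\<lambda>h. 0)) (at x)" by simp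
    show "open (- K)" "x \<in> - K" using assms by auto
    show "0 = f y" if "y \<in> - K" for y using assms(3)[of y] that by simp
  qed
  moreover have "(f has_derivative (\<lambda>h. g x \<bullet> h)) (at x)" using assms(1) by (simp add: C1_def)
  ultimately have "(\<lambda>h. 0) = (\<lambda>h. g x \<bullet> h)" by (rule has_derivative_unique)
  from fun_cong[OF this, of "g x"] show ?thesis by simp
qed

lemma test_functionI:
  fixes f :: "real^'n \<Rightarrow> real"
  assumes "C1 f g" "compact K" "K \<subseteq> Q" "\<And>x. x \<notin> K \<Longrightarrow> f x = 0"
  shows "f \<in> test_functions Q"
proof -
  have "continuous_on UNIV (\<lambda>x. frechet_derivative f (at x) (axis j 1))" for j
    unfolding C1_frechet[OF assms(1)] using assms(1) by (intro continuous_intros) (auto simp: C1_def)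
  moreover have "f differentiable (at x)" for x
    using assms(1) unfolding C1_def differentiable_def by blast
  ultimately show ?thesis unfolding test_functions_def using assms by auto
qed

lemma test_functionE:
  fixes f :: "real^'n \<Rightarrow> real"
  assumes "f \<in> test_functions Q"
  obtains g K where "C1 f g" "compact K" "K \<subseteq> Q" "\<And>x. x \<notin> K \<Longrightarrow> f x = 0"
    "\<And>x. x \<notin> K \<Longrightarrow> g x = 0"
proof -
  define g where "g x = (\<chi> j. frechet_derivative f (at x) (axis j 1))" for x
  have d: "(f has_derivative frechet_derivative f (at x)) (at x)" for x
    using assms by (simp add: test_functions_def frechet_derivative_works[symmetric])
  have "frechet_derivative f (at x) = (\<lambda>h. g x \<bullet> h)" for x
  proof
    fix h
    have lin: "linear (frechet_derivative f (at x))" using d has_derivative_linear by blast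
    have "frechet_derivative f (at x) h = frechet_derivative f (at x) (\<Sum>j\<in>UNIV. h $ j *\<^sub>R axis j 1)"
      using basis_expansion[of h] by (simp add: scalar_mult_eq_scaleR)
    also have "\<dots> = g x \<bullet> h"
      using lin by (simp add: linear_sum linear_scale g_def inner_vec_def mult.commute)
    finally show "frechet_derivative f (at x) h = g x \<bullet> h" .
  qed
  then have "C1 f g"
    unfolding C1_def using d assms
    by (auto simp: g_def test_functions_def intro!: continuous_on_vec_lambda)
  moreover obtain K where "compact K" "K \<subseteq> Q" "\<And>x. x \<notin> K \<Longrightarrow> f x = 0"
    using assms by (auto simp: test_functions_def)
  ultimately show ?thesis
    using that[of g K] C1_zero_outside[of f g K] compact_imp_closed[of K] by auto
qed

text \<open>Squaring the positive part makes it continuously differentiable across 0, which is the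
  smoothness that \<open>test_functions\<close> asks for.\<close>

definition sq_pos :: "real \<Rightarrow> real" where "sq_pos t = (max 0 t)\<^sup>2"

lemma sq_pos_deriv: "(sq_pos has_real_derivative 2 * max 0 t) (at t)"
proof -
  consider "t < 0" | "t = 0" | "0 < t" by linarith
  then show ?thesis
  proof cases
    case 1
    have "((\<lambda>_. 0) has_real_derivative 2 * max 0 t) (at t)" using 1 by (simp add: max_def)
    then show ?thesis
      by (rule has_field_derivative_transform_within_open[of _ _ _ "{..<0}"])
        (use 1 in \<open>auto simp: sq_pos_def\<close>)
  next
    case 2
    have "((\<lambda>h::real. (max 0 h)\<^sup>2 / h) \<longlongrightarrow> 0) (at 0)"
    proof (rule Lim_null_comparison[where g = abs])
      show "\<forall>\<^sub>F h in at 0. norm ((max 0 h)\<^sup>2 / h) \<le> \<bar>h :: real\<bar>"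
        by (auto simp: eventually_at_filter power2_eq_square max_def abs_mult)
    qed (auto intro!: tendsto_eq_intros)
    then show ?thesis using 2 by (simp add: DERIV_def sq_pos_def)
  next
    case 3
    have "((\<lambda>t. t\<^sup>2) has_real_derivative 2 * max 0 t) (at t)"
      using 3 by (auto intro!: derivative_eq_intros)
    then show ?thesis
      by (rule has_field_derivative_transform_within_open[of _ _ _ "{0<..}"])
        (use 3 in \<open>auto simp: sq_pos_def\<close>)
  qed
qed

text \<open>A continuously differentiable step, 0 up to \<open>t = 0\<close> and 1 from
  \<open>t = 1\<close> on. The denominator is positive everywhere because \<open>t\<close> and
  \<open>1 - t\<close> are never both nonpositive.\<close>

definition sstep :: "real \<Rightarrow> real" where
  "sstep t = sq_pos t / (sq_pos t + sq_pos (1 - t))"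

definition sstep' :: "real \<Rightarrow> real" where
  "sstep' t = (2 * max 0 t * (sq_pos t + sq_pos (1 - t)) - sq_pos t * (2 * max 0 t - 2 * max 0 (1 - t)))
     / (sq_pos t + sq_pos (1 - t))\<^sup>2"

lemma sstep_denominator: "0 < sq_pos t + sq_pos (1 - t)"
proof (cases "0 < t")
  case True
  then have "0 < sq_pos t" by (simp add: sq_pos_def)
  then show ?thesis by (simp add: sq_pos_def add_pos_nonneg)
next
  case False
  then have "0 < sq_pos (1 - t)" by (simp add: sq_pos_def)
  then show ?thesis by (simp add: sq_pos_def add_nonneg_pos)
qed

lemma sstep_deriv: "(sstep has_real_derivative sstep' t) (at t)"
proof -
  have 1: "((\<lambda>t. sq_pos (1 - t)) has_real_derivative (2 * max 0 (1 - t)) * (- 1)) (at t)"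
    by (rule DERIV_chain2[OF sq_pos_deriv]) (auto intro!: derivative_eq_intros)
  show ?thesis unfolding sstep_def[abs_def] sstep'_def
    using sstep_denominator[of t]
    by (auto intro!: derivative_eq_intros sq_pos_deriv 1 simp: power2_eq_square)
qed

lemma sstep'_continuous: "continuous_on UNIV sstep'"
proof -
  have "sq_pos t + sq_pos (1 - t) \<noteq> 0" for t using sstep_denominator[of t] by simp
  then show ?thesis unfolding sstep'_def[abs_def] sq_pos_def
    by (intro continuous_intros) (auto simp: sq_pos_def)
qed

lemma sstep_eq_0: "t \<le> 0 \<Longrightarrow> sstep t = 0"
  and sstep_eq_1: "1 \<le> t \<Longrightarrow> sstep t = 1"
  and sstep_bounds: "0 \<le> sstep t" "sstep t \<le> 1"
  using sstep_denominator[of t] by (auto simp: sstep_def sq_pos_def divide_le_eq_1)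

lemma sstep'_eq_0: "t \<le> 0 \<Longrightarrow> sstep' t = 0" "1 \<le> t \<Longrightarrow> sstep' t = 0"
  by (auto simp: sstep'_def sq_pos_def power2_eq_square algebra_simps max_def)

lemma sstep'_bounded: obtains C where "0 < C" "\<And>t. \<bar>sstep' t\<bar> \<le> C"
proof -
  have "compact (sstep' ` {0..1})"
    using sstep'_continuous by (intro compact_continuous_image) (auto intro: continuous_on_subset)
  then obtain C where C: "0 < C" "\<forall>x\<in>sstep' ` {0..1}. norm x \<le> C"
    using compact_imp_bounded bounded_pos by metis
  have "\<bar>sstep' t\<bar> \<le> C" for t
    using C sstep'_eq_0[of t] by (cases "t \<in> {0..1}") auto
  then show ?thesis using C(1) that by blast
qed

text \<open>\<open>box_bump J a b m\<close> increases to the indicator of the box \<open>a < x < b\<close> in the coordinates \<open>J\<close>.\<close>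

definition box_bump :: "'n set \<Rightarrow> real^'n \<Rightarrow> real^'n \<Rightarrow> nat \<Rightarrow> real^'n \<Rightarrow> real" where
  "box_bump J a b m x = (\<Prod>i\<in>J. sstep (real m * (x $ i - a $ i) - 1) * sstep (real m * (b $ i - x $ i) - 1))"

lemma C1_box_bump:
  fixes J :: "('n::finite) set"
  assumes "\<And>i. i \<in> J \<Longrightarrow> d $ i = 0"
  shows "\<exists>G. C1 (box_bump J a b m) G \<and> (\<forall>x. G x \<bullet> d = 0)"
proof -
  define f where "f i x = sstep (real m * (x $ i - a $ i) - 1) * sstep (real m * (b $ i - x $ i) - 1)" for i and x :: "real^'n"
  define f1 where "f1 i x = sstep ((real m *\<^sub>R (axis i 1 :: real^'n)) \<bullet> x + (- real m * a $ i - 1))" for i and x :: "real^'n"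
  define f2 where "f2 i x = sstep ((- real m *\<^sub>R (axis i 1 :: real^'n)) \<bullet> x + (real m * b $ i - 1))" for i and x :: "real^'n"
  define g1 where "g1 i x = sstep' ((real m *\<^sub>R (axis i 1 :: real^'n)) \<bullet> x + (- real m * a $ i - 1)) *\<^sub>R (real m *\<^sub>R (axis i 1 :: real^'n))" for i and x :: "real^'n"
  define g2 where "g2 i x = sstep' ((- real m *\<^sub>R (axis i 1 :: real^'n)) \<bullet> x + (real m * b $ i - 1)) *\<^sub>R (- real m *\<^sub>R (axis i 1 :: real^'n))" for i and x :: "real^'n"
  have 1: "C1 (f1 i) (g1 i)" "C1 (f2 i) (g2 i)" for i
    unfolding f1_def[abs_def] g1_def[abs_def] f2_def[abs_def] g2_def[abs_def]
    by (rule C1_linear[OF sstep_deriv sstep'_continuous])+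
  have f: "f i = (\<lambda>x. f1 i x * f2 i x)" for i
    by (rule ext) (simp add: f_def f1_def f2_def inner_axis' algebra_simps)
  have "\<exists>G. C1 (\<lambda>x. \<Prod>i\<in>J. f i x) G \<and> (\<forall>x. G x \<bullet> d = 0)"
  proof (rule C1_prod)
    show "C1 (f i) (\<lambda>x. f1 i x *\<^sub>R g2 i x + f2 i x *\<^sub>R g1 i x)" for i
      unfolding f by (rule C1_mult[OF 1])
    show "(f1 i x *\<^sub>R g2 i x + f2 i x *\<^sub>R g1 i x) \<bullet> d = 0" if "i \<in> J" for i x
      using assms[OF that] by (simp add: g1_def g2_def inner_add_left inner_diff_left inner_axis')
  qed simp
  then show ?thesis by (simp add: f_def box_bump_def[abs_def])
qed

lemma box_bump_bounds: "0 \<le> box_bump J a b m x" "box_bump J a b m x \<le> 1"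
  unfolding box_bump_def using sstep_bounds
  by (auto intro!: prod_nonneg prod_le_1 mult_le_one mult_nonneg_nonneg)

lemma box_bump_support:
  fixes J :: "('n::finite) set"
  assumes "box_bump J a b m x \<noteq> 0" "i \<in> J"
  shows "a $ i + 1 / real m \<le> x $ i \<and> x $ i \<le> b $ i - 1 / real m \<and> 0 < m"
proof -
  have "finite J" by simp
  then have nz: "sstep (real m * (x $ i - a $ i) - 1) \<noteq> 0" "sstep (real m * (b $ i - x $ i) - 1) \<noteq> 0"
    using assms by (auto simp: box_bump_def)
  then have "0 < real m * (x $ i - a $ i) - 1" "0 < real m * (b $ i - x $ i) - 1"
    using sstep_eq_0 not_le by blast+
  then have "0 < m" by (cases "m = 0") auto
  then show ?thesis
    using \<open>0 < real m * (x $ i - a $ i) - 1\<close> \<open>0 < real m * (b $ i - x $ i) - 1\<close>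
    by (auto simp: field_simps)
qed

lemma box_bump_eventually_1:
  fixes J :: "('n::finite) set"
  assumes "\<And>i. i \<in> J \<Longrightarrow> a $ i < x $ i \<and> x $ i < b $ i"
  shows "\<forall>\<^sub>F m in sequentially. box_bump J a b m x = 1"
proof -
  have ev: "\<forall>\<^sub>F m in sequentially. sstep (real m * c - 1) = 1" if c: "0 < c" for c
  proof -
    obtain m0 :: nat where m0: "2 / c < real m0" using reals_Archimedean2 by blast
    have "sstep (real m * c - 1) = 1" if "m0 \<le> m" for m
    proof (rule sstep_eq_1)
      have "2 / c < real m" using m0 that by linarith
      then show "1 \<le> real m * c - 1" using c by (simp add: field_simps)
    qed
    then show ?thesis unfolding eventually_sequentially by blast
  qed
  have "\<forall>\<^sub>F m in sequentially. \<forall>i\<in>J. sstep (real m * (x $ i - a $ i) - 1) * sstep (real m * (b $ i - x $ i) - 1) = 1"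
  proof (rule eventually_ball_finite)
    show "\<forall>i\<in>J. \<forall>\<^sub>F m in sequentially. sstep (real m * (x $ i - a $ i) - 1) * sstep (real m * (b $ i - x $ i) - 1) = 1"
    proof
      fix i assume "i \<in> J"
      then have "0 < x $ i - a $ i" "0 < b $ i - x $ i" using assms by auto
      then show "\<forall>\<^sub>F m in sequentially. sstep (real m * (x $ i - a $ i) - 1) * sstep (real m * (b $ i - x $ i) - 1) = 1"
        using ev[of "x $ i - a $ i"] ev[of "b $ i - x $ i"] by (auto elim: eventually_elim2)
    qed
  qed simp
  then show ?thesis by (rule eventually_mono) (simp add: box_bump_def)
qed

text \<open>\<open>U\<close> is a countable union of boxes, and \<open>\<psi> m\<close> is one minus
  the product of one minus the bumps of the first \<open>m\<close> of them. With
  \<open>J = UNIV\<close> this approximates the indicator of \<open>U\<close>; with one index left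
  out it approximates the cylinder over \<open>U\<close> in that coordinate by functions constant
  along it.\<close>

lemma open_approx_bump:
  fixes U :: "(real^'n) set" and J :: "'n set"
  assumes U: "open U" and d: "\<And>i. i \<in> J \<Longrightarrow> d $ i = 0"
  obtains \<psi> G K where "\<And>m. C1 (\<psi> m) (G m)" "\<And>m x. G m x \<bullet> d = 0"
    "\<And>m x. 0 \<le> \<psi> m x" "\<And>m x. \<psi> m x \<le> 1" "\<And>m. compact (K m)" "\<And>m. K m \<subseteq> U"
    "\<And>m x. \<psi> m x \<noteq> 0 \<Longrightarrow> \<exists>z\<in>K m. \<forall>i\<in>J. x $ i = z $ i"
    "\<And>x. (\<lambda>m. \<psi> m x) \<longlonglongrightarrow> (if \<exists>z\<in>U. \<forall>i\<in>J. x $ i = z $ i then 1 else 0)"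
proof -
  obtain D where D: "countable D" "D \<subseteq> Pow U" "\<And>X. X \<in> D \<Longrightarrow> \<exists>a b. X = box a b" "\<Union>D = U"
    using open_countable_Union_open_box[OF U] by metis
  define D' where "D' = insert {} D"
  have D': "countable D'" "D' \<noteq> {}" "\<Union>D' = U" using D by (auto simp: D'_def)
  define X where "X l = from_nat_into D' l" for l
  have XD: "X l \<in> D'" for l using D' by (simp add: X_def from_nat_into)
  have "box 0 (0::real^'n) = {}" by simp
  then have "\<exists>a b. X l = box a b" for l using XD[of l] D(3) unfolding D'_def by (metis insertE)
  then obtain a b where ab: "\<And>l. X l = box (a l) (b l)" by metis
  have XU: "X l \<subseteq> U" for l using XD[of l] D'(3) by blast
  have cov: "\<exists>l. z \<in> X l" if "z \<in> U" for z
    using that D' by (metis UnionE X_def from_nat_into_surj)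
  \<comment> \<open>Empty boxes are skipped: a bump sees only the coordinates in \<open>J\<close>
    and could be nonzero although the box is empty because of another coordinate.\<close>
  define \<psi> where "\<psi> m x = 1 - (\<Prod>l\<in>{l. l < m \<and> X l \<noteq> {}}. 1 - box_bump J (a l) (b l) m x)" for m x
  \<comment> \<open>Outside \<open>J\<close> the compact set keeps only the centre of the box. The
    bumps do not decay in those coordinates, and their support is described by agreement on
    \<open>J\<close> alone.\<close>
  define lo where "lo l m = (\<chi> i. if i \<in> J then a l $ i + 1 / real m else (a l $ i + b l $ i) / 2)" for l m
  define hi where "hi l m = (\<chi> i. if i \<in> J then b l $ i - 1 / real m else (a l $ i + b l $ i) / 2)" for l m
  define K where "K m = (\<Union>l\<in>{l. l < m \<and> X l \<noteq> {}}. cbox (lo l m) (hi l m))" for m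
  have bnd: "0 \<le> 1 - box_bump J (a l) (b l) m x" "1 - box_bump J (a l) (b l) m x \<le> 1" for l m x
    using box_bump_bounds[of J "a l" "b l" m x] by auto
  have "\<exists>G. C1 (\<psi> m) G \<and> (\<forall>x. G x \<bullet> d = 0)" for m
  proof -
    obtain g where g: "\<And>l. C1 (box_bump J (a l) (b l) m) (g l)" "\<And>l x. g l x \<bullet> d = 0"
      using choice[of "\<lambda>l G. C1 (box_bump J (a l) (b l) m) G \<and> (\<forall>x. G x \<bullet> d = 0)"]
        C1_box_bump[of J d, OF d] by blast
    obtain G where G: "C1 (\<lambda>x. \<Prod>l\<in>{l. l < m \<and> X l \<noteq> {}}. 1 - box_bump J (a l) (b l) m x) G" "\<And>x. G x \<bullet> d = 0"
      using C1_prod[of "{l. l < m \<and> X l \<noteq> {}}" "\<lambda>l x. 1 - box_bump J (a l) (b l) m x" "\<lambda>l x. 0 - g l x" d]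
        C1_diff[OF C1_const g(1)] g(2) by (auto simp: inner_diff_left)
    show ?thesis unfolding \<psi>_def[abs_def]
      using C1_diff[OF C1_const G(1), of 1] G(2) by (auto intro!: exI[of _ "\<lambda>x. 0 - G x"] simp: inner_diff_left)
  qed
  then obtain G where G: "\<And>m. C1 (\<psi> m) (G m)" "\<And>m x. G m x \<bullet> d = 0" by metis
  have psi01: "0 \<le> \<psi> m x" "\<psi> m x \<le> 1" for m x
    unfolding \<psi>_def using bnd by (auto intro!: prod_le_1 prod_nonneg)
  have nz: "\<exists>l<m. X l \<noteq> {} \<and> box_bump J (a l) (b l) m x \<noteq> 0" if "\<psi> m x \<noteq> 0" for m x
  proof (rule ccontr)
    assume "\<not> ?thesis"
    then have "(\<Prod>l\<in>{l. l < m \<and> X l \<noteq> {}}. 1 - box_bump J (a l) (b l) m x) = 1" by (intro prod.neutral) auto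
    then show False using that by (simp add: \<psi>_def)
  qed
  have supp: "\<exists>z\<in>K m. \<forall>i\<in>J. x $ i = z $ i" if psi: "\<psi> m x \<noteq> 0" for m x
  proof -
    obtain l where l: "l < m" "X l \<noteq> {}" "box_bump J (a l) (b l) m x \<noteq> 0" using nz[OF psi] by blast
    define z where "z = (\<chi> i. if i \<in> J then x $ i else (a l $ i + b l $ i) / 2)"
    have "z \<in> cbox (lo l m) (hi l m)"
      using box_bump_support[OF l(3)] by (auto simp: z_def lo_def hi_def mem_box_cart)
    then show ?thesis using l by (intro bexI[of _ z]) (auto simp: K_def z_def)
  qed
  have KU: "K m \<subseteq> U" for m
  proof -
    have "cbox (lo l m) (hi l m) \<subseteq> X l" if "l < m" "X l \<noteq> {}" for l
    proof
      fix z assume z: "z \<in> cbox (lo l m) (hi l m)"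
      have "a l $ i < z $ i \<and> z $ i < b l $ i" for i
      proof -
        have 1: "a l $ i < b l $ i" using that(2) by (simp add: ab interval_eq_empty_cart not_le)
        have 2: "0 < 1 / real m" using that by simp
        have 3: "lo l m $ i \<le> z $ i" "z $ i \<le> hi l m $ i" using z by (simp_all add: mem_box_cart)
        show ?thesis
        proof (cases "i \<in> J")
          case True
          then have "a l $ i + 1 / real m \<le> z $ i" "z $ i \<le> b l $ i - 1 / real m"
            using 3 by (simp_all add: lo_def hi_def)
          then show ?thesis using 2 by (intro conjI; linarith)
        next
          case False
          then have "(a l $ i + b l $ i) / 2 \<le> z $ i" "z $ i \<le> (a l $ i + b l $ i) / 2"
            using 3 by (simp_all add: lo_def hi_def)
          then have "z $ i = (a l $ i + b l $ i) / 2" by (intro antisym)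
          then show ?thesis using 1 by simp
        qed
      qed
      then show "z \<in> X l" by (simp add: ab mem_box_cart)
    qed
    then show ?thesis using XU by (fastforce simp: K_def)
  qed
  have lim: "(\<lambda>m. \<psi> m x) \<longlonglongrightarrow> (if \<exists>z\<in>U. \<forall>i\<in>J. x $ i = z $ i then 1 else 0)" for x
  proof (cases "\<exists>z\<in>U. \<forall>i\<in>J. x $ i = z $ i")
    case True
    then obtain z where z: "z \<in> U" "\<And>i. i \<in> J \<Longrightarrow> x $ i = z $ i" by blast
    obtain l where l: "z \<in> X l" using cov[OF z(1)] by blast
    then have "\<forall>\<^sub>F m in sequentially. box_bump J (a l) (b l) m x = 1"
      using z(2) by (intro box_bump_eventually_1) (auto simp: ab mem_box_cart)
    moreover have "\<forall>\<^sub>F m in sequentially. l < m" by (rule eventually_gt_at_top)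
    ultimately have "\<forall>\<^sub>F m in sequentially. \<psi> m x = 1"
    proof eventually_elim
      case (elim m)
      then have "(\<Prod>l\<in>{l. l < m \<and> X l \<noteq> {}}. 1 - box_bump J (a l) (b l) m x) = 0"
        using l by (intro prod_zero) auto
      then show ?case by (simp add: \<psi>_def)
    qed
    then show ?thesis using True by (simp add: tendsto_eventually)
  next
    case False
    then have "\<psi> m x = 0" for m using supp[of m x] KU[of m] by blast
    then show ?thesis unfolding if_not_P[OF False] by simp
  qed
  have "compact (K m)" for m unfolding K_def by (intro compact_UN) auto
  from that[OF G psi01 this KU supp lim] show ?thesis .
qed

section \<open>Uniqueness of the distributional derivative\<close>

lemma borel_measurable_restrict:
  assumes "sets M = sets (restrict_space borel Q)" "f \<in> borel_measurable borel"
  shows "f \<in> borel_measurable M"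
  using measurable_restrict_space1[OF assms(2), of Q] measurable_cong_sets[OF assms(1) refl] by blast

lemma sets_restrict_borel:
  assumes "sets M = sets (restrict_space borel Q)" "Q \<in> sets borel"
  shows "E \<in> sets M \<longleftrightarrow> E \<in> sets borel \<and> E \<subseteq> Q"
  using assms by (auto simp: sets_restrict_space_iff)

lemma test_function_borel: "\<phi> \<in> test_functions Q \<Longrightarrow> \<phi> \<in> borel_measurable borel"
  by (metis test_functionE C1_continuous borel_measurable_continuous_onI)

text \<open>Bump functions converge to the indicator of an open set, so dominated convergence gives
  equality there. Open sets form an intersection-stable generator, and the equality passes to
  complements and disjoint unions; sets are intersected with \<open>Q\<close> so that the induction
  runs in the full Borel algebra.\<close>

lemma test_integrals_determine_measure:
  fixes Q :: "(real^'n) set" and s1 s2 :: "real^'n \<Rightarrow> real"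
  assumes Q: "open Q"
    and M1: "sets M1 = sets (restrict_space borel Q)" "integrable M1 s1"
    and M2: "sets M2 = sets (restrict_space borel Q)" "integrable M2 s2"
    and eq: "\<And>\<phi>. \<phi> \<in> test_functions Q \<Longrightarrow> (\<integral>x. \<phi> x * s1 x \<partial>M1) = (\<integral>x. \<phi> x * s2 x \<partial>M2)"
    and E: "E \<in> sets borel" "E \<subseteq> Q"
  shows "(LINT x:E|M1. s1 x) = (LINT x:E|M2. s2 x)"
proof -
  have QB: "Q \<in> sets borel" using Q by simp
  note sM1 = sets_restrict_borel[OF M1(1) QB] and sM2 = sets_restrict_borel[OF M2(1) QB]
  have si: "set_integrable M1 A s1" "set_integrable M2 A s2" if "A \<in> sets borel" "A \<subseteq> Q" for A
    unfolding set_integrable_def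
    by (rule integrable_mult_indicator; use that M1(2) M2(2) sM1 sM2 in auto)+
  have op: "(LINT x:U|M1. s1 x) = (LINT x:U|M2. s2 x)" if U: "open U" "U \<subseteq> Q" for U
  proof -
    obtain \<psi> G K where \<psi>: "\<And>m. C1 (\<psi> m) (G m)" "\<And>m x. G m x \<bullet> 0 = 0"
      "\<And>m x. 0 \<le> \<psi> m x" "\<And>m x. \<psi> m x \<le> 1" "\<And>m. compact (K m)" "\<And>m. K m \<subseteq> U"
      "\<And>m x. \<psi> m x \<noteq> 0 \<Longrightarrow> \<exists>z\<in>K m. \<forall>i\<in>UNIV. x $ i = z $ i"
      "\<And>x. (\<lambda>m. \<psi> m x) \<longlonglongrightarrow> (if \<exists>z\<in>U. \<forall>i\<in>UNIV. x $ i = z $ i then 1 else 0)"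
      by (rule open_approx_bump[OF U(1), of UNIV 0]) (simp, rule that)
    have eqv: "(\<forall>i\<in>UNIV. x $ i = z $ i) \<longleftrightarrow> x = z" for x z :: "real^'n" by (auto simp: vec_eq_iff)
    have test: "\<psi> m \<in> test_functions Q" for m
    proof (rule test_functionI[OF \<psi>(1,5)])
      show "K m \<subseteq> Q" using \<psi>(6) U by blast
      show "\<psi> m x = 0" if "x \<notin> K m" for x using \<psi>(7)[of m x] that unfolding eqv by auto
    qed
    have lim: "(\<lambda>m. \<psi> m x) \<longlonglongrightarrow> indicator U x" for x
      using \<psi>(8)[of x] unfolding eqv by (auto simp: indicator_def)
    have conv: "(\<lambda>m. \<integral>x. \<psi> m x * s x \<partial>M) \<longlonglongrightarrow> (LINT x:U|M. s x)"
      if M: "sets M = sets (restrict_space borel Q)" "integrable M s" for M and s :: "real^'n \<Rightarrow> real"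
      unfolding set_lebesgue_integral_def
    proof (rule integral_dominated_convergence[where w = "\<lambda>x. norm (s x)"])
      have [measurable]: "s \<in> borel_measurable M" using M by auto
      have "U \<in> sets M" using sets_restrict_borel[OF M(1) QB] U by auto
      then show "(\<lambda>x. indicator U x *\<^sub>R s x) \<in> borel_measurable M" by measurable
      have [measurable]: "\<psi> m \<in> borel_measurable M" for m
        by (rule borel_measurable_restrict[OF M(1) test_function_borel[OF test]])
      show "(\<lambda>x. \<psi> m x * s x) \<in> borel_measurable M" for m by measurable
      show "AE x in M. (\<lambda>m. \<psi> m x * s x) \<longlonglongrightarrow> indicator U x *\<^sub>R s x"
        by (auto intro!: tendsto_intros lim)
      show "AE x in M. norm (\<psi> m x * s x) \<le> norm (s x)" for m
        using \<psi>(3,4) by (auto simp: abs_mult intro!: mult_left_le_one_le)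
    qed (use M in auto)
    show ?thesis
      by (rule LIMSEQ_unique[OF conv[OF M1]]) (simp add: eq[OF test] conv[OF M2])
  qed
  have borel: "sets (borel :: (real^'n) measure) = sigma_sets UNIV {S. open S}"
    by (simp add: borel_def)
  have "Int_stable {S :: (real^'n) set. open S}" by (auto simp: Int_stable_def)
  moreover have "{S :: (real^'n) set. open S} \<subseteq> Pow UNIV" by simp
  moreover have "E \<in> sigma_sets UNIV {S. open S}" using E borel by simp
  ultimately have "(LINT x:E \<inter> Q|M1. s1 x) = (LINT x:E \<inter> Q|M2. s2 x)"
  proof (induction rule: sigma_sets_induct_disjoint)
    case (basic A)
    then show ?case using Q by (intro op) auto
  next
    case (compl A)
    have A: "A \<in> sets borel" using compl borel by simp
    have d: "((UNIV - A) \<inter> Q) \<union> (A \<inter> Q) = Q" by auto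
    have "(LINT x:((UNIV - A) \<inter> Q) \<union> (A \<inter> Q)|M1. s1 x) = (LINT x:(UNIV - A) \<inter> Q|M1. s1 x) + (LINT x:A \<inter> Q|M1. s1 x)"
      using A QB by (intro set_integral_Un si(1)) auto
    moreover have "(LINT x:((UNIV - A) \<inter> Q) \<union> (A \<inter> Q)|M2. s2 x) = (LINT x:(UNIV - A) \<inter> Q|M2. s2 x) + (LINT x:A \<inter> Q|M2. s2 x)"
      using A QB by (intro set_integral_Un si(2)) auto
    ultimately show ?case using compl op[OF Q] unfolding d by simp
  next
    case (union A)
    have A: "A i \<in> sets borel" for i using union borel by auto
    have "(LINT x:(\<Union>i. A i \<inter> Q)|M1. s1 x) = (\<Sum>i. LINT x:A i \<inter> Q|M1. s1 x)"
      using A QB union(1) sM1 by (intro lebesgue_integral_countable_add si(1)) (auto simp: disjoint_family_on_def)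
    moreover have "(LINT x:(\<Union>i. A i \<inter> Q)|M2. s2 x) = (\<Sum>i. LINT x:A i \<inter> Q|M2. s2 x)"
      using A QB union(1) sM2 by (intro lebesgue_integral_countable_add si(2)) (auto simp: disjoint_family_on_def)
    ultimately show ?case using union(3) by simp
  qed (simp add: set_lebesgue_integral_def)
  moreover have "E \<inter> Q = E" using E by auto
  ultimately show ?thesis by simp
qed

lemma set_lebesgue_integral_component:
  fixes f :: "'a \<Rightarrow> real^'n^'m"
  assumes "integrable M f" "E \<in> sets M"
  shows "(LINT x:E|M. f x) $ i $ j = (LINT x:E|M. f x $ i $ j)"
proof -
  have bl: "bounded_linear (\<lambda>y::real^'n^'m. y $ i $ j)"
    using bounded_linear_compose[OF bounded_linear_vec_nth bounded_linear_vec_nth] .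
  have "integrable M (\<lambda>x. indicator E x *\<^sub>R f x)" using assms by (intro integrable_mult_indicator)
  from integral_bounded_linear[OF bl this] show ?thesis
    by (simp add: set_lebesgue_integral_def)
qed

lemma integrable_component:
  fixes f :: "'a \<Rightarrow> real^'n^'m"
  assumes "integrable M f"
  shows "integrable M (\<lambda>x. f x $ i $ j)"
  using integrable_bounded_linear[OF bounded_linear_compose[OF bounded_linear_vec_nth bounded_linear_vec_nth] assms]
  by simp

text \<open>Makes the arbitrary choice in \<open>distr_deriv\<close> harmless: any derivative found
  by hand agrees with the chosen one on Borel subsets of \<open>Q\<close>.\<close>

lemma has_distributional_derivative_unique:
  fixes Q :: "(real^'n) set" and u :: "real^'n \<Rightarrow> real^'m"
  assumes Q: "open Q" and D: "has_distributional_derivative Q u D1" "has_distributional_derivative Q u D2"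
    and E: "E \<in> sets borel" "E \<subseteq> Q"
  shows "D1 E = D2 E"
proof -
  have QB: "Q \<in> sets borel" using Q by simp
  obtain M1 and s1 :: "real^'n \<Rightarrow> real^'n^'m" where 1: "sets M1 = sets (restrict_space borel Q)" "integrable M1 s1"
      "\<And>E. E \<in> sets M1 \<Longrightarrow> D1 E = (LINT x:E|M1. s1 x)"
      "\<And>\<phi> i j. \<phi> \<in> test_functions Q \<Longrightarrow> (LINT x:Q|lebesgue. u x $ i * frechet_derivative \<phi> (at x) (axis j 1))
             = - (LINT x|M1. \<phi> x * s1 x $ i $ j)"
    using D(1) unfolding has_distributional_derivative_def by blast
  obtain M2 and s2 :: "real^'n \<Rightarrow> real^'n^'m" where 2: "sets M2 = sets (restrict_space borel Q)" "integrable M2 s2"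
      "\<And>E. E \<in> sets M2 \<Longrightarrow> D2 E = (LINT x:E|M2. s2 x)"
      "\<And>\<phi> i j. \<phi> \<in> test_functions Q \<Longrightarrow> (LINT x:Q|lebesgue. u x $ i * frechet_derivative \<phi> (at x) (axis j 1))
             = - (LINT x|M2. \<phi> x * s2 x $ i $ j)"
    using D(2) unfolding has_distributional_derivative_def by blast
  have E12: "E \<in> sets M1" "E \<in> sets M2" using sets_restrict_borel[OF 1(1) QB] sets_restrict_borel[OF 2(1) QB] E by auto
  have "D1 E $ i $ j = D2 E $ i $ j" for i j
  proof -
    have "(LINT x:E|M1. s1 x $ i $ j) = (LINT x:E|M2. s2 x $ i $ j)"
    proof (rule test_integrals_determine_measure[OF Q 1(1) _ 2(1) _ _ E])
      show "integrable M1 (\<lambda>x. s1 x $ i $ j)" "integrable M2 (\<lambda>x. s2 x $ i $ j)"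
        using 1(2) 2(2) by (auto intro: integrable_component)
      show "(\<integral>x. \<phi> x * s1 x $ i $ j \<partial>M1) = (\<integral>x. \<phi> x * s2 x $ i $ j \<partial>M2)" if "\<phi> \<in> test_functions Q" for \<phi>
        using 1(4)[OF that, of i j] 2(4)[OF that, of i j] by simp
    qed
    then show ?thesis
      using 1(3)[OF E12(1)] 2(3)[OF E12(2)] 1(2) 2(2) E12 by (simp add: set_lebesgue_integral_component)
  qed
  then show ?thesis by (simp add: vec_eq_iff)
qed

section \<open>Piecewise constant functions on a line\<close>

text \<open>The antiderivative of \<open>\<gamma> t * \<phi>' t\<close> is the piecewise product
  \<open>l t * \<phi> t\<close> minus the jumps \<open>S\<close> collected so far. The correction
  makes it continuous across \<open>T\<close>, so the fundamental theorem with finitely many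
  exceptional points applies. Beyond the support it is 0 on the left and minus the sum of all jumps
  on the right.\<close>

lemma piecewise_constant_integral_by_parts:
  fixes \<gamma> \<phi> \<phi>' l r :: "real \<Rightarrow> real"
  assumes T: "finite T" and K: "compact K" and \<phi>: "\<And>t. (\<phi> has_real_derivative \<phi>' t) (at t)"
    and \<phi>': "continuous_on UNIV \<phi>'"
    and off: "\<And>t. t \<notin> K \<Longrightarrow> \<phi> t = 0" "\<And>t. t \<notin> K \<Longrightarrow> \<phi>' t = 0"
    and loc: "\<And>t. t \<in> K \<Longrightarrow> \<exists>d>0. (\<forall>s\<in>{t-d<..<t}. \<gamma> s = l t) \<and> (\<forall>s\<in>{t<..<t+d}. \<gamma> s = r t)"
    and reg: "\<And>t. t \<in> K \<Longrightarrow> t \<notin> T \<Longrightarrow> \<gamma> t = l t \<and> r t = l t"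
    and \<gamma>: "\<gamma> \<in> borel_measurable borel" "\<And>t. \<bar>\<gamma> t\<bar> \<le> C"
  shows "(\<integral>t. \<gamma> t * \<phi>' t \<partial>lborel) = - (\<Sum>t\<in>T. \<phi> t * (r t - l t))"
proof -
  define S where "S t = (\<Sum>\<tau>\<in>{\<tau>\<in>T. \<tau> < t}. (r \<tau> - l \<tau>) * \<phi> \<tau>)" for t
  define F where "F t = l t * \<phi> t - S t" for t
  \<comment> \<open>Links the left limits prescribed by \<open>l\<close> at neighbouring points,
    which are given separately for each point.\<close>
  have left: "l s = c" if s: "s \<in> K" and c: "\<forall>x\<in>{p<..<q}. \<gamma> x = c" "p < s" "s \<le> q" for s c p q
  proof -
    obtain d where d: "d > 0" "\<forall>x\<in>{s-d<..<s}. \<gamma> x = l s" using loc[OF s] by blast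
    obtain x where x: "max p (s - d) < x" "x < s" using c d(1) dense[of "max p (s - d)" s] by auto
    then have "\<gamma> x = c" using c by simp
    moreover have "\<gamma> x = l s" using x d(2) by simp
    ultimately show ?thesis by simp
  qed
  \<comment> \<open>Two one-sided formulas for \<open>F\<close> around \<open>t\<close>: for
    \<open>s <= t\<close> the sum \<open>S\<close> does not yet contain the jump at
    \<open>t\<close>, for \<open>s > t\<close> it does.\<close>
  have near: "\<exists>d>0. (\<forall>s\<in>{t-d<..t}. F s = l t * \<phi> s - S t) \<and>
      (\<forall>s\<in>{t<..<t+d}. F s = (if t \<in> K then r t * \<phi> s else 0) - S t - (if t \<in> T then (r t - l t) * \<phi> t else 0))
      \<and> (t \<notin> K \<longrightarrow> (\<forall>s\<in>{t-d<..<t+d}. \<phi> s = 0))" for t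
  proof -
    obtain d1 where d1: "d1 > 0" "\<forall>\<tau>\<in>T. \<tau> \<noteq> t \<longrightarrow> d1 \<le> \<bar>\<tau> - t\<bar>"
      using finite_set_avoid[OF T, of t] by (auto simp: dist_real_def abs_minus_commute)
    have SL: "S s = S t" if "s \<in> {t-d1<..t}" for s
    proof -
      have "{\<tau>\<in>T. \<tau> < s} = {\<tau>\<in>T. \<tau> < t}" using that d1 by force
      then show ?thesis by (simp add: S_def)
    qed
    have SR: "S s = S t + (if t \<in> T then (r t - l t) * \<phi> t else 0)" if "s \<in> {t<..<t+d1}" for s
    proof -
      have "{\<tau>\<in>T. \<tau> < s} = {\<tau>\<in>T. \<tau> < t} \<union> ({t} \<inter> T)" using that d1 by force
      then show ?thesis using T by (auto simp: S_def sum.union_disjoint)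
    qed
    show ?thesis
    proof (cases "t \<in> K")
      case True
      obtain d where d: "d > 0" "\<forall>s\<in>{t-d<..<t}. \<gamma> s = l t" "\<forall>s\<in>{t<..<t+d}. \<gamma> s = r t" using loc[OF True] by blast
      have 1: "l s * \<phi> s = l t * \<phi> s" if "s \<in> {t-d<..t}" for s
        using left[of s "t - d" t "l t"] that d(2) off(1)[of s] by (cases "s \<in> K") auto
      have 2: "l s * \<phi> s = r t * \<phi> s" if "s \<in> {t<..<t+d}" for s
        using left[of s t "t + d" "r t"] that d(3) off(1)[of s] by (cases "s \<in> K") auto
      show ?thesis
      proof (intro exI[of _ "min d d1"] conjI ballI impI)
        show "F s = l t * \<phi> s - S t" if "s \<in> {t - min d d1<..t}" for s
          using 1[of s] SL[of s] that by (auto simp: F_def)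
        show "F s = (if t \<in> K then r t * \<phi> s else 0) - S t - (if t \<in> T then (r t - l t) * \<phi> t else 0)"
          if "s \<in> {t<..<t + min d d1}" for s
          using 2[of s] SR[of s] that True by (auto simp: F_def)
      qed (use True d(1) d1(1) in auto)
    next
      case False
      obtain d where d: "d > 0" "ball t d \<subseteq> - K"
        using K False compact_imp_closed open_contains_ball by (metis Compl_iff open_Compl)
      then have "\<phi> s = 0" if "s \<in> {t-d<..<t+d}" for s
        using that off by (auto simp: ball_def dist_real_def subset_iff abs_less_iff)
      note phi0 = this
      show ?thesis
      proof (intro exI[of _ "min d d1"] conjI ballI impI)
        show "F s = l t * \<phi> s - S t" if "s \<in> {t - min d d1<..t}" for s
          using phi0[of s] SL[of s] that d(1) by (auto simp: F_def)
        show "F s = (if t \<in> K then r t * \<phi> s else 0) - S t - (if t \<in> T then (r t - l t) * \<phi> t else 0)"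
          if "s \<in> {t<..<t + min d d1}" for s
          using phi0[of s] phi0[of t] SR[of s] that False d(1) by (auto simp: F_def)
        show "\<phi> s = 0" if "s \<in> {t - min d d1<..<t + min d d1}" for s
          using that by (intro phi0) auto
      qed (use d(1) d1(1) in auto)
    qed
  qed
  have contphi: "isCont \<phi> t" for t using \<phi> DERIV_isCont by blast
  have contF: "isCont F t" for t
  proof -
    obtain d where d: "d > 0" "\<forall>s\<in>{t-d<..t}. F s = l t * \<phi> s - S t"
      "\<forall>s\<in>{t<..<t+d}. F s = (if t \<in> K then r t * \<phi> s else 0) - S t - (if t \<in> T then (r t - l t) * \<phi> t else 0)"
      using near[of t] by blast
    have Ft: "F t = l t * \<phi> t - S t" by (simp add: F_def)
    have ev1: "\<forall>\<^sub>F s in at_left t. s \<in> {t-d<..t}"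
      using d(1) eventually_at_left_field[of _ t] by (auto intro!: exI[of _ "t - d"])
    have "((\<lambda>s. l t * \<phi> s - S t) \<longlongrightarrow> F t) (at_left t)"
      unfolding Ft using contphi[of t] by (intro tendsto_intros) (auto simp: isCont_def intro: filterlim_at_split[THEN iffD1, THEN conjunct1])
    then have L: "(F \<longlongrightarrow> F t) (at_left t)"
      by (rule Lim_transform_eventually) (use ev1 d(2) in \<open>auto elim!: eventually_mono\<close>)
    have ev2: "\<forall>\<^sub>F s in at_right t. s \<in> {t<..<t+d}"
      using d(1) eventually_at_right_field[of _ t] by (auto intro!: exI[of _ "t + d"])
    have "((\<lambda>s. (if t \<in> K then r t * \<phi> s else 0) - S t - (if t \<in> T then (r t - l t) * \<phi> t else 0)) \<longlongrightarrow>
       (if t \<in> K then r t * \<phi> t else 0) - S t - (if t \<in> T then (r t - l t) * \<phi> t else 0)) (at_right t)"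
      using contphi[of t] by (cases "t \<in> K") (auto intro!: tendsto_intros simp: isCont_def intro: filterlim_at_split[THEN iffD1, THEN conjunct2])
    \<comment> \<open>The formula on the right continues to the value at \<open>t\<close>: off
      \<open>T\<close> the one-sided limits agree, on \<open>T\<close> the collected jump cancels
      the jump of the product, and off \<open>K\<close> the factor \<open>\<phi> t\<close>
      vanishes.\<close>
    moreover have "(if t \<in> K then r t * \<phi> t else 0) - S t - (if t \<in> T then (r t - l t) * \<phi> t else 0) = F t"
      using reg[of t] off(1)[of t] by (auto simp: Ft algebra_simps)
    ultimately have "((\<lambda>s. (if t \<in> K then r t * \<phi> s else 0) - S t - (if t \<in> T then (r t - l t) * \<phi> t else 0)) \<longlongrightarrow> F t) (at_right t)"
      by simp
    then have "(F \<longlongrightarrow> F t) (at_right t)"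
      by (rule Lim_transform_eventually) (use ev2 d(3) in \<open>auto elim!: eventually_mono\<close>)
    with L show ?thesis by (simp add: isCont_def filterlim_at_split)
  qed
  have derF: "(F has_real_derivative \<gamma> t * \<phi>' t) (at t)" if t: "t \<notin> T" for t
  proof -
    obtain d where d: "d > 0" "\<forall>s\<in>{t-d<..t}. F s = l t * \<phi> s - S t"
      "\<forall>s\<in>{t<..<t+d}. F s = (if t \<in> K then r t * \<phi> s else 0) - S t - (if t \<in> T then (r t - l t) * \<phi> t else 0)"
      "t \<notin> K \<longrightarrow> (\<forall>s\<in>{t-d<..<t+d}. \<phi> s = 0)"
      using near[of t] by blast
    have eq: "F s = l t * \<phi> s - S t" if "s \<in> {t-d<..<t+d}" for s
      using that d t reg[of t] by (cases "s \<le> t"; cases "t \<in> K") auto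
    have val: "l t * \<phi>' t = \<gamma> t * \<phi>' t" using reg[of t] t off(2)[of t] by (cases "t \<in> K") auto
    have "((\<lambda>s. l t * \<phi> s - S t) has_real_derivative \<gamma> t * \<phi>' t) (at t)"
      unfolding val[symmetric] by (auto intro!: derivative_eq_intros \<phi>)
    then show ?thesis
      by (rule has_field_derivative_transform_within_open[of _ _ _ "{t-d<..<t+d}"]) (use d(1) eq in auto)
  qed
  obtain b where b: "b > 0" "K \<union> T \<subseteq> {-b<..<b}"
  proof -
    have "bounded (K \<union> T)" using K T by (simp add: compact_imp_bounded finite_imp_bounded)
    then obtain b where b: "b > 0" "\<forall>x\<in>K \<union> T. norm x < b" unfolding bounded_pos_less by blast
    have "K \<union> T \<subseteq> {-b<..<b}"
    proof
      fix x assume "x \<in> K \<union> T"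
      then have "norm x < b" using b(2) by blast
      then show "x \<in> {-b<..<b}" by auto
    qed
    with b(1) show ?thesis by (rule that)
  qed
  have "((\<lambda>t. \<gamma> t * \<phi>' t) has_integral (F b - F (- b))) {-b..b}"
    using T b(1) derF contF
    by (intro fundamental_theorem_of_calculus_interior_strong[of T])
       (auto simp: has_real_derivative_iff_has_vector_derivative[symmetric] continuous_at_imp_continuous_on)
  then have HK: "((\<lambda>t. \<gamma> t * \<phi>' t) has_integral (F b - F (- b))) UNIV"
  proof (rule has_integral_on_superset[OF _ _ subset_UNIV])
    fix t assume "t \<notin> {-b..b}"
    then have "t \<notin> K" using b(2) by auto
    then show "\<gamma> t * \<phi>' t = 0" by (simp add: off(2))
  qed
  have Fb: "F b = - (\<Sum>t\<in>T. \<phi> t * (r t - l t))" "F (- b) = 0"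
  proof -
    have "b \<notin> K" "- b \<notin> K" using b(2) by auto
    moreover have "{\<tau>\<in>T. \<tau> < b} = T" "{\<tau>\<in>T. \<tau> < - b} = {}" using b(2) by auto
    moreover from this have "S b = (\<Sum>\<tau>\<in>T. (r \<tau> - l \<tau>) * \<phi> \<tau>)" "S (- b) = 0"
      by (simp_all only: S_def sum.empty)
    ultimately show "F b = - (\<Sum>t\<in>T. \<phi> t * (r t - l t))" "F (- b) = 0"
      by (simp_all add: F_def off mult.commute)
  qed
  have int: "integrable lborel (\<lambda>t. \<gamma> t * \<phi>' t)"
  proof -
    have "set_integrable lborel {-b..b} \<phi>'"
      unfolding set_integrable_def
      using \<phi>' by (intro borel_integrable_compact) (auto intro: continuous_on_subset)
    then have 1: "integrable lborel (\<lambda>t. C * (indicator {-b..b} t *\<^sub>R \<phi>' t))"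
      unfolding set_integrable_def by simp
    have [measurable]: "\<phi>' \<in> borel_measurable borel" using \<phi>' by (rule borel_measurable_continuous_onI)
    have "\<bar>\<gamma> t * \<phi>' t\<bar> \<le> \<bar>C * (indicator {-b..b} t *\<^sub>R \<phi>' t)\<bar>" for t
    proof (cases "t \<in> K")
      case True
      then have "t \<in> {-b..b}" using b(2) by auto
      then show ?thesis using \<gamma>(2)[of t] by (auto simp: abs_mult intro!: mult_right_mono)
    qed (simp add: off)
    then show ?thesis using \<gamma>(1) by (intro Bochner_Integration.integrable_bound[OF 1]) auto
  qed
  have "(\<integral>t. \<gamma> t * \<phi>' t \<partial>lborel) = F b - F (- b)"
    using has_integral_unique[OF HK has_integral_integral_lborel[OF int]] by simp
  then show ?thesis by (simp add: Fb)
qed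

section \<open>Jumps of locally conical functions\<close>

definition outer :: "real^'m \<Rightarrow> real^'n \<Rightarrow> real^'n^'m" where
  "outer a \<nu> = (\<chi> i j. a $ i * \<nu> $ j)"

lemma jump_tensor_outer: "jump_tensor u x = outer (jump u x) (jump_normal u x)"
  by (simp add: jump_tensor_def outer_def)

lemma outer_minus: "outer (- a) (- \<nu>) = outer a \<nu>"
  by (simp add: outer_def)

lemma half_ball_open: "open (half_ball x r \<nu>)"
proof -
  have "half_ball x r \<nu> = ball x r \<inter> {y. (y - x) \<bullet> \<nu> > 0}" by (auto simp: half_ball_def)
  moreover have "open {y. (y - x) \<bullet> \<nu> > 0}" by (intro open_Collect_less continuous_intros)
  ultimately show ?thesis by auto
qed

lemma half_ball_borel [measurable]: "half_ball x r \<nu> \<in> sets borel"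
  by (rule borel_open[OF half_ball_open])

lemma half_ball_subset: "half_ball x r \<nu> \<subseteq> ball x r"
  by (auto simp: half_ball_def)

lemma emeasure_half_ball_finite: "emeasure lborel (half_ball x r \<nu>) < \<infinity>"
  using emeasure_mono[of "half_ball x r \<nu>" "ball x r" lborel] half_ball_subset[of x r \<nu>]
    emeasure_lborel_ball_finite[of x r] by (auto intro: le_less_trans)

lemma half_ball_pos:
  assumes "0 < r" "\<nu> \<noteq> 0"
  shows "0 < measure lborel (half_ball x r \<nu>)"
proof -
  have "x + (r / 2 / norm \<nu>) *\<^sub>R \<nu> \<in> half_ball x r \<nu>"
    using assms by (auto simp: half_ball_def dist_norm)
  then have "\<not> negligible (half_ball x r \<nu>)" using open_not_negligible[OF half_ball_open] by blast
  then have "emeasure lborel (half_ball x r \<nu>) \<noteq> 0"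
    by (auto simp: negligible_iff_null_sets null_sets_def)
  then show ?thesis using emeasure_half_ball_finite[of x r \<nu>]
    by (simp add: measure_def enn2real_positive_iff zero_less_iff_neq_zero)
qed

lemma nn_integral_dilate:
  fixes f :: "'a::euclidean_space \<Rightarrow> ennreal"
  assumes [measurable]: "f \<in> borel_measurable borel" and "0 < c"
  shows "(\<integral>\<^sup>+y. f y \<partial>lborel) = ennreal (c ^ DIM('a)) * (\<integral>\<^sup>+y. f (x + c *\<^sub>R (y - x)) \<partial>lborel)"
proof -
  have "(\<integral>\<^sup>+y. f y \<partial>lborel) = (\<integral>\<^sup>+y. f (y + x) \<partial>lborel)"
    by (rule nn_integral_lborel_translate[symmetric]) measurable
  also have "\<dots> = ennreal (c ^ DIM('a)) * (\<integral>\<^sup>+y. f (c *\<^sub>R y + x) \<partial>lborel)"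
    by (rule nn_integral_lborel_scale) (use assms in auto)
  also have "(\<integral>\<^sup>+y. f (c *\<^sub>R y + x) \<partial>lborel) = (\<integral>\<^sup>+y. f (c *\<^sub>R (y + (- x)) + x) \<partial>lborel)"
    by (rule nn_integral_lborel_translate[symmetric]) measurable
  finally show ?thesis by (simp add: add.commute)
qed

lemma dilate_half_ball:
  assumes "0 < s" "0 < r"
  shows "x + (s / r) *\<^sub>R (y - x) \<in> half_ball x s \<nu> \<longleftrightarrow> y \<in> half_ball x r \<nu>"
proof -
  have "dist x (x + (s / r) *\<^sub>R (y - x)) = s / r * dist x y"
    using assms by (simp add: dist_norm norm_minus_commute[of x])
  moreover have "s / r * dist x y < s \<longleftrightarrow> dist x y < r" using assms by (simp add: field_simps)
  moreover have "0 < s / r * ((y - x) \<bullet> \<nu>) \<longleftrightarrow> 0 < (y - x) \<bullet> \<nu>"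
    using assms by (simp add: zero_less_mult_iff zero_less_divide_iff)
  ultimately show ?thesis by (simp add: half_ball_def)
qed

text \<open>Near each point of \<open>Q\<close> the bounded field \<open>w\<close> is constant along
  the rays ending there. Means over small half balls then do not depend on the radius, which reduces
  approximate limits to statements about one fixed half ball.\<close>

locale conical_field =
  fixes Q :: "(real^'n) set" and w :: "real^'n \<Rightarrow> real^'n" and G :: "real^'n^'n" and B :: real
  assumes openQ: "open Q" and bddQ: "bounded Q"
    and w_borel [measurable]: "w \<in> borel_measurable borel" and w_bdd: "\<And>x. norm (w x) \<le> B"
    and conical: "\<And>x. x \<in> Q \<Longrightarrow> \<exists>r>0. ball x r \<subseteq> Q \<and> (\<forall>y\<in>ball x r. \<forall>t. 0 < t \<and> t \<le> 1 \<longrightarrow> w (x + t *\<^sub>R (y - x)) = w y)"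
begin

definition u :: "real^'n \<Rightarrow> real^'n" where "u x = G *v x + w x"

lemma u_borel [measurable]: "u \<in> borel_measurable borel"
proof -
  have "continuous_on UNIV (\<lambda>x. G *v x)" by (intro continuous_intros)
  then have [measurable]: "(\<lambda>x. G *v x) \<in> borel_measurable borel" by (rule borel_measurable_continuous_onI)
  show ?thesis unfolding u_def[abs_def] by measurable
qed

text \<open>Records values of \<open>w\<close>, not of \<open>u\<close>: they differ from the
  one-sided limits of \<open>u\<close> by \<open>G *v x\<close>, which drops out of the
  jump.\<close>

definition two_valued :: "real^'n \<Rightarrow> real \<Rightarrow> real^'n \<Rightarrow> real^'n \<Rightarrow> real^'n \<Rightarrow> bool" where
  "two_valued x r a b \<nu> \<longleftrightarrow>
     (AE y in lborel. (y \<in> half_ball x r \<nu> \<longrightarrow> w y = a) \<and> (y \<in> half_ball x r (- \<nu>) \<longrightarrow> w y = b))"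

lemma integrable_half:
  assumes "h \<in> borel_measurable borel" "\<And>y. y \<in> half_ball x r \<nu> \<Longrightarrow> \<bar>h y\<bar> \<le> (c::real)"
  shows "integrable lborel (\<lambda>y. indicator (half_ball x r \<nu>) y * h y)"
proof (rule Bochner_Integration.integrable_bound)
  show "integrable lborel (\<lambda>y. c * indicator (half_ball x r \<nu>) y)"
    using emeasure_half_ball_finite[of x r \<nu>] by simp
  show "AE y in lborel. norm (indicator (half_ball x r \<nu>) y * h y) \<le> norm (c * indicator (half_ball x r \<nu>) y)"
    using assms(2) by (intro AE_I2) (fastforce simp: indicator_def)
qed (use assms(1) in measurable)

text \<open>The mean of \<open>h\<close> over a half ball is independent of the radius, while the
  linear part of \<open>u\<close> contributes at most a multiple of the radius. A vanishing limit
  therefore forces the mean of \<open>h\<close> to be zero already on one half ball.\<close>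

lemma one_sided_limit_iff:
  assumes x: "x \<in> Q" and \<nu>: "norm \<nu> = 1"
  shows "one_sided_limit u x \<nu> a \<longleftrightarrow> (\<exists>r>0. AE y in lborel. y \<in> half_ball x r \<nu> \<longrightarrow> w y = a - G *v x)"
proof -
  let ?N = "CARD('n)"
  obtain Cg where Cg: "\<And>y. norm (G *v y) \<le> norm y * Cg" "0 \<le> Cg"
    using bounded_linear.nonneg_bounded[OF matrix_vector_mul_bounded_linear[of G]] by blast
  define vol where "vol s = measure lborel (half_ball x s \<nu>)" for s
  define A where "A s = (\<integral>y. indicator (half_ball x s \<nu>) y * norm (u y - a) \<partial>lborel)" for s
  define h where "h y = norm (w y - (a - G *v x))" for y
  define I where "I s = (\<integral>y. indicator (half_ball x s \<nu>) y * h y \<partial>lborel)" for s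
  have [measurable]: "h \<in> borel_measurable borel" unfolding h_def[abs_def] by measurable
  have volpos: "0 < vol s" if "0 < s" for s
    unfolding vol_def using half_ball_pos[of s \<nu> x] that \<nu> by fastforce
  have osl: "one_sided_limit u x \<nu> a \<longleftrightarrow> ((\<lambda>s. A s / vol s) \<longlongrightarrow> 0) (at_right 0)"
  proof -
    have "(LINT y:half_ball x s \<nu>|lebesgue. norm (u y - a)) = A s" for s
      unfolding set_lebesgue_integral_def A_def
      by (subst integral_completion) auto
    moreover have "measure lebesgue (half_ball x s \<nu>) = vol s" for s unfolding vol_def by simp
    ultimately show ?thesis unfolding one_sided_limit_def by simp
  qed
  have hb: "\<bar>h y\<bar> \<le> B + norm (a - G *v x)" for y
    unfolding h_def using w_bdd[of y] norm_triangle_ineq4[of "w y" "a - G *v x"] by auto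
  have intI: "integrable lborel (\<lambda>y. indicator (half_ball x s \<nu>) y * h y)" for s
    using hb by (intro integrable_half) auto
  have split: "u y - a = G *v (y - x) + (w y - (a - G *v x))" for y
    by (simp add: u_def matrix_vector_mult_diff_distrib)
  have G1: "norm (G *v (y - x)) \<le> Cg * s" if "y \<in> half_ball x s \<nu>" for y s
  proof -
    have "norm (G *v (y - x)) \<le> norm (y - x) * Cg" by (rule Cg)
    also have "\<dots> \<le> s * Cg"
      using that Cg(2) by (intro mult_right_mono) (auto simp: half_ball_def dist_norm norm_minus_commute)
    finally show ?thesis by (simp add: mult.commute)
  qed
  have intA: "integrable lborel (\<lambda>y. indicator (half_ball x s \<nu>) y * norm (u y - a))" for s
  proof (rule integrable_half)
    show "\<bar>norm (u y - a)\<bar> \<le> Cg * s + (B + norm (a - G *v x))" if "y \<in> half_ball x s \<nu>" for y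
      using G1[OF that] hb[of y] norm_triangle_ineq[of "G *v (y - x)" "w y - (a - G *v x)"]
      unfolding split h_def abs_norm_cancel by linarith
  qed measurable
  have intc: "integrable lborel (\<lambda>y. Cg * s * indicator (half_ball x s \<nu>) y)" for s
    using emeasure_half_ball_finite[of x s \<nu>] by simp
  have Iscale: "I s / vol s = I r / vol r"
    if sr: "0 < s" "s \<le> r" and con: "\<And>y t. y \<in> ball x r \<Longrightarrow> 0 < t \<Longrightarrow> t \<le> 1 \<Longrightarrow> w (x + t *\<^sub>R (y - x)) = w y" for s r
  proof -
    have r: "0 < r" using sr by simp
    have dil: "ennreal (\<integral>y. indicator (half_ball x s \<nu>) y * g y \<partial>lborel)
        = ennreal ((s / r) ^ ?N) * ennreal (\<integral>y. indicator (half_ball x r \<nu>) y * g y \<partial>lborel)"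
      if [measurable]: "g \<in> borel_measurable borel" and g0: "\<And>y. 0 \<le> g y"
        and gc: "\<And>y. y \<in> ball x r \<Longrightarrow> g (x + (s / r) *\<^sub>R (y - x)) = g y"
        and int: "\<And>s. integrable lborel (\<lambda>y. indicator (half_ball x s \<nu>) y * g y)" for g
    proof -
      have "ennreal (\<integral>y. indicator (half_ball x s \<nu>) y * g y \<partial>lborel)
          = (\<integral>\<^sup>+y. ennreal (indicator (half_ball x s \<nu>) y * g y) \<partial>lborel)"
        using int g0 by (intro nn_integral_eq_integral[symmetric]) auto
      also have "\<dots> = ennreal ((s / r) ^ ?N) * (\<integral>\<^sup>+y. ennreal (indicator (half_ball x s \<nu>) (x + (s / r) *\<^sub>R (y - x)) * g (x + (s / r) *\<^sub>R (y - x))) \<partial>lborel)"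
        using sr by (subst nn_integral_dilate[of _ "s / r" x]) auto
      also have "(\<integral>\<^sup>+y. ennreal (indicator (half_ball x s \<nu>) (x + (s / r) *\<^sub>R (y - x)) * g (x + (s / r) *\<^sub>R (y - x))) \<partial>lborel)
          = (\<integral>\<^sup>+y. ennreal (indicator (half_ball x r \<nu>) y * g y) \<partial>lborel)"
      proof (intro nn_integral_cong arg_cong[of _ _ ennreal])
        fix y
        show "indicator (half_ball x s \<nu>) (x + (s / r) *\<^sub>R (y - x)) * g (x + (s / r) *\<^sub>R (y - x))
            = indicator (half_ball x r \<nu>) y * g y"
          using dilate_half_ball[OF sr(1) r, of x y \<nu>] gc[of y] half_ball_subset[of x r \<nu>]
          by (cases "y \<in> half_ball x r \<nu>") auto
      qed
      also have "\<dots> = ennreal (\<integral>y. indicator (half_ball x r \<nu>) y * g y \<partial>lborel)"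
        using int g0 by (intro nn_integral_eq_integral) auto
      finally show ?thesis .
    qed
    have sr01: "0 < s / r" "s / r \<le> 1" using sr r by auto
    have "ennreal (I s) = ennreal ((s / r) ^ ?N) * ennreal (I r)"
      unfolding I_def
    proof (rule dil)
      show "h (x + (s / r) *\<^sub>R (y - x)) = h y" if "y \<in> ball x r" for y
        using con[OF that sr01] by (simp add: h_def)
    qed (use intI in \<open>auto simp: h_def\<close>)
    moreover have "0 \<le> I s" for s unfolding I_def by (intro Bochner_Integration.integral_nonneg) (auto simp: h_def)
    ultimately have Is: "I s = (s / r) ^ ?N * I r"
      using sr01 by (simp add: ennreal_mult[symmetric] ennreal_inj)
    have "ennreal (vol s) = ennreal ((s / r) ^ ?N) * ennreal (vol r)"
      using dil[of "\<lambda>_. 1"] emeasure_half_ball_finite[of x _ \<nu>] by (simp add: vol_def)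
    then have "vol s = (s / r) ^ ?N * vol r"
      using sr01 volpos[OF r] volpos[OF sr(1)] by (simp add: ennreal_mult[symmetric] ennreal_inj)
    then show ?thesis using Is sr(1) r by auto
  qed
  show ?thesis
  proof
    assume "one_sided_limit u x \<nu> a"
    then have lim: "((\<lambda>s. A s / vol s) \<longlongrightarrow> 0) (at_right 0)" by (simp add: osl)
    obtain r where r: "r > 0" "\<forall>y\<in>ball x r. \<forall>t. 0 < t \<and> t \<le> 1 \<longrightarrow> w (x + t *\<^sub>R (y - x)) = w y"
      using conical[OF x] by blast
    have le: "I r / vol r - Cg * s \<le> A s / vol s" if s: "0 < s" "s \<le> r" for s
    proof -
      have "I s \<le> A s + (\<integral>y. Cg * s * indicator (half_ball x s \<nu>) y \<partial>lborel)"
        unfolding I_def A_def Bochner_Integration.integral_add[OF intA intc, symmetric]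
      proof (rule integral_mono[OF intI])
        fix y
        show "indicator (half_ball x s \<nu>) y * h y \<le> indicator (half_ball x s \<nu>) y * norm (u y - a) + Cg * s * indicator (half_ball x s \<nu>) y"
        proof (cases "y \<in> half_ball x s \<nu>")
          case True
          have "h y \<le> norm (u y - a) + norm (G *v (y - x))"
            unfolding split h_def using norm_triangle_ineq4[of "G *v (y - x) + (w y - (a - G *v x))" "G *v (y - x)"] by simp
          then show ?thesis using True G1[OF True] by simp
        qed simp
      qed (use intA intc in auto)
      then have "I s - Cg * s * vol s \<le> A s" by (simp add: vol_def)
      then have "(I s - Cg * s * vol s) / vol s \<le> A s / vol s"
        using volpos[OF s(1)] by (intro divide_right_mono) auto
      then show ?thesis using volpos[OF s(1)] Iscale[OF s] r(2) by (simp add: diff_divide_distrib)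
    qed
    have "((\<lambda>s. I r / vol r - Cg * s) \<longlongrightarrow> I r / vol r - Cg * 0) (at_right 0)"
      by (intro tendsto_intros)
    moreover have "\<forall>\<^sub>F s in at_right 0. I r / vol r - Cg * s \<le> A s / vol s"
      using r(1) le by (auto simp: eventually_at_right_field intro!: exI[of _ r])
    ultimately have "I r / vol r - Cg * 0 \<le> 0"
      using lim by (intro tendsto_le[of "at_right (0::real)"]) auto
    then have "I r \<le> 0" using volpos[OF r(1)] by (simp add: divide_le_0_iff)
    moreover have "0 \<le> I r" unfolding I_def by (intro Bochner_Integration.integral_nonneg) (auto simp: h_def)
    ultimately have "I r = 0" by simp
    then have "AE y in lborel. indicator (half_ball x r \<nu>) y * h y = 0"
      unfolding I_def using intI by (subst (asm) integral_nonneg_eq_0_iff_AE) (auto simp: h_def)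
    then have "AE y in lborel. y \<in> half_ball x r \<nu> \<longrightarrow> w y = a - G *v x"
      by eventually_elim (auto simp: h_def)
    then show "\<exists>r>0. AE y in lborel. y \<in> half_ball x r \<nu> \<longrightarrow> w y = a - G *v x" using r(1) by blast
  next
    assume "\<exists>r>0. AE y in lborel. y \<in> half_ball x r \<nu> \<longrightarrow> w y = a - G *v x"
    then obtain r where r: "0 < r" "AE y in lborel. y \<in> half_ball x r \<nu> \<longrightarrow> w y = a - G *v x" by blast
    have up: "A s / vol s \<le> Cg * s" if s: "0 < s" "s \<le> r" for s
    proof -
      have "A s \<le> (\<integral>y. Cg * s * indicator (half_ball x s \<nu>) y \<partial>lborel)"
        unfolding A_def
      proof (rule integral_mono_AE[OF intA intc])
        show "AE y in lborel. indicator (half_ball x s \<nu>) y * norm (u y - a) \<le> Cg * s * indicator (half_ball x s \<nu>) y"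
          using r(2)
        proof eventually_elim
          case (elim y)
          show ?case
          proof (cases "y \<in> half_ball x s \<nu>")
            case True
            then have "y \<in> half_ball x r \<nu>" using s by (auto simp: half_ball_def)
            then have "u y - a = G *v (y - x)" using elim by (simp add: split)
            then show ?thesis using True G1[OF True] by simp
          qed simp
        qed
      qed
      then have "A s \<le> Cg * s * vol s" by (simp add: vol_def)
      then show ?thesis using volpos[OF s(1)] by (simp add: divide_le_eq)
    qed
    have A0: "0 \<le> A s / vol s" for s
      unfolding A_def vol_def by (intro divide_nonneg_nonneg Bochner_Integration.integral_nonneg) auto
    have "((\<lambda>s. Cg * s) \<longlongrightarrow> Cg * 0) (at_right 0)" by (intro tendsto_intros)
    then have "((\<lambda>s. A s / vol s) \<longlongrightarrow> 0) (at_right 0)"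
      by (intro tendsto_sandwich[of "\<lambda>_. 0" "\<lambda>s. A s / vol s" "at_right 0" "\<lambda>s. Cg * s"])
         (use r(1) up A0 in \<open>auto simp: eventually_at_right_field intro!: exI[of _ r]\<close>)
    then show "one_sided_limit u x \<nu> a" by (simp add: osl)
  qed
qed

lemma is_jump_triple_iff:
  assumes x: "x \<in> Q"
  shows "is_jump_triple u x (a, b, \<nu>) \<longleftrightarrow>
    a \<noteq> b \<and> norm \<nu> = 1 \<and> (\<exists>r>0. two_valued x r (a - G *v x) (b - G *v x) \<nu>)"
proof (cases "norm \<nu> = 1")
  case True
  have mono: "half_ball x s n \<subseteq> half_ball x r n" if "s \<le> r" for s r n
    using that by (auto simp: half_ball_def)
  have "(\<exists>r>0. AE y in lborel. y \<in> half_ball x r \<nu> \<longrightarrow> w y = a - G *v x) \<and>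
        (\<exists>r>0. AE y in lborel. y \<in> half_ball x r (- \<nu>) \<longrightarrow> w y = b - G *v x)
      \<longleftrightarrow> (\<exists>r>0. two_valued x r (a - G *v x) (b - G *v x) \<nu>)" (is "?L \<longleftrightarrow> ?R")
  proof
    assume ?L
    then obtain r s where rs: "r > 0" "AE y in lborel. y \<in> half_ball x r \<nu> \<longrightarrow> w y = a - G *v x"
      "s > 0" "AE y in lborel. y \<in> half_ball x s (- \<nu>) \<longrightarrow> w y = b - G *v x" by blast
    have "two_valued x (min r s) (a - G *v x) (b - G *v x) \<nu>"
      unfolding two_valued_def using rs(2,4)
      by eventually_elim (use mono[of "min r s" r \<nu>] mono[of "min r s" s "- \<nu>"] in auto)
    then show ?R using rs by (intro exI[of _ "min r s"]) auto
  next
    assume ?R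
    then show ?L unfolding two_valued_def by (blast intro: AE_mp AE_I2 elim: eventually_mono)
  qed
  moreover have "norm (- \<nu>) = 1" using True by simp
  ultimately show ?thesis
    unfolding is_jump_triple_def using one_sided_limit_iff[OF x] True by simp
qed (simp add: is_jump_triple_def)

text \<open>The half balls contain the common point \<open>x + c (\<nu> + \<nu>')\<close>, since
  \<open>1 + \<nu> \<bullet> \<nu>'\<close> is positive unless the unit normals are opposite. Their
  intersection is then nonempty and open, hence not null, and carries both values.\<close>

lemma AE_half_balls_overlap:
  assumes "AE y in lborel. y \<in> half_ball x r \<nu> \<longrightarrow> w y = a" "AE y in lborel. y \<in> half_ball x s \<nu>' \<longrightarrow> w y = a'"
    and "0 < r" "0 < s" "norm \<nu> = 1" "norm \<nu>' = 1" "\<nu>' \<noteq> - \<nu>"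
  shows "a = a'"
proof -
  define U where "U = half_ball x r \<nu> \<inter> half_ball x s \<nu>'"
  have "open U" unfolding U_def by (intro open_Int half_ball_open)
  have "\<nu> \<bullet> \<nu>' \<noteq> - 1"
  proof
    assume "\<nu> \<bullet> \<nu>' = - 1"
    then have "(norm (\<nu> + \<nu>'))\<^sup>2 = 0"
      using assms(5,6) by (simp add: power2_norm_eq_inner inner_add_left inner_add_right inner_commute norm_eq_1)
    then show False using assms(7) by (simp add: add_eq_0_iff)
  qed
  moreover have "\<bar>\<nu> \<bullet> \<nu>'\<bar> \<le> 1" using Cauchy_Schwarz_ineq2[of \<nu> \<nu>'] assms by simp
  ultimately have pos: "0 < 1 + \<nu> \<bullet> \<nu>'" by auto
  \<comment> \<open>\<open>\<nu> + \<nu>'\<close> has norm at most 2, so a quarter of the smaller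
    radius keeps the point inside both balls.\<close>
  define c where "c = min r s / 4"
  have c: "0 < c" "2 * c < r" "2 * c < s" using assms by (auto simp: c_def)
  have "norm (\<nu> + \<nu>') \<le> 2" using norm_triangle_ineq[of \<nu> \<nu>'] assms by simp
  then have "c * norm (\<nu> + \<nu>') \<le> c * 2" using c by (intro mult_left_mono) auto
  then have "c * norm (\<nu> + \<nu>') < r" "c * norm (\<nu> + \<nu>') < s" using c by linarith+
  then have "x + c *\<^sub>R (\<nu> + \<nu>') \<in> U"
    unfolding U_def half_ball_def using pos c assms
    by (auto simp: dist_norm inner_add_left inner_add_right norm_eq_1 inner_commute add.commute simp flip: distrib_left)
  moreover have "\<exists>y\<in>U. w y = a \<and> w y = a'"
  proof (rule ccontr)
    assume no: "\<not> ?thesis"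
    have "AE y in lborel. y \<notin> U"
      using assms(1,2) by eventually_elim (use no in \<open>auto simp: U_def\<close>)
    then have "negligible U" using \<open>open U\<close>
      by (simp add: negligible_iff_null_sets AE_iff_null_sets[symmetric] null_sets_completion_iff borel_open)
    then show False using open_not_negligible[OF \<open>open U\<close>] \<open>x + c *\<^sub>R (\<nu> + \<nu>') \<in> U\<close> by blast
  qed
  ultimately show ?thesis by auto
qed

lemma two_valuedD:
  assumes "two_valued x r a b \<nu>"
  shows "AE y in lborel. y \<in> half_ball x r \<nu> \<longrightarrow> w y = a" "AE y in lborel. y \<in> half_ball x r (- \<nu>) \<longrightarrow> w y = b"
  using assms unfolding two_valued_def by (auto elim: eventually_mono)

text \<open>Compares the four pairs of half balls. Distinct values are demanded of the second triple
  only, so the result also excludes a jump where some description with equal values exists.\<close>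

lemma two_valued_unique:
  assumes t: "two_valued x r a b \<nu>" "0 < r" "norm \<nu> = 1"
    and t': "two_valued x r' a' b' \<nu>'" "0 < r'" "norm \<nu>' = 1" "a' \<noteq> b'"
  shows "(a' = a \<and> b' = b \<and> \<nu>' = \<nu>) \<or> (a' = b \<and> b' = a \<and> \<nu>' = - \<nu>)"
proof -
  note ov = AE_half_balls_overlap
  note d = two_valuedD[OF t(1)] and d' = two_valuedD[OF t'(1)]
  have n: "norm (- \<nu>) = 1" "norm (- \<nu>') = 1" using t t' by auto
  have "\<nu>' \<noteq> - \<nu> \<Longrightarrow> a = a'" using ov[OF d(1) d'(1)] t t' by simp
  moreover have "\<nu>' \<noteq> \<nu> \<Longrightarrow> a = b'" using ov[OF d(1) d'(2)] t t' n by simp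
  moreover have "\<nu>' \<noteq> \<nu> \<Longrightarrow> b = a'" using ov[OF d(2) d'(1)] t t' n by simp
  moreover have "\<nu>' \<noteq> - \<nu> \<Longrightarrow> b = b'" using ov[OF d(2) d'(2)] t t' n by (simp add: minus_equation_iff)
  moreover have "\<nu> \<noteq> - \<nu>"
  proof
    assume "\<nu> = - \<nu>"
    then have "2 *\<^sub>R \<nu> = 0" by (metis add.right_inverse scaleR_2)
    then show False using t(3) by simp
  qed
  ultimately show ?thesis using t'(4) by (cases "\<nu>' = \<nu>"; cases "\<nu>' = - \<nu>") auto
qed

lemma jump_set_iff:
  "x \<in> jump_set Q u \<longleftrightarrow> x \<in> Q \<and> (\<exists>a b \<nu> r. a \<noteq> b \<and> norm \<nu> = 1 \<and> 0 < r \<and> two_valued x r a b \<nu>)"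
proof (cases "x \<in> Q")
  case True
  have "(\<exists>t. is_jump_triple u x t) \<longleftrightarrow> (\<exists>a b \<nu>. is_jump_triple u x (a, b, \<nu>))" by auto
  also have "\<dots> \<longleftrightarrow> (\<exists>a b \<nu> r. a \<noteq> b \<and> norm \<nu> = 1 \<and> 0 < r \<and> two_valued x r a b \<nu>)"
  proof
    assume "\<exists>a b \<nu>. is_jump_triple u x (a, b, \<nu>)"
    then obtain a b \<nu> where t: "is_jump_triple u x (a, b, \<nu>)" by blast
    then have "a - G *v x \<noteq> b - G *v x" using True by (simp add: is_jump_triple_iff)
    then show "\<exists>a b \<nu> r. a \<noteq> b \<and> norm \<nu> = 1 \<and> 0 < r \<and> two_valued x r a b \<nu>"
      using t unfolding is_jump_triple_iff[OF True] by blast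
  next
    assume "\<exists>a b \<nu> r. a \<noteq> b \<and> norm \<nu> = 1 \<and> 0 < r \<and> two_valued x r a b \<nu>"
    then obtain a b \<nu> r where "a \<noteq> b" "norm \<nu> = 1" "0 < r" "two_valued x r a b \<nu>" by blast
    then have "is_jump_triple u x (a + G *v x, b + G *v x, \<nu>)"
      unfolding is_jump_triple_iff[OF True] by auto
    then show "\<exists>a b \<nu>. is_jump_triple u x (a, b, \<nu>)" by blast
  qed
  finally show ?thesis using True by (simp add: jump_set_def)
qed (simp add: jump_set_def)

lemma jump_values:
  assumes x: "x \<in> Q" and t: "a \<noteq> b" "norm \<nu> = 1" "0 < r" "two_valued x r a b \<nu>"
  shows "(jump u x = a - b \<and> jump_normal u x = \<nu>) \<or> (jump u x = - (a - b) \<and> jump_normal u x = - \<nu>)"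
proof -
  obtain a' b' \<nu>' where eq: "jump_triple u x = (a', b', \<nu>')" by (cases "jump_triple u x") auto
  have "is_jump_triple u x (a + G *v x, b + G *v x, \<nu>)"
    unfolding is_jump_triple_iff[OF x] using t by auto
  then have "is_jump_triple u x (jump_triple u x)" unfolding jump_triple_def by (rule someI)
  then obtain s where s: "a' \<noteq> b'" "norm \<nu>' = 1" "0 < s" "two_valued x s (a' - G *v x) (b' - G *v x) \<nu>'"
    unfolding eq is_jump_triple_iff[OF x] by blast
  have "(a' - G *v x = a \<and> b' - G *v x = b \<and> \<nu>' = \<nu>) \<or> (a' - G *v x = b \<and> b' - G *v x = a \<and> \<nu>' = - \<nu>)"
    using s t by (intro two_valued_unique[OF t(4,3,2) s(4,3,2)]) auto
  moreover have "jump u x = (a' - G *v x) - (b' - G *v x)" "jump_normal u x = \<nu>'"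
    by (simp_all add: jump_def jump_normal_def eq)
  ultimately show ?thesis by auto
qed

lemma jump_tensor_eq:
  assumes "x \<in> Q" "a \<noteq> b" "norm \<nu> = 1" "0 < r" "two_valued x r a b \<nu>"
  shows "jump_tensor u x = outer (a - b) \<nu>"
  using jump_values[OF assms] outer_minus[of "a - b" \<nu>] by (auto simp: jump_tensor_outer)

text \<open>Limits of points of \<open>stratum r \<Theta>\<close> stay in it: along a subsequence the values and normals converge
  in the compact set \<open>\<Theta>\<close>, and each point of the limit half ball lies in the approximating ones
  eventually.\<close>

definition stratum :: "real \<Rightarrow> ((real^'n) \<times> (real^'n) \<times> (real^'n)) set \<Rightarrow> (real^'n) set" where
  "stratum r \<Theta> = {x. \<exists>(a, b, \<nu>)\<in>\<Theta>. two_valued x r a b \<nu>}"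

lemma stratum_closed:
  assumes \<Theta>: "compact \<Theta>"
  shows "closed (stratum r \<Theta>)"
  unfolding closed_sequential_limits
proof (intro allI impI, elim conjE)
  fix X x assume X: "\<forall>k. X k \<in> stratum r \<Theta>" "X \<longlonglongrightarrow> x"
  have "\<exists>p\<in>\<Theta>. two_valued (X k) r (fst p) (fst (snd p)) (snd (snd p))" for k
  proof -
    have "X k \<in> stratum r \<Theta>" using X(1) by blast
    then obtain a b \<nu> where "(a, b, \<nu>) \<in> \<Theta>" "two_valued (X k) r a b \<nu>" by (auto simp: stratum_def)
    then show ?thesis by (intro bexI[of _ "(a, b, \<nu>)"]) auto
  qed
  then obtain p where p: "\<And>k. p k \<in> \<Theta>" "\<And>k. two_valued (X k) r (fst (p k)) (fst (snd (p k))) (snd (snd (p k)))"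
    by metis
  obtain q \<sigma> where q: "q \<in> \<Theta>" "strict_mono \<sigma>" "(p \<circ> \<sigma>) \<longlonglongrightarrow> q"
    using \<Theta> p(1) unfolding compact_def by blast
  obtain a b \<nu> where abn: "q = (a, b, \<nu>)" by (cases q) auto
  define A where "A k = fst ((p \<circ> \<sigma>) k)" for k
  define B' where "B' k = fst (snd ((p \<circ> \<sigma>) k))" for k
  define V where "V k = snd (snd ((p \<circ> \<sigma>) k))" for k
  define Y where "Y k = X (\<sigma> k)" for k
  have lim: "A \<longlonglongrightarrow> a" "B' \<longlonglongrightarrow> b" "V \<longlonglongrightarrow> \<nu>"
    unfolding A_def B'_def V_def using tendsto_fst[OF q(3)] tendsto_fst[OF tendsto_snd[OF q(3)]]
      tendsto_snd[OF tendsto_snd[OF q(3)]] by (auto simp: abn)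
  have Yx: "Y \<longlonglongrightarrow> x" unfolding Y_def using LIMSEQ_subseq_LIMSEQ[OF X(2) q(2)] by (simp add: o_def)
  have inhalf: "\<forall>\<^sub>F k in sequentially. y \<in> half_ball (Y k) r (N k)"
    if "y \<in> half_ball x r n" "N \<longlonglongrightarrow> n" for y n and N :: "nat \<Rightarrow> real^'n"
  proof -
    have "(\<lambda>k. dist (Y k) y) \<longlonglongrightarrow> dist x y" by (intro tendsto_intros Yx)
    moreover have "dist x y < r" using that by (auto simp: half_ball_def)
    ultimately have "\<forall>\<^sub>F k in sequentially. dist (Y k) y < r" by (rule order_tendstoD)
    moreover have "(\<lambda>k. (y - Y k) \<bullet> N k) \<longlonglongrightarrow> (y - x) \<bullet> n" by (intro tendsto_intros Yx that)
    then have "\<forall>\<^sub>F k in sequentially. 0 < (y - Y k) \<bullet> N k"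
      by (rule order_tendstoD) (use that in \<open>auto simp: half_ball_def\<close>)
    ultimately show ?thesis by eventually_elim (auto simp: half_ball_def)
  qed
  have "AE y in lborel. \<forall>k. (y \<in> half_ball (Y k) r (V k) \<longrightarrow> w y = A k) \<and> (y \<in> half_ball (Y k) r (- V k) \<longrightarrow> w y = B' k)"
    unfolding AE_all_countable using p(2) by (auto simp: two_valued_def A_def B'_def V_def Y_def)
  then have "two_valued x r a b \<nu>"
    unfolding two_valued_def
  proof eventually_elim
    case (elim y)
    show ?case
    proof (intro conjI impI)
      assume "y \<in> half_ball x r \<nu>"
      then have "\<forall>\<^sub>F k in sequentially. A k = w y" 
        by (rule eventually_mono[OF inhalf[OF _ lim(3)]]) (use elim in auto)
      then show "w y = a" using lim(1) tendsto_eventually LIMSEQ_unique by blast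
    next
      assume "y \<in> half_ball x r (- \<nu>)"
      then have "\<forall>\<^sub>F k in sequentially. B' k = w y"
        by (rule eventually_mono[OF inhalf[OF _ tendsto_minus[OF lim(3)]]]) (use elim in auto)
      then show "w y = b" using lim(2) tendsto_eventually LIMSEQ_unique by blast
    qed
  qed
  then show "x \<in> stratum r \<Theta>" using q(1) abn by (auto simp: stratum_def)
qed

text \<open>The lower bound on the difference of the values survives limits and keeps the jump from
  closing; the bound \<open>k\<close> gives compactness. Letting \<open>k\<close> grow exhausts all
  jumps with tensor in \<open>F\<close>.\<close>

definition triples :: "nat \<Rightarrow> (real^'n^'n) set \<Rightarrow> ((real^'n) \<times> (real^'n) \<times> (real^'n)) set" where
  "triples k F = {p. norm (fst p) \<le> real k \<and> norm (fst (snd p)) \<le> real k \<and> 1 / real (Suc k) \<le> norm (fst p - fst (snd p)) \<and>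
     norm (snd (snd p)) = 1 \<and> outer (fst p - fst (snd p)) (snd (snd p)) \<in> F}"

lemma triples_compact:
  assumes "closed F"
  shows "compact (triples k F)"
proof -
  have "continuous_on UNIV (\<lambda>p. outer (fst p - fst (snd p)) (snd (snd p)))"
    unfolding outer_def by (intro continuous_intros continuous_on_vec_lambda)
  then have "closed ((\<lambda>p. outer (fst p - fst (snd p)) (snd (snd p))) -` F)"
    by (rule closed_vimage[OF assms])
  then have "closed {p. outer (fst p - fst (snd p)) (snd (snd p)) \<in> F}" by (simp add: vimage_def)
  then have "closed (triples k F)"
    unfolding triples_def by (intro closed_Collect_conj closed_Collect_le closed_Collect_eq continuous_intros) simp
  moreover have "triples k F \<subseteq> cball 0 (real k) \<times> cball 0 (real k) \<times> cball 0 1"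
    by (auto simp: triples_def)
  moreover have "compact (cball (0::real^'n) (real k) \<times> cball (0::real^'n) (real k) \<times> cball (0::real^'n) 1)"
    by (intro compact_Times compact_cball)
  ultimately show ?thesis using compact_Int_closed by (metis Int_absorb1 inf_commute)
qed

text \<open>Every jump has some size, radius and bound, hence lies in one of countably many strata,
  which are closed when \<open>F\<close> is. Borel measurability of the jump set and of the jump
  tensor comes from here.\<close>

lemma jump_set_strata:
  "{x \<in> jump_set Q u. jump_tensor u x \<in> F} = Q \<inter> (\<Union>k. \<Union>l. stratum (1 / real (Suc l)) (triples k F))"
proof safe
  fix x assume x: "x \<in> jump_set Q u" "jump_tensor u x \<in> F"
  then show "x \<in> Q" by (simp add: jump_set_def)
  obtain a b \<nu> r where t: "a \<noteq> b" "norm \<nu> = 1" "0 < r" "two_valued x r a b \<nu>"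
    using x(1) by (auto simp: jump_set_iff)
  obtain l where l: "1 / real (Suc l) < r" using t(3) nat_approx_posE by blast
  obtain k1 where k1: "1 / real (Suc k1) < norm (a - b)" using t(1) nat_approx_posE[of "norm (a - b)"] by auto
  obtain k2 :: nat where k2: "max (norm a) (norm b) \<le> real k2" using real_arch_simple by blast
  define k where "k = max k1 k2"
  have "1 / real (Suc k) \<le> 1 / real (Suc k1)" unfolding k_def by (intro divide_left_mono) auto
  then have "(a, b, \<nu>) \<in> triples k F"
    using t k1 k2 x(2) jump_tensor_eq[OF \<open>x \<in> Q\<close> t] by (auto simp: triples_def k_def)
  moreover have "two_valued x (1 / real (Suc l)) a b \<nu>"
    using t(4) unfolding two_valued_def by eventually_elim (use l in \<open>auto simp: half_ball_def\<close>)
  ultimately have "x \<in> stratum (1 / real (Suc l)) (triples k F)" unfolding stratum_def by blast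
  then show "x \<in> (\<Union>k. \<Union>l. stratum (1 / real (Suc l)) (triples k F))" by blast
next
  fix x k l assume x: "x \<in> Q" "x \<in> stratum (1 / real (Suc l)) (triples k F)"
  then obtain a b \<nu> where p: "(a, b, \<nu>) \<in> triples k F" "two_valued x (1 / real (Suc l)) a b \<nu>"
    by (auto simp: stratum_def)
  have "0 < 1 / real (Suc k)" by simp
  then have "a \<noteq> b" using p(1) by (auto simp: triples_def)
  then have t: "a \<noteq> b" "norm \<nu> = 1" "0 < 1 / real (Suc l)" "two_valued x (1 / real (Suc l)) a b \<nu>"
    using p by (auto simp: triples_def)
  then show "x \<in> jump_set Q u" unfolding jump_set_iff using x(1) by blast
  show "jump_tensor u x \<in> F" using jump_tensor_eq[OF x(1) t] p(1) by (auto simp: triples_def)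
qed

lemma jump_strata_borel: "closed F \<Longrightarrow> {x \<in> jump_set Q u. jump_tensor u x \<in> F} \<in> sets borel"
proof -
  assume "closed F"
  then have [measurable]: "stratum r (triples k F) \<in> sets borel" for r k
    by (intro borel_closed stratum_closed triples_compact)
  have [measurable]: "Q \<in> sets borel" using openQ by simp
  show ?thesis unfolding jump_set_strata by measurable
qed

lemma jump_set_borel [measurable]: "jump_set Q u \<in> sets borel"
  using jump_strata_borel[of UNIV] by simp

lemma jump_tensor_measurable [measurable]:
  "(\<lambda>x. indicator (jump_set Q u) x *\<^sub>R jump_tensor u x) \<in> borel_measurable borel"
proof (rule borel_measurableI)
  fix S :: "(real^'n^'n) set" assume "open S"
  let ?f = "\<lambda>x. indicator (jump_set Q u) x *\<^sub>R jump_tensor u x"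
  have "closed (- S)" using \<open>open S\<close> by (rule closed_Compl)
  then have JS: "{x \<in> jump_set Q u. jump_tensor u x \<in> - S} \<in> sets borel" by (rule jump_strata_borel)
  have "?f -` S = (jump_set Q u - {x \<in> jump_set Q u. jump_tensor u x \<in> - S}) \<union> (if 0 \<in> S then - jump_set Q u else {})"
    (is "_ = ?R")
  proof (rule set_eqI)
    show "x \<in> ?f -` S \<longleftrightarrow> x \<in> ?R" for x by (cases "x \<in> jump_set Q u") auto
  qed
  moreover have "(if 0 \<in> S then - jump_set Q u else {}) \<in> sets borel" by (simp add: borel_comp)
  then have "?R \<in> sets borel" using JS by (intro sets.Un sets.Diff jump_set_borel)
  ultimately show "?f -` S \<inter> space borel \<in> sets borel" by simp
qed

end

section \<open>The Gauss--Green formula on the cube\<close>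

text \<open>On every line in direction \<open>v\<close> the derivative of a compactly supported
  function integrates to zero, by the one-dimensional formula with the constant 1 and no jumps;
  slicing collects the lines.\<close>

lemma integral_derivative_compact_support:
  fixes F :: "'a::euclidean_space \<Rightarrow> real"
  assumes F: "C1 F g" and K: "compact K" "\<And>x. x \<notin> K \<Longrightarrow> F x = 0" and v: "v \<noteq> 0"
  shows "(\<integral>x. g x \<bullet> v \<partial>lborel) = 0" "integrable lborel (\<lambda>x. g x \<bullet> v)"
proof -
  have g0: "g x = 0" if "x \<notin> K" for x
    using C1_zero_outside[OF F compact_imp_closed[OF K(1)] K(2) that] .
  have cont: "continuous_on UNIV (\<lambda>x. g x \<bullet> v)"
    using F unfolding C1_def by (intro continuous_intros) auto
  have "integrable lborel (\<lambda>x. indicator K x *\<^sub>R (g x \<bullet> v))"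
    using K(1) cont by (intro borel_integrable_compact) (auto intro: continuous_on_subset)
  moreover have "(\<lambda>x. indicator K x *\<^sub>R (g x \<bullet> v)) = (\<lambda>x. g x \<bullet> v)"
    using g0 by (intro ext) (auto simp: indicator_def)
  ultimately show int: "integrable lborel (\<lambda>x. g x \<bullet> v)" by simp
  define n where "n = v /\<^sub>R (v \<bullet> v)"
  have nv: "n \<bullet> v = 1" using v by (simp add: n_def)
  have "(\<integral>t. g (x + t *\<^sub>R v) \<bullet> v \<partial>lborel) = 0" for x
  proof -
    define L where "L = (\<lambda>y. n \<bullet> (y - x)) ` K"
    have "compact L" unfolding L_def using K(1) by (intro compact_continuous_image continuous_intros)
    have off: "x + t *\<^sub>R v \<notin> K" if "t \<notin> L" for t
    proof
      assume "x + t *\<^sub>R v \<in> K"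
      then have "n \<bullet> (x + t *\<^sub>R v - x) \<in> L" unfolding L_def by blast
      then show False using that nv by simp
    qed
    have "(\<integral>t. 1 * (g (x + t *\<^sub>R v) \<bullet> v) \<partial>lborel) = - (\<Sum>t\<in>{}. F (x + t *\<^sub>R v) * (1 - 1))"
    proof (rule piecewise_constant_integral_by_parts[where K = L and C = 1])
      show "((\<lambda>t. F (x + t *\<^sub>R v)) has_real_derivative g (x + t *\<^sub>R v) \<bullet> v) (at t)" for t
      proof -
        have "((\<lambda>t. F (x + t *\<^sub>R v)) has_derivative (\<lambda>h. g (x + t *\<^sub>R v) \<bullet> (h *\<^sub>R v))) (at t)"
          by (rule has_derivative_compose[where f = "\<lambda>t. x + t *\<^sub>R v"])
             (use F in \<open>auto simp: C1_def intro!: derivative_eq_intros\<close>)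
        then show ?thesis by (simp add: has_field_derivative_def mult_commute_abs)
      qed
      show "continuous_on UNIV (\<lambda>t. g (x + t *\<^sub>R v) \<bullet> v)"
        by (rule continuous_on_compose2[OF cont]) (auto intro!: continuous_intros)
    qed (use \<open>compact L\<close> off K(2) g0 in \<open>auto intro: exI[of _ 1]\<close>)
    then show ?thesis by simp
  qed
  then show "(\<integral>x. g x \<bullet> v \<partial>lborel) = 0" using integral_slice[OF int nv, of 0] by simp
qed

lemma C1_inner: "C1 (\<lambda>x. c \<bullet> x) (\<lambda>x. c)"
  unfolding C1_def by (auto intro!: derivative_eq_intros)

text \<open>The preceding result for the product of \<open>\<phi>\<close> with the linear
  function.\<close>

lemma affine_integral_by_parts:
  fixes \<phi> :: "real^'n \<Rightarrow> real"
  assumes \<phi>: "C1 \<phi> g" and K: "compact K" "\<And>x. x \<notin> K \<Longrightarrow> \<phi> x = 0"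
  shows "(\<integral>x. (c \<bullet> x) * (g x \<bullet> axis j 1) \<partial>lborel) = - c $ j * (\<integral>x. \<phi> x \<partial>lborel)"
    "integrable lborel (\<lambda>x. (c \<bullet> x) * (g x \<bullet> axis j 1))" "integrable lborel \<phi>"
proof -
  have ax: "axis j (1::real) \<noteq> 0" by (simp add: axis_eq_0_iff)
  note D = C1_mult[OF C1_inner[of c] \<phi>]
  have int: "integrable lborel (\<lambda>x. ((c \<bullet> x) *\<^sub>R g x + \<phi> x *\<^sub>R c) \<bullet> axis j 1)"
    and zero: "(\<integral>x. ((c \<bullet> x) *\<^sub>R g x + \<phi> x *\<^sub>R c) \<bullet> axis j 1 \<partial>lborel) = 0"
    using integral_derivative_compact_support[OF D K(1) _ ax] K(2) by auto
  have "integrable lborel (\<lambda>x. indicator K x *\<^sub>R \<phi> x)"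
    using K(1) C1_continuous[OF \<phi>] by (intro borel_integrable_compact) (auto intro: continuous_on_subset)
  moreover have "(\<lambda>x. indicator K x *\<^sub>R \<phi> x) = \<phi>" using K(2) by (intro ext) (auto simp: indicator_def)
  ultimately show ip: "integrable lborel \<phi>" by simp
  have eq: "((c \<bullet> x) *\<^sub>R g x + \<phi> x *\<^sub>R c) \<bullet> axis j 1 = (c \<bullet> x) * (g x \<bullet> axis j 1) + \<phi> x * c $ j" for x
    by (simp add: inner_add_left inner_axis)
  have ic: "integrable lborel (\<lambda>x. \<phi> x * c $ j)" using ip by simp
  from Bochner_Integration.integrable_diff[OF int ic]
  show i1: "integrable lborel (\<lambda>x. (c \<bullet> x) * (g x \<bullet> axis j 1))" unfolding eq by simp
  show "(\<integral>x. (c \<bullet> x) * (g x \<bullet> axis j 1) \<partial>lborel) = - c $ j * (\<integral>x. \<phi> x \<partial>lborel)"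
    using zero unfolding eq
    by (simp add: Bochner_Integration.integral_add[OF i1 ic] eq_neg_iff_add_eq_0 mult.commute)
qed

section \<open>The unit cube and its faces\<close>

lemma mem_unit_cube: "x \<in> (unit_cube :: (real^'n) set) \<longleftrightarrow> (\<forall>i. \<bar>x $ i\<bar> < 1/2)"
proof -
  have "\<bar>x $ i\<bar> < 1/2 \<longleftrightarrow> - 1/2 < x $ i \<and> x $ i < 1/2" for i by linarith
  then show ?thesis unfolding unit_cube_def mem_box_cart by simp
qed

lemma unit_cubeD:
  assumes "x \<in> (unit_cube :: (real^'n) set)"
  shows "- (1/2) < x $ i" "x $ i < 1/2"
  using assms unfolding mem_unit_cube by (metis abs_less_iff minus_less_iff)+

lemma unit_cube_open: "open (unit_cube :: (real^'n) set)"
  unfolding unit_cube_def by (rule open_box)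

lemma unit_cube_borel [measurable]: "(unit_cube :: (real^'n) set) \<in> sets borel"
  by (rule borel_open[OF unit_cube_open])

lemma unit_cube_bounded: "bounded (unit_cube :: (real^'n) set)"
  unfolding unit_cube_def by (rule bounded_box)

lemma emeasure_unit_cube: "emeasure lborel (unit_cube :: (real^'n) set) = 1"
proof -
  have "emeasure lborel (unit_cube :: (real^'n) set)
      = ennreal (\<Prod>b\<in>Basis. ((\<chi> i. 1/2) - (\<chi> i. - 1/2) :: real^'n) \<bullet> b)"
    unfolding unit_cube_def
    by (rule emeasure_lborel_box) (auto simp: Basis_vec_def inner_axis)
  also have "(\<Prod>b\<in>Basis. ((\<chi> i. 1/2) - (\<chi> i. - 1/2) :: real^'n) \<bullet> b) = 1"
    by (intro prod.neutral) (auto simp: Basis_vec_def inner_axis)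
  finally show ?thesis by simp
qed

text \<open>The sign \<open>s = 1\<close> selects the face where coordinate \<open>j\<close> is
  \<open>-1/2\<close>, and \<open>s = -1\<close> the opposite one. For \<open>x\<close> in the cube
  this is the foot of the perpendicular to that face, and \<open>face_dist\<close> is its
  length.\<close>

definition face_point :: "'n \<Rightarrow> real \<Rightarrow> real^'n \<Rightarrow> real^'n" where
  "face_point j s x = (\<chi> i. if i = j then - s / 2 else x $ i)"

definition face_dist :: "'n \<Rightarrow> real \<Rightarrow> real^'n \<Rightarrow> real" where
  "face_dist j s x = 1/2 + s * x $ j"

lemma face_point_frontier:
  fixes x :: "real^'n"
  assumes "x \<in> unit_cube" "s = 1 \<or> s = -1"
  shows "face_point j s x \<in> frontier unit_cube"
proof -
  have "face_point j s x \<in> cbox (\<chi> i. - 1/2) (\<chi> i. 1/2)"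
  proof -
    have "- (1/2) \<le> x $ i" "x $ i \<le> 1/2" for i using unit_cubeD[OF assms(1), of i] by (simp_all add: less_imp_le)
    then show ?thesis using assms(2) by (auto simp: face_point_def mem_box_cart)
  qed
  moreover have "face_point j s x \<notin> unit_cube"
    using assms by (auto simp: face_point_def mem_unit_cube intro!: exI[of _ j])
  moreover have "box (\<chi> i. - 1/2) (\<chi> i. 1/2) \<noteq> ({} :: (real^'n) set)"
    using assms(1) by (auto simp: unit_cube_def)
  ultimately show ?thesis
    by (simp add: frontier_def unit_cube_def interior_open[OF open_box])
qed

text \<open>The cylinder over a null subset of a face is Lebesgue null, so a statement valid almost
  everywhere on the boundary holds at the foot of almost every point of the cube.\<close>

lemma face_null_cylinder:
  fixes N :: "(real^'n) set"
  assumes N: "N \<in> null_sets (hausdorff_measure (CARD('n) - 1))" and s: "s = 1 \<or> s = -1"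
  shows "AE x in lebesgue. x \<in> unit_cube \<longrightarrow> face_point j s x \<notin> N"
proof -
  define n :: "real^'n" where "n = s *\<^sub>R axis j 1"
  have n: "norm n = 1" using s by (auto simp: n_def norm_axis_1)
  have nx: "n \<bullet> x = s * x $ j" for x by (simp add: n_def inner_axis')
  have ss: "s * s = 1" using s by auto
  have NB [measurable]: "N \<in> sets borel" using N by (auto simp: null_sets_def)
  have "emeasure (hausdorff_measure (DIM(real^'n) - 1)) (N \<inter> hyper n (- 1/2)) \<le> emeasure (hausdorff_measure (DIM(real^'n) - 1)) N"
    by (rule emeasure_mono) auto
  then have "emeasure (hausdorff_measure (DIM(real^'n) - 1)) (N \<inter> hyper n (- 1/2)) = 0"
    using N by (simp add: null_sets_def)
  then have "emeasure lborel (cyl n (- 1/2) (N \<inter> hyper n (- 1/2))) = 0"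
    by (subst (asm) emeasure_hausdorff_hyper[OF n]) auto
  then have "cyl n (- 1/2) (N \<inter> hyper n (- 1/2)) \<in> null_sets lborel" by (auto simp: null_sets_def)
  then have "AE x in lborel. x \<notin> cyl n (- 1/2) (N \<inter> hyper n (- 1/2))" by (rule AE_not_in)
  then have "AE x in lborel. x \<in> unit_cube \<longrightarrow> face_point j s x \<notin> N"
  proof eventually_elim
    case (elim x)
    show ?case
    proof (intro impI notI)
      assume x: "x \<in> unit_cube" "face_point j s x \<in> N"
      have eq: "onto_hyper n (- 1/2) x = face_point j s x"
      proof -
        have "(- 1/2 - s * x $ j) * s = - s / 2 - x $ j" using ss by (simp add: algebra_simps)
        moreover have "n $ i = (if i = j then s else 0)" for i by (simp add: n_def axis_def)
        ultimately show ?thesis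
          by (simp add: onto_hyper_def nx face_point_def vec_eq_iff)
      qed
      have "x \<in> strip n (- 1/2)" using s unit_cubeD[OF x(1), of j] by (auto simp: strip_def nx)
      then show False using elim x(2) eq onto_hyper_in[OF n, of "- 1/2" x] by (simp add: cyl_def)
    qed
  qed
  then show ?thesis by (rule AE_completion)
qed

text \<open>A superlevel set of a maximal function restricted to small radii, taken at the foot
  point; so it depends only on the coordinates other than \<open>j\<close>. The strict inequality
  makes it open.\<close>

definition bad_set :: "(real^'n \<Rightarrow> real) \<Rightarrow> 'n \<Rightarrow> real \<Rightarrow> real \<Rightarrow> real \<Rightarrow> (real^'n) set" where
  "bad_set f j s \<beta> \<delta> = {x. \<exists>r. 0 < r \<and> r < \<delta> \<and> \<beta> * r ^ CARD('n) < (LINT y:ball (face_point j s x) r|lebesgue. f y)}"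

text \<open>By continuity from below a slightly smaller ball about \<open>z\<close> still exceeds
  \<open>c\<close>, and it is contained in the ball of radius \<open>r\<close> about every nearby
  centre.\<close>

lemma ball_integral_lsc:
  fixes f :: "'a::euclidean_space \<Rightarrow> real"
  assumes f: "integrable lebesgue f" "\<And>x. 0 \<le> f x" and c: "c < (LINT y:ball z r|lebesgue. f y)"
  shows "\<exists>d>0. \<forall>z'\<in>ball z d. c < (LINT y:ball z' r|lebesgue. f y)"
proof -
  have "(\<lambda>k. LINT y:ball z (r - 1 / real (Suc k))|lebesgue. f y) \<longlonglongrightarrow> (LINT y:ball z r|lebesgue. f y)"
    unfolding set_lebesgue_integral_def
  proof (rule integral_dominated_convergence[where w = "\<lambda>x. norm (f x)"])
    show "AE x in lebesgue. (\<lambda>k. indicator (ball z (r - 1 / real (Suc k))) x *\<^sub>R f x) \<longlonglongrightarrow> indicator (ball z r) x *\<^sub>R f x"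
    proof (rule AE_I2)
      fix x
      show "(\<lambda>k. indicator (ball z (r - 1 / real (Suc k))) x *\<^sub>R f x) \<longlonglongrightarrow> indicator (ball z r) x *\<^sub>R f x"
      proof (cases "x \<in> ball z r")
        case True
        have "(\<lambda>k. r - 1 / real (Suc k)) \<longlonglongrightarrow> r - 0" by (intro tendsto_intros LIMSEQ_Suc lim_1_over_n)
        then have "\<forall>\<^sub>F k in sequentially. dist z x < r - 1 / real (Suc k)"
          by (rule order_tendstoD) (use True in auto)
        then have "\<forall>\<^sub>F k in sequentially. indicator (ball z (r - 1 / real (Suc k))) x *\<^sub>R f x = indicator (ball z r) x *\<^sub>R f x"
          by eventually_elim (use True in auto)
        then show ?thesis by (rule tendsto_eventually)
      next
        case False
        then have "x \<notin> ball z (r - 1 / real (Suc k))" for k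
          by (auto simp: not_less) (smt (verit) divide_nonneg_nonneg of_nat_0_le_iff)
        then show ?thesis using False by simp
      qed
    qed
    show "(\<lambda>x. indicator (ball z r) x *\<^sub>R f x) \<in> borel_measurable lebesgue"
      "(\<lambda>x. indicator (ball z (r - 1 / real (Suc k))) x *\<^sub>R f x) \<in> borel_measurable lebesgue" for k
      using f by (auto intro!: borel_measurable_times borel_measurable_indicator simp del: mem_ball)
  qed (use f in \<open>auto simp: indicator_def\<close>)
  then have "\<forall>\<^sub>F k in sequentially. c < (LINT y:ball z (r - 1 / real (Suc k))|lebesgue. f y)"
    using c by (rule order_tendstoD)
  then obtain k where k: "c < (LINT y:ball z (r - 1 / real (Suc k))|lebesgue. f y)"
    by (auto simp: eventually_sequentially)
  show ?thesis
  proof (intro exI[of _ "1 / real (Suc k)"] conjI ballI)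
    fix z' assume z': "z' \<in> ball z (1 / real (Suc k))"
    have "ball z (r - 1 / real (Suc k)) \<subseteq> ball z' r"
    proof
      fix y assume "y \<in> ball z (r - 1 / real (Suc k))"
      then show "y \<in> ball z' r" using z' dist_triangle[of z' y z] by (simp add: dist_commute)
    qed
    then have "(LINT y:ball z (r - 1 / real (Suc k))|lebesgue. f y) \<le> (LINT y:ball z' r|lebesgue. f y)"
      unfolding set_lebesgue_integral_def
      by (intro integral_mono integrable_mult_indicator f) (use f in \<open>auto simp: indicator_def\<close>)
    then show "c < (LINT y:ball z' r|lebesgue. f y)" using k by simp
  qed simp
qed

lemma bad_set_open:
  fixes f :: "real^'n \<Rightarrow> real"
  assumes f: "integrable lebesgue f" "\<And>x. 0 \<le> f x"
  shows "open (bad_set f j s \<beta> \<delta>)"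
  unfolding open_contains_ball
proof
  fix x assume "x \<in> bad_set f j s \<beta> \<delta>"
  then obtain r where r: "0 < r" "r < \<delta>" "\<beta> * r ^ CARD('n) < (LINT y:ball (face_point j s x) r|lebesgue. f y)"
    by (auto simp: bad_set_def)
  obtain d where d: "d > 0" "\<forall>z'\<in>ball (face_point j s x) d. \<beta> * r ^ CARD('n) < (LINT y:ball z' r|lebesgue. f y)"
    using ball_integral_lsc[OF f r(3)] by blast
  have "dist (face_point j s x) (face_point j s y) \<le> dist x y" for y
    unfolding dist_vec_def L2_set_def face_point_def by (intro real_sqrt_le_mono sum_mono) auto
  then have "face_point j s y \<in> ball (face_point j s x) d" if "y \<in> ball x d" for y
    using that unfolding mem_ball by (meson le_less_trans)
  then have "ball x d \<subseteq> bad_set f j s \<beta> \<delta>"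
    using d(2) r(1,2) unfolding bad_set_def by blast
  then show "\<exists>e>0. ball x e \<subseteq> bad_set f j s \<beta> \<delta>" using d(1) by blast
qed

lemma face_point_cong: "(\<And>i. i \<noteq> j \<Longrightarrow> x $ i = z $ i) \<Longrightarrow> face_point j s x = face_point j s z"
  by (auto simp: face_point_def vec_eq_iff)

text \<open>The face is divided into \<open>p ^ (N - 1)\<close> cells of side \<open>1/p\<close>.
  What lies over one cell fits into a ball of radius \<open>\<rho>\<close> about the foot of any of
  its points, and a single point outside the bad set bounds the integral over that ball. Summing
  over the cells leaves one factor \<open>1/p\<close>, the order of the width of the layer.\<close>

lemma grid_estimate:
  fixes f :: "real^'n \<Rightarrow> real"
  assumes f: "integrable lebesgue f" "\<And>x. 0 \<le> f x" and s: "s = 1 \<or> s = -1"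
    and p: "0 < p" "(real CARD('n) + 2) / real p < \<delta>" and \<beta>: "0 \<le> \<beta>"
  shows "(LINT y:{y \<in> unit_cube - bad_set f j s \<beta> \<delta>. face_dist j s y < 2 / real p}|lebesgue. f y)
    \<le> \<beta> * (real CARD('n) + 2) ^ CARD('n) / real p"
proof -
  let ?N = "CARD('n)"
  \<comment> \<open>Coordinates other than \<open>j\<close> differ by at most \<open>1/p\<close>,
    coordinate \<open>j\<close> by at most \<open>2/p\<close>. These add up to
    \<open>(N + 1) / p\<close>, and one more unit gives strict containment in the ball.\<close>
  define \<rho> where "\<rho> = (real ?N + 2) / real p"
  define S where "S = {y \<in> unit_cube - bad_set f j s \<beta> \<delta>. face_dist j s y < 2 / real p}"
  define cell where "cell y = (\<lambda>i\<in>UNIV - {j}. nat \<lfloor>(y $ i + 1/2) * real p\<rfloor>)" for y :: "real^'n"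
  define I where "I = (UNIV - {j}) \<rightarrow>\<^sub>E {..<p}"
  define R where "R c = {y \<in> S. \<forall>i\<in>UNIV - {j}. \<lfloor>(y $ i + 1/2) * real p\<rfloor> = int (c i)}" for c
  have [measurable]: "bad_set f j s \<beta> \<delta> \<in> sets borel" using bad_set_open[OF f] by simp
  have SB [measurable]: "S \<in> sets borel"
  proof -
    have "{y \<in> space borel. y \<in> unit_cube \<and> y \<notin> bad_set f j s \<beta> \<delta> \<and> face_dist j s y < 2 / real p} \<in> sets borel"
      unfolding face_dist_def by measurable
    then show ?thesis by (simp add: S_def)
  qed
  have RB [measurable]: "R c \<in> sets borel" for c
  proof -
    have "{y \<in> space borel. y \<in> S \<and> (\<forall>i\<in>UNIV - {j}. \<lfloor>(y $ i + 1/2) * real p\<rfloor> = int (c i))} \<in> sets borel" by measurable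
    then show ?thesis by (simp add: R_def)
  qed
  have intm: "integrable lebesgue (\<lambda>x. indicator A x *\<^sub>R f x)" if "A \<in> sets borel" for A
    using that f(1) by (intro integrable_mult_indicator) auto
  have fin: "finite I" unfolding I_def by (intro finite_PiE) auto
  have cardI: "card I = p ^ (?N - 1)" unfolding I_def by (simp add: card_PiE)
  have rng: "0 \<le> \<lfloor>(y $ i + 1/2) * real p\<rfloor> \<and> \<lfloor>(y $ i + 1/2) * real p\<rfloor> < int p" if "y \<in> unit_cube" for y :: "real^'n" and i
  proof -
    have "\<bar>y $ i\<bar> < 1/2" using that by (simp add: mem_unit_cube)
    then have "0 \<le> (y $ i + 1/2) * real p" "(y $ i + 1/2) * real p < real p"
      using p(1) by (auto simp: abs_less_iff)
    then show ?thesis by (auto simp: floor_less_iff)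
  qed
  have cov: "S \<subseteq> (\<Union>c\<in>I. R c)"
  proof
    fix y assume y: "y \<in> S"
    then have yc: "y \<in> unit_cube" by (simp add: S_def)
    have "cell y \<in> I" unfolding cell_def I_def using rng[OF yc] by (auto simp: nat_less_iff)
    moreover have "y \<in> R (cell y)" unfolding R_def cell_def using y rng[OF yc] by auto
    ultimately show "y \<in> (\<Union>c\<in>I. R c)" by blast
  qed
  have cell_le: "(LINT y:R c|lebesgue. f y) \<le> \<beta> * \<rho> ^ ?N" for c
  proof (cases "R c = {}")
    case True
    then show ?thesis using \<beta> by (simp add: set_lebesgue_integral_def \<rho>_def)
  next
    case False
    then obtain z where z: "z \<in> R c" by blast
    then have zS: "z \<in> S" by (simp add: R_def)
    have "R c \<subseteq> ball (face_point j s z) \<rho>"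
    proof
      fix y assume y: "y \<in> R c"
      then have yS: "y \<in> S" by (simp add: R_def)
      have comp: "\<bar>(y - face_point j s z) $ i\<bar> \<le> (if i = j then 2 / real p else 1 / real p)" for i
      proof (cases "i = j")
        case True
        have "0 < face_dist j s y" "face_dist j s y < 2 / real p"
          using yS s unit_cubeD[of y j] by (auto simp: S_def face_dist_def)
        then show ?thesis using True s by (auto simp: face_point_def face_dist_def)
      next
        case False
        then have "\<lfloor>(y $ i + 1/2) * real p\<rfloor> = \<lfloor>(z $ i + 1/2) * real p\<rfloor>" using y z by (auto simp: R_def)
        then have "\<bar>(y $ i + 1/2) * real p - (z $ i + 1/2) * real p\<bar> < 1" by linarith
        moreover have "(y $ i + 1/2) * real p - (z $ i + 1/2) * real p = (y $ i - z $ i) * real p"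
          by (simp add: algebra_simps)
        ultimately have "\<bar>y $ i - z $ i\<bar> * real p < 1" by (simp add: abs_mult)
        then show ?thesis using False p(1) by (simp add: face_point_def field_simps)
      qed
      have "norm (y - face_point j s z) \<le> (\<Sum>i\<in>UNIV. \<bar>(y - face_point j s z) $ i\<bar>)" by (rule norm_le_l1_cart)
      also have "\<dots> \<le> (\<Sum>i\<in>UNIV. (if i = j then 2 / real p else 1 / real p))" by (intro sum_mono comp)
      also have "\<dots> \<le> (\<Sum>i\<in>UNIV. 1 / real p + (if i = j then 1 / real p else 0))"
        by (intro sum_mono) (auto simp: field_simps)
      also have "\<dots> = real ?N / real p + 1 / real p" by (subst sum.distrib) simp
      also have "\<dots> < \<rho>" using p(1) by (simp add: \<rho>_def field_simps)
      finally show "y \<in> ball (face_point j s z) \<rho>" by (simp add: dist_norm norm_minus_commute)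
    qed
    then have "(LINT y:R c|lebesgue. f y) \<le> (LINT y:ball (face_point j s z) \<rho>|lebesgue. f y)"
      unfolding set_lebesgue_integral_def
      by (intro integral_mono integrable_mult_indicator f) (use f in \<open>auto simp: indicator_def\<close>)
    also have "\<dots> \<le> \<beta> * \<rho> ^ ?N"
    proof -
      have "0 < \<rho>" "\<rho> < \<delta>" using p by (auto simp: \<rho>_def add_pos_pos)
      moreover have "z \<notin> bad_set f j s \<beta> \<delta>" using zS by (simp add: S_def)
      ultimately have "\<not> \<beta> * \<rho> ^ ?N < (LINT y:ball (face_point j s z) \<rho>|lebesgue. f y)"
        unfolding bad_set_def by blast
      then show ?thesis by simp
    qed
    finally show ?thesis .
  qed
  have "(LINT y:S|lebesgue. f y) \<le> (\<integral>y. (\<Sum>c\<in>I. indicator (R c) y *\<^sub>R f y) \<partial>lebesgue)"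
    unfolding set_lebesgue_integral_def
  proof (rule integral_mono)
    show "indicator S y *\<^sub>R f y \<le> (\<Sum>c\<in>I. indicator (R c) y *\<^sub>R f y)" for y
    proof (cases "y \<in> S")
      case True
      then obtain c where c: "c \<in> I" "y \<in> R c" using cov by blast
      have "f y = indicator (R c) y *\<^sub>R f y" using c by simp
      also have "\<dots> \<le> (\<Sum>c\<in>I. indicator (R c) y *\<^sub>R f y)"
        using c(1) fin f(2) by (intro member_le_sum) auto
      finally show ?thesis using True by simp
    next
      case False
      have "0 \<le> (\<Sum>c\<in>I. indicator (R c) y *\<^sub>R f y)" using f(2) by (intro sum_nonneg) auto
      then show ?thesis using False by simp
    qed
    show "integrable lebesgue (\<lambda>y. indicator S y *\<^sub>R f y)" by (rule intm[OF SB])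
    show "integrable lebesgue (\<lambda>y. \<Sum>c\<in>I. indicator (R c) y *\<^sub>R f y)"
      by (intro Bochner_Integration.integrable_sum intm[OF RB])
  qed
  also have "\<dots> = (\<Sum>c\<in>I. LINT y:R c|lebesgue. f y)"
    unfolding set_lebesgue_integral_def
    by (rule Bochner_Integration.integral_sum) (rule intm[OF RB])
  also have "\<dots> \<le> (\<Sum>c\<in>I. \<beta> * \<rho> ^ ?N)" by (intro sum_mono cell_le)
  also have "\<dots> = real p ^ (?N - 1) * (\<beta> * \<rho> ^ ?N)" by (simp add: cardI)
  also have "\<dots> = \<beta> * (real ?N + 2) ^ ?N / real p"
  proof -
    have "real p ^ ?N = real p ^ (?N - 1) * real p"
      by (metis One_nat_def Suc_pred zero_less_card_finite power_Suc2)
    then show ?thesis using p(1) by (simp add: \<rho>_def power_divide field_simps)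
  qed
  finally show ?thesis unfolding S_def .
qed

lemma continuous_of_derivative:
  assumes "\<And>t. (f has_real_derivative f' t) (at t)"
  shows "continuous_on UNIV f"
  by (intro continuous_at_imp_continuous_on ballI DERIV_isCont[OF assms])

locale cube_derivative =
  fixes u :: "real^'n \<Rightarrow> real^'n" and C :: "real^'n^'n" and M :: "(real^'n) measure" and \<sigma> :: "real^'n \<Rightarrow> real^'n^'n"
    and i j :: 'n
  assumes u_int: "set_integrable lebesgue unit_cube u"
    and fin: "finite_measure M" and setsM: "sets M = sets (restrict_space borel unit_cube)" and \<sigma>_int: "integrable M \<sigma>"
    and deriv: "\<And>\<phi>. \<phi> \<in> test_functions unit_cube \<Longrightarrow>
      (LINT x:unit_cube|lebesgue. u x $ i * frechet_derivative \<phi> (at x) (axis j 1)) = - (LINT x|M. \<phi> x * \<sigma> x $ i $ j)"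
    and trc: "has_trace unit_cube u (\<lambda>x. C *v x)"
begin

abbreviation Q :: "(real^'n) set" where "Q \<equiv> unit_cube"

definition v :: "real^'n \<Rightarrow> real" where "v x = u x $ i - C $ i \<bullet> x"
text \<open>With the boundary datum subtracted, the extension by zero should create no derivative on
  the boundary; the layer estimates make this precise.\<close>

definition g :: "real^'n \<Rightarrow> real" where "g x = indicator Q x * v x"
definition \<tau> :: "real^'n \<Rightarrow> real" where "\<tau> x = \<sigma> x $ i $ j"

lemma C_comp: "(C *v x) $ i = C $ i \<bullet> x"
  by (rule matrix_vector_mul_component)

lemma \<tau>_int: "integrable M \<tau>"
  unfolding \<tau>_def[abs_def] by (rule integrable_component[OF \<sigma>_int])

lemma Q_lebesgue_integrable_bounded:
  fixes h :: "real^'n \<Rightarrow> real"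
  assumes "h \<in> borel_measurable borel" "\<And>x. x \<in> Q \<Longrightarrow> \<bar>h x\<bar> \<le> c"
  shows "integrable lborel (\<lambda>x. indicator Q x * h x)"
proof (rule Bochner_Integration.integrable_bound)
  show "integrable lborel (\<lambda>x. c * indicator Q x)" by (simp add: emeasure_unit_cube)
  show "AE x in lborel. norm (indicator Q x * h x) \<le> norm (c * indicator Q x)"
    using assms(2) by (intro AE_I2) (fastforce simp: indicator_def)
qed (use assms(1) in measurable)

lemma inner_Q_bounded: "x \<in> Q \<Longrightarrow> \<bar>c \<bullet> x\<bar> \<le> norm c * real CARD('n)"
proof -
  assume x: "x \<in> Q"
  have "norm x \<le> (\<Sum>k\<in>UNIV. \<bar>x $ k\<bar>)" by (rule norm_le_l1_cart)
  also have "\<dots> \<le> (\<Sum>k\<in>(UNIV::'n set). 1)" 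
  proof (rule sum_mono)
    show "\<bar>x $ k\<bar> \<le> 1" for k using unit_cubeD[OF x, of k] by linarith
  qed
  finally have "norm x \<le> real CARD('n)" by simp
  then have "norm c * norm x \<le> norm c * real CARD('n)" by (intro mult_left_mono) auto
  then show ?thesis using Cauchy_Schwarz_ineq2[of c x] by linarith
qed

lemma g_int: "integrable lebesgue g"
proof -
  have bl: "bounded_linear (\<lambda>y::real^'n. y $ i)" by (rule bounded_linear_vec_nth)
  have 1: "integrable lebesgue (\<lambda>x. indicator Q x * u x $ i)"
    using integrable_bounded_linear[OF bl u_int[unfolded set_integrable_def]] by simp
  have "integrable lborel (\<lambda>x. indicator Q x * (C $ i \<bullet> x))"
    using inner_Q_bounded by (intro Q_lebesgue_integrable_bounded) auto
  then have "integrable lebesgue (\<lambda>x. indicator Q x * (C $ i \<bullet> x))" by (subst integrable_completion) auto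
  from Bochner_Integration.integrable_diff[OF 1 this] show ?thesis
    unfolding g_def[abs_def] v_def by (simp add: right_diff_distrib)
qed

text \<open>Subtracting the affine datum shifts the derivative by the constant density
  \<open>C $ i $ j\<close>.\<close>

lemma test_identity:
  assumes \<phi>: "C1 \<phi> G" and K: "compact K" "K \<subseteq> Q" "\<And>x. x \<notin> K \<Longrightarrow> \<phi> x = 0"
  shows "(\<integral>x. g x * (G x \<bullet> axis j 1) \<partial>lebesgue) = - (\<integral>x. \<phi> x * \<tau> x \<partial>M) + C $ i $ j * (\<integral>x. \<phi> x \<partial>lborel)"
proof -
  have G0: "G x = 0" if "x \<notin> K" for x using C1_zero_outside[OF \<phi> compact_imp_closed[OF K(1)] K(3) that] .
  have G0Q: "x \<notin> Q \<Longrightarrow> G x = 0" for x using G0 K(2) by blast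
  have cont: "continuous_on UNIV (\<lambda>x. G x \<bullet> axis j 1)" using \<phi> unfolding C1_def by (intro continuous_intros) auto
  have aff: "(\<integral>x. (C $ i \<bullet> x) * (G x \<bullet> axis j 1) \<partial>lborel) = - C $ i $ j * (\<integral>x. \<phi> x \<partial>lborel)"
    "integrable lborel (\<lambda>x. (C $ i \<bullet> x) * (G x \<bullet> axis j 1))"
    using affine_integral_by_parts[OF \<phi> K(1,3)] by auto
  have affl: "integrable lebesgue (\<lambda>x. (C $ i \<bullet> x) * (G x \<bullet> axis j 1))"
    using aff(2) by (subst integrable_completion) auto
  have bl: "bounded_linear (\<lambda>y::real^'n. y $ i)" by (rule bounded_linear_vec_nth)
  have u1: "integrable lebesgue (\<lambda>x. indicator Q x * u x $ i)"
    using integrable_bounded_linear[OF bl u_int[unfolded set_integrable_def]] by simp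
  obtain c where c: "\<And>x. \<bar>G x \<bullet> axis j 1\<bar> \<le> c"
  proof -
    have "compact ((\<lambda>x. G x \<bullet> axis j 1) ` K)"
      using K(1) cont by (intro compact_continuous_image) (auto intro: continuous_on_subset)
    then have "bounded ((\<lambda>x. G x \<bullet> axis j 1) ` K)" by (rule compact_imp_bounded)
    then obtain b where b: "b > 0" "\<forall>y\<in>(\<lambda>x. G x \<bullet> axis j 1) ` K. norm y \<le> b"
      unfolding bounded_pos by blast
    have "\<bar>G x \<bullet> axis j 1\<bar> \<le> b" for x
      using b G0[of x] by (cases "x \<in> K") auto
    then show ?thesis by (rule that)
  qed
  have Gm: "(\<lambda>x. G x \<bullet> axis j 1) \<in> borel_measurable lebesgue"
    using borel_measurable_continuous_onI[OF cont] by (intro measurable_completion) auto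
  have u2: "integrable lebesgue (\<lambda>x. (G x \<bullet> axis j 1) * (indicator Q x * u x $ i))"
  proof (rule Bochner_Integration.integrable_bound)
    show "integrable lebesgue (\<lambda>x. c * (indicator Q x * u x $ i))" using u1 by simp
    show "AE x in lebesgue. norm ((G x \<bullet> axis j 1) * (indicator Q x * u x $ i)) \<le> norm (c * (indicator Q x * u x $ i))"
      using c by (intro AE_I2) (auto simp: abs_mult intro!: mult_right_mono order_trans[OF c])
  qed (use Gm u1 in auto)
  have "(\<integral>x. (G x \<bullet> axis j 1) * (indicator Q x * u x $ i) \<partial>lebesgue) = - (\<integral>x. \<phi> x * \<tau> x \<partial>M)"
    using deriv[OF test_functionI[OF \<phi> K]]
    by (simp add: set_lebesgue_integral_def C1_frechet[OF \<phi>] \<tau>_def mult_ac)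
  moreover have "(\<integral>x. g x * (G x \<bullet> axis j 1) \<partial>lebesgue)
      = (\<integral>x. (G x \<bullet> axis j 1) * (indicator Q x * u x $ i) - (C $ i \<bullet> x) * (G x \<bullet> axis j 1) \<partial>lebesgue)"
    by (intro Bochner_Integration.integral_cong) (auto simp: g_def v_def indicator_def G0Q algebra_simps)
  moreover have "\<dots> = (\<integral>x. (G x \<bullet> axis j 1) * (indicator Q x * u x $ i) \<partial>lebesgue) - (\<integral>x. (C $ i \<bullet> x) * (G x \<bullet> axis j 1) \<partial>lebesgue)"
    using u2 affl by (rule Bochner_Integration.integral_diff)
  moreover have "(\<integral>x. (C $ i \<bullet> x) * (G x \<bullet> axis j 1) \<partial>lebesgue) = - C $ i $ j * (\<integral>x. \<phi> x \<partial>lborel)"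
    using aff by (subst integral_completion) auto
  ultimately show ?thesis by simp
qed

text \<open>Open unions of full lines in direction \<open>j\<close>. A cut-off depending only on the
  other coordinates localizes to such a set without adding a term to the derivative in direction
  \<open>j\<close>.\<close>

definition lateral :: "(real^'n) set \<Rightarrow> bool" where
  "lateral U \<longleftrightarrow> open U \<and> (\<forall>x z. (\<forall>k. k \<noteq> j \<longrightarrow> x $ k = z $ k) \<longrightarrow> x \<in> U \<longleftrightarrow> z \<in> U)"

lemma borel_M: "h \<in> borel_measurable borel \<Longrightarrow> h \<in> borel_measurable M"
  by (rule borel_measurable_restrict[OF setsM])

lemma space_M: "space M = Q"
  using sets_eq_imp_space_eq[OF setsM] by (simp add: space_restrict_space)

text \<open>The test functions are bumps independent of coordinate \<open>j\<close> times
  \<open>\<eta> (x $ j)\<close>, so only \<open>\<eta>\<close> is differentiated. The support of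
  \<open>\<eta>\<close> keeps a distance from the two faces, which makes the product admissible;
  dominated convergence replaces the bumps by the indicator of \<open>U\<close>.\<close>

lemma strip_identity:
  fixes \<eta> \<eta>' :: "real \<Rightarrow> real"
  assumes U: "lateral U" and d: "\<And>t. (\<eta> has_real_derivative \<eta>' t) (at t)" and cont: "continuous_on UNIV \<eta>'"
    and b: "\<And>t. \<bar>\<eta>' t\<bar> \<le> c" "\<And>t. \<bar>\<eta> t\<bar> \<le> 1" and lohi: "- 1/2 < lo" "hi < 1/2"
    and supp: "\<And>t. t \<notin> {lo..hi} \<Longrightarrow> \<eta> t = 0"
  shows "(\<integral>x. g x * (indicator U x * \<eta>' (x $ j)) \<partial>lebesgue)
    = - (\<integral>x. indicator U x * \<eta> (x $ j) * \<tau> x \<partial>M) + C $ i $ j * (\<integral>x. indicator Q x * (indicator U x * \<eta> (x $ j)) \<partial>lborel)"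
proof -
  have oU: "open (U \<inter> Q)" using U unit_cube_open by (auto simp: lateral_def)
  have UB [measurable]: "U \<in> sets borel" using U by (auto simp: lateral_def)
  obtain \<psi> G K where \<psi>: "\<And>m. C1 (\<psi> m) (G m)" "\<And>m x. G m x \<bullet> axis j 1 = 0"
      "\<And>m x. 0 \<le> \<psi> m x" "\<And>m x. \<psi> m x \<le> 1" "\<And>m. compact (K m)" "\<And>m. K m \<subseteq> U \<inter> Q"
      "\<And>m x. \<psi> m x \<noteq> 0 \<Longrightarrow> \<exists>z\<in>K m. \<forall>k\<in>UNIV - {j}. x $ k = z $ k"
      "\<And>x. (\<lambda>m. \<psi> m x) \<longlonglongrightarrow> (if \<exists>z\<in>U \<inter> Q. \<forall>k\<in>UNIV - {j}. x $ k = z $ k then 1 else 0)"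
    by (rule open_approx_bump[OF oU, of "UNIV - {j}" "axis j 1"]) (simp add: axis_def, rule that)
  \<comment> \<open>For \<open>x\<close> in the cube, sharing the other coordinates with a point of
    \<open>U \<inter> Q\<close> is the same as lying in \<open>U\<close>, because \<open>U\<close>
    is lateral.\<close>
  have lim: "(\<lambda>m. \<psi> m x) \<longlonglongrightarrow> indicator U x" if x: "x \<in> Q" for x
  proof -
    have "(\<exists>z\<in>U \<inter> Q. \<forall>k\<in>UNIV - {j}. x $ k = z $ k) \<longleftrightarrow> x \<in> U"
      using U x unfolding lateral_def by blast
    then show ?thesis using \<psi>(8)[of x] by (auto simp: indicator_def)
  qed
  note e = C1_linear[where h = \<eta> and h' = \<eta>' and a = "axis j (1::real) :: real^'n" and b = 0, OF d cont]
  define \<phi> where "\<phi> m x = \<psi> m x * \<eta> (x $ j)" for m x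
  define GG where "GG m x = \<psi> m x *\<^sub>R (\<eta>' (axis j 1 \<bullet> x + 0) *\<^sub>R axis j 1) + \<eta> (axis j 1 \<bullet> x + 0) *\<^sub>R G m x" for m and x :: "real^'n"
  have C1\<phi>: "C1 (\<phi> m) (GG m)" for m
    using C1_mult[OF \<psi>(1) e, of m] unfolding \<phi>_def[abs_def] GG_def[abs_def] by (simp add: inner_axis')
  have GGj: "GG m x \<bullet> axis j 1 = \<psi> m x * \<eta>' (x $ j)" for m x
    using \<psi>(2)[of m x] by (simp add: GG_def inner_add_left inner_axis' inner_axis)
  \<comment> \<open>The compact sets of the bumps with coordinate \<open>j\<close> replaced by the
    support interval of \<open>\<eta>\<close>.\<close>
  define K' where "K' m = (\<lambda>(z, t). \<chi> k. if k = j then t else z $ k) ` (K m \<times> {lo..hi})" for m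
  have cK: "compact (K' m)" for m
  proof -
    have "continuous_on (K m \<times> {lo..hi}) (\<lambda>(z, t). \<chi> k. if k = j then t else z $ k)"
      unfolding split_beta
    proof (rule continuous_on_vec_lambda)
      show "continuous_on (K m \<times> {lo..hi}) (\<lambda>x. if k = j then snd x else fst x $ k)" for k
        by (cases "k = j") (auto intro!: continuous_intros)
    qed
    then show ?thesis unfolding K'_def using \<psi>(5) by (intro compact_continuous_image compact_Times) auto
  qed
  have KQ: "K' m \<subseteq> Q" for m
  proof
    fix x assume "x \<in> K' m"
    then obtain z t where zt: "z \<in> K m" "lo \<le> t" "t \<le> hi" "x = (\<chi> k. if k = j then t else z $ k)"
      by (auto simp: K'_def)
    have "z \<in> Q" using \<psi>(6) zt(1) by blast
    then show "x \<in> Q" using lohi zt(2,3) unfolding zt(4) mem_unit_cube by auto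
  qed
  have off: "\<phi> m x = 0" if "x \<notin> K' m" for m x
  proof (rule ccontr)
    assume nz: "\<phi> m x \<noteq> 0"
    then obtain z where z: "z \<in> K m" "\<forall>k\<in>UNIV - {j}. x $ k = z $ k" using \<psi>(7)[of m x] by (auto simp: \<phi>_def)
    have "x $ j \<in> {lo..hi}" using nz supp by (auto simp: \<phi>_def)
    moreover have "x = (\<chi> k. if k = j then x $ j else z $ k)" using z(2) by (auto simp: vec_eq_iff)
    ultimately have "x \<in> K' m" unfolding K'_def using z(1) by (intro image_eqI[of _ _ "(z, x $ j)"]) auto
    then show False using that by simp
  qed
  have id: "(\<integral>x. g x * (\<psi> m x * \<eta>' (x $ j)) \<partial>lebesgue) = - (\<integral>x. \<phi> m x * \<tau> x \<partial>M) + C $ i $ j * (\<integral>x. \<phi> m x \<partial>lborel)" for m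
    using test_identity[OF C1\<phi> cK KQ off] unfolding GGj .
  have [measurable]: "\<psi> m \<in> borel_measurable borel" for m
    using C1_continuous[OF \<psi>(1)] by (rule borel_measurable_continuous_onI)
  have [measurable]: "\<eta>' \<in> borel_measurable borel" using cont by (rule borel_measurable_continuous_onI)
  have "continuous_on UNIV \<eta>" using d by (rule continuous_of_derivative)
  then have [measurable]: "\<eta> \<in> borel_measurable borel" by (rule borel_measurable_continuous_onI)
  have gm: "g \<in> borel_measurable lebesgue" using g_int by auto
  have leb: "h \<in> borel_measurable lebesgue" if "h \<in> borel_measurable borel" for h :: "real^'n \<Rightarrow> real"
    using that by (intro measurable_completion) auto
  have A: "(\<lambda>m. \<integral>x. g x * (\<psi> m x * \<eta>' (x $ j)) \<partial>lebesgue) \<longlonglongrightarrow> (\<integral>x. g x * (indicator U x * \<eta>' (x $ j)) \<partial>lebesgue)"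
  proof (rule integral_dominated_convergence[where w = "\<lambda>x. c * norm (g x)"])
    show "(\<lambda>x. g x * (indicator U x * \<eta>' (x $ j))) \<in> borel_measurable lebesgue"
      "(\<lambda>x. g x * (\<psi> m x * \<eta>' (x $ j))) \<in> borel_measurable lebesgue" for m
      by (intro borel_measurable_times gm leb; measurable)+
    show "integrable lebesgue (\<lambda>x. c * norm (g x))" using g_int by simp
    show "AE x in lebesgue. (\<lambda>m. g x * (\<psi> m x * \<eta>' (x $ j))) \<longlonglongrightarrow> g x * (indicator U x * \<eta>' (x $ j))"
    proof (rule AE_I2)
      fix x
      show "(\<lambda>m. g x * (\<psi> m x * \<eta>' (x $ j))) \<longlonglongrightarrow> g x * (indicator U x * \<eta>' (x $ j))"
      proof (cases "x \<in> Q")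
        case True
        then show ?thesis by (intro tendsto_intros lim)
      qed (simp add: g_def)
    qed
    show "AE x in lebesgue. norm (g x * (\<psi> m x * \<eta>' (x $ j))) \<le> c * norm (g x)" for m
    proof (rule AE_I2)
      fix x
      have "\<psi> m x * \<bar>\<eta>' (x $ j)\<bar> \<le> 1 * c" using \<psi>(3,4) b(1) by (intro mult_mono) auto
      then have "norm (g x) * (\<psi> m x * \<bar>\<eta>' (x $ j)\<bar>) \<le> norm (g x) * c" by (intro mult_left_mono) auto
      then show "norm (g x * (\<psi> m x * \<eta>' (x $ j))) \<le> c * norm (g x)" using \<psi>(3)[of m x] by (simp add: abs_mult mult_ac)
    qed
  qed
  have B: "(\<lambda>m. \<integral>x. \<phi> m x * \<tau> x \<partial>M) \<longlonglongrightarrow> (\<integral>x. indicator U x * \<eta> (x $ j) * \<tau> x \<partial>M)"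
  proof (rule integral_dominated_convergence[where w = "\<lambda>x. norm (\<tau> x)"])
    have tm: "\<tau> \<in> borel_measurable M" using \<tau>_int by auto
    show "(\<lambda>x. indicator U x * \<eta> (x $ j) * \<tau> x) \<in> borel_measurable M"
      "(\<lambda>x. \<phi> m x * \<tau> x) \<in> borel_measurable M" for m
      unfolding \<phi>_def by (intro borel_measurable_times[OF _ tm] borel_M; measurable)+
    show "integrable M (\<lambda>x. norm (\<tau> x))" using \<tau>_int by simp
    show "AE x in M. (\<lambda>m. \<phi> m x * \<tau> x) \<longlonglongrightarrow> indicator U x * \<eta> (x $ j) * \<tau> x"
      unfolding \<phi>_def by (intro AE_I2 tendsto_intros lim) (simp add: space_M)
    show "AE x in M. norm (\<phi> m x * \<tau> x) \<le> norm (\<tau> x)" for m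
    proof (rule AE_I2)
      fix x
      have "\<psi> m x * \<bar>\<eta> (x $ j)\<bar> \<le> 1 * 1" using \<psi>(3,4) b(2) by (intro mult_mono) auto
      then show "norm (\<phi> m x * \<tau> x) \<le> norm (\<tau> x)"
        using \<psi>(3)[of m x] by (simp add: \<phi>_def abs_mult mult_left_le_one_le)
    qed
  qed
  have phiQ: "\<phi> m x = indicator Q x * (\<psi> m x * \<eta> (x $ j))" for m x
    using off[of x m] KQ[of m] by (cases "x \<in> Q") (auto simp: \<phi>_def)
  have D: "(\<lambda>m. \<integral>x. \<phi> m x \<partial>lborel) \<longlonglongrightarrow> (\<integral>x. indicator Q x * (indicator U x * \<eta> (x $ j)) \<partial>lborel)"
    unfolding phiQ
  proof (rule integral_dominated_convergence[where w = "indicator Q"])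
    show "integrable lborel (indicator Q :: real^'n \<Rightarrow> real)" by (simp add: emeasure_unit_cube)
    show "AE x in lborel. (\<lambda>m. indicator Q x * (\<psi> m x * \<eta> (x $ j))) \<longlonglongrightarrow> indicator Q x * (indicator U x * \<eta> (x $ j))"
    proof (rule AE_I2)
      fix x
      show "(\<lambda>m. indicator Q x * (\<psi> m x * \<eta> (x $ j))) \<longlonglongrightarrow> indicator Q x * (indicator U x * \<eta> (x $ j))"
      proof (cases "x \<in> Q")
        case True
        then show ?thesis by (intro tendsto_intros lim)
      qed simp
    qed
    show "AE x in lborel. norm (indicator Q x * (\<psi> m x * \<eta> (x $ j))) \<le> indicator Q x" for m
    proof (rule AE_I2)
      fix x
      have "\<psi> m x * \<bar>\<eta> (x $ j)\<bar> \<le> 1 * 1" using \<psi>(3,4) b(2) by (intro mult_mono) auto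
      then show "norm (indicator Q x * (\<psi> m x * \<eta> (x $ j))) \<le> indicator Q x"
        using \<psi>(3)[of m x] by (auto simp: indicator_def abs_mult)
    qed
  qed measurable
  show ?thesis
    using LIMSEQ_unique[OF A] tendsto_add[OF tendsto_minus[OF B] tendsto_mult_left[OF D, of "C $ i $ j"]]
    unfolding id by blast
qed

end

section \<open>Boundary layers and the vanishing flux through a face\<close>

context cube_derivative begin

text \<open>A weighted integral of \<open>g\<close> over the points of \<open>U\<close> at distance
  between \<open>\<epsilon>\<close> and \<open>2 * \<epsilon>\<close> from a face; the weight is the
  derivative of a cut-off that switches on there. It approximates the flux of \<open>g\<close>
  through the face.\<close>

definition layer :: "real \<Rightarrow> real \<Rightarrow> (real^'n) set \<Rightarrow> real" where
  "layer \<epsilon> s U = (\<integral>x. g x * (indicator U x * (sstep' (face_dist j s x / \<epsilon> - 1) / \<epsilon>)) \<partial>lebesgue)"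

definition near :: "real \<Rightarrow> real \<Rightarrow> (real^'n) set" where
  "near s a = {x. face_dist j s x \<le> a}"

lemma near_borel [measurable]: "near s a \<in> sets borel"
proof -
  have "{x \<in> space borel. face_dist j s x \<le> a} \<in> sets borel" unfolding face_dist_def by measurable
  then show ?thesis by (simp add: near_def)
qed

text \<open>An upper bound for the variation, close to the face, of the derivative of
  \<open>g\<close> in direction \<open>j\<close>.\<close>

definition mass :: "real \<Rightarrow> real \<Rightarrow> real" where
  "mass s a = (\<integral>x. indicator (near s a) x * \<bar>\<tau> x\<bar> \<partial>M) + \<bar>C $ i $ j\<bar> * (\<integral>x. indicator Q x * indicator (near s a) x \<partial>lborel)"

lemma face_dist_pos: "x \<in> Q \<Longrightarrow> s = 1 \<or> s = -1 \<Longrightarrow> 0 < face_dist j s x"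
  using unit_cubeD[of x j] by (auto simp: face_dist_def)

lemma sstep_scaled_deriv:
  assumes "\<epsilon> \<noteq> 0"
  shows "((\<lambda>t. sstep ((1/2 + s * t) / \<epsilon> - 1)) has_real_derivative s * (sstep' ((1/2 + s * t) / \<epsilon> - 1) / \<epsilon>)) (at t)"
proof -
  have "((\<lambda>t. sstep ((1/2 + s * t) / \<epsilon> - 1)) has_real_derivative sstep' ((1/2 + s * t) / \<epsilon> - 1) * (s / \<epsilon>)) (at t)"
    by (rule DERIV_chain2[OF sstep_deriv]) (use assms in \<open>auto intro!: derivative_eq_intros\<close>)
  then show ?thesis by (simp add: mult.commute)
qed

lemma sstep'_scaled_continuous: "continuous_on UNIV (\<lambda>t. s * (sstep' ((1/2 + s * t) / \<epsilon> - 1) / \<epsilon>))"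
proof (cases "\<epsilon> = 0")
  case False
  have "continuous_on UNIV (\<lambda>t. sstep' ((1/2 + s * t) / \<epsilon> - 1))"
    by (rule continuous_on_compose2[OF sstep'_continuous]) (use False in \<open>auto intro!: continuous_intros\<close>)
  then show ?thesis using False by (intro continuous_intros) auto
qed simp

lemma sstep'_borel [measurable]: "sstep' \<in> borel_measurable borel"
  by (rule borel_measurable_continuous_onI[OF sstep'_continuous])

lemma layer_integrable:
  assumes [measurable]: "U \<in> sets borel"
  shows "integrable lebesgue (\<lambda>x. g x * (indicator U x * (sstep' (face_dist j s x / \<epsilon> - 1) / \<epsilon>)))"
proof -
  obtain c where c: "0 < c" "\<And>t. \<bar>sstep' t\<bar> \<le> c" using sstep'_bounded by blast
  show ?thesis
  proof (rule Bochner_Integration.integrable_bound)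
    show "integrable lebesgue (\<lambda>x. c / \<bar>\<epsilon>\<bar> * g x)" using g_int by simp
    have "(\<lambda>x. indicator U x * (sstep' (face_dist j s x / \<epsilon> - 1) / \<epsilon>)) \<in> borel_measurable borel"
      unfolding face_dist_def by measurable
    then have h: "(\<lambda>x. indicator U x * (sstep' (face_dist j s x / \<epsilon> - 1) / \<epsilon>)) \<in> borel_measurable lebesgue"
      by (intro measurable_completion) auto
    show "(\<lambda>x. g x * (indicator U x * (sstep' (face_dist j s x / \<epsilon> - 1) / \<epsilon>))) \<in> borel_measurable lebesgue"
      by (rule borel_measurable_times[OF _ h]) (use g_int in auto)
    show "AE x in lebesgue. norm (g x * (indicator U x * (sstep' (face_dist j s x / \<epsilon> - 1) / \<epsilon>))) \<le> norm (c / \<bar>\<epsilon>\<bar> * g x)"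
    proof (rule AE_I2)
      fix x
      have "\<bar>sstep' (face_dist j s x / \<epsilon> - 1) / \<epsilon>\<bar> \<le> c / \<bar>\<epsilon>\<bar>" using c(2) by (simp add: divide_right_mono)
      then have "\<bar>indicator U x * (sstep' (face_dist j s x / \<epsilon> - 1) / \<epsilon>)\<bar> \<le> c / \<bar>\<epsilon>\<bar>"
        using c(1) by (auto simp: indicator_def)
      then have "\<bar>g x\<bar> * \<bar>indicator U x * (sstep' (face_dist j s x / \<epsilon> - 1) / \<epsilon>)\<bar> \<le> \<bar>g x\<bar> * (c / \<bar>\<epsilon>\<bar>)"
        by (intro mult_left_mono) auto
      then show "norm (g x * (indicator U x * (sstep' (face_dist j s x / \<epsilon> - 1) / \<epsilon>))) \<le> norm (c / \<bar>\<epsilon>\<bar> * g x)"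
        using c(1) by (simp add: abs_mult mult_ac)
    qed
  qed
qed

text \<open>Tests with the difference of the cut-offs at the two scales. It vanishes up to the
  distance \<open>\<epsilon>\<close> and from \<open>2 * a\<close> on, so the change is paid for by
  the derivative in the near region, with a bound independent of \<open>U\<close>.\<close>

lemma layer_compare:
  assumes U: "lateral U" and s: "s = 1 \<or> s = -1" and \<epsilon>: "0 < \<epsilon>" "\<epsilon> \<le> a" "a \<le> 1/8"
  shows "\<bar>layer \<epsilon> s U - layer a s U\<bar> \<le> mass s (2 * a)"
proof -
  have UB [measurable]: "U \<in> sets borel" using U by (auto simp: lateral_def)
  obtain c where c: "0 < c" "\<And>t. \<bar>sstep' t\<bar> \<le> c" using sstep'_bounded by blast
  have a0: "0 < a" using \<epsilon> by simp
  define \<eta> where "\<eta> t = sstep ((1/2 + s * t) / \<epsilon> - 1) - sstep ((1/2 + s * t) / a - 1)" for t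
  define \<eta>' where "\<eta>' t = s * (sstep' ((1/2 + s * t) / \<epsilon> - 1) / \<epsilon>) - s * (sstep' ((1/2 + s * t) / a - 1) / a)" for t
  define lo where "lo = (if s = 1 then \<epsilon> - 1/2 else 1/2 - 2 * a)"
  define hi where "hi = (if s = 1 then 2 * a - 1/2 else 1/2 - \<epsilon>)"
  have \<eta>0: "\<eta> t = 0" if "1/2 + s * t \<le> \<epsilon> \<or> 2 * a \<le> 1/2 + s * t" for t
    using that
  proof
    assume "1/2 + s * t \<le> \<epsilon>"
    then have "(1/2 + s * t) / \<epsilon> \<le> 1" "(1/2 + s * t) / a \<le> 1" using \<epsilon> a0 by (simp_all add: divide_le_eq_1)
    then show ?thesis by (simp add: \<eta>_def sstep_eq_0)
  next
    assume le: "2 * a \<le> 1/2 + s * t"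
    then have "2 * \<epsilon> \<le> 1/2 + s * t" using \<epsilon> by linarith
    then have "2 \<le> (1/2 + s * t) / \<epsilon>" "2 \<le> (1/2 + s * t) / a" using \<epsilon>(1) a0 le by (simp_all only: pos_le_divide_eq)
    then show ?thesis by (simp add: \<eta>_def sstep_eq_1)
  qed
  have \<eta>1: "\<bar>\<eta> t\<bar> \<le> 1" for t
    using sstep_bounds[of "(1/2 + s * t) / \<epsilon> - 1"] sstep_bounds[of "(1/2 + s * t) / a - 1"] unfolding \<eta>_def by linarith
  have id: "(\<integral>x. g x * (indicator U x * \<eta>' (x $ j)) \<partial>lebesgue)
    = - (\<integral>x. indicator U x * \<eta> (x $ j) * \<tau> x \<partial>M) + C $ i $ j * (\<integral>x. indicator Q x * (indicator U x * \<eta> (x $ j)) \<partial>lborel)"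
  proof (rule strip_identity[OF U])
    show "(\<eta> has_real_derivative \<eta>' t) (at t)" for t
      unfolding \<eta>_def[abs_def] \<eta>'_def using \<epsilon> a0 by (intro DERIV_diff sstep_scaled_deriv) auto
    show "continuous_on UNIV \<eta>'"
      unfolding \<eta>'_def[abs_def] by (intro continuous_on_diff sstep'_scaled_continuous)
    show "\<bar>\<eta>' t\<bar> \<le> c / \<epsilon> + c / a" for t
    proof -
      have "\<bar>s * (sstep' ((1/2 + s * t) / e - 1) / e)\<bar> \<le> c / e" if "0 < e" for e
        using s c(2) that by (auto simp: abs_mult divide_right_mono)
      from this[OF \<epsilon>(1)] this[OF a0] show ?thesis unfolding \<eta>'_def by linarith
    qed
    show "\<eta> t = 0" if "t \<notin> {lo..hi}" for t
      using that s by (intro \<eta>0) (auto simp: lo_def hi_def not_le)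
  qed (use s \<epsilon> a0 \<eta>1 in \<open>auto simp: lo_def hi_def\<close>)
  have LHS: "(\<integral>x. g x * (indicator U x * \<eta>' (x $ j)) \<partial>lebesgue) = s * (layer \<epsilon> s U - layer a s U)"
    unfolding layer_def Bochner_Integration.integral_diff[OF layer_integrable[OF UB] layer_integrable[OF UB], symmetric]
      integral_mult_right_zero[symmetric]
    by (intro Bochner_Integration.integral_cong) (auto simp: \<eta>'_def face_dist_def algebra_simps)
  have nr: "\<bar>indicator U x * \<eta> (x $ j)\<bar> \<le> indicator (near s (2 * a)) x" for x
  proof (cases "x \<in> near s (2 * a)")
    case True
    then show ?thesis using \<eta>1[of "x $ j"] by (auto simp: indicator_def)
  next
    case False
    then have "2 * a \<le> 1/2 + s * x $ j" by (simp add: near_def face_dist_def)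
    then show ?thesis using \<eta>0[of "x $ j"] by simp
  qed
  have cont\<eta>: "continuous_on UNIV \<eta>"
  proof -
    have "(\<eta> has_real_derivative \<eta>' t) (at t)" for t
      unfolding \<eta>_def[abs_def] \<eta>'_def using \<epsilon> a0 by (intro DERIV_diff sstep_scaled_deriv) auto
    then show ?thesis by (rule continuous_of_derivative)
  qed
  then have [measurable]: "\<eta> \<in> borel_measurable borel" by (rule borel_measurable_continuous_onI)
  have "\<bar>\<integral>x. indicator U x * \<eta> (x $ j) * \<tau> x \<partial>M\<bar> \<le> (\<integral>x. indicator (near s (2 * a)) x * \<bar>\<tau> x\<bar> \<partial>M)"
  proof -
    have nm: "near s (2 * a) \<inter> Q \<in> sets M" using sets_restrict_borel[OF setsM unit_cube_borel] by auto
    have int: "integrable M (\<lambda>x. indicator (near s (2 * a)) x * \<bar>\<tau> x\<bar>)"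
    proof -
      have "integrable M (\<lambda>x. indicator (near s (2 * a) \<inter> Q) x *\<^sub>R \<bar>\<tau> x\<bar>)"
        using nm \<tau>_int by (intro integrable_mult_indicator integrable_abs) auto
      then show ?thesis
        by (rule Bochner_Integration.integrable_cong[THEN iffD1, rotated -1]) (auto simp: space_M indicator_def)
    qed
    have "norm (\<integral>x. indicator U x * \<eta> (x $ j) * \<tau> x \<partial>M) \<le> (\<integral>x. indicator (near s (2 * a)) x * \<bar>\<tau> x\<bar> \<partial>M)"
    proof (rule Bochner_Integration.integral_norm_bound_integral[OF _ int])
      show "norm (indicator U x * \<eta> (x $ j) * \<tau> x) \<le> indicator (near s (2 * a)) x * \<bar>\<tau> x\<bar>" for x
        using mult_right_mono[OF nr[of x], of "\<bar>\<tau> x\<bar>"] by (simp add: abs_mult)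
      then show "integrable M (\<lambda>x. indicator U x * \<eta> (x $ j) * \<tau> x)"
        by (intro Bochner_Integration.integrable_bound[OF int] borel_measurable_times[OF borel_M] AE_I2)
           (use \<tau>_int in \<open>auto intro: order_trans\<close>)
    qed
    then show ?thesis by simp
  qed
  moreover have "\<bar>\<integral>x. indicator Q x * (indicator U x * \<eta> (x $ j)) \<partial>lborel\<bar> \<le> (\<integral>x. indicator Q x * indicator (near s (2 * a)) x \<partial>lborel)"
  proof -
    have 1: "integrable lborel (\<lambda>x. indicator Q x * indicator (near s (2 * a)) x :: real)"
      by (rule Q_lebesgue_integrable_bounded[where c = 1]) (auto simp: indicator_def)
    have 2: "integrable lborel (\<lambda>x. indicator Q x * (indicator U x * \<eta> (x $ j)))"
      by (rule Q_lebesgue_integrable_bounded[where c = 1])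
         (measurable, use \<eta>1 in \<open>auto simp: indicator_def\<close>)
    have "norm (\<integral>x. indicator Q x * (indicator U x * \<eta> (x $ j)) \<partial>lborel) \<le> (\<integral>x. indicator Q x * indicator (near s (2 * a)) x \<partial>lborel)"
    proof (rule Bochner_Integration.integral_norm_bound_integral[OF 2 1])
      show "norm (indicator Q x * (indicator U x * \<eta> (x $ j))) \<le> indicator Q x * indicator (near s (2 * a)) x" for x
        using mult_left_mono[OF nr[of x], of "indicator Q x"] by (simp add: abs_mult)
    qed
    then show ?thesis by simp
  qed
  then have "\<bar>C $ i $ j * (\<integral>x. indicator Q x * (indicator U x * \<eta> (x $ j)) \<partial>lborel)\<bar>
      \<le> \<bar>C $ i $ j\<bar> * (\<integral>x. indicator Q x * indicator (near s (2 * a)) x \<partial>lborel)"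
    by (simp add: abs_mult mult_left_mono)
  ultimately have "\<bar>s * (layer \<epsilon> s U - layer a s U)\<bar> \<le> mass s (2 * a)"
    using id unfolding LHS mass_def by linarith
  then show ?thesis using s by (auto simp: abs_mult)
qed

text \<open>All points of the open cube have positive distance from the face, so the near regions
  shrink to the empty set there; dominated convergence applies to both integrals.\<close>

lemma mass_tendsto: "s = 1 \<or> s = -1 \<Longrightarrow> (\<lambda>k. mass s (2 / real (Suc k))) \<longlonglongrightarrow> 0"
proof -
  assume s: "s = 1 \<or> s = -1"
  have ind: "(\<lambda>k. indicator (near s (2 / real (Suc k))) x :: real) \<longlonglongrightarrow> 0" if x: "x \<in> Q" for x
  proof -
    have "(\<lambda>k. 2 * (1 / real (Suc k))) \<longlonglongrightarrow> 2 * 0" by (intro tendsto_intros LIMSEQ_Suc lim_1_over_n)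
    then have "(\<lambda>k. 2 / real (Suc k)) \<longlonglongrightarrow> 0" by simp
    then have "\<forall>\<^sub>F k in sequentially. 2 / real (Suc k) < face_dist j s x"
      by (rule order_tendstoD) (rule face_dist_pos[OF x s])
    then have "\<forall>\<^sub>F k in sequentially. indicator (near s (2 / real (Suc k))) x = (0::real)"
      by eventually_elim (auto simp: near_def indicator_def)
    then show ?thesis by (rule tendsto_eventually)
  qed
  have "(\<lambda>k. \<integral>x. indicator (near s (2 / real (Suc k))) x * \<bar>\<tau> x\<bar> \<partial>M) \<longlonglongrightarrow> (\<integral>x. 0 \<partial>M)"
  proof (rule integral_dominated_convergence[where w = "\<lambda>x. \<bar>\<tau> x\<bar>"])
    show "(\<lambda>x. indicator (near s (2 / real (Suc k))) x * \<bar>\<tau> x\<bar>) \<in> borel_measurable M" for k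
    proof -
      have [measurable]: "\<tau> \<in> borel_measurable M" using \<tau>_int by auto
      show ?thesis by (intro borel_measurable_times[OF borel_M]; measurable)
    qed
    show "AE x in M. (\<lambda>k. indicator (near s (2 / real (Suc k))) x * \<bar>\<tau> x\<bar>) \<longlonglongrightarrow> 0"
      using ind by (intro AE_I2 tendsto_mult_left_zero) (auto simp: space_M)
  qed (use \<tau>_int in \<open>auto simp: indicator_def\<close>)
  moreover have "(\<lambda>k. \<integral>x. indicat_real Q x * indicator (near s (2 / real (Suc k))) x \<partial>lborel) \<longlonglongrightarrow> (\<integral>x. 0 \<partial>(lborel :: (real^'n) measure))"
  proof (rule integral_dominated_convergence[where w = "indicator Q"])
    show "integrable lborel (indicator Q :: real^'n \<Rightarrow> real)" by (simp add: emeasure_unit_cube)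
    show "AE x in lborel. (\<lambda>k. indicator Q x * indicator (near s (2 / real (Suc k))) x :: real) \<longlonglongrightarrow> 0"
    proof (rule AE_I2)
      fix x
      show "(\<lambda>k. indicator Q x * indicator (near s (2 / real (Suc k))) x :: real) \<longlonglongrightarrow> 0"
        using ind[of x] by (cases "x \<in> Q") auto
    qed
  qed (auto simp: indicator_def)
  ultimately have "(\<lambda>k. mass s (2 / real (Suc k))) \<longlonglongrightarrow> 0 + \<bar>C $ i $ j\<bar> * 0"
    unfolding mass_def by (intro tendsto_intros) simp_all
  then show ?thesis by simp
qed

text \<open>Almost every foot point is a trace point, where small balls have small means of
  \<open>g\<close>; its points leave the bad set once the radii are small. Dominated convergence
  turns this into smallness of the integral over the bad set.\<close>

lemma bad_set_vanishes:
  assumes s: "s = 1 \<or> s = -1" and \<beta>: "0 < \<beta>"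
  shows "(\<lambda>k. \<integral>x. indicator (bad_set (\<lambda>x. \<bar>g x\<bar>) j s \<beta> (1 / real (Suc k))) x * \<bar>g x\<bar> \<partial>lebesgue) \<longlonglongrightarrow> 0"
proof -
  let ?N = "CARD('n)"
  let ?bad = "\<lambda>k. bad_set (\<lambda>x. \<bar>g x\<bar>) j s \<beta> (1 / real (Suc k))"
  have fi: "integrable lebesgue (\<lambda>x. \<bar>g x\<bar>)" using g_int by simp
  have badB: "?bad k \<in> sets borel" for k using bad_set_open[OF fi] by simp
  obtain N where N: "N \<in> null_sets (hausdorff_measure (?N - 1))"
    "\<And>z. z \<notin> N \<Longrightarrow> z \<in> frontier Q \<Longrightarrow>
        ((\<lambda>r. (LINT y:Q \<inter> ball z r|lebesgue. norm (u y - C *v z)) / r ^ ?N) \<longlongrightarrow> 0) (at_right 0)"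
    using trc unfolding has_trace_def by (auto elim!: AE_E3)
  have good: "\<exists>k0. \<forall>k\<ge>k0. x \<notin> ?bad k" if x: "x \<in> Q" "face_point j s x \<notin> N" for x
  proof -
    define z where "z = face_point j s x"
    define c where "c = unit_ball_vol (real ?N)"
    \<comment> \<open>The trace quotient controls \<open>u y - C *v z\<close>. Replacing the datum
      at \<open>z\<close> by the one at \<open>y\<close> costs at most
      \<open>norm (C $ i) * r\<close> per point, and \<open>c\<close> is the volume of the unit
      ball.\<close>
    have lim: "((\<lambda>r. (LINT y:Q \<inter> ball z r|lebesgue. norm (u y - C *v z)) / r ^ ?N + norm (C $ i) * r * c) \<longlongrightarrow> 0 + norm (C $ i) * 0 * c) (at_right 0)"
      using N(2)[of z] x face_point_frontier[OF x(1) s, of j] by (intro tendsto_intros) (auto simp: z_def)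
    then have "\<forall>\<^sub>F r in at_right 0. (LINT y:Q \<inter> ball z r|lebesgue. norm (u y - C *v z)) / r ^ ?N + norm (C $ i) * r * c < \<beta>"
      by (rule order_tendstoD) (use \<beta> in simp)
    then obtain r0 where r0: "r0 > 0" "\<And>r. 0 < r \<Longrightarrow> r < r0 \<Longrightarrow>
        (LINT y:Q \<inter> ball z r|lebesgue. norm (u y - C *v z)) / r ^ ?N + norm (C $ i) * r * c < \<beta>"
      unfolding eventually_at_right_field by blast
    have le: "(LINT y:ball z r|lebesgue. \<bar>g y\<bar>) \<le> \<beta> * r ^ ?N" if r: "0 < r" "r < r0" for r
    proof -
      have ub: "set_integrable lebesgue (Q \<inter> ball z r) (\<lambda>y. norm (u y - C *v z))"
      proof -
        have 1: "set_integrable lebesgue (Q \<inter> ball z r) u"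
          by (rule set_integrable_subset[OF u_int]) auto
        have "Q \<inter> ball z r \<in> lmeasurable" by (intro bounded_set_imp_lmeasurable bounded_Int) (auto simp: unit_cube_bounded)
        then have 2: "set_integrable lebesgue (Q \<inter> ball z r) (\<lambda>y. C *v z)"
          unfolding set_integrable_def by (auto simp: fmeasurable_def)
        show ?thesis by (rule set_integrable_norm[OF set_integral_diff(1)[OF 1 2]])
      qed
      have cb: "integrable lebesgue (\<lambda>y. norm (C $ i) * r * indicator (ball z r) y)"
        using emeasure_lborel_ball_finite[of z r] by (intro integrable_mult_right integrable_real_indicator) auto
      have "(LINT y:ball z r|lebesgue. \<bar>g y\<bar>)
          \<le> (\<integral>y. indicator (Q \<inter> ball z r) y *\<^sub>R norm (u y - C *v z) + norm (C $ i) * r * indicator (ball z r) y \<partial>lebesgue)"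
        unfolding set_lebesgue_integral_def
      proof (rule integral_mono)
        show "integrable lebesgue (\<lambda>y. indicator (ball z r) y *\<^sub>R \<bar>g y\<bar>)"
          using fi by (intro integrable_mult_indicator) auto
        show "integrable lebesgue (\<lambda>y. indicator (Q \<inter> ball z r) y *\<^sub>R norm (u y - C *v z) + norm (C $ i) * r * indicator (ball z r) y)"
          using ub cb unfolding set_integrable_def by (rule Bochner_Integration.integrable_add)
        fix y
        show "indicator (ball z r) y *\<^sub>R \<bar>g y\<bar>
            \<le> indicator (Q \<inter> ball z r) y *\<^sub>R norm (u y - C *v z) + norm (C $ i) * r * indicator (ball z r) y"
        proof (cases "y \<in> Q \<inter> ball z r")
          case True
          have "v y = (u y - C *v z) $ i - C $ i \<bullet> (y - z)" by (simp add: v_def C_comp inner_diff_right)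
          then have "\<bar>v y\<bar> \<le> \<bar>(u y - C *v z) $ i\<bar> + \<bar>C $ i \<bullet> (y - z)\<bar>" by linarith
          also have "\<bar>(u y - C *v z) $ i\<bar> \<le> norm (u y - C *v z)" by (rule component_le_norm_cart)
          also have "\<bar>C $ i \<bullet> (y - z)\<bar> \<le> norm (C $ i) * norm (y - z)" by (rule Cauchy_Schwarz_ineq2)
          also have "\<dots> \<le> norm (C $ i) * r" using True by (intro mult_left_mono) (auto simp: dist_norm norm_minus_commute)
          finally show ?thesis using True by (simp add: g_def)
        next
          case False
          then show ?thesis using r(1) by (auto simp: g_def indicator_def)
        qed
      qed
      also have "\<dots> = (LINT y:Q \<inter> ball z r|lebesgue. norm (u y - C *v z)) + norm (C $ i) * r * (c * r ^ ?N)"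
        using ub cb r(1) unfolding set_integrable_def set_lebesgue_integral_def
        by (subst Bochner_Integration.integral_add) (auto simp: content_ball c_def)
      also have "\<dots> = ((LINT y:Q \<inter> ball z r|lebesgue. norm (u y - C *v z)) / r ^ ?N + norm (C $ i) * r * c) * r ^ ?N"
        using r(1) by (simp add: field_simps)
      also have "\<dots> \<le> \<beta> * r ^ ?N" using r0(2)[OF r] r(1) by (intro mult_right_mono) auto
      finally show ?thesis .
    qed
    obtain k0 where k0: "1 / real (Suc k0) < r0" using nat_approx_posE[OF r0(1)] by blast
    have "x \<notin> ?bad k" if "k0 \<le> k" for k
    proof
      assume "x \<in> ?bad k"
      then obtain r where r: "0 < r" "r < 1 / real (Suc k)" "\<beta> * r ^ ?N < (LINT y:ball z r|lebesgue. \<bar>g y\<bar>)"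
        unfolding bad_set_def z_def by blast
      have "1 / real (Suc k) \<le> 1 / real (Suc k0)" using that by (intro divide_left_mono) auto
      then have "r < r0" using r(2) k0 by linarith
      then show False using le[OF r(1)] r(3) by simp
    qed
    then show ?thesis by blast
  qed
  have "(\<lambda>k. \<integral>x. indicator (?bad k) x * \<bar>g x\<bar> \<partial>lebesgue) \<longlonglongrightarrow> (\<integral>x. 0 \<partial>(lebesgue :: (real^'n) measure))"
  proof (rule integral_dominated_convergence[where w = "\<lambda>x. \<bar>g x\<bar>"])
    show "(\<lambda>x. indicator (?bad k) x * \<bar>g x\<bar>) \<in> borel_measurable lebesgue" for k
      using badB fi by (intro borel_measurable_times borel_measurable_indicator) auto
    show "AE x in lebesgue. (\<lambda>k. indicator (?bad k) x * \<bar>g x\<bar>) \<longlonglongrightarrow> 0"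
      using face_null_cylinder[OF N(1) s, of j]
    proof eventually_elim
      case (elim x)
      show ?case
      proof (cases "x \<in> Q")
        case True
        then obtain k0 where "\<forall>k\<ge>k0. x \<notin> ?bad k" using good[of x] elim by blast
        then have "\<forall>\<^sub>F k in sequentially. indicator (?bad k) x * \<bar>g x\<bar> = 0"
          unfolding eventually_sequentially by (intro exI[of _ k0]) auto
        then show ?thesis by (rule tendsto_eventually)
      qed (simp add: g_def)
    qed
  qed (use fi in \<open>auto simp: indicator_def\<close>)
  then show ?thesis by simp
qed

lemma bad_set_lateral: "lateral (bad_set (\<lambda>x. \<bar>g x\<bar>) j s \<beta> \<delta>)"
  unfolding lateral_def
proof (intro conjI allI impI)
  show "open (bad_set (\<lambda>x. \<bar>g x\<bar>) j s \<beta> \<delta>)" by (rule bad_set_open) (use g_int in auto)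
  fix x z :: "real^'n" assume "\<forall>k. k \<noteq> j \<longrightarrow> x $ k = z $ k"
  then have "face_point j s x = face_point j s z" by (intro face_point_cong) auto
  then show "x \<in> bad_set (\<lambda>x. \<bar>g x\<bar>) j s \<beta> \<delta> \<longleftrightarrow> z \<in> bad_set (\<lambda>x. \<bar>g x\<bar>) j s \<beta> \<delta>"
    by (simp add: bad_set_def)
qed

text \<open>The thin layer is split along the bad set \<open>U\<close>. Over \<open>U\<close> it is
  compared with the layer at a fixed scale \<open>a\<close>, which is small because \<open>g\<close>
  has little integral over \<open>U\<close>; off \<open>U\<close> the grid estimate applies. The
  order of choices is \<open>a\<close>, \<open>\<beta>\<close>, the radius \<open>\<delta>\<close>
  of the bad set, and then \<open>p\<close>.\<close>

lemma layer_tendsto: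
  assumes s: "s = 1 \<or> s = -1"
  shows "(\<lambda>p. layer (1 / real p) s UNIV) \<longlonglongrightarrow> 0"
proof (rule LIMSEQ_I)
  let ?N = "CARD('n)"
  fix \<kappa> :: real assume \<kappa>: "0 < \<kappa>"
  obtain c where c: "0 < c" "\<And>t. \<bar>sstep' t\<bar> \<le> c" using sstep'_bounded by blast
  have fi: "integrable lebesgue (\<lambda>x. \<bar>g x\<bar>)" using g_int by simp
  have "\<forall>\<^sub>F k in sequentially. mass s (2 / real (Suc k)) < \<kappa> / 4"
    by (rule order_tendstoD[OF mass_tendsto[OF s]]) (use \<kappa> in simp)
  moreover have "\<forall>\<^sub>F k in sequentially. 8 \<le> k" by (rule eventually_ge_at_top)
  ultimately have "\<forall>\<^sub>F k in sequentially. mass s (2 / real (Suc k)) < \<kappa> / 4 \<and> 8 \<le> k" by eventually_elim simp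
  then obtain ka where ka: "mass s (2 / real (Suc ka)) < \<kappa> / 4" "8 \<le> ka"
    by (auto simp: eventually_sequentially)
  define a where "a = 1 / real (Suc ka)"
  have a: "0 < a" "a \<le> 1/8" "mass s (2 * a) < \<kappa> / 4" using ka by (auto simp: a_def field_simps)
  \<comment> \<open>Makes the grid estimate times the weight bound \<open>c * p\<close> equal to
    \<open>\<kappa> / 4\<close>.\<close>
  define \<beta> where "\<beta> = \<kappa> / (4 * c * (real ?N + 2) ^ ?N)"
  have \<beta>: "0 < \<beta>" unfolding \<beta>_def using \<kappa> c(1) by (intro divide_pos_pos mult_pos_pos zero_less_power) auto
  have "\<forall>\<^sub>F k in sequentially. (\<integral>x. indicator (bad_set (\<lambda>x. \<bar>g x\<bar>) j s \<beta> (1 / real (Suc k))) x * \<bar>g x\<bar> \<partial>lebesgue) < \<kappa> * a / (4 * c)"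
    by (rule order_tendstoD[OF bad_set_vanishes[OF s \<beta>]]) (use \<kappa> a(1) c(1) in simp)
  then obtain k where k: "(\<integral>x. indicator (bad_set (\<lambda>x. \<bar>g x\<bar>) j s \<beta> (1 / real (Suc k))) x * \<bar>g x\<bar> \<partial>lebesgue) < \<kappa> * a / (4 * c)"
    by (auto simp: eventually_sequentially)
  \<comment> \<open>With \<open>a\<close> fixed, the integral over the bad set at this radius is
    below \<open>\<kappa> * a / (4 * c)\<close>, which the weight \<open>c / a\<close> of the layer
    at scale \<open>a\<close> turns into \<open>\<kappa> / 4\<close>.\<close>
  define \<delta> where "\<delta> = 1 / real (Suc k)"
  define U where "U = bad_set (\<lambda>x. \<bar>g x\<bar>) j s \<beta> \<delta>"
  have kU: "(\<integral>x. indicator U x * \<bar>g x\<bar> \<partial>lebesgue) < \<kappa> * a / (4 * c)" using k by (simp add: U_def \<delta>_def)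
  have latU: "lateral U" unfolding U_def by (rule bad_set_lateral)
  then have UB: "U \<in> sets borel" by (auto simp: lateral_def)
  have intU: "integrable lebesgue (\<lambda>x. indicator A x * \<bar>g x\<bar>)" if "A \<in> sets borel" for A
    using that integrable_mult_indicator[OF _ fi, of A] by auto
  have bnd: "\<bar>layer e s A\<bar> \<le> c / e * (\<integral>x. indicator (A \<inter> near s (2 * e)) x * \<bar>g x\<bar> \<partial>lebesgue)"
    if e: "0 < e" and [measurable]: "A \<in> sets borel" for e A
  proof -
    have "norm (layer e s A) \<le> (\<integral>x. c / e * (indicator (A \<inter> near s (2 * e)) x * \<bar>g x\<bar>) \<partial>lebesgue)"
      unfolding layer_def
    proof (rule Bochner_Integration.integral_norm_bound_integral[OF layer_integrable])
      show "integrable lebesgue (\<lambda>x. c / e * (indicator (A \<inter> near s (2 * e)) x * \<bar>g x\<bar>))"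
        by (intro integrable_mult_right intU) measurable
      fix x
      show "norm (g x * (indicator A x * (sstep' (face_dist j s x / e - 1) / e))) \<le> c / e * (indicator (A \<inter> near s (2 * e)) x * \<bar>g x\<bar>)"
      proof (cases "x \<in> A \<inter> near s (2 * e)")
        case True
        have "\<bar>sstep' (face_dist j s x / e - 1) / e\<bar> \<le> c / e" using c(2) e by (simp add: divide_right_mono)
        then have "\<bar>g x\<bar> * \<bar>sstep' (face_dist j s x / e - 1) / e\<bar> \<le> \<bar>g x\<bar> * (c / e)" by (rule mult_left_mono) simp
        then show ?thesis using True by (simp add: abs_mult mult.commute)
      next
        case False
        have "sstep' (face_dist j s x / e - 1) = 0" if "x \<notin> near s (2 * e)"
        proof (rule sstep'_eq_0(2))
          have "2 * e \<le> face_dist j s x" using that by (simp add: near_def)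
          then have "2 \<le> face_dist j s x / e" using e by (simp only: pos_le_divide_eq)
          then show "1 \<le> face_dist j s x / e - 1" by simp
        qed
        then show ?thesis using False by (cases "x \<in> A") auto
      qed
    qed measurable
    then show ?thesis by simp
  qed
  have aU: "\<bar>layer a s U\<bar> \<le> \<kappa> / 4"
  proof -
    have "(\<integral>x. indicator (U \<inter> near s (2 * a)) x * \<bar>g x\<bar> \<partial>lebesgue) \<le> (\<integral>x. indicator U x * \<bar>g x\<bar> \<partial>lebesgue)"
      using UB by (intro integral_mono intU) (auto simp: indicator_def)
    then have "c / a * (\<integral>x. indicator (U \<inter> near s (2 * a)) x * \<bar>g x\<bar> \<partial>lebesgue) \<le> c / a * (\<kappa> * a / (4 * c))"
      using kU c(1) a(1) by (intro mult_left_mono) auto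
    also have "\<dots> = \<kappa> / 4" using c(1) a(1) by (simp add: field_simps)
    finally show ?thesis using bnd[OF a(1) UB] by linarith
  qed
  obtain p0 :: nat where p0: "max (1 / a) ((real ?N + 2) / \<delta>) < real p0" using reals_Archimedean2 by blast
  have "norm (layer (1 / real p) s UNIV - 0) < \<kappa>" if pp: "p0 \<le> p" for p
  proof -
    have p: "1 / a < real p" "(real ?N + 2) / \<delta> < real p" using p0 pp by auto
    have p1: "0 < p" using p(1) a(1) by (metis divide_pos_pos gr0I less_asym of_nat_0 zero_less_one)
    have \<delta>0: "0 < \<delta>" by (simp add: \<delta>_def)
    have ea: "0 < 1 / real p" "1 / real p \<le> a" using p(1) p1 a(1) by (auto simp: field_simps)
    have "layer (1 / real p) s UNIV = layer (1 / real p) s U + layer (1 / real p) s (- U)"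
      unfolding layer_def
        Bochner_Integration.integral_add[OF layer_integrable[OF UB] layer_integrable[OF borel_comp[OF UB]], symmetric]
      by (intro Bochner_Integration.integral_cong) (auto simp: indicator_def)
    moreover have "\<bar>layer (1 / real p) s U\<bar> < \<kappa> / 2"
      using layer_compare[OF latU s ea a(2)] aU a(3) by linarith
    moreover have "\<bar>layer (1 / real p) s (- U)\<bar> \<le> \<kappa> / 2"
    proof -
      define S where "S = {y \<in> Q - U. face_dist j s y < 2 / real p}"
      have [measurable]: "U \<in> sets borel" by (rule UB)
      have SB: "S \<in> sets borel"
      proof -
        have "{y \<in> space borel. y \<in> Q \<and> y \<notin> U \<and> face_dist j s y < 2 / real p} \<in> sets borel"
          unfolding face_dist_def by measurable
        then show ?thesis by (simp add: S_def)
      qed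
      \<comment> \<open>The grid estimate has a strict inequality for the distance,
        \<open>near\<close> a weak one; they differ on a hyperplane.\<close>
      have null: "AE x in lebesgue. face_dist j s x \<noteq> 2 / real p"
      proof -
        have "negligible {x :: real^'n. axis j 1 \<bullet> x = s * (2 / real p - 1/2)}"
          by (intro negligible_hyperplane) (auto simp: axis_eq_0_iff)
        then have "AE x in lebesgue. x \<notin> {x :: real^'n. axis j 1 \<bullet> x = s * (2 / real p - 1/2)}"
          unfolding negligible_iff_null_sets by (rule AE_not_in)
        then show ?thesis by eventually_elim (use s in \<open>auto simp: face_dist_def inner_axis'\<close>)
      qed
      have "(\<integral>x. indicator (- U \<inter> near s (2 * (1 / real p))) x * \<bar>g x\<bar> \<partial>lebesgue) = (LINT x:S|lebesgue. \<bar>g x\<bar>)"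
        unfolding set_lebesgue_integral_def
      proof (rule integral_cong_AE)
        show "AE x in lebesgue. indicator (- U \<inter> near s (2 * (1 / real p))) x * \<bar>g x\<bar> = indicator S x *\<^sub>R \<bar>g x\<bar>"
          using null by eventually_elim (auto simp: S_def near_def indicator_def g_def)
        show "(\<lambda>x. indicator (- U \<inter> near s (2 * (1 / real p))) x * \<bar>g x\<bar>) \<in> borel_measurable lebesgue"
          using intU[of "- U \<inter> near s (2 * (1 / real p))"] by auto
        show "(\<lambda>x. indicator S x *\<^sub>R \<bar>g x\<bar>) \<in> borel_measurable lebesgue" using intU[OF SB] by auto
      qed
      also have "\<dots> \<le> \<beta> * (real ?N + 2) ^ ?N / real p"
        unfolding S_def U_def
        by (rule grid_estimate[OF fi _ s p1]) (use \<beta> p(2) p1 \<delta>0 in \<open>auto simp: field_simps\<close>)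
      finally have "c / (1 / real p) * (\<integral>x. indicator (- U \<inter> near s (2 * (1 / real p))) x * \<bar>g x\<bar> \<partial>lebesgue)
          \<le> c / (1 / real p) * (\<beta> * (real ?N + 2) ^ ?N / real p)"
        using c(1) by (intro mult_left_mono) auto
      also have "\<dots> = c * (\<beta> * (real ?N + 2) ^ ?N)" using p1 by simp
      also have "\<dots> = \<kappa> / 4"
      proof -
        have "0 < (real ?N + 2) ^ ?N" by (intro zero_less_power) auto
        then show ?thesis using c(1) unfolding \<beta>_def by simp
      qed
      finally have "\<bar>layer (1 / real p) s (- U)\<bar> \<le> \<kappa> / 4" using bnd[OF ea(1), of "- U"] UB by (simp add: borel_comp)
      then show ?thesis using \<kappa> by linarith
    qed
    ultimately show ?thesis by simp
  qed
  then show "\<exists>p0. \<forall>p\<ge>p0. norm (layer (1 / real p) s UNIV - 0) < \<kappa>" by blast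
qed

text \<open>Tests with cut-offs that tend to 1 inside the cube. Their derivatives are two boundary
  layers, which vanish in the limit; what remains compares the total of \<open>\<tau>\<close> with
  the constant density on a cube of volume one.\<close>

theorem total_derivative: "(\<integral>x. \<tau> x \<partial>M) = C $ i $ j"
proof -
  have UB: "UNIV \<in> sets (borel :: (real^'n) measure)" by simp
  obtain c where c: "0 < c" "\<And>t. \<bar>sstep' t\<bar> \<le> c" using sstep'_bounded by blast
  \<comment> \<open>The sum of the two one-sided cut-offs minus one: 0 near both faces and 1 in the
    middle, since for \<open>e <= 1/8\<close> the transition regions are disjoint.\<close>
  define \<eta> where "\<eta> e t = sstep ((1/2 + 1 * t) / e - 1) + sstep ((1/2 + (-1) * t) / e - 1) - 1" for e t
  define \<eta>' where "\<eta>' e t = 1 * (sstep' ((1/2 + 1 * t) / e - 1) / e) + (-1) * (sstep' ((1/2 + (-1) * t) / e - 1) / e) - 0" for e t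
  have der: "(\<eta> e has_real_derivative \<eta>' e t) (at t)" if "0 < e" for e t
    unfolding \<eta>_def[abs_def] \<eta>'_def using that by (intro DERIV_diff DERIV_add sstep_scaled_deriv DERIV_const) auto
  have b1: "\<bar>\<eta> e t\<bar> \<le> 1" for e t
    using sstep_bounds[of "(1/2 + 1 * t) / e - 1"] sstep_bounds[of "(1/2 + (-1) * t) / e - 1"] unfolding \<eta>_def by linarith
  have id: "layer e 1 UNIV - layer e (-1) UNIV = - (\<integral>x. \<eta> e (x $ j) * \<tau> x \<partial>M) + C $ i $ j * (\<integral>x. indicator Q x * \<eta> e (x $ j) \<partial>lborel)"
    if e: "0 < e" "e \<le> 1/8" for e
  proof -
    have "(\<integral>x. g x * (indicator UNIV x * \<eta>' e (x $ j)) \<partial>lebesgue)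
      = - (\<integral>x. indicator UNIV x * \<eta> e (x $ j) * \<tau> x \<partial>M) + C $ i $ j * (\<integral>x. indicator Q x * (indicator UNIV x * \<eta> e (x $ j)) \<partial>lborel)"
    proof (rule strip_identity[where lo = "e - 1/2" and hi = "1/2 - e" and c = "2 * c / e"])
      show "lateral UNIV" by (simp add: lateral_def)
      show "continuous_on UNIV (\<eta>' e)"
        unfolding \<eta>'_def[abs_def] by (intro continuous_on_diff continuous_on_add sstep'_scaled_continuous continuous_on_const)
      show "\<bar>\<eta>' e t\<bar> \<le> 2 * c / e" for t
      proof -
        have "\<bar>sstep' x / e\<bar> \<le> c / e" for x using c(2) e by (simp add: divide_right_mono)
        from this[of "(1/2 + 1 * t) / e - 1"] this[of "(1/2 + (-1) * t) / e - 1"]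
        show ?thesis unfolding \<eta>'_def by linarith
      qed
      show "\<eta> e t = 0" if t: "t \<notin> {e - 1/2..1/2 - e}" for t
      proof -
        have *: "sstep (x / e - 1) = 0" if "x \<le> e" for x using that e by (intro sstep_eq_0) simp
        have **: "sstep (x / e - 1) = 1" if "2 * e \<le> x" for x
        proof (rule sstep_eq_1)
          have "2 \<le> x / e" using that e by (simp only: pos_le_divide_eq)
          then show "1 \<le> x / e - 1" by simp
        qed
        consider "1/2 + t < e" | "1/2 - t < e" using t by force
        then show ?thesis
        proof cases
          case 1
          then have "sstep ((1/2 + 1 * t) / e - 1) = 0" "sstep ((1/2 + (-1) * t) / e - 1) = 1"
            using e by (auto intro!: * **)
          then show ?thesis by (simp only: \<eta>_def)
        next
          case 2
          then have "sstep ((1/2 + 1 * t) / e - 1) = 1" "sstep ((1/2 + (-1) * t) / e - 1) = 0"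
            using e by (auto intro!: * **)
          then show ?thesis by (simp only: \<eta>_def)
        qed
      qed
    qed (use e der b1 in auto)
    moreover have "(\<integral>x. g x * (indicator UNIV x * \<eta>' e (x $ j)) \<partial>lebesgue) = layer e 1 UNIV - layer e (-1) UNIV"
      unfolding layer_def Bochner_Integration.integral_diff[OF layer_integrable[OF UB] layer_integrable[OF UB], symmetric]
      by (intro Bochner_Integration.integral_cong) (auto simp: \<eta>'_def face_dist_def algebra_simps)
    ultimately show ?thesis by simp
  qed
  have lim\<eta>: "(\<lambda>p. \<eta> (1 / real p) (x $ j)) \<longlonglongrightarrow> 1" if x: "x \<in> Q" for x
  proof -
    have x1: "0 < 1/2 + 1 * x $ j" "0 < 1/2 + (-1) * x $ j" using unit_cubeD[OF x, of j] by auto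
    have ev: "\<forall>\<^sub>F p in sequentially. sstep (y / (1 / real p) - 1) = 1" if "0 < y" for y
    proof -
      obtain p0 :: nat where p0: "2 / y < real p0" using reals_Archimedean2 by blast
      have "sstep (y / (1 / real p) - 1) = 1" if "p0 \<le> p" for p
      proof (rule sstep_eq_1)
        have "2 / y < real p" using p0 that by linarith
        then have "2 < y * real p" using \<open>0 < y\<close> by (simp add: field_simps)
        then show "1 \<le> y / (1 / real p) - 1" by simp
      qed
      then show ?thesis unfolding eventually_sequentially by blast
    qed
    have "\<forall>\<^sub>F p in sequentially. \<eta> (1 / real p) (x $ j) = 1"
      using ev[OF x1(1)] ev[OF x1(2)] by eventually_elim (simp only: \<eta>_def)
    then show ?thesis by (rule tendsto_eventually)
  qed
  have \<eta>m: "\<eta> e \<in> borel_measurable borel" if "0 < e" for e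
  proof -
    have "continuous_on UNIV (\<eta> e)" using der[OF that] by (rule continuous_of_derivative)
    then show ?thesis by (rule borel_measurable_continuous_onI)
  qed
  have A: "(\<lambda>p. \<integral>x. \<eta> (1 / real (Suc p)) (x $ j) * \<tau> x \<partial>M) \<longlonglongrightarrow> (\<integral>x. \<tau> x \<partial>M)"
  proof (rule integral_dominated_convergence[where w = "\<lambda>x. \<bar>\<tau> x\<bar>"])
    show "(\<lambda>x. \<eta> (1 / real (Suc p)) (x $ j) * \<tau> x) \<in> borel_measurable M" for p
    proof -
      have [measurable]: "\<eta> (1 / real (Suc p)) \<in> borel_measurable borel" by (rule \<eta>m) simp
      have "(\<lambda>x::real^'n. \<eta> (1 / real (Suc p)) (x $ j)) \<in> borel_measurable borel" by measurable
      then show ?thesis using \<tau>_int by (intro borel_measurable_times[OF borel_M]) auto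
    qed
    show "AE x in M. (\<lambda>p. \<eta> (1 / real (Suc p)) (x $ j) * \<tau> x) \<longlonglongrightarrow> \<tau> x"
    proof (rule AE_I2)
      fix x assume "x \<in> space M"
      then have "(\<lambda>p. \<eta> (1 / real (Suc p)) (x $ j) * \<tau> x) \<longlonglongrightarrow> 1 * \<tau> x"
        by (intro tendsto_intros LIMSEQ_Suc[OF lim\<eta>]) (simp add: space_M)
      then show "(\<lambda>p. \<eta> (1 / real (Suc p)) (x $ j) * \<tau> x) \<longlonglongrightarrow> \<tau> x" by simp
    qed
    show "AE x in M. norm (\<eta> (1 / real (Suc p)) (x $ j) * \<tau> x) \<le> \<bar>\<tau> x\<bar>" for p
      using b1 by (auto simp: abs_mult intro!: mult_left_le_one_le)
  qed (use \<tau>_int in auto)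
  have B: "(\<lambda>p. \<integral>x. indicator Q x * \<eta> (1 / real (Suc p)) (x $ j) \<partial>lborel) \<longlonglongrightarrow> (\<integral>x. indicator Q x \<partial>(lborel :: (real^'n) measure))"
  proof (rule integral_dominated_convergence[where w = "indicator Q"])
    show "integrable lborel (indicator Q :: real^'n \<Rightarrow> real)" by (simp add: emeasure_unit_cube)
    show "(\<lambda>x. indicator Q x * \<eta> (1 / real (Suc p)) (x $ j)) \<in> borel_measurable lborel" for p
    proof -
      have [measurable]: "\<eta> (1 / real (Suc p)) \<in> borel_measurable borel" by (rule \<eta>m) simp
      show ?thesis by measurable
    qed
    show "AE x in lborel. (\<lambda>p. indicator Q x * \<eta> (1 / real (Suc p)) (x $ j)) \<longlonglongrightarrow> indicator Q x"
    proof (rule AE_I2)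
      fix x
      show "(\<lambda>p. indicator Q x * \<eta> (1 / real (Suc p)) (x $ j)) \<longlonglongrightarrow> indicator Q x"
        using LIMSEQ_Suc[OF lim\<eta>, of x] by (cases "x \<in> Q") auto
    qed
    show "AE x in lborel. norm (indicator Q x * \<eta> (1 / real (Suc p)) (x $ j)) \<le> indicator Q x" for p
      using b1 by (auto simp: indicator_def)
  qed auto
  have "(\<lambda>p. layer (1 / real (Suc p)) 1 UNIV - layer (1 / real (Suc p)) (-1) UNIV) \<longlonglongrightarrow> 0 - 0"
    by (intro tendsto_diff LIMSEQ_Suc[OF layer_tendsto]) auto
  moreover have "(\<lambda>p. layer (1 / real (Suc p)) 1 UNIV - layer (1 / real (Suc p)) (-1) UNIV)
      \<longlonglongrightarrow> - (\<integral>x. \<tau> x \<partial>M) + C $ i $ j * (\<integral>x. indicator Q x \<partial>(lborel :: (real^'n) measure))"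
  proof (rule Lim_transform_eventually)
    show "(\<lambda>p. - (\<integral>x. \<eta> (1 / real (Suc p)) (x $ j) * \<tau> x \<partial>M) + C $ i $ j * (\<integral>x. indicator Q x * \<eta> (1 / real (Suc p)) (x $ j) \<partial>lborel))
      \<longlonglongrightarrow> - (\<integral>x. \<tau> x \<partial>M) + C $ i $ j * (\<integral>x. indicator Q x \<partial>(lborel :: (real^'n) measure))"
      by (intro tendsto_intros A B)
    have "\<forall>\<^sub>F p in sequentially. 8 \<le> p" by (rule eventually_ge_at_top)
    then show "\<forall>\<^sub>F p in sequentially. - (\<integral>x. \<eta> (1 / real (Suc p)) (x $ j) * \<tau> x \<partial>M) + C $ i $ j * (\<integral>x. indicator Q x * \<eta> (1 / real (Suc p)) (x $ j) \<partial>lborel)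
       = layer (1 / real (Suc p)) 1 UNIV - layer (1 / real (Suc p)) (-1) UNIV"
      by eventually_elim (subst id, auto simp: field_simps)
  qed
  ultimately have "- (\<integral>x. \<tau> x \<partial>M) + C $ i $ j * (\<integral>x. indicator Q x \<partial>(lborel :: (real^'n) measure)) = 0"
    using LIMSEQ_unique by fastforce
  moreover have "(\<integral>x. indicat_real Q x \<partial>(lborel :: (real^'n) measure)) = 1"
    by (simp add: measure_def emeasure_unit_cube)
  ultimately show ?thesis by simp
qed

end

section \<open>Assembling the derivative of a locally conical function\<close>

text \<open>Joins the Lebesgue part and the jump part into the one positive measure that
  \<open>has_distributional_derivative\<close> asks for.\<close>

definition plus_measure :: "'a measure \<Rightarrow> 'a measure \<Rightarrow> 'a measure" where
  "plus_measure A B = measure_of (space A) (sets A) (\<lambda>E. emeasure A E + emeasure B E)"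

lemma sets_plus_measure [simp]: "sets (plus_measure A B) = sets A"
  and space_plus_measure [simp]: "space (plus_measure A B) = space A"
  by (simp_all add: plus_measure_def sets.space_closed sets.sigma_sets_eq)

lemma emeasure_plus_measure:
  assumes "sets B = sets A" "E \<in> sets A"
  shows "emeasure (plus_measure A B) E = emeasure A E + emeasure B E"
  unfolding plus_measure_def
proof (rule emeasure_measure_of_sigma)
  show "sigma_algebra (space A) (sets A)" ..
  show "positive (sets A) (\<lambda>E. emeasure A E + emeasure B E)" by (simp add: positive_def)
  show "countably_additive (sets A) (\<lambda>E. emeasure A E + emeasure B E)"
    unfolding countably_additive_def
  proof (intro allI impI)
    fix F :: "nat \<Rightarrow> _" assume F: "range F \<subseteq> sets A" "disjoint_family F"
    then show "(\<Sum>i. emeasure A (F i) + emeasure B (F i)) = emeasure A (\<Union>i. F i) + emeasure B (\<Union>i. F i)"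
      using assms(1) by (subst suminf_add[symmetric]) (auto simp: suminf_emeasure)
  qed
qed fact

lemma nn_integral_plus_measure:
  assumes s: "sets B = sets A" and f: "f \<in> borel_measurable A"
  shows "(\<integral>\<^sup>+x. f x \<partial>plus_measure A B) = (\<integral>\<^sup>+x. f x \<partial>A) + (\<integral>\<^sup>+x. f x \<partial>B)"
proof -
  have sp: "space B = space A" by (rule sets_eq_imp_space_eq[OF s])
  have mB: "h \<in> borel_measurable B" "h \<in> borel_measurable (plus_measure A B)" if "h \<in> borel_measurable A" for h :: "_ \<Rightarrow> ennreal"
    using that measurable_cong_sets[OF s refl] measurable_cong_sets[OF sets_plus_measure refl] by blast+
  show ?thesis using f
  proof (induction rule: borel_measurable_induct)
    case (cong f g)
    have *: "(\<integral>\<^sup>+x. f x \<partial>N) = (\<integral>\<^sup>+x. g x \<partial>N)" if "space N = space A" for N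
      using cong(3) that by (intro nn_integral_cong) auto
    show ?case by (simp only: *[OF space_plus_measure] *[OF refl] *[OF sp] cong(4))
  next
    case (set E)
    then show ?case using s by (simp add: emeasure_plus_measure)
  next
    case (mult f c)
    then have f: "f \<in> borel_measurable A" by blast
    show ?case
      unfolding nn_integral_cmult[OF f] nn_integral_cmult[OF mB(1)[OF f]] nn_integral_cmult[OF mB(2)[OF f]]
      using mult by (simp only: distrib_left)
  next
    case (add f g)
    then have f: "f \<in> borel_measurable A" "g \<in> borel_measurable A" by blast+
    show ?case
      unfolding nn_integral_add[OF f(2) f(1)] nn_integral_add[OF mB(1)[OF f(2)] mB(1)[OF f(1)]]
        nn_integral_add[OF mB(2)[OF f(2)] mB(2)[OF f(1)]]
        nn_integral_add[OF f(1) f(2)] nn_integral_add[OF mB(1)[OF f(1)] mB(1)[OF f(2)]]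
        nn_integral_add[OF mB(2)[OF f(1)] mB(2)[OF f(2)]]
      using add by (simp only: ac_simps)
  next
    case (seq U)
    then have U: "U i \<in> borel_measurable A" "incseq U" for i by blast+
    have inc: "incseq (\<lambda>i. \<integral>\<^sup>+x. U i x \<partial>N)" for N
      using U(2) by (auto simp: incseq_def le_fun_def intro!: nn_integral_mono)
    have S: "(\<integral>\<^sup>+x. (SUP i. U i x) \<partial>N) = (SUP i. \<integral>\<^sup>+x. U i x \<partial>N)" if "\<And>i. U i \<in> borel_measurable N" for N
      by (rule nn_integral_monotone_convergence_SUP[OF U(2) that])
    have IH: "(\<integral>\<^sup>+x. U i x \<partial>plus_measure A B) = (\<integral>\<^sup>+x. U i x \<partial>A) + (\<integral>\<^sup>+x. U i x \<partial>B)" for i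
      using seq by blast
    have "(\<integral>\<^sup>+x. (SUP i. U i x) \<partial>plus_measure A B) = (\<integral>\<^sup>+x. (SUP i. U i x) \<partial>A) + (\<integral>\<^sup>+x. (SUP i. U i x) \<partial>B)"
      unfolding S[OF U(1)] S[OF mB(1)[OF U(1)]] S[OF mB(2)[OF U(1)]] IH
      by (rule ennreal_SUP_add[OF inc inc])
    then show ?case by (simp add: image_image SUP_apply[abs_def])
  qed
qed

lemma integral_plus_measure:
  fixes f :: "'a \<Rightarrow> real"
  assumes s: "sets B = sets A" and f: "integrable A f" "integrable B f"
  shows "integrable (plus_measure A B) f" "(\<integral>x. f x \<partial>plus_measure A B) = (\<integral>x. f x \<partial>A) + (\<integral>x. f x \<partial>B)"
proof -
  have fm [measurable]: "f \<in> borel_measurable A" using f by auto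
  have fm': "f \<in> borel_measurable (plus_measure A B)"
    using measurable_cong_sets[OF sets_plus_measure refl] fm by blast
  have nn: "(\<integral>\<^sup>+x. ennreal (h (f x)) \<partial>plus_measure A B) = (\<integral>\<^sup>+x. ennreal (h (f x)) \<partial>A) + (\<integral>\<^sup>+x. ennreal (h (f x)) \<partial>B)"
    if [measurable]: "h \<in> borel_measurable borel" for h :: "real \<Rightarrow> real"
    by (rule nn_integral_plus_measure[OF s]) measurable
  show int: "integrable (plus_measure A B) f"
    using f nn[of abs] fm' by (simp add: integrable_iff_bounded)
  have fin: "(\<integral>\<^sup>+x. ennreal (f x) \<partial>A) < top" "(\<integral>\<^sup>+x. ennreal (f x) \<partial>B) < top"
    "(\<integral>\<^sup>+x. ennreal (- f x) \<partial>A) < top" "(\<integral>\<^sup>+x. ennreal (- f x) \<partial>B) < top"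
    using f integrableD(2)[OF f(1)] integrableD(2)[OF f(2)] integrableD(3)[OF f(1)] integrableD(3)[OF f(2)]
    by (auto simp: real_integrable_def less_top)
  show "(\<integral>x. f x \<partial>plus_measure A B) = (\<integral>x. f x \<partial>A) + (\<integral>x. f x \<partial>B)"
    unfolding real_lebesgue_integral_def[OF int] real_lebesgue_integral_def[OF f(1)] real_lebesgue_integral_def[OF f(2)]
    using nn[of "\<lambda>x. x"] nn[of "\<lambda>x. - x"] fin by (simp add: enn2real_plus)
qed

section \<open>The representing measure of the derivative\<close>

context conical_field begin

definition T :: "real^'n \<Rightarrow> real^'n^'n" where
  "T x = indicator (jump_set Q u) x *\<^sub>R jump_tensor u x"

abbreviation "H \<equiv> hausdorff_measure (CARD('n) - 1) :: (real^'n) measure"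

lemma T_borel [measurable]: "T \<in> borel_measurable borel"
  unfolding T_def[abs_def] by (rule jump_tensor_measurable)

lemma T_outside: "x \<notin> Q \<Longrightarrow> T x = 0"
  by (simp add: T_def jump_set_def)

lemma T_nonzero: "x \<in> jump_set Q u \<Longrightarrow> T x \<noteq> 0"
proof -
  assume x: "x \<in> jump_set Q u"
  then obtain a b \<nu> r where t: "x \<in> Q" "a \<noteq> b" "norm \<nu> = 1" "0 < r" "two_valued x r a b \<nu>"
    unfolding jump_set_iff by blast
  have "a - b \<noteq> 0" "\<nu> \<noteq> 0" using t by auto
  then obtain k l where "(a - b) $ k \<noteq> 0" "\<nu> $ l \<noteq> 0" by (auto simp: vec_eq_iff)
  then have "outer (a - b) \<nu> $ k $ l \<noteq> 0" by (simp add: outer_def)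
  then show ?thesis using x jump_tensor_eq[OF t] by (auto simp: T_def)
qed

text \<open>The density with respect to \<open>M\<close>: on the jump set the direction of the jump
  tensor, elsewhere the constant gradient. Off the jump set \<open>T\<close> is zero and the first
  summand vanishes; on it \<open>T\<close> is nonzero, so multiplication by
  \<open>norm (T x)\<close> gives back \<open>T x\<close>.\<close>

definition \<sigma> :: "real^'n \<Rightarrow> real^'n^'n" where
  "\<sigma> x = (1 / norm (T x)) *\<^sub>R T x + indicator (- jump_set Q u) x *\<^sub>R G"

definition MA :: "(real^'n) measure" where "MA = restrict_space lborel Q"
definition MB :: "(real^'n) measure" where "MB = restrict_space (density H (\<lambda>x. ennreal (norm (T x)))) Q"
definition M :: "(real^'n) measure" where "M = plus_measure MA MB"

lemma Q_borel [measurable]: "Q \<in> sets borel"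
  using openQ by (rule borel_open)

lemma sets_MAB: "sets MA = sets (restrict_space borel Q)" "sets MB = sets (restrict_space borel Q)"
  unfolding MA_def MB_def by (intro sets_restrict_space_cong; simp)+

lemma setsM: "sets M = sets (restrict_space borel Q)"
  by (simp add: M_def sets_MAB)

lemma \<sigma>_borel [measurable]: "\<sigma> \<in> borel_measurable borel"
  unfolding \<sigma>_def[abs_def] by measurable

lemma norm_\<sigma>: "norm (\<sigma> x) \<le> 1 + norm G"
proof -
  have "norm (\<sigma> x) \<le> norm ((1 / norm (T x)) *\<^sub>R T x) + norm (indicator (- jump_set Q u) x *\<^sub>R G)"
    unfolding \<sigma>_def by (rule norm_triangle_ineq)
  also have "\<dots> \<le> 1 + norm G" by (intro add_mono) (auto simp: indicator_def)
  finally show ?thesis .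
qed

lemma T_\<sigma>: "norm (T x) *\<^sub>R \<sigma> x = T x"
  using T_nonzero[of x] by (cases "x \<in> jump_set Q u") (auto simp: \<sigma>_def T_def)

lemma emeasure_Q_finite: "emeasure lborel Q < \<infinity>"
  using bddQ emeasure_bounded_finite by blast

end

text \<open>The facts from which membership in \<open>SBV\<close> follows: the jumps carry no
  volume, have finite total variation, and account for the whole derivative of
  \<open>w\<close>.\<close>

locale conical_SBV = conical_field Q w G B
  for Q :: "(real^'n) set" and w :: "real^'n \<Rightarrow> real^'n" and G :: "real^'n^'n" and B :: real +
  assumes jump_null: "\<exists>Z\<in>null_sets lborel. jump_set Q u \<subseteq> Z"
    and TV: "(\<integral>\<^sup>+x. ennreal (norm (T x)) \<partial>H) < \<infinity>"
    and by_parts: "\<And>\<phi> g K i j. C1 \<phi> g \<Longrightarrow> compact K \<Longrightarrow> K \<subseteq> Q \<Longrightarrow> (\<And>x. x \<notin> K \<Longrightarrow> \<phi> x = 0) \<Longrightarrow>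
       (\<integral>x. w x $ i * (g x \<bullet> axis j 1) \<partial>lborel) = - (\<integral>x. \<phi> x * T x $ i $ j \<partial>H)"
begin

lemma T_integrable: "integrable H T"
  using TV by (simp add: integrable_iff_bounded)

lemma finite_M: "finite_measure M"
proof (rule finite_measureI)
  have QA: "Q \<in> sets (restrict_space borel Q)" by (simp add: sets_restrict_space_iff)
  have "emeasure M Q = emeasure MA Q + emeasure MB Q"
    unfolding M_def using QA by (intro emeasure_plus_measure) (auto simp: sets_MAB)
  also have "emeasure MA Q = emeasure lborel Q" unfolding MA_def by (rule emeasure_restrict_space) auto
  also have "emeasure MB Q = emeasure (density H (\<lambda>x. ennreal (norm (T x)))) Q"
    unfolding MB_def by (rule emeasure_restrict_space) auto
  also have "\<dots> = (\<integral>\<^sup>+x. ennreal (norm (T x)) * indicator Q x \<partial>H)" by (rule emeasure_density) auto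
  also have "\<dots> \<le> (\<integral>\<^sup>+x. ennreal (norm (T x)) \<partial>H)" by (intro nn_integral_mono) (auto simp: indicator_def)
  finally have "emeasure M Q \<le> emeasure lborel Q + (\<integral>\<^sup>+x. ennreal (norm (T x)) \<partial>H)" by (simp add: add_left_mono)
  also have "\<dots> < \<infinity>" using TV emeasure_Q_finite by (simp add: less_top)
  finally show "emeasure M (space M) \<noteq> \<infinity>"
    using sets_eq_imp_space_eq[OF setsM] by (simp add: space_restrict_space)
qed

lemma \<sigma>_integrable: "integrable M \<sigma>"
proof -
  interpret finite_measure M by (rule finite_M)
  show ?thesis
    by (rule integrable_const_bound[where B = "1 + norm G"])
       (use norm_\<sigma> borel_measurable_restrict[OF setsM \<sigma>_borel] in auto)
qed

text \<open>Lebesgue measure does not see the jump set and finds the density \<open>G\<close>; the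
  jump part multiplies \<open>\<sigma>\<close> by \<open>norm (T x)\<close>, which gives
  \<open>T\<close> back and ignores everything off the jump set.\<close>

lemma integral_\<sigma>:
  assumes h: "h \<in> borel_measurable borel" "\<And>x. \<bar>h x\<bar> \<le> c"
  shows "(\<integral>x. h x * \<sigma> x $ i $ j \<partial>M) = G $ i $ j * (\<integral>x. indicator Q x * h x \<partial>lborel) + (\<integral>x. h x * T x $ i $ j \<partial>H)"
proof -
  note [measurable] = h(1)
  obtain Z where Z: "Z \<in> null_sets lborel" "jump_set Q u \<subseteq> Z" using jump_null by blast
  have c0: "0 \<le> c" using h(2)[of 0] by linarith
  have "continuous_on UNIV (\<lambda>A::real^'n^'n. A $ i $ j)" by (intro continuous_intros)
  then have "(\<lambda>A::real^'n^'n. A $ i $ j) \<in> borel_measurable borel" by (rule borel_measurable_continuous_onI)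
  from measurable_compose[OF \<sigma>_borel this] measurable_compose[OF T_borel this]
  have [measurable]: "(\<lambda>x. \<sigma> x $ i $ j) \<in> borel_measurable borel" "(\<lambda>x. T x $ i $ j) \<in> borel_measurable borel"
    by auto
  have cmp: "\<bar>A $ i $ j\<bar> \<le> norm A" for A :: "real^'n^'n"
    using component_le_norm_cart[of "A $ i" j] Finite_Cartesian_Product.norm_nth_le[of A i] by linarith
  have hs: "\<bar>h x * \<sigma> x $ i $ j\<bar> \<le> c * (1 + norm G)" for x
    using mult_mono[OF h(2)[of x] order_trans[OF cmp[of "\<sigma> x"] norm_\<sigma>[of x]]] c0 by (simp add: abs_mult)
  have iA: "integrable lborel (\<lambda>x. indicator Q x *\<^sub>R (h x * \<sigma> x $ i $ j))"
  proof (rule Bochner_Integration.integrable_bound)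
    show "integrable lborel (\<lambda>x. c * (1 + norm G) * indicator Q x)" using emeasure_Q_finite by simp
    show "AE x in lborel. norm (indicator Q x *\<^sub>R (h x * \<sigma> x $ i $ j)) \<le> norm (c * (1 + norm G) * indicator Q x)"
    proof (rule AE_I2)
      fix x
      show "norm (indicator Q x *\<^sub>R (h x * \<sigma> x $ i $ j)) \<le> norm (c * (1 + norm G) * indicator Q x)"
        using hs[of x] by (cases "x \<in> Q") (auto intro: order_trans[OF _ abs_ge_self])
    qed
  qed measurable
  have "(\<integral>x. h x * \<sigma> x $ i $ j \<partial>MA) = (\<integral>x. indicator Q x *\<^sub>R (h x * \<sigma> x $ i $ j) \<partial>lborel)"
    unfolding MA_def by (rule integral_restrict_space) simp
  also have "\<dots> = (\<integral>x. G $ i $ j * (indicator Q x * h x) \<partial>lborel)"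
  proof (rule integral_cong_AE)
    show "AE x in lborel. indicator Q x *\<^sub>R (h x * \<sigma> x $ i $ j) = G $ i $ j * (indicator Q x * h x)"
      using AE_not_in[OF Z(1)]
    proof eventually_elim
      case (elim x)
      then have "x \<notin> jump_set Q u" using Z by blast
      then show ?case by (simp add: \<sigma>_def T_def)
    qed
  qed measurable
  finally have A: "(\<integral>x. h x * \<sigma> x $ i $ j \<partial>MA) = G $ i $ j * (\<integral>x. indicator Q x * h x \<partial>lborel)" by simp
  have iA': "integrable MA (\<lambda>x. h x * \<sigma> x $ i $ j)"
    unfolding MA_def by (subst integrable_restrict_space) (use iA in auto)
  have TT: "indicator Q x *\<^sub>R (norm (T x) *\<^sub>R (h x * \<sigma> x $ i $ j)) = h x * T x $ i $ j" for x
  proof -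
    have "norm (T x) * \<sigma> x $ i $ j = T x $ i $ j" using arg_cong[OF T_\<sigma>[of x], of "\<lambda>A. A $ i $ j"] by simp
    then show ?thesis using T_outside[of x] by (cases "x \<in> Q") (auto simp: mult_ac)
  qed
  have iT: "integrable H (\<lambda>x. h x * T x $ i $ j)"
  proof (rule Bochner_Integration.integrable_bound)
    show "integrable H (\<lambda>x. c * norm (T x))" using T_integrable by simp
    show "AE x in H. norm (h x * T x $ i $ j) \<le> norm (c * norm (T x))"
      using mult_mono[OF h(2) cmp] c0 by (auto simp: abs_mult)
  qed measurable
  have "(\<integral>x. h x * \<sigma> x $ i $ j \<partial>MB) = (\<integral>x. indicator Q x *\<^sub>R (h x * \<sigma> x $ i $ j) \<partial>density H (\<lambda>x. ennreal (norm (T x))))"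
    unfolding MB_def by (rule integral_restrict_space) simp
  also have "\<dots> = (\<integral>x. norm (T x) *\<^sub>R (indicator Q x *\<^sub>R (h x * \<sigma> x $ i $ j)) \<partial>H)"
    by (rule integral_density) auto
  also have "\<dots> = (\<integral>x. h x * T x $ i $ j \<partial>H)"
    unfolding TT[symmetric] by (simp add: mult_ac)
  finally have B: "(\<integral>x. h x * \<sigma> x $ i $ j \<partial>MB) = (\<integral>x. h x * T x $ i $ j \<partial>H)" .
  have iB': "integrable MB (\<lambda>x. h x * \<sigma> x $ i $ j)"
    unfolding MB_def
  proof (subst integrable_restrict_space)
    have "integrable H (\<lambda>x. norm (T x) *\<^sub>R (indicator Q x *\<^sub>R (h x * \<sigma> x $ i $ j)))"
      using iT unfolding TT[symmetric] by (simp add: mult_ac)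
    then show "integrable (density H (\<lambda>x. ennreal (norm (T x)))) (\<lambda>x. indicator Q x *\<^sub>R (h x * \<sigma> x $ i $ j))"
      by (subst integrable_density) auto
  qed simp
  show ?thesis
    unfolding M_def using integral_plus_measure(2)[OF _ iA' iB'] A B by (simp add: sets_MAB)
qed

definition D :: "(real^'n) set \<Rightarrow> real^'n^'n" where "D E = (LINT x:E|M. \<sigma> x)"

lemma u_bounded_on_Q: obtains c where "\<And>x. x \<in> Q \<Longrightarrow> norm (u x) \<le> c"
proof -
  obtain C where C: "\<And>y. norm (G *v y) \<le> norm y * C" "0 \<le> C"
    using bounded_linear.nonneg_bounded[OF matrix_vector_mul_bounded_linear[of G]] by blast
  obtain R where R: "\<And>x. x \<in> Q \<Longrightarrow> norm x \<le> R" using bddQ unfolding bounded_iff by blast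
  have "norm (u x) \<le> R * C + B" if "x \<in> Q" for x
    unfolding u_def using norm_triangle_ineq[of "G *v x" "w x"] C(1)[of x] w_bdd[of x]
      mult_right_mono[OF R[OF that] C(2)] by linarith
  then show ?thesis by (rule that)
qed

lemma u_set_integrable: "set_integrable lebesgue Q u"
proof -
  obtain c where c: "\<And>x. x \<in> Q \<Longrightarrow> norm (u x) \<le> c" using u_bounded_on_Q by blast
  have "integrable lborel (\<lambda>x. indicator Q x *\<^sub>R u x)"
  proof (rule Bochner_Integration.integrable_bound)
    show "integrable lborel (\<lambda>x. c * indicator Q x)" using emeasure_Q_finite by simp
    show "AE x in lborel. norm (indicator Q x *\<^sub>R u x) \<le> norm (c * indicator Q x)"
    proof (rule AE_I2)
      fix x
      show "norm (indicator Q x *\<^sub>R u x) \<le> norm (c * indicator Q x)"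
        using c[of x] by (cases "x \<in> Q") auto
    qed
  qed measurable
  then show ?thesis unfolding set_integrable_def by (subst integrable_completion) auto
qed

lemma deriv_identity:
  assumes "\<phi> \<in> test_functions Q"
  shows "(LINT x:Q|lebesgue. u x $ i * frechet_derivative \<phi> (at x) (axis j 1)) = - (LINT x|M. \<phi> x * \<sigma> x $ i $ j)"
proof -
  obtain g K where \<phi>: "C1 \<phi> g" and K: "compact K" "K \<subseteq> Q" "\<And>x. x \<notin> K \<Longrightarrow> \<phi> x = 0" "\<And>x. x \<notin> K \<Longrightarrow> g x = 0"
    using test_functionE[OF assms] by metis
  have gQ: "x \<notin> Q \<Longrightarrow> g x = 0" "x \<notin> Q \<Longrightarrow> \<phi> x = 0" for x using K by blast+
  have [measurable]: "\<phi> \<in> borel_measurable borel" using C1_continuous[OF \<phi>] by (rule borel_measurable_continuous_onI)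
  have gc: "continuous_on UNIV (\<lambda>x. g x \<bullet> axis j 1)" using \<phi> unfolding C1_def by (intro continuous_intros) auto
  then have [measurable]: "(\<lambda>x. g x \<bullet> axis j 1) \<in> borel_measurable borel" by (rule borel_measurable_continuous_onI)
  have "continuous_on UNIV (\<lambda>y::real^'n. y $ i)" by (intro continuous_intros)
  then have "(\<lambda>y::real^'n. y $ i) \<in> borel_measurable borel" by (rule borel_measurable_continuous_onI)
  from measurable_compose[OF u_borel this] measurable_compose[OF w_borel this]
  have [measurable]: "(\<lambda>x. u x $ i) \<in> borel_measurable borel" "(\<lambda>x. w x $ i) \<in> borel_measurable borel" by auto
  have m: "(\<lambda>x. indicator Q x *\<^sub>R (u x $ i * (g x \<bullet> axis j 1))) \<in> borel_measurable borel" by measurable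
  have "compact (\<phi> ` K)"
    using K(1) C1_continuous[OF \<phi>] by (intro compact_continuous_image) (auto intro: continuous_on_subset)
  then have "bounded (\<phi> ` K)" by (rule compact_imp_bounded)
  then obtain c where c: "0 < c" "\<forall>y\<in>\<phi> ` K. norm y \<le> c" unfolding bounded_pos by blast
  have cb: "\<bar>\<phi> x\<bar> \<le> c" for x using c K(3)[of x] by (cases "x \<in> K") auto
  have "(LINT x:Q|lebesgue. u x $ i * frechet_derivative \<phi> (at x) (axis j 1))
      = (\<integral>x. indicator Q x *\<^sub>R (u x $ i * (g x \<bullet> axis j 1)) \<partial>lborel)"
    unfolding set_lebesgue_integral_def C1_frechet[OF \<phi>] by (rule integral_completion) (use m in simp)
  also have "\<dots> = (\<integral>x. (G $ i \<bullet> x) * (g x \<bullet> axis j 1) + w x $ i * (g x \<bullet> axis j 1) \<partial>lborel)"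
    using gQ(1) by (intro Bochner_Integration.integral_cong)
      (auto simp: indicator_def u_def matrix_vector_mul_component algebra_simps)
  also have "\<dots> = (\<integral>x. (G $ i \<bullet> x) * (g x \<bullet> axis j 1) \<partial>lborel) + (\<integral>x. w x $ i * (g x \<bullet> axis j 1) \<partial>lborel)"
  proof (rule Bochner_Integration.integral_add)
    show "integrable lborel (\<lambda>x. (G $ i \<bullet> x) * (g x \<bullet> axis j 1))"
      by (rule affine_integral_by_parts(2)[OF \<phi> K(1,3)])
    have ax: "axis j (1::real) \<noteq> 0" by (simp add: axis_eq_0_iff)
    show "integrable lborel (\<lambda>x. w x $ i * (g x \<bullet> axis j 1))"
    proof (rule Bochner_Integration.integrable_bound)
      show "integrable lborel (\<lambda>x. B * (g x \<bullet> axis j 1))"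
        using integral_derivative_compact_support(2)[OF \<phi> K(1,3) ax] by simp
      show "AE x in lborel. norm (w x $ i * (g x \<bullet> axis j 1)) \<le> norm (B * (g x \<bullet> axis j 1))"
      proof (rule AE_I2)
        fix x
        have "\<bar>w x $ i\<bar> \<le> \<bar>B\<bar>" using component_le_norm_cart[of "w x" i] w_bdd[of x] by linarith
        then show "norm (w x $ i * (g x \<bullet> axis j 1)) \<le> norm (B * (g x \<bullet> axis j 1))"
          by (auto simp: abs_mult intro: mult_right_mono)
      qed
    qed measurable
  qed
  also have "\<dots> = - G $ i $ j * (\<integral>x. \<phi> x \<partial>lborel) - (\<integral>x. \<phi> x * T x $ i $ j \<partial>H)"
    using affine_integral_by_parts(1)[OF \<phi> K(1,3)] by_parts[OF \<phi> K(1-3), of i j] by simp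
  also have "(\<integral>x. \<phi> x \<partial>lborel) = (\<integral>x. indicator Q x * \<phi> x \<partial>lborel)"
    using gQ(2) by (intro Bochner_Integration.integral_cong) (auto simp: indicator_def)
  finally show ?thesis using integral_\<sigma>[of \<phi> c i j] cb by simp
qed

lemma has_deriv_D: "has_distributional_derivative Q u D"
  unfolding has_distributional_derivative_def
  by (rule exI[of _ M], rule exI[of _ \<sigma>])
     (use finite_M setsM \<sigma>_integrable deriv_identity in \<open>auto simp: D_def\<close>)

lemma D_eq:
  assumes E: "E \<in> sets borel" "E \<subseteq> Q"
  shows "D E = measure lborel E *\<^sub>R G + (\<integral>x. indicator E x *\<^sub>R T x \<partial>H)"
proof -
  have EM: "E \<in> sets M" using sets_restrict_borel[OF setsM Q_borel] E by blast
  have iT: "integrable H (\<lambda>x. indicator E x *\<^sub>R T x)" using E T_integrable by (intro integrable_mult_indicator) auto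
  have "D E $ i $ j = (measure lborel E *\<^sub>R G + (\<integral>x. indicator E x *\<^sub>R T x \<partial>H)) $ i $ j" for i j
  proof -
    have bl: "bounded_linear (\<lambda>y::real^'n^'n. y $ i $ j)"
      using bounded_linear_compose[OF bounded_linear_vec_nth bounded_linear_vec_nth] .
    have "D E $ i $ j = (LINT x:E|M. \<sigma> x $ i $ j)"
      unfolding D_def by (rule set_lebesgue_integral_component[OF \<sigma>_integrable EM])
    also have "\<dots> = G $ i $ j * (\<integral>x. indicat_real Q x * indicat_real E x \<partial>lborel) + (\<integral>x. indicator E x * T x $ i $ j \<partial>H)"
      unfolding set_lebesgue_integral_def
      using integral_\<sigma>[of "indicator E" 1 i j] E(1) by (simp add: indicator_def)
    also have "(\<integral>x. indicat_real Q x * indicat_real E x \<partial>lborel) = (\<integral>x. indicat_real E x \<partial>lborel)"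
      using E by (intro Bochner_Integration.integral_cong) (auto simp: indicator_def)
    also have "(\<integral>x. indicat_real E x \<partial>lborel) = measure lborel E" using E by simp
    also have "(\<integral>x. indicator E x * T x $ i $ j \<partial>H) = (\<integral>x. indicator E x *\<^sub>R T x \<partial>H) $ i $ j"
      using integral_bounded_linear[OF bl iT] by simp
    finally show ?thesis by (simp add: mult.commute)
  qed
  then show ?thesis by (simp add: vec_eq_iff)
qed

lemma distr_deriv_eq: "E \<in> sets borel \<Longrightarrow> E \<subseteq> Q \<Longrightarrow> distr_deriv Q u E = D E"
  unfolding distr_deriv_def
  by (rule has_distributional_derivative_unique[OF openQ someI[of _ D] has_deriv_D]) (use has_deriv_D in auto)

lemma set_integrable_const_Q: "set_integrable lebesgue Q (\<lambda>x. A :: real^'n^'n)"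
  unfolding set_integrable_def using emeasure_Q_finite by (subst integrable_completion) auto

lemma set_integral_const:
  assumes "E \<in> sets borel" "E \<subseteq> Q"
  shows "(LINT x:E|lebesgue. A) = measure lborel E *\<^sub>R (A :: real^'n^'n)"
proof -
  have "emeasure lborel E \<le> emeasure lborel Q" using assms by (intro emeasure_mono) auto
  then have "emeasure lborel E < \<infinity>" using emeasure_Q_finite by (rule le_less_trans)
  then have "emeasure lebesgue E < \<infinity>" using assms by simp
  then show ?thesis unfolding set_lebesgue_integral_def using assms by simp
qed

text \<open>\<open>ac_gradient\<close> is an unspecified choice and comes with its own exceptional
  set. It is compared with the candidate \<open>G\<close>, whose exceptional set contains the jumps:
  both give the same integrals over Borel sets freed from the two null sets, and removing these
  changes neither integrals nor volumes.\<close>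

lemma ac_gradient_spec:
  "set_integrable lebesgue Q (ac_gradient Q u) \<and>
     (\<forall>E\<in>sets borel. E \<subseteq> Q \<longrightarrow> (LINT x:E|lebesgue. ac_gradient Q u x) = measure lborel E *\<^sub>R G)"
proof -
  define P where "P G' \<longleftrightarrow> set_integrable lebesgue Q G' \<and>
        (\<exists>Z\<in>null_sets lborel. \<forall>E\<in>sets borel. E \<subseteq> Q - Z \<longrightarrow> distr_deriv Q u E = (LINT x:E|lebesgue. G' x))"
    for G' :: "real^'n \<Rightarrow> real^'n^'n"
  obtain Z where Z: "Z \<in> null_sets lborel" "jump_set Q u \<subseteq> Z" using jump_null by blast
  have Dz: "distr_deriv Q u E = measure lborel E *\<^sub>R G" if E: "E \<in> sets borel" "E \<subseteq> Q - Z" for E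
  proof -
    have z: "indicator E x *\<^sub>R T x = 0" for x using E Z(2) by (auto simp: indicator_def T_def)
    have EQ: "E \<subseteq> Q" using E by blast
    show ?thesis unfolding distr_deriv_eq[OF E(1) EQ] D_eq[OF E(1) EQ] z by simp
  qed
  have "P (\<lambda>x. G)"
    unfolding P_def
  proof (intro conjI bexI[of _ Z] ballI impI)
    show "distr_deriv Q u E = (LINT x:E|lebesgue. G)" if "E \<in> sets borel" "E \<subseteq> Q - Z" for E
      unfolding Dz[OF that] by (rule set_integral_const[symmetric]) (use that in auto)
  qed (use Z set_integrable_const_Q in auto)
  then have "P (SOME G'. P G')" by (rule someI[of P "\<lambda>x. G"])
  moreover have "(SOME G'. P G') = ac_gradient Q u" unfolding ac_gradient_def P_def ..
  ultimately have "P (ac_gradient Q u)" by simp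
  then obtain Z' where int: "set_integrable lebesgue Q (ac_gradient Q u)" and Z': "Z' \<in> null_sets lborel"
    "\<And>E. E \<in> sets borel \<Longrightarrow> E \<subseteq> Q - Z' \<Longrightarrow> distr_deriv Q u E = (LINT x:E|lebesgue. ac_gradient Q u x)"
    unfolding P_def by blast
  have "(LINT x:E|lebesgue. ac_gradient Q u x) = measure lborel E *\<^sub>R G" if E: "E \<in> sets borel" "E \<subseteq> Q" for E
  proof -
    have ZB: "Z \<in> sets borel" "Z' \<in> sets borel" using Z(1) Z'(1) by (auto simp: null_sets_def)
    define E' where "E' = E - (Z \<union> Z')"
    have E': "E' \<in> sets borel" "E' \<subseteq> Q - Z" "E' \<subseteq> Q - Z'" using E ZB by (auto simp: E'_def)
    have nu: "Z \<union> Z' \<in> null_sets lborel" using Z(1) Z'(1) by (rule null_sets.Un)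
    have "(LINT x:E|lebesgue. ac_gradient Q u x) = (LINT x:E'|lebesgue. ac_gradient Q u x)"
      unfolding set_lebesgue_integral_def
    proof (rule integral_cong_AE)
      show "AE x in lebesgue. indicator E x *\<^sub>R ac_gradient Q u x = indicator E' x *\<^sub>R ac_gradient Q u x"
        using AE_completion[OF AE_not_in[OF nu]] by eventually_elim (auto simp: E'_def indicator_def)
      have si: "(\<lambda>x. indicator A x *\<^sub>R ac_gradient Q u x) \<in> borel_measurable lebesgue" if A: "A \<in> sets borel" "A \<subseteq> Q" for A
      proof -
        have "set_integrable lebesgue A (ac_gradient Q u)" by (rule set_integrable_subset[OF int _ A(2)]) (use A in simp)
        then show ?thesis unfolding set_integrable_def by (rule borel_measurable_integrable)
      qed
      have "E' \<subseteq> Q" using E' by auto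
      show "(\<lambda>x. indicator E x *\<^sub>R ac_gradient Q u x) \<in> borel_measurable lebesgue" by (rule si[OF E])
      show "(\<lambda>x. indicator E' x *\<^sub>R ac_gradient Q u x) \<in> borel_measurable lebesgue" by (rule si[OF E'(1) \<open>E' \<subseteq> Q\<close>])
    qed
    also have "\<dots> = measure lborel E' *\<^sub>R G" using Z'(2)[OF E'(1,3)] Dz[OF E'(1,2)] by simp
    also have "measure lborel E' = measure lborel E"
      unfolding E'_def using nu E by (intro measure_Diff_null_set) auto
    finally show ?thesis .
  qed
  then show ?thesis using int by blast
qed

text \<open>Integrals over all measurable sets determine a density, entry by entry. Lebesgue sets
  are first replaced by their Borel main part, because the integrals are known for Borel
  sets.\<close>

lemma ac_gradient_AE: "AE x in lebesgue. x \<in> Q \<longrightarrow> ac_gradient Q u x = G"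
proof -
  have int: "integrable lebesgue (\<lambda>x. indicator Q x *\<^sub>R ac_gradient Q u x)"
    using ac_gradient_spec unfolding set_integrable_def by blast
  have intG: "integrable lebesgue (\<lambda>x. indicator Q x *\<^sub>R G)"
    using set_integrable_const_Q unfolding set_integrable_def by blast
  have comp: "AE x in lebesgue. (indicator Q x *\<^sub>R ac_gradient Q u x) $ i $ j = (indicator Q x *\<^sub>R G) $ i $ j" for i j
  proof (rule density_unique_real)
    show "integrable lebesgue (\<lambda>x. (indicator Q x *\<^sub>R ac_gradient Q u x) $ i $ j)" by (rule integrable_component[OF int])
    show "integrable lebesgue (\<lambda>x. (indicator Q x *\<^sub>R G) $ i $ j)" by (rule integrable_component[OF intG])
    fix A :: "(real^'n) set" assume A: "A \<in> sets lebesgue"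
    obtain A' where A': "A' \<in> sets borel" "AE x in lebesgue. x \<in> A \<longleftrightarrow> x \<in> A'"
    proof -
      define N where "N = main_part lborel A"
      have "N \<in> sets borel" unfolding N_def using main_part_sets[OF A] by simp
      moreover obtain N0 where N0: "N0 \<in> null_sets lborel" "null_part lborel A \<subseteq> N0"
        using null_part[OF A] by blast
      have "AE x in lebesgue. x \<notin> null_part lborel A"
        using AE_completion[OF AE_not_in[OF N0(1)]] by eventually_elim (use N0(2) in blast)
      then have "AE x in lebesgue. x \<in> A \<longleftrightarrow> x \<in> N"
        by eventually_elim (use main_part_null_part_Un[OF A] in \<open>auto simp: N_def\<close>)
      ultimately show ?thesis by (rule that)
    qed
    have *: "(LINT x:A|lebesgue. (indicator Q x *\<^sub>R F x) $ i $ j) = (LINT x:A' \<inter> Q|lebesgue. F x) $ i $ j"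
      if F: "integrable lebesgue (\<lambda>x. indicator Q x *\<^sub>R F x)" for F :: "real^'n \<Rightarrow> real^'n^'n"
    proof -
      have "(LINT x:A|lebesgue. (indicator Q x *\<^sub>R F x) $ i $ j) = (LINT x:A|lebesgue. indicator Q x *\<^sub>R F x) $ i $ j"
        by (rule set_lebesgue_integral_component[symmetric, OF F A])
      also have "(LINT x:A|lebesgue. indicator Q x *\<^sub>R F x) = (LINT x:A' \<inter> Q|lebesgue. F x)"
        unfolding set_lebesgue_integral_def
      proof (rule integral_cong_AE)
        show "AE x in lebesgue. indicator A x *\<^sub>R indicator Q x *\<^sub>R F x = indicator (A' \<inter> Q) x *\<^sub>R F x"
          using A'(2) by eventually_elim (auto simp: indicator_def)
        show "(\<lambda>x. indicator A x *\<^sub>R indicator Q x *\<^sub>R F x) \<in> borel_measurable lebesgue"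
          using integrable_mult_indicator[OF A F] by auto
        have "integrable lebesgue (\<lambda>x. indicator A' x *\<^sub>R indicator Q x *\<^sub>R F x)"
          using A'(1) by (intro integrable_mult_indicator F) auto
        moreover have "(\<lambda>x. indicator A' x *\<^sub>R indicator Q x *\<^sub>R F x) = (\<lambda>x. indicator (A' \<inter> Q) x *\<^sub>R F x)"
          by (intro ext) (auto simp: indicator_def)
        ultimately show "(\<lambda>x. indicator (A' \<inter> Q) x *\<^sub>R F x) \<in> borel_measurable lebesgue" by auto
      qed
      finally show ?thesis .
    qed
    have "A' \<inter> Q \<in> sets borel" "A' \<inter> Q \<subseteq> Q" using A'(1) by auto
    then show "(LINT x:A|lebesgue. (indicator Q x *\<^sub>R ac_gradient Q u x) $ i $ j) = (LINT x:A|lebesgue. (indicator Q x *\<^sub>R G) $ i $ j)"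
      unfolding *[OF int] *[OF intG] using ac_gradient_spec set_integral_const by metis
  qed
  have "AE x in lebesgue. \<forall>p\<in>(UNIV :: ('n \<times> 'n) set). (indicator Q x *\<^sub>R ac_gradient Q u x) $ fst p $ snd p = (indicator Q x *\<^sub>R G) $ fst p $ snd p"
    by (rule AE_finite_allI) (simp, rule comp)
  then show ?thesis by eventually_elim (auto simp: vec_eq_iff)
qed

theorem SBV_u: "u \<in> SBV Q"
proof -
  have BV: "u \<in> BV Q" unfolding BV_def using u_set_integrable has_deriv_D by blast
  have si: "set_integrable H (jump_set Q u) (jump_tensor u)"
    using T_integrable unfolding set_integrable_def T_def[abs_def] .
  have "cantor_part Q u E = 0" if E: "E \<in> sets borel" "E \<subseteq> Q" for E
  proof -
    have "(LINT x:E \<inter> jump_set Q u|H. jump_tensor u x) = (\<integral>x. indicator E x *\<^sub>R T x \<partial>H)"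
      unfolding set_lebesgue_integral_def T_def
      by (intro Bochner_Integration.integral_cong) (auto simp: indicator_def)
    then show ?thesis
      unfolding cantor_part_def using distr_deriv_eq[OF E] D_eq[OF E] ac_gradient_spec E by simp
  qed
  then show ?thesis unfolding SBV_def using BV si by blast
qed

end

section \<open>Functions determined by the signs of countably many affine functions\<close>

text \<open>\<open>Hy\<close> lists hyperplanes by unit normal and offset. Without opposite normals
  every hyperplane appears only once, so parallel members are disjoint. On a compact set finitely
  many of them decide the value of \<open>w\<close> by the signs of a point.\<close>

locale arrangement =
  fixes Q :: "(real^'n) set" and w :: "real^'n \<Rightarrow> real^'n" and G :: "real^'n^'n" and B :: real
    and Hy :: "((real^'n) \<times> real) set"
  assumes openQ': "open Q" and bddQ': "bounded Q"
    and w_borel' [measurable]: "w \<in> borel_measurable borel" and w_bdd': "\<And>x. norm (w x) \<le> B"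
    and countable_Hy: "countable Hy"
    and unit_normal: "\<And>h. h \<in> Hy \<Longrightarrow> norm (fst h) = 1"
    and no_antipodal: "\<And>h h'. h \<in> Hy \<Longrightarrow> h' \<in> Hy \<Longrightarrow> fst h' \<noteq> - fst h"
    and determined: "\<And>K. compact K \<Longrightarrow> K \<subseteq> Q \<Longrightarrow> \<exists>F\<subseteq>Hy. finite F \<and>
      (\<forall>y\<in>K. \<forall>z\<in>K. (\<forall>h\<in>F. sgn (fst h \<bullet> y - snd h) = sgn (fst h \<bullet> z - snd h)) \<longrightarrow> w y = w z)"
begin

text \<open>In the ball only the members of \<open>F\<close> through the centre matter, and only
  through the sides to which displacements point. These signs are invariant under dilation about
  \<open>x\<close>, which yields the conical structure.\<close>

definition fan :: "real^'n \<Rightarrow> ((real^'n) \<times> real) set \<Rightarrow> real \<Rightarrow> bool" where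
  "fan x F r \<longleftrightarrow> 0 < r \<and> (\<forall>y\<in>ball x r. \<forall>z\<in>ball x r.
     (\<forall>h\<in>F. fst h \<bullet> x = snd h \<longrightarrow> sgn (fst h \<bullet> (y - x)) = sgn (fst h \<bullet> (z - x))) \<longrightarrow> w y = w z)"

lemma fan_pos: "fan x F r \<Longrightarrow> 0 < r"
  by (simp add: fan_def)

lemma fanD:
  assumes "fan x F r" "dist x y < r" "dist x z < r"
    "\<And>h. h \<in> F \<Longrightarrow> fst h \<bullet> x = snd h \<Longrightarrow> sgn (fst h \<bullet> (y - x)) = sgn (fst h \<bullet> (z - x))"
  shows "w y = w z"
proof -
  have "y \<in> ball x r" "z \<in> ball x r" using assms(2,3) by auto
  then show ?thesis using assms(1,4) unfolding fan_def by metis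
qed

lemma fan_mono:
  assumes "fan x F r" "F \<subseteq> F'" shows "fan x F' r"
  unfolding fan_def
proof (intro conjI ballI impI)
  show "0 < r" using assms(1) by (simp add: fan_def)
  fix y z assume "y \<in> ball x r" "z \<in> ball x r"
    "\<forall>h\<in>F'. fst h \<bullet> x = snd h \<longrightarrow> sgn (fst h \<bullet> (y - x)) = sgn (fst h \<bullet> (z - x))"
  then show "w y = w z" using assms(2) by (intro fanD[OF assms(1)]) auto
qed

text \<open>Close to \<open>x\<close> nothing crosses a hyperplane that misses \<open>x\<close>, so
  only those through \<open>x\<close> still distinguish points.\<close>

lemma fan_of_determined:
  assumes F: "finite F" and e: "0 < e" "cball x e \<subseteq> K"
    and det: "\<forall>y\<in>K. \<forall>z\<in>K. (\<forall>h\<in>F. sgn (fst h \<bullet> y - snd h) = sgn (fst h \<bullet> z - snd h)) \<longrightarrow> w y = w z"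
  shows "\<exists>r>0. r \<le> e \<and> fan x F r"
proof -
  have "\<forall>\<^sub>F y in nhds x. fst h \<bullet> x \<noteq> snd h \<longrightarrow> sgn (fst h \<bullet> y - snd h) = sgn (fst h \<bullet> x - snd h)" for h :: "(real^'n) \<times> real"
  proof -
    have c: "isCont (\<lambda>y. fst h \<bullet> y - snd h) x" by (intro continuous_intros)
    then have t: "((\<lambda>y. fst h \<bullet> y - snd h) \<longlongrightarrow> fst h \<bullet> x - snd h) (nhds x)"
      using tendsto_at_iff_tendsto_nhds[of "\<lambda>y. fst h \<bullet> y - snd h" x] by (simp add: isCont_def)
    consider "fst h \<bullet> x - snd h < 0" | "fst h \<bullet> x - snd h = 0" | "0 < fst h \<bullet> x - snd h" by linarith
    then show ?thesis
    proof cases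
      case 1
      from order_tendstoD(2)[OF t 1] show ?thesis by eventually_elim (use 1 in auto)
    next
      case 3
      from order_tendstoD(1)[OF t 3] show ?thesis by eventually_elim (use 3 in auto)
    qed auto
  qed
  then have "\<forall>\<^sub>F y in nhds x. \<forall>h\<in>F. fst h \<bullet> x \<noteq> snd h \<longrightarrow> sgn (fst h \<bullet> y - snd h) = sgn (fst h \<bullet> x - snd h)"
    using F by (simp add: eventually_ball_finite_distrib)
  then obtain d where d: "0 < d" "\<And>y h. dist y x < d \<Longrightarrow> h \<in> F \<Longrightarrow> fst h \<bullet> x \<noteq> snd h \<Longrightarrow>
      sgn (fst h \<bullet> y - snd h) = sgn (fst h \<bullet> x - snd h)"
    unfolding eventually_nhds_metric by blast
  have "fan x F (min d e)"
    unfolding fan_def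
  proof (intro conjI ballI impI)
    fix y z assume y: "y \<in> ball x (min d e)" and z: "z \<in> ball x (min d e)"
      and s: "\<forall>h\<in>F. fst h \<bullet> x = snd h \<longrightarrow> sgn (fst h \<bullet> (y - x)) = sgn (fst h \<bullet> (z - x))"
    have "sgn (fst h \<bullet> y - snd h) = sgn (fst h \<bullet> z - snd h)" if h: "h \<in> F" for h
    proof (cases "fst h \<bullet> x = snd h")
      case True then show ?thesis using s h by (simp add: inner_diff_right)
    next
      case False
      then show ?thesis using d(2)[of y h] d(2)[of z h] h y z by (simp add: dist_commute)
    qed
    moreover have "y \<in> K" "z \<in> K" using e(2) y z by (auto simp: subset_iff)
    ultimately show "w y = w z" using det by blast
  qed (use d e in auto)
  then show ?thesis using d(1) e(1) by (intro exI[of _ "min d e"]) auto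
qed

lemma fan_exists:
  assumes "x \<in> Q"
  obtains F r where "finite F" "F \<subseteq> Hy" "fan x F r" "ball x r \<subseteq> Q"
proof -
  obtain e where e: "0 < e" "cball x e \<subseteq> Q" using openQ' assms open_contains_cball by blast
  obtain F where F: "F \<subseteq> Hy" "finite F" "\<forall>y\<in>cball x e. \<forall>z\<in>cball x e.
      (\<forall>h\<in>F. sgn (fst h \<bullet> y - snd h) = sgn (fst h \<bullet> z - snd h)) \<longrightarrow> w y = w z"
    using determined[OF compact_cball e(2)] by blast
  obtain r where r: "0 < r" "r \<le> e" "fan x F r" using fan_of_determined[OF F(2) e(1) order_refl F(3)] by blast
  have "ball x r \<subseteq> Q" using e(2) r(2) by (auto simp: subset_iff)
  then show ?thesis using that F r by blast
qed

lemma fan_conical: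
  assumes f: "fan x F r" and d: "dist x y < r" and t: "0 < t" "t \<le> 1"
  shows "w (x + t *\<^sub>R (y - x)) = w y"
proof (rule fanD[OF f _ d])
  have "dist x (x + t *\<^sub>R (y - x)) = t * dist x y" using t by (simp add: dist_norm norm_minus_commute)
  also have "\<dots> \<le> 1 * dist x y" using t by (intro mult_right_mono) auto
  finally show "dist x (x + t *\<^sub>R (y - x)) < r" using d by simp
qed (use t in \<open>simp add: sgn_mult\<close>)

sublocale conical_field Q w G B
proof
  fix x assume "x \<in> Q"
  then obtain F r where "finite F" "F \<subseteq> Hy" "fan x F r" "ball x r \<subseteq> Q" by (rule fan_exists)
  then show "\<exists>r>0. ball x r \<subseteq> Q \<and> (\<forall>y\<in>ball x r. \<forall>t. 0 < t \<and> t \<le> 1 \<longrightarrow> w (x + t *\<^sub>R (y - x)) = w y)"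
    using fan_conical[of x F r] by (intro exI[of _ r]) (simp add: fan_pos)
qed (use openQ' bddQ' w_bdd' in auto)

text \<open>The value of \<open>w\<close> just beside \<open>x\<close> in direction
  \<open>d\<close>. As the limit of a sequence it is a Borel function on the whole space; at the
  centre of a fan the sequence is eventually constant.\<close>

definition side :: "real^'n \<Rightarrow> real^'n \<Rightarrow> real^'n" where
  "side d x = lim (\<lambda>k. w (x + (1 / real (Suc k)) *\<^sub>R d))"

definition leap :: "real^'n \<Rightarrow> real^'n \<Rightarrow> real^'n" where
  "leap n x = side n x - side (- n) x"

lemma side_borel [measurable]: "side d \<in> borel_measurable borel"
  unfolding side_def[abs_def] by (rule borel_measurable_lim_metric) measurable

lemma leap_borel [measurable]: "leap n \<in> borel_measurable borel"
  unfolding leap_def[abs_def] by measurable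

lemma side_eq:
  assumes f: "fan x F r" and t: "0 < t" "t * norm d < r"
  shows "w (x + t *\<^sub>R d) = side d x"
proof -
  have "(\<lambda>k. 1 / real (Suc k) * norm d) \<longlonglongrightarrow> 0 * norm d"
    using LIMSEQ_inverse_real_of_nat by (intro tendsto_intros) (simp add: inverse_eq_divide)
  then have "\<forall>\<^sub>F k in sequentially. 1 / real (Suc k) * norm d < r"
    using fan_pos[OF f] by (intro order_tendstoD(2)) auto
  then have "\<forall>\<^sub>F k in sequentially. w (x + (1 / real (Suc k)) *\<^sub>R d) = w (x + t *\<^sub>R d)"
  proof eventually_elim
    case (elim k)
    show ?case
      by (rule fanD[OF f]) (use elim t in \<open>auto simp: dist_norm sgn_mult\<close>)
  qed
  then have "(\<lambda>k. w (x + (1 / real (Suc k)) *\<^sub>R d)) \<longlonglongrightarrow> w (x + t *\<^sub>R d)" by (rule tendsto_eventually)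
  then show ?thesis unfolding side_def by (simp add: limI)
qed

lemma side_bdd: assumes "fan x F r" shows "norm (side d x) \<le> B"
proof -
  have r: "0 < r" using assms by (rule fan_pos)
  have "r / (2 * (1 + norm d)) * norm d = r * (norm d / (2 * (1 + norm d)))" by simp
  also have "\<dots> < r * 1"
  proof (rule mult_strict_left_mono[OF _ r])
    have z: "0 < 2 * (1 + z) \<and> z < 1 * (2 * (1 + z))" if "0 \<le> z" for z :: real using that by auto
    have "0 < 2 * (1 + norm d)" "norm d < 1 * (2 * (1 + norm d))" using z[OF norm_ge_zero] by blast+
    then show "norm d / (2 * (1 + norm d)) < 1" by (simp only: pos_divide_less_eq)
  qed
  finally have "r / (2 * (1 + norm d)) * norm d < r" by simp
  moreover have "0 < r / (2 * (1 + norm d))" using r by (simp add: add_pos_nonneg)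
  ultimately have "w (x + (r / (2 * (1 + norm d))) *\<^sub>R d) = side d x" using side_eq[OF assms] by blast
  then show ?thesis using w_bdd by metis
qed

lemma T_zero:
  assumes "two_valued x r a a \<nu>" "0 < r" "norm \<nu> = 1"
  shows "T x = 0"
proof -
  have "x \<notin> jump_set Q u"
  proof
    assume "x \<in> jump_set Q u"
    then obtain a' b' \<nu>' r' where t': "a' \<noteq> b'" "norm \<nu>' = 1" "0 < r'" "two_valued x r' a' b' \<nu>'"
      unfolding jump_set_iff by blast
    show False using two_valued_unique[OF assms t'(4,3,2,1)] t'(1) by auto
  qed
  then show ?thesis by (simp add: T_def)
qed

lemma T_two_valued:
  assumes "x \<in> Q" and t: "two_valued x r a b \<nu>" "0 < r" "norm \<nu> = 1"
  shows "T x = outer (a - b) \<nu>"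
proof (cases "a = b")
  case True
  have "T x = 0" using T_zero[of x r a \<nu>] t True by simp
  then show ?thesis using True by (simp add: outer_def zero_vec_def)
next
  case False
  then have "x \<in> jump_set Q u" using assms unfolding jump_set_iff by blast
  then show ?thesis using jump_tensor_eq[OF assms(1) False t(3,2,1)] by (simp add: T_def)
qed

text \<open>With one hyperplane through \<open>x\<close>, each open half ball lies on one side of
  it, and \<open>w\<close> is constant there.\<close>

lemma T_single:
  assumes x: "x \<in> Q" and f: "fan x F r" and h: "h \<in> F" "fst h \<bullet> x = snd h" "norm (fst h) = 1"
    and single: "\<And>h'. h' \<in> F \<Longrightarrow> fst h' \<bullet> x = snd h' \<Longrightarrow> h' = h"
  shows "T x = outer (leap (fst h) x) (fst h)"
  unfolding leap_def
proof (rule T_two_valued[OF x])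
  have r: "0 < r" using f by (rule fan_pos)
  have val: "w y = side \<nu> x" if "y \<in> half_ball x r \<nu>" "\<nu> = fst h \<or> \<nu> = - fst h" for y \<nu>
  proof -
    have nn: "fst h \<bullet> fst h = 1" using h(3) by (simp add: norm_eq_1)
    have \<nu>: "norm \<nu> = 1" using that h by auto
    have "w y = w (x + (r/2) *\<^sub>R \<nu>)"
    proof (rule fanD[OF f])
      show "dist x y < r" using that by (auto simp: half_ball_def)
      show "dist x (x + (r/2) *\<^sub>R \<nu>) < r" using r \<nu> by (simp add: dist_norm)
      fix h' assume "h' \<in> F" "fst h' \<bullet> x = snd h'"
      then have "h' = h" by (rule single)
      then show "sgn (fst h' \<bullet> (y - x)) = sgn (fst h' \<bullet> (x + (r/2) *\<^sub>R \<nu> - x))"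
        using that r nn by (auto simp: half_ball_def inner_commute sgn_mult)
    qed
    also have "\<dots> = side \<nu> x" using r \<nu> by (intro side_eq[OF f]) auto
    finally show ?thesis .
  qed
  show "two_valued x r (side (fst h) x) (side (- fst h) x) (fst h)"
    unfolding two_valued_def by (rule AE_I2) (use val in auto)
qed (use fan_pos[OF f] h in auto)

lemma T_none:
  assumes f: "fan x F r" and none: "\<And>h. h \<in> F \<Longrightarrow> fst h \<bullet> x \<noteq> snd h"
  shows "T x = 0"
proof (rule T_zero)
  have "w y = w x" if "dist x y < r" for y
    by (rule fanD[OF f that]) (use fan_pos[OF f] none in auto)
  \<comment> \<open>The normal is an arbitrary unit vector: with equal values on both sides its
    direction is immaterial.\<close>
  then show "two_valued x r (w x) (w x) (axis undefined 1)"
    unfolding two_valued_def by (intro AE_I2) (auto simp: half_ball_def)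
qed (use fan_pos[OF f] in \<open>auto simp: norm_axis_1\<close>)

lemma hyper_null:
  assumes "h \<in> Hy" shows "hyper (fst h) (snd h) \<in> null_sets lborel"
proof -
  have "fst h \<noteq> 0" using unit_normal[OF assms] by auto
  then have "negligible (hyper (fst h) (snd h))" unfolding hyper_def by (intro negligible_hyperplane) auto
  then show ?thesis by (simp add: negligible_iff_null_sets null_sets_completion_iff)
qed

lemma jump_null': "\<exists>Z\<in>null_sets lborel. jump_set Q u \<subseteq> Z"
proof
  show "(\<Union>h\<in>Hy. hyper (fst h) (snd h)) \<in> null_sets lborel"
    by (rule null_sets_UN'[OF countable_Hy hyper_null])
  show "jump_set Q u \<subseteq> (\<Union>h\<in>Hy. hyper (fst h) (snd h))"
  proof
    fix x assume x: "x \<in> jump_set Q u"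
    then have "x \<in> Q" by (simp add: jump_set_def)
    then obtain F r where F: "finite F" "F \<subseteq> Hy" "fan x F r" "ball x r \<subseteq> Q" by (rule fan_exists)
    have "\<exists>h\<in>F. fst h \<bullet> x = snd h" using T_none[OF F(3)] T_nonzero[OF x] by blast
    then show "x \<in> (\<Union>h\<in>Hy. hyper (fst h) (snd h))" using F(2) by (auto simp: hyper_def)
  qed
qed

text \<open>Two members are either parallel, hence disjoint, or meet in a null set of codimension
  two; countably many of these can be discarded.\<close>

lemma AE_single:
  "AE x in H. \<forall>h\<in>Hy. \<forall>h'\<in>Hy. h \<noteq> h' \<longrightarrow> \<not> (x \<in> hyper (fst h) (snd h) \<and> x \<in> hyper (fst h') (snd h'))"
proof -
  have "AE x in H. h \<noteq> h' \<longrightarrow> \<not> (x \<in> hyper (fst h) (snd h) \<and> x \<in> hyper (fst h') (snd h'))"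
    if h: "h \<in> Hy" "h' \<in> Hy" for h h'
  proof (cases "fst h = fst h'")
    case True
    have "h \<noteq> h' \<longrightarrow> \<not> (x \<in> hyper (fst h) (snd h) \<and> x \<in> hyper (fst h') (snd h'))" for x
      using True by (auto simp: hyper_def prod_eq_iff)
    then show ?thesis by simp
  next
    case False
    have "fst h \<noteq> - fst h'" using no_antipodal[OF h(2,1)] .
    then have "emeasure H (hyper (fst h) (snd h) \<inter> hyper (fst h') (snd h')) = 0"
      using hausdorff_null_hyper_Int[of "fst h" "fst h'"] unit_normal h False by simp
    then have "hyper (fst h) (snd h) \<inter> hyper (fst h') (snd h') \<in> null_sets H"
      by (intro null_setsI) auto
    from AE_not_in[OF this] show ?thesis by eventually_elim auto
  qed
  then show ?thesis using countable_Hy by (simp add: AE_ball_countable)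
qed

lemma T_on_hyper:
  assumes x: "x \<in> Q"
    and single: "\<forall>h\<in>Hy. \<forall>h'\<in>Hy. h \<noteq> h' \<longrightarrow> \<not> (x \<in> hyper (fst h) (snd h) \<and> x \<in> hyper (fst h') (snd h'))"
    and h: "h \<in> Hy" "x \<in> hyper (fst h) (snd h)"
  shows "T x = outer (leap (fst h) x) (fst h)"
proof -
  obtain F r where F: "finite F" "F \<subseteq> Hy" "fan x F r" "ball x r \<subseteq> Q" using x by (rule fan_exists)
  have f: "fan x (insert h F) r" using F(3) by (rule fan_mono) auto
  have i: "insert h F \<subseteq> Hy" using F(2) h(1) by blast
  show ?thesis
    by (rule T_single[OF x f]) (use h single i unit_normal in \<open>auto simp: hyper_def\<close>)
qed

lemma T_off_hyper:
  assumes "\<And>h. h \<in> Hy \<Longrightarrow> x \<notin> hyper (fst h) (snd h)"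
  shows "T x = 0"
proof (cases "x \<in> Q")
  case True
  then obtain F r where F: "finite F" "F \<subseteq> Hy" "fan x F r" "ball x r \<subseteq> Q" by (rule fan_exists)
  show ?thesis by (rule T_none[OF F(3)]) (use F(2) assms in \<open>auto simp: hyper_def\<close>)
qed (simp add: T_outside)

end

text \<open>The cylinder over the piece has height one, and one more unit of radius places it in an
  open ball.\<close>

lemma hausdorff_hyper_bounded:
  fixes n :: "'a::euclidean_space"
  assumes n: "norm n = 1" and E: "E \<in> sets borel" "\<And>x. x \<in> E \<Longrightarrow> norm x \<le> R"
  shows "emeasure (hausdorff_measure (DIM('a) - 1)) (E \<inter> hyper n s) \<le> emeasure lborel (ball 0 (R + 2) :: 'a set)"
proof -
  have "cyl n s (E \<inter> hyper n s) \<subseteq> ball 0 (R + 2)"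
  proof
    fix x assume x: "x \<in> cyl n s (E \<inter> hyper n s)"
    then have s: "s \<le> n \<bullet> x" "n \<bullet> x < s + 1" and e: "x + (s - n \<bullet> x) *\<^sub>R n \<in> E"
      by (auto simp: cyl_def strip_def onto_hyper_def)
    have "norm x \<le> norm (x + (s - n \<bullet> x) *\<^sub>R n) + norm ((s - n \<bullet> x) *\<^sub>R n)"
      using norm_triangle_ineq4[of "x + (s - n \<bullet> x) *\<^sub>R n" "(s - n \<bullet> x) *\<^sub>R n"] by simp
    then show "x \<in> ball 0 (R + 2)" using E(2)[OF e] s n by simp
  qed
  then have "emeasure lborel (cyl n s (E \<inter> hyper n s)) \<le> emeasure lborel (ball 0 (R + 2) :: 'a set)"
    by (intro emeasure_mono) auto
  then show ?thesis using emeasure_hausdorff_hyper[of n "E \<inter> hyper n s" s] n E by simp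
qed


lemma hit_integrable:
  fixes n v m :: "'a::euclidean_space" and f :: "'a \<Rightarrow> real"
  assumes n: "norm n = 1" and nv: "n \<bullet> v \<noteq> 0" and mv: "m \<bullet> v = 1"
    and f: "integrable (hausdorff_measure (DIM('a) - 1)) (\<lambda>x. indicator (hyper n s) x * f x)"
    and [measurable]: "f \<in> borel_measurable borel"
  shows "integrable lborel (\<lambda>x. indicator (strip m c) x * f (hit n s v x))"
  unfolding integrable_iff_bounded
proof
  have "(\<integral>\<^sup>+x. ennreal (norm (indicator (strip m c) x * f (hit n s v x))) \<partial>lborel)
      = (\<integral>\<^sup>+x. ennreal \<bar>f (hit n s v x)\<bar> * indicator (strip m c) x \<partial>lborel)"
    by (intro nn_integral_cong) (auto simp: indicator_def)
  also have "\<dots> = ennreal \<bar>n \<bullet> v\<bar> * (\<integral>\<^sup>+x. ennreal \<bar>f x\<bar> * indicator (hyper n s) x \<partial>hausdorff_measure (DIM('a) - 1))"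
    by (rule nn_integral_hit[OF n nv mv]) measurable
  also have "(\<integral>\<^sup>+x. ennreal \<bar>f x\<bar> * indicator (hyper n s) x \<partial>hausdorff_measure (DIM('a) - 1))
      = (\<integral>\<^sup>+x. ennreal (norm (indicator (hyper n s) x * f x)) \<partial>hausdorff_measure (DIM('a) - 1))"
    by (intro nn_integral_cong) (auto simp: indicator_def)
  also have "ennreal \<bar>n \<bullet> v\<bar> * \<dots> < \<infinity>"
    using f unfolding integrable_iff_bounded by (auto simp: ennreal_mult_less_top)
  finally show "(\<integral>\<^sup>+x. ennreal (norm (indicator (strip m c) x * f (hit n s v x))) \<partial>lborel) < \<infinity>" .
qed measurable

lemma AE_not_in_hyperplane:
  fixes a :: "'a::euclidean_space"
  assumes "a \<noteq> 0 \<or> b \<noteq> 0"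
  shows "AE x in lborel. a \<bullet> x \<noteq> b"
proof -
  have "negligible {x. a \<bullet> x = b}" using assms by (rule negligible_hyperplane)
  moreover have "{x. a \<bullet> x = b} \<in> sets borel" by (rule borel_closed[OF closed_hyperplane])
  ultimately have "{x. a \<bullet> x = b} \<in> null_sets lborel"
    by (simp add: negligible_iff_null_sets null_sets_completion_iff)
  from AE_not_in[OF this] show ?thesis by eventually_elim simp
qed

section \<open>Integration by parts across the hyperplanes\<close>

context arrangement begin

text \<open>Along almost every line in direction \<open>v\<close> the finitely many relevant hyperplanes are crossed
  one at a time.\<close>

lemma AE_generic_line:
  assumes F: "finite F" "F \<subseteq> Hy" and v: "v \<noteq> 0"
  shows "AE x in lborel. (\<forall>h\<in>F. fst h \<bullet> v = 0 \<longrightarrow> fst h \<bullet> x \<noteq> snd h) \<and>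
    (\<forall>h\<in>F. \<forall>h'\<in>F. h \<noteq> h' \<longrightarrow> fst h \<bullet> v \<noteq> 0 \<longrightarrow> fst h' \<bullet> v \<noteq> 0 \<longrightarrow>
      (snd h - fst h \<bullet> x) / (fst h \<bullet> v) \<noteq> (snd h' - fst h' \<bullet> x) / (fst h' \<bullet> v))"
proof -
  have 1: "AE x in lborel. fst h \<bullet> v = 0 \<longrightarrow> fst h \<bullet> x \<noteq> snd h" if "h \<in> F" for h
  proof -
    have "norm (fst h) = 1" using unit_normal that F by blast
    then have "fst h \<noteq> 0 \<or> snd h \<noteq> 0" by auto
    from AE_not_in_hyperplane[OF this] show ?thesis by eventually_elim simp
  qed
  have 2: "AE x in lborel. h \<noteq> h' \<longrightarrow> fst h \<bullet> v \<noteq> 0 \<longrightarrow> fst h' \<bullet> v \<noteq> 0 \<longrightarrow>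
      (snd h - fst h \<bullet> x) / (fst h \<bullet> v) \<noteq> (snd h' - fst h' \<bullet> x) / (fst h' \<bullet> v)" if h: "h \<in> F" "h' \<in> F" for h h'
  proof (cases "h \<noteq> h' \<and> fst h \<bullet> v \<noteq> 0 \<and> fst h' \<bullet> v \<noteq> 0")
    case True
    define p q where "p = fst h \<bullet> v" and "q = fst h' \<bullet> v"
    have pq: "p \<noteq> 0" "q \<noteq> 0" using True by (auto simp: p_def q_def)
    have n1: "norm (fst h) = 1" "norm (fst h') = 1" using unit_normal F h by blast+
    \<comment> \<open>Simultaneous crossing means that \<open>x\<close> lies on the hyperplane with
      these coefficients. If all of them vanished, the unit normals would force \<open>p = q\<close>
      or \<open>p = - q\<close>, that is equal members or opposite normals;
      \<open>no_antipodal\<close> excludes the latter.\<close>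
    have "q *\<^sub>R fst h - p *\<^sub>R fst h' \<noteq> 0 \<or> q * snd h - p * snd h' \<noteq> 0"
    proof (rule ccontr)
      assume "\<not> ?thesis"
      then have e: "q *\<^sub>R fst h = p *\<^sub>R fst h'" "q * snd h = p * snd h'" by auto
      from e(1) have "norm (q *\<^sub>R fst h) = norm (p *\<^sub>R fst h')" by (rule arg_cong)
      from this have "\<bar>q\<bar> = \<bar>p\<bar>" using n1 by simp
      then consider "p = q" | "p = - q" by linarith
      then show False
      proof cases
        case 1
        then have "h = h'" using e pq by (simp add: prod_eq_iff)
        then show False using True by blast
      next
        case 2
        then have "q *\<^sub>R (fst h + fst h') = 0" using e(1) by (simp add: scaleR_add_right)
        then have "fst h' = - fst h" using pq(2) by (simp add: add_eq_0_iff)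
        then show False using no_antipodal[of h h'] F h by blast
      qed
    qed
    from AE_not_in_hyperplane[OF this] show ?thesis
    proof eventually_elim
      case (elim x)
      show ?case
      proof (intro impI notI)
        assume "(snd h - fst h \<bullet> x) / (fst h \<bullet> v) = (snd h' - fst h' \<bullet> x) / (fst h' \<bullet> v)"
        then have "q * (snd h - fst h \<bullet> x) = p * (snd h' - fst h' \<bullet> x)"
          using pq unfolding p_def[symmetric] q_def[symmetric] by (simp add: field_simps)
        then show False using elim by (simp add: inner_diff_left algebra_simps)
      qed
    qed
  qed auto
  have "AE x in lborel. \<forall>h\<in>F. fst h \<bullet> v = 0 \<longrightarrow> fst h \<bullet> x \<noteq> snd h"
    using 1 F(1) by (simp add: AE_finite_all)
  moreover have "AE x in lborel. \<forall>h\<in>F. \<forall>h'\<in>F. h \<noteq> h' \<longrightarrow> fst h \<bullet> v \<noteq> 0 \<longrightarrow> fst h' \<bullet> v \<noteq> 0 \<longrightarrow>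
      (snd h - fst h \<bullet> x) / (fst h \<bullet> v) \<noteq> (snd h' - fst h' \<bullet> x) / (fst h' \<bullet> v)"
    using 2 F(1) by (simp add: AE_finite_all)
  ultimately show ?thesis by eventually_elim blast
qed

text \<open>On a line through \<open>x\<close>, the jump of \<open>w\<close> at its crossing with \<open>hyper (fst h) (snd h)\<close> is
  \<open>leap\<close>, with the sign of \<open>fst h \<bullet> v\<close>.\<close>

lemma line_by_parts:
  assumes \<phi>: "C1 \<phi> g" and K0: "compact K0" "\<And>x. x \<notin> K0 \<Longrightarrow> \<phi> x = 0" "\<And>x. x \<notin> K0 \<Longrightarrow> g x = 0"
    and F: "finite F" "F \<subseteq> Hy" and fan: "\<And>x. x \<in> K0 \<Longrightarrow> \<exists>r. fan x F r" and v: "v \<noteq> 0"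
    and gen: "\<forall>h\<in>F. fst h \<bullet> v = 0 \<longrightarrow> fst h \<bullet> x \<noteq> snd h"
      "\<forall>h\<in>F. \<forall>h'\<in>F. h \<noteq> h' \<longrightarrow> fst h \<bullet> v \<noteq> 0 \<longrightarrow> fst h' \<bullet> v \<noteq> 0 \<longrightarrow>
      (snd h - fst h \<bullet> x) / (fst h \<bullet> v) \<noteq> (snd h' - fst h' \<bullet> x) / (fst h' \<bullet> v)"
  shows "(\<integral>t. w (x + t *\<^sub>R v) $ i * (g (x + t *\<^sub>R v) \<bullet> v) \<partial>lborel)
    = - (\<Sum>h\<in>{h\<in>F. fst h \<bullet> v \<noteq> 0}. sgn (fst h \<bullet> v) *
        (\<phi> (hit (fst h) (snd h) v x) * leap (fst h) (hit (fst h) (snd h) v x) $ i))"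
proof -
  define F1 where "F1 = {h\<in>F. fst h \<bullet> v \<noteq> 0}"
  define \<theta> where "\<theta> h = (snd h - fst h \<bullet> x) / (fst h \<bullet> v)" for h :: "(real^'n) \<times> real"
  define K1 where "K1 = {t. x + t *\<^sub>R v \<in> K0}"
  let ?l = "\<lambda>t. side (- v) (x + t *\<^sub>R v) $ i" and ?r = "\<lambda>t. side v (x + t *\<^sub>R v) $ i"
  have finF1: "finite F1" using F(1) by (simp add: F1_def)
  have inj: "inj_on \<theta> F1" using gen(2) unfolding inj_on_def F1_def \<theta>_def by blast
  have on: "fst h \<bullet> (x + t *\<^sub>R v) = snd h \<longleftrightarrow> h \<in> F1 \<and> t = \<theta> h" if "h \<in> F" for h t
  proof (cases "fst h \<bullet> v = 0")
    case True then show ?thesis using gen(1) that by (simp add: inner_add_right F1_def)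
  next
    case False then show ?thesis using that by (auto simp: inner_add_right F1_def \<theta>_def field_simps)
  qed
  have K1: "compact K1"
  proof -
    obtain R where R: "\<And>y. y \<in> K0 \<Longrightarrow> norm y \<le> R" using compact_imp_bounded[OF K0(1)] unfolding bounded_iff by blast
    have "closed ((\<lambda>t. x + t *\<^sub>R v) -` K0)"
      by (intro closed_vimage compact_imp_closed K0 continuous_intros)
    then have "closed K1" by (simp add: K1_def vimage_def)
    moreover have "norm t \<le> (R + norm x) / norm v" if "t \<in> K1" for t
    proof -
      have "norm (t *\<^sub>R v) \<le> norm (x + t *\<^sub>R v) + norm x" using norm_triangle_ineq4[of "x + t *\<^sub>R v" x] by simp
      then have "\<bar>t\<bar> * norm v \<le> R + norm x" using R[of "x + t *\<^sub>R v"] that by (simp add: K1_def)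
      then show ?thesis using v by (simp add: pos_le_divide_eq)
    qed
    then have "bounded K1" unfolding bounded_iff by blast
    ultimately show ?thesis by (simp add: compact_eq_bounded_closed)
  qed
  have der: "((\<lambda>t. \<phi> (x + t *\<^sub>R v)) has_real_derivative g (x + t *\<^sub>R v) \<bullet> v) (at t)" for t
  proof -
    have "((\<lambda>t. x + t *\<^sub>R v) has_derivative (\<lambda>h. h *\<^sub>R v)) (at t)" by (auto intro!: derivative_eq_intros)
    moreover have "(\<phi> has_derivative (\<lambda>h. g (x + t *\<^sub>R v) \<bullet> h)) (at (x + t *\<^sub>R v))" using \<phi> by (simp add: C1_def)
    ultimately have "((\<lambda>t. \<phi> (x + t *\<^sub>R v)) has_derivative (\<lambda>h. g (x + t *\<^sub>R v) \<bullet> (h *\<^sub>R v))) (at t)"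
      by (rule has_derivative_compose)
    then show ?thesis unfolding has_field_derivative_def by (simp add: mult.commute[of _ "_ \<bullet> v"])
  qed
  have "(\<integral>t. w (x + t *\<^sub>R v) $ i * (g (x + t *\<^sub>R v) \<bullet> v) \<partial>lborel) = - (\<Sum>t\<in>\<theta> ` F1. \<phi> (x + t *\<^sub>R v) * (?r t - ?l t))"
  proof (rule piecewise_constant_integral_by_parts[OF _ K1 der])
    show "finite (\<theta> ` F1)" using finF1 by blast
    have "continuous_on UNIV (\<lambda>t. g (x + t *\<^sub>R v))"
      by (rule continuous_on_compose2[of UNIV g]) (use \<phi> in \<open>auto simp: C1_def intro!: continuous_intros\<close>)
    then show "continuous_on UNIV (\<lambda>t. g (x + t *\<^sub>R v) \<bullet> v)" by (intro continuous_intros)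
    show "\<And>t. t \<notin> K1 \<Longrightarrow> \<phi> (x + t *\<^sub>R v) = 0" "\<And>t. t \<notin> K1 \<Longrightarrow> g (x + t *\<^sub>R v) \<bullet> v = 0"
      using K0 by (auto simp: K1_def)
    show "\<exists>d>0. (\<forall>s\<in>{t - d<..<t}. w (x + s *\<^sub>R v) $ i = ?l t) \<and> (\<forall>s\<in>{t<..<t + d}. w (x + s *\<^sub>R v) $ i = ?r t)"
      if tK: "t \<in> K1" for t
    proof -
      obtain r where r: "fan (x + t *\<^sub>R v) F r" using fan tK unfolding K1_def by blast
      have d: "0 < r / norm v" using fan_pos[OF r] v by simp
      have "w (x + s *\<^sub>R v) = side (- v) (x + t *\<^sub>R v)" if "s \<in> {t - r / norm v<..<t}" for s
      proof -
        have "t - s < r / norm v" using that by auto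
        then have "(t - s) * norm (- v) < r" using v by (simp add: pos_less_divide_eq)
        from side_eq[OF r _ this] that show ?thesis by (simp add: algebra_simps)
      qed
      moreover have "w (x + s *\<^sub>R v) = side v (x + t *\<^sub>R v)" if "s \<in> {t<..<t + r / norm v}" for s
      proof -
        have "s - t < r / norm v" using that by auto
        then have "(s - t) * norm v < r" using v by (simp add: pos_less_divide_eq)
        from side_eq[OF r _ this] that show ?thesis by (simp add: algebra_simps)
      qed
      ultimately show ?thesis using d by (intro exI[of _ "r / norm v"]) auto
    qed
    show "w (x + t *\<^sub>R v) $ i = ?l t \<and> ?r t = ?l t" if t: "t \<in> K1" "t \<notin> \<theta> ` F1" for t
    proof -
      obtain r where r: "fan (x + t *\<^sub>R v) F r" using fan t unfolding K1_def by blast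
      have none: "fst h \<bullet> (x + t *\<^sub>R v) \<noteq> snd h" if "h \<in> F" for h using on[OF that] t(2) by blast
      have r0: "0 < r" using r by (rule fan_pos)
      have c: "w y = w (x + t *\<^sub>R v)" if "dist (x + t *\<^sub>R v) y < r" for y
        by (rule fanD[OF r that]) (use r0 none in auto)
      have sd: "side d (x + t *\<^sub>R v) = w (x + t *\<^sub>R v)" if d: "d \<noteq> 0" for d
      proof -
        have "0 < r / (2 * norm d)" "r / (2 * norm d) * norm d < r" using r0 d by auto
        from side_eq[OF r this] c[of "x + t *\<^sub>R v + (r / (2 * norm d)) *\<^sub>R d"] r0 d show ?thesis
          by (simp add: dist_norm)
      qed
      show ?thesis using sd[of v] sd[of "- v"] v by simp
    qed
    have "continuous_on UNIV (\<lambda>y::real^'n. y $ i)" by (intro continuous_intros)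
    then have m: "(\<lambda>y::real^'n. y $ i) \<in> borel_measurable borel" by (rule borel_measurable_continuous_onI)
    have "(\<lambda>t. w (x + t *\<^sub>R v)) \<in> borel_measurable borel" by measurable
    from measurable_compose[OF this m] show "(\<lambda>t. w (x + t *\<^sub>R v) $ i) \<in> borel_measurable borel" .
    show "\<bar>w (x + t *\<^sub>R v) $ i\<bar> \<le> B" for t
      using component_le_norm_cart[of "w (x + t *\<^sub>R v)" i] w_bdd[of "x + t *\<^sub>R v"] by linarith
  qed
  also have "(\<Sum>t\<in>\<theta> ` F1. \<phi> (x + t *\<^sub>R v) * (?r t - ?l t)) = (\<Sum>h\<in>F1. \<phi> (x + \<theta> h *\<^sub>R v) * (?r (\<theta> h) - ?l (\<theta> h)))"
    using inj by (subst sum.reindex) (auto simp: o_def)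
  also have "\<dots> = (\<Sum>h\<in>F1. sgn (fst h \<bullet> v) *
        (\<phi> (hit (fst h) (snd h) v x) * leap (fst h) (hit (fst h) (snd h) v x) $ i))"
  proof (rule sum.cong[OF refl])
    fix h assume h: "h \<in> F1"
    have hp: "x + \<theta> h *\<^sub>R v = hit (fst h) (snd h) v x" by (simp add: hit_def \<theta>_def)
    define p where "p = hit (fst h) (snd h) v x"
    have hv: "fst h \<bullet> v \<noteq> 0" "h \<in> F" using h by (auto simp: F1_def)
    show "\<phi> (x + \<theta> h *\<^sub>R v) * (?r (\<theta> h) - ?l (\<theta> h)) = sgn (fst h \<bullet> v) *
        (\<phi> (hit (fst h) (snd h) v x) * leap (fst h) (hit (fst h) (snd h) v x) $ i)"
    proof (cases "p \<in> K0")
      case True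
      then obtain r where r: "fan p F r" using fan by blast
      have r0: "0 < r" using r by (rule fan_pos)
      \<comment> \<open>Crossing times of distinct transversal members differ on this line, and the
        other members miss it, so \<open>h\<close> is alone at \<open>p\<close>.\<close>
      have single: "h' = h" if "h' \<in> F" "fst h' \<bullet> p = snd h'" for h'
        using on[OF that(1), of "\<theta> h"] that(2) h inj unfolding hp p_def by (auto simp: inj_on_def)
      have n: "fst h \<bullet> fst h = 1" "fst h \<noteq> 0" using unit_normal[of h] hv(2) F(2) by (auto simp: norm_eq_1)
      \<comment> \<open>With \<open>h\<close> alone at \<open>p\<close>, the value beside
        \<open>p\<close> depends only on the side of \<open>h\<close> to which the direction points;
        so \<open>v\<close> may be traded for the normal or its opposite.\<close>
      have same: "side d p = side d' p" if d: "d \<noteq> 0" "d' \<noteq> 0" "sgn (fst h \<bullet> d) = sgn (fst h \<bullet> d')" for d d'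
      proof -
        have a: "0 < r / (2 * norm d)" "r / (2 * norm d) * norm d < r"
          "0 < r / (2 * norm d')" "r / (2 * norm d') * norm d' < r" using r0 d by auto
        have "w (p + (r / (2 * norm d)) *\<^sub>R d) = w (p + (r / (2 * norm d')) *\<^sub>R d')"
          by (rule fanD[OF r]) (use r0 d single in \<open>auto simp: dist_norm sgn_mult dest!: single\<close>)
        then show ?thesis using side_eq[OF r a(1,2)] side_eq[OF r a(3,4)] by simp
      qed
      have "side v p - side (- v) p = sgn (fst h \<bullet> v) *\<^sub>R leap (fst h) p"
      proof (cases "0 < fst h \<bullet> v")
        case True
        then show ?thesis using same[of v "fst h"] same[of "- v" "- fst h"] v n by (simp add: leap_def)
      next
        case False
        then have neg: "fst h \<bullet> v < 0" using hv by simp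
        then show ?thesis using same[of v "- fst h"] same[of "- v" "fst h"] v n by (simp add: leap_def)
      qed
      from arg_cong[OF this, of "\<lambda>y. y $ i"] show ?thesis unfolding hp p_def[symmetric] by simp
    next
      case False
      then show ?thesis using K0(2)[OF False] unfolding hp p_def by simp
    qed
  qed
  finally show ?thesis unfolding F1_def .
qed

text \<open>On lines parallel to axis \<open>j\<close> the integral becomes a sum over crossings.
  Each crossing term integrates to a surface integral with the factor
  \<open>\<bar>fst h \<bullet> v\<bar>\<close>, which the sign of the crossing turns into component
  \<open>j\<close> of the normal. As \<open>H\<close>-almost every point lies on at most one member,
  the sum over \<open>F\<close> reassembles \<open>T\<close>.\<close>

lemma by_parts':
  assumes \<phi>: "C1 \<phi> g" and K0: "compact K0" "K0 \<subseteq> Q" "\<And>x. x \<notin> K0 \<Longrightarrow> \<phi> x = 0"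
  shows "(\<integral>x. w x $ i * (g x \<bullet> axis j 1) \<partial>lborel) = - (\<integral>x. \<phi> x * T x $ i $ j \<partial>H)"
proof -
  define v :: "real^'n" where "v = axis j 1"
  have v: "v \<noteq> 0" "v \<bullet> v = 1" by (auto simp: v_def axis_eq_0_iff inner_axis_axis)
  have g0: "\<And>x. x \<notin> K0 \<Longrightarrow> g x = 0" by (rule C1_zero_outside[OF \<phi> compact_imp_closed[OF K0(1)] K0(3)])
  \<comment> \<open>The compact support is thickened so that one finite set \<open>F\<close>
    provides a fan at each of its points.\<close>
  obtain e where e: "0 < e" "(\<Union>x\<in>K0. cball x e) \<subseteq> Q"
    by (rule compact_subset_open_imp_cball_epsilon_subset[OF K0(1) openQ K0(2)])
  obtain F where F: "F \<subseteq> Hy" "finite F" and Fdet: "\<forall>y\<in>(\<Union>x\<in>K0. cball x e). \<forall>z\<in>(\<Union>x\<in>K0. cball x e).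
      (\<forall>h\<in>F. sgn (fst h \<bullet> y - snd h) = sgn (fst h \<bullet> z - snd h)) \<longrightarrow> w y = w z"
    using determined[OF compact_minkowski_sum_cball[OF K0(1)] e(2)] by blast
  have fan: "\<exists>r. fan x F r" if "x \<in> K0" for x
  proof -
    have "cball x e \<subseteq> (\<Union>x\<in>K0. cball x e)" using that by blast
    from fan_of_determined[OF F(2) e(1) this Fdet] show ?thesis by blast
  qed
  have [measurable]: "\<phi> \<in> borel_measurable borel" using C1_continuous[OF \<phi>] by (rule borel_measurable_continuous_onI)
  have gc: "continuous_on UNIV (\<lambda>x. g x \<bullet> v)" using \<phi> unfolding C1_def by (intro continuous_intros) auto
  then have [measurable]: "(\<lambda>x. g x \<bullet> v) \<in> borel_measurable borel" by (rule borel_measurable_continuous_onI)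
  have "continuous_on UNIV (\<lambda>y::real^'n. y $ i)" by (intro continuous_intros)
  then have cm: "(\<lambda>y::real^'n. y $ i) \<in> borel_measurable borel" by (rule borel_measurable_continuous_onI)
  have [measurable]: "(\<lambda>x. w x $ i) \<in> borel_measurable borel" by (rule measurable_compose[OF w_borel cm])
  have [measurable]: "(\<lambda>x. leap n x $ i) \<in> borel_measurable borel" for n by (rule measurable_compose[OF leap_borel cm])
  have B0: "0 \<le> B" using w_bdd[of 0] norm_ge_zero order_trans by blast
  have int: "integrable lborel (\<lambda>x. w x $ i * (g x \<bullet> v))"
  proof (rule Bochner_Integration.integrable_bound)
    show "integrable lborel (\<lambda>x. B * (g x \<bullet> v))"
      using integral_derivative_compact_support(2)[OF \<phi> K0(1,3) v(1)] by simp
    have "norm (w x $ i * (g x \<bullet> v)) \<le> norm (B * (g x \<bullet> v))" for x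
    proof -
      have "\<bar>w x $ i\<bar> \<le> \<bar>B\<bar>" using component_le_norm_cart[of "w x" i] w_bdd[of x] by linarith
      then show ?thesis by (auto simp: abs_mult intro: mult_right_mono)
    qed
    then show "AE x in lborel. norm (w x $ i * (g x \<bullet> v)) \<le> norm (B * (g x \<bullet> v))" by simp
  qed measurable
  have "compact (\<phi> ` K0)"
    using K0(1) C1_continuous[OF \<phi>] by (intro compact_continuous_image) (auto intro: continuous_on_subset)
  then have "bounded (\<phi> ` K0)" by (rule compact_imp_bounded)
  then obtain c where c: "0 < c" "\<forall>y\<in>\<phi> ` K0. norm y \<le> c" unfolding bounded_pos by blast
  have cb: "\<bar>\<phi> x\<bar> \<le> c" for x using c K0(3)[of x] by (cases "x \<in> K0") auto
  have leap_b: "norm (leap n x) \<le> 2 * B" if xK: "x \<in> K0" for n x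
  proof -
    obtain r where r: "fan x F r" using fan[OF xK] by blast
    show ?thesis unfolding leap_def
      using norm_triangle_ineq4[of "side n x" "side (- n) x"] side_bdd[OF r, of n] side_bdd[OF r, of "- n"] by linarith
  qed
  define f where "f n x = \<phi> x * leap n x $ i" for n x
  have f_borel [measurable]: "f n \<in> borel_measurable borel" for n unfolding f_def[abs_def] by measurable
  have fint: "integrable H (\<lambda>x. indicator (hyper (fst h) (snd h)) x * f (fst h) x)" if h: "h \<in> F" for h
  proof (rule Bochner_Integration.integrable_bound)
    have K0b: "K0 \<in> sets borel" using K0(1) by (simp add: borel_compact)
    have "norm (fst h) = 1" using unit_normal h F(1) by blast
    moreover obtain R where "\<And>x. x \<in> K0 \<Longrightarrow> norm x \<le> R"
      using compact_imp_bounded[OF K0(1)] unfolding bounded_iff by blast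
    ultimately have "emeasure H (K0 \<inter> hyper (fst h) (snd h)) \<le> emeasure lborel (ball 0 (R + 2) :: (real^'n) set)"
      using hausdorff_hyper_bounded[of "fst h" K0 R "snd h"] K0b by simp
    then have "emeasure H (K0 \<inter> hyper (fst h) (snd h)) < \<infinity>"
      using emeasure_lborel_ball_finite by (rule le_less_trans)
    then show "integrable H (\<lambda>x. (c * (2 * B)) * indicator (K0 \<inter> hyper (fst h) (snd h)) x)"
      using K0b by (intro integrable_mult_right integrable_real_indicator) auto
    have "norm (indicator (hyper (fst h) (snd h)) x * f (fst h) x)
        \<le> norm ((c * (2 * B)) * indicator (K0 \<inter> hyper (fst h) (snd h)) x)" for x
    proof (cases "x \<in> K0")
      case True
      have "\<bar>leap (fst h) x $ i\<bar> \<le> 2 * B"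
        using component_le_norm_cart[of "leap (fst h) x" i] leap_b[OF True, of "fst h"] by linarith
      then have "\<bar>\<phi> x\<bar> * \<bar>leap (fst h) x $ i\<bar> \<le> c * (2 * B)"
        using cb[of x] c B0 by (intro mult_mono) auto
      then show ?thesis using True B0 c by (auto simp: f_def indicator_def abs_mult)
    next
      case False then show ?thesis using K0(3) by (simp add: f_def)
    qed
    then show "AE x in H. norm (indicator (hyper (fst h) (snd h)) x * f (fst h) x)
        \<le> norm ((c * (2 * B)) * indicator (K0 \<inter> hyper (fst h) (snd h)) x)" by simp
    show "(\<lambda>x. indicator (hyper (fst h) (snd h)) x * f (fst h) x) \<in> borel_measurable H" by measurable
  qed
  define F1 where "F1 = {h\<in>F. fst h \<bullet> v \<noteq> 0}"
  have F1: "finite F1" using F by (simp add: F1_def)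
  let ?I = "\<lambda>h. \<integral>x. indicator (hyper (fst h) (snd h)) x * f (fst h) x \<partial>H"
  have "(\<integral>x. w x $ i * (g x \<bullet> v) \<partial>lborel)
      = (\<integral>x. indicator (strip v 0) x * (\<integral>t. w (x + t *\<^sub>R v) $ i * (g (x + t *\<^sub>R v) \<bullet> v) \<partial>lborel) \<partial>lborel)"
    by (rule integral_slice[OF int v(2), symmetric])
  also have "\<dots> = (\<integral>x. - (\<Sum>h\<in>F1. sgn (fst h \<bullet> v) * (indicator (strip v 0) x * f (fst h) (hit (fst h) (snd h) v x))) \<partial>lborel)"
  proof (rule integral_cong_AE)
    show "AE x in lborel. indicator (strip v 0) x * (\<integral>t. w (x + t *\<^sub>R v) $ i * (g (x + t *\<^sub>R v) \<bullet> v) \<partial>lborel) =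
      - (\<Sum>h\<in>F1. sgn (fst h \<bullet> v) * (indicator (strip v 0) x * f (fst h) (hit (fst h) (snd h) v x)))"
      using AE_generic_line[OF F(2,1) v(1)]
    proof eventually_elim
      case (elim x)
      have "(\<integral>t. w (x + t *\<^sub>R v) $ i * (g (x + t *\<^sub>R v) \<bullet> v) \<partial>lborel)
          = - (\<Sum>h\<in>F1. sgn (fst h \<bullet> v) * f (fst h) (hit (fst h) (snd h) v x))"
        unfolding F1_def f_def
        by (rule line_by_parts[OF \<phi> K0(1,3) g0 F(2,1) fan v(1)]) (use elim in auto)
      then show ?case by (simp add: sum_distrib_left mult_ac)
    qed
    show "(\<lambda>x. indicator (strip v 0) x * (\<integral>t. w (x + t *\<^sub>R v) $ i * (g (x + t *\<^sub>R v) \<bullet> v) \<partial>lborel)) \<in> borel_measurable lborel"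
    proof -
      have [measurable]: "(\<lambda>p. w (fst p + snd p *\<^sub>R v) $ i * (g (fst p + snd p *\<^sub>R v) \<bullet> v)) \<in> borel_measurable (lborel \<Otimes>\<^sub>M lborel)"
      proof -
        have a: "(\<lambda>p::(real^'n) \<times> real. fst p + snd p *\<^sub>R v) \<in> lborel \<Otimes>\<^sub>M lborel \<rightarrow>\<^sub>M borel" by measurable
        have b: "(\<lambda>x. w x $ i * (g x \<bullet> v)) \<in> borel_measurable borel" by measurable
        from measurable_compose[OF a b] show ?thesis .
      qed
      have "(\<lambda>x. \<integral>t. w (x + t *\<^sub>R v) $ i * (g (x + t *\<^sub>R v) \<bullet> v) \<partial>lborel) \<in> borel_measurable lborel"
        by (rule lborel.borel_measurable_lebesgue_integral) (simp add: case_prod_beta')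
      then show ?thesis by measurable
    qed
    show "(\<lambda>x. - (\<Sum>h\<in>F1. sgn (fst h \<bullet> v) * (indicator (strip v 0) x * f (fst h) (hit (fst h) (snd h) v x)))) \<in> borel_measurable lborel"
      by measurable
  qed
  also have "\<dots> = - (\<Sum>h\<in>F1. \<integral>x. sgn (fst h \<bullet> v) * (indicator (strip v 0) x * f (fst h) (hit (fst h) (snd h) v x)) \<partial>lborel)"
  proof (subst integral_minus, subst Bochner_Integration.integral_sum)
    show "integrable lborel (\<lambda>x. sgn (fst h \<bullet> v) * (indicator (strip v 0) x * f (fst h) (hit (fst h) (snd h) v x)))" if "h \<in> F1" for h
    proof (rule integrable_mult_right, rule hit_integrable)
      have "h \<in> Hy" using that F by (auto simp: F1_def)
      then show "norm (fst h) = 1" by (rule unit_normal)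
      show "integrable (hausdorff_measure (DIM(real^'n) - 1)) (\<lambda>x. indicator (hyper (fst h) (snd h)) x * f (fst h) x)"
        using fint that by (simp add: F1_def)
    qed (use that v in \<open>auto simp: F1_def\<close>)
  qed simp
  also have "\<dots> = - (\<Sum>h\<in>F1. fst h \<bullet> v * ?I h)"
  proof -
    have "(\<integral>x. sgn (fst h \<bullet> v) * (indicator (strip v 0) x * f (fst h) (hit (fst h) (snd h) v x)) \<partial>lborel) = fst h \<bullet> v * ?I h"
      if h: "h \<in> F1" for h
    proof -
      have "h \<in> Hy" using h F by (auto simp: F1_def)
      then have hv: "norm (fst h) = 1" "fst h \<bullet> v \<noteq> 0" using h by (auto simp: F1_def intro: unit_normal)
      have "(\<integral>x. sgn (fst h \<bullet> v) * (indicator (strip v 0) x * f (fst h) (hit (fst h) (snd h) v x)) \<partial>lborel)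
          = sgn (fst h \<bullet> v) * (\<bar>fst h \<bullet> v\<bar> * ?I h)"
        using integral_hit[OF hv v(2) f_borel[of "fst h"], of 0 "snd h"] by simp
      then show ?thesis by (simp add: sgn_mult_abs flip: mult.assoc)
    qed
    then show ?thesis by simp
  qed
  also have "(\<Sum>h\<in>F1. fst h \<bullet> v * ?I h) = (\<Sum>h\<in>F. fst h \<bullet> v * ?I h)"
    using F(2) unfolding F1_def by (intro sum.mono_neutral_left) auto
  also have "\<dots> = (\<integral>x. (\<Sum>h\<in>F. fst h \<bullet> v * (indicator (hyper (fst h) (snd h)) x * f (fst h) x)) \<partial>H)"
    using fint by (subst Bochner_Integration.integral_sum) auto
  also have "\<dots> = (\<integral>x. \<phi> x * T x $ i $ j \<partial>H)"
  proof (rule integral_cong_AE)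
    show "AE x in H. (\<Sum>h\<in>F. fst h \<bullet> v * (indicator (hyper (fst h) (snd h)) x * f (fst h) x)) = \<phi> x * T x $ i $ j"
      using AE_single
    proof eventually_elim
      case (elim x)
      show ?case
      proof (cases "x \<in> K0")
        case False then show ?thesis using K0(3) by (simp add: f_def)
      next
        case True
        then obtain r where r: "fan x F r" using fan by blast
        show ?thesis
        proof (cases "\<exists>h\<in>F. x \<in> hyper (fst h) (snd h)")
          case False
          then have "T x = 0" by (intro T_none[OF r]) (auto simp: hyper_def)
          moreover have "(\<Sum>h\<in>F. fst h \<bullet> v * (indicator (hyper (fst h) (snd h)) x * f (fst h) x)) = 0"
            using False by (intro sum.neutral) auto
          ultimately show ?thesis by simp
        next
          case True
          then obtain h where h: "h \<in> F" "x \<in> hyper (fst h) (snd h)" by blast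
          have hH: "h \<in> Hy" using h F by blast
          have oth: "x \<notin> hyper (fst h') (snd h')" if "h' \<in> F" "h' \<noteq> h" for h'
            using elim that h F by blast
          have "(\<Sum>h'\<in>F. fst h' \<bullet> v * (indicator (hyper (fst h') (snd h')) x * f (fst h') x)) = fst h \<bullet> v * f (fst h) x"
            using F(2) h oth by (subst sum.remove[OF F(2) h(1)]) (auto intro!: sum.neutral)
          moreover have "T x = outer (leap (fst h) x) (fst h)"
            by (rule T_on_hyper[OF _ elim hH h(2)]) (use \<open>x \<in> K0\<close> K0(2) in blast)
          ultimately show ?thesis by (simp add: outer_def f_def v_def inner_axis)
        qed
      qed
    qed
    have "continuous_on UNIV (\<lambda>A::real^'n^'n. A $ i $ j)" by (intro continuous_intros)
    then have "(\<lambda>A::real^'n^'n. A $ i $ j) \<in> borel_measurable borel" by (rule borel_measurable_continuous_onI)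
    from measurable_compose[OF T_borel this] show "(\<lambda>x. \<phi> x * T x $ i $ j) \<in> borel_measurable H" by measurable
  qed measurable
  finally show ?thesis unfolding v_def .
qed

lemma conical_SBV_I:
  assumes "(\<integral>\<^sup>+x. ennreal (norm (T x)) \<partial>H) < \<infinity>"
  shows "conical_SBV Q w G B"
  by unfold_locales (use assms jump_null' by_parts' in auto)

end

lemma norm_outer: "norm (outer a \<nu>) = norm a * norm \<nu>"
proof -
  have "norm (outer a \<nu> $ i) = \<bar>a $ i\<bar> * norm \<nu>" for i
  proof -
    have "outer a \<nu> $ i = a $ i *\<^sub>R \<nu>" by (simp add: outer_def vec_eq_iff)
    then show ?thesis by simp
  qed
  then have "norm (outer a \<nu>) = L2_set (\<lambda>i. \<bar>a $ i\<bar> * norm \<nu>) UNIV" by (simp add: norm_vec_def)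
  also have "\<dots> = L2_set (\<lambda>i. \<bar>a $ i\<bar>) UNIV * norm \<nu>" by (rule L2_set_left_distrib[symmetric]) simp
  finally show ?thesis by (simp add: norm_vec_def)
qed

lemma trace_outer: "trace (outer a \<nu>) = a \<bullet> \<nu>"
  by (simp add: trace_def outer_def inner_vec_def)

lemma abs_trace_le: "\<bar>trace (A :: real^'n^'n)\<bar> \<le> real CARD('n) * norm A"
proof -
  have "\<bar>trace A\<bar> \<le> (\<Sum>i\<in>UNIV. \<bar>A $ i $ i\<bar>)" unfolding trace_def by (rule sum_abs)
  also have "\<dots> \<le> (\<Sum>i\<in>(UNIV::'n set). norm A)"
  proof (rule sum_mono)
    fix i show "\<bar>A $ i $ i\<bar> \<le> norm A"
      using component_le_norm_cart[of "A $ i" i] Finite_Cartesian_Product.norm_nth_le[of A i] by linarith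
  qed
  finally show ?thesis by simp
qed

text \<open>Each one-sided value is attained on a ray ending at \<open>x\<close>; letting the point
  move to \<open>x\<close> along the ray compares the value with \<open>L x\<close>. The two values
  therefore differ by at most \<open>2 * \<eta>\<close>.\<close>

lemma (in conical_field) T_norm_le:
  assumes x: "x \<in> Q" and r: "0 < r" and L: "bounded_linear L" and near: "\<And>y. y \<in> ball x r \<Longrightarrow> norm (w y - L y) \<le> \<eta>"
  shows "norm (T x) \<le> 2 * \<eta>"
proof (cases "x \<in> jump_set Q u")
  case True
  then obtain a b \<nu> r' where t: "a \<noteq> b" "norm \<nu> = 1" "0 < r'" "two_valued x r' a b \<nu>"
    unfolding jump_set_iff by blast
  obtain s where s: "0 < s" "ball x s \<subseteq> Q" "\<And>y t. y \<in> ball x s \<Longrightarrow> 0 < t \<Longrightarrow> t \<le> 1 \<Longrightarrow> w (x + t *\<^sub>R (y - x)) = w y"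
    using conical[OF x] by blast
  have val: "norm (c - L x) \<le> \<eta>" if c: "AE y in lborel. y \<in> half_ball x r' n \<longrightarrow> w y = c" "norm n = 1" for c n
  proof -
    define \<rho> where "\<rho> = min r' (min r s)"
    have \<rho>: "0 < \<rho>" "\<rho> \<le> r'" "\<rho> \<le> r" "\<rho> \<le> s" using r s(1) t(3) by (auto simp: \<rho>_def)
    have "\<exists>y\<in>half_ball x \<rho> n. w y = c"
    proof (rule ccontr)
      assume no: "\<not> ?thesis"
      have "AE y in lborel. y \<notin> half_ball x \<rho> n"
        using c(1) by eventually_elim (use no \<rho> in \<open>auto simp: half_ball_def\<close>)
      then have "negligible (half_ball x \<rho> n)"
        by (simp add: negligible_iff_null_sets AE_iff_null_sets[symmetric] null_sets_completion_iff)
      moreover have "x + (\<rho>/2) *\<^sub>R n \<in> half_ball x \<rho> n"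
        using \<rho> c(2) norm_eq_1[of n] by (simp add: half_ball_def dist_norm)
      ultimately show False using open_not_negligible[OF half_ball_open] by blast
    qed
    then obtain y where y: "y \<in> half_ball x \<rho> n" "w y = c" by blast
    then have d: "dist x y < \<rho>" by (simp add: half_ball_def)
    have "norm (c - L (x + t *\<^sub>R (y - x))) \<le> \<eta>" if "0 < t" "t \<le> 1" for t
    proof -
      have "norm (t *\<^sub>R (y - x)) \<le> 1 * norm (y - x)" using that by (simp add: mult_left_le_one_le)
      then have "x + t *\<^sub>R (y - x) \<in> ball x r" using d \<rho> by (simp add: dist_norm norm_minus_commute)
      from near[OF this] s(3)[of y t] that d \<rho> y(2) show ?thesis by simp
    qed
    then have "\<forall>\<^sub>F t in at_right 0. norm (c - L (x + t *\<^sub>R (y - x))) \<le> \<eta>"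
      by (intro eventually_at_rightI[of 0 1]) auto
    moreover have "((\<lambda>t. norm (c - L (x + t *\<^sub>R (y - x)))) \<longlongrightarrow> norm (c - L (x + 0 *\<^sub>R (y - x)))) (at_right 0)"
      by (intro tendsto_intros bounded_linear.tendsto[OF L])
    ultimately show ?thesis using tendsto_upperbound[of _ _ "at_right (0::real)"] by fastforce
  qed
  have "norm (a - L x) \<le> \<eta>" "norm (b - L x) \<le> \<eta>" using val two_valuedD[OF t(4)] t(2) by auto
  then have "norm (a - b) \<le> 2 * \<eta>" using norm_triangle_ineq4[of "a - L x" "b - L x"] by simp
  moreover have "T x = outer (a - b) \<nu>" using True jump_tensor_eq[OF x t] by (simp add: T_def)
  ultimately show ?thesis using t(2) by (simp add: norm_outer)
next
  case False
  have "norm (w x - L x) \<le> \<eta>" using near[of x] r by simp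
  then have "0 \<le> \<eta>" using norm_ge_zero order_trans by blast
  then show ?thesis using False by (simp add: T_def)
qed

text \<open>The Gauss--Green formula gives the total mass \<open>C\<close> of the derivative, of
  which \<open>G\<close> is the absolutely continuous share because the cube has volume one.\<close>

lemma (in conical_SBV) integral_T:
  assumes Q: "Q = unit_cube" and tr: "has_trace unit_cube u (\<lambda>x. C *v x)"
  shows "(\<integral>x. T x \<partial>H) = C - G"
proof -
  have "(\<integral>x. T x $ i $ j \<partial>H) = C $ i $ j - G $ i $ j" for i j
  proof -
    interpret cd: cube_derivative u C M \<sigma> i j
    proof (rule cube_derivative.intro)
      show "set_integrable lebesgue unit_cube u" using u_set_integrable unfolding Q .
      show "finite_measure M" by (rule finite_M)
      show "sets M = sets (restrict_space borel unit_cube)" using setsM unfolding Q .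
      show "integrable M \<sigma>" by (rule \<sigma>_integrable)
      show "has_trace unit_cube u (\<lambda>x. C *v x)" by (rule tr)
      fix \<phi> :: "real^'n \<Rightarrow> real" assume "\<phi> \<in> test_functions unit_cube"
      then have "\<phi> \<in> test_functions Q" unfolding Q .
      from deriv_identity[OF this, of i j]
      show "(LINT x:unit_cube|lebesgue. u x $ i * frechet_derivative \<phi> (at x) (axis j 1)) = - (LINT x|M. \<phi> x * \<sigma> x $ i $ j)"
        unfolding Q .
    qed
    have "C $ i $ j = (\<integral>x. 1 * \<sigma> x $ i $ j \<partial>M)" using cd.total_derivative by (simp add: cd.\<tau>_def)
    also have "\<dots> = G $ i $ j * (\<integral>x. indicator Q x * 1 \<partial>lborel) + (\<integral>x. 1 * T x $ i $ j \<partial>H)"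
      by (rule integral_\<sigma>[of "\<lambda>x. 1" 1]) auto
    also have "(\<integral>x. indicator Q x * 1 \<partial>lborel) = (1::real)"
      using emeasure_unit_cube[where ?'n='n] by (simp add: Q measure_def)
    finally show ?thesis by simp
  qed
  moreover have "(\<integral>x. T x \<partial>H) $ i $ j = (\<integral>x. T x $ i $ j \<partial>H)" for i j
  proof -
    have bl: "bounded_linear (\<lambda>y::real^'n^'n. y $ i $ j)"
      using bounded_linear_compose[OF bounded_linear_vec_nth bounded_linear_vec_nth] .
    show ?thesis using integral_bounded_linear[OF bl T_integrable] by simp
  qed
  ultimately show ?thesis by (simp add: vec_eq_iff)
qed

lemma (in conical_field) jump_energy_T: "jump_energy Q u = (\<integral>\<^sup>+x. ennreal \<bar>trace (T x)\<bar> \<partial>H)"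
  unfolding jump_energy_def
  by (intro nn_integral_cong) (auto simp: T_def indicator_def jump_tensor_outer trace_outer trace_def[of 0])

section \<open>Staircase approximation of a linear map, refined towards the boundary of the cube\<close>

text \<open>The vector \<open>\<kappa>\<close> only serves to exclude antipodal normals. The steps have width \<open>eps m\<close>,
  proportional to \<open>e\<close>, on the \<open>m\<close>-th shell.\<close>

locale staircase =
  fixes a b :: "'k \<Rightarrow> real^'n" and I :: "'k set" and C G :: "real^'n^'n" and \<kappa> :: "real^'n" and e sg :: real
  assumes I: "finite I" and b1: "\<And>k. k \<in> I \<Longrightarrow> 1 \<le> norm (b k)"
    and lb: "\<And>k. k \<in> I \<Longrightarrow> 0 < \<kappa> \<bullet> b k" and li: "\<And>i. 0 < \<kappa> $ i"
    and e01: "0 < e" "e \<le> 1"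
    and decomp: "\<And>x. (\<Sum>k\<in>I. (b k \<bullet> x) *\<^sub>R a k) = (C - G) *v x"
    and sign: "\<And>k. k \<in> I \<Longrightarrow> 0 \<le> sg * (a k \<bullet> b k)" and sg: "sg = 1 \<or> sg = -1"
begin

text \<open>The half sides start at \<open>1/4\<close> and approach \<open>1/2\<close>; the shell
  from \<open>rad m\<close> to \<open>rad (Suc m)\<close> has width \<open>(1/2) ^ (m + 3)\<close>.
  Since \<open>e <= 1\<close>, the step width \<open>eps m\<close> does not exceed it.\<close>

definition rad :: "nat \<Rightarrow> real" where "rad m = 1/2 - (1/2) ^ (m + 2)"
definition eps :: "nat \<Rightarrow> real" where "eps m = e * (1/2) ^ (m + 3)"
definition core :: "nat \<Rightarrow> (real^'n) set" where "core m = {x. \<forall>i. \<bar>x $ i\<bar> < rad m}"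
definition idx :: "real^'n \<Rightarrow> nat" where "idx x = (LEAST m. x \<in> core m)"
text \<open>An open set on which, inside the cube, \<open>idx\<close> is at least \<open>m\<close>.
  The sets \<open>core\<close> only give open upper bounds for \<open>idx\<close>; both together
  make \<open>idx\<close> locally constant off the shell faces.\<close>

definition beyond :: "nat \<Rightarrow> (real^'n) set" where "beyond m = {x. m = 0 \<or> (\<exists>i. rad (m - 1) < \<bar>x $ i\<bar>)}"

definition stair :: "real^'n \<Rightarrow> real^'n" where
  "stair x = (if x \<in> unit_cube then \<Sum>k\<in>I. (eps (idx x) * of_int \<lfloor>b k \<bullet> x / eps (idx x)\<rfloor>) *\<^sub>R a k else 0)"

definition nrm :: "'k \<Rightarrow> real^'n" where "nrm k = (1 / norm (b k)) *\<^sub>R b k"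

definition faces :: "((real^'n) \<times> real) set" where
  "faces = (\<lambda>(i, s, m). (axis i 1, s * rad m)) ` (UNIV \<times> {1, -1} \<times> UNIV)"
text \<open>The hyperplanes where \<open>b k \<bullet> x / eps m\<close> is an integer, rescaled to
  unit normals.\<close>

definition planes :: "((real^'n) \<times> real) set" where
  "planes = (\<lambda>(k, m, z). (nrm k, of_int z * (eps m / norm (b k)))) ` (I \<times> UNIV \<times> UNIV)"

definition AA :: real where "AA = (\<Sum>k\<in>I. norm (a k))"
definition bnd :: real where "bnd = (\<Sum>k\<in>I. (norm (b k) * real CARD('n) + 1) * norm (a k))"

lemma rad_mono: "m \<le> m' \<Longrightarrow> rad m \<le> rad m'"
  unfolding rad_def by (intro diff_left_mono power_decreasing) auto

lemma rad_strict: "rad m < rad (Suc m)" "rad m < 1/2" "0 < rad m"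
proof -
  have "(1/2::real) ^ (m + 2) \<le> (1/2) ^ 2" by (rule power_decreasing) auto
  then show "0 < rad m" by (simp add: rad_def power2_eq_square)
qed (simp_all add: rad_def)

lemma eps_pos: "0 < eps m" using e01 by (simp add: eps_def)

lemma eps_antimono: "m \<le> m' \<Longrightarrow> eps m' \<le> eps m"
  unfolding eps_def using e01 by (intro mult_left_mono power_decreasing) auto

lemma eps_le: "eps m \<le> (1/2) ^ (m + 3)" "eps m \<le> 1"
proof -
  show 1: "eps m \<le> (1/2) ^ (m + 3)" using e01 unfolding eps_def by (intro mult_left_le_one_le) auto
  have "(1/2::real) ^ (m + 3) \<le> 1" by (intro power_le_one) auto
  with 1 show "eps m \<le> 1" by linarith
qed

lemma core_open: "open (core m)"
proof -
  have "core m = (\<Inter>i. {x. \<bar>x $ i\<bar> < rad m})" by (auto simp: core_def)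
  also have "open \<dots>" by (intro open_INT ballI open_Collect_less continuous_intros) auto
  finally show ?thesis .
qed

lemma core_mono: "m \<le> m' \<Longrightarrow> core m \<subseteq> core m'"
  using rad_mono[of m m'] by (auto simp: core_def intro: less_le_trans)

lemma core_subset: "core m \<subseteq> unit_cube"
proof
  fix x assume "x \<in> core m"
  then have "\<bar>x $ i\<bar> < 1/2" for i using rad_strict(2)[of m] less_trans unfolding core_def by blast
  then show "x \<in> unit_cube" unfolding mem_unit_cube by blast
qed

lemma beyond_open: "open (beyond m)"
proof -
  have "beyond m = (if m = 0 then UNIV else (\<Union>i. {x. rad (m - 1) < \<bar>x $ i\<bar>}))" by (auto simp: beyond_def)
  also have "open \<dots>" by (auto intro!: open_UN open_Collect_less continuous_intros)
  finally show ?thesis .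
qed

lemma rad_tendsto: "rad \<longlonglongrightarrow> 1/2"
proof -
  have "(\<lambda>m. (1/2::real) ^ m) \<longlonglongrightarrow> 0" by (rule LIMSEQ_power_zero) simp
  then have "(\<lambda>m. (1/2::real) ^ (m + 2)) \<longlonglongrightarrow> 0" by (rule LIMSEQ_ignore_initial_segment)
  then have "(\<lambda>m. 1/2 - (1/2::real) ^ (m + 2)) \<longlonglongrightarrow> 1/2 - 0" by (intro tendsto_intros)
  then show ?thesis by (simp add: rad_def[abs_def])
qed

lemma core_covers:
  assumes "x \<in> unit_cube" shows "\<exists>m. x \<in> core m"
proof -
  have "\<forall>\<^sub>F m in sequentially. \<bar>x $ i\<bar> < rad m" for i
    by (rule order_tendstoD(1)[OF rad_tendsto]) (use assms in \<open>auto simp: mem_unit_cube\<close>)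
  then have "\<forall>\<^sub>F m in sequentially. \<forall>i. \<bar>x $ i\<bar> < rad m" by (simp add: eventually_all_finite)
  then have "\<exists>m. \<forall>i. \<bar>x $ i\<bar> < rad m" by (rule eventually_happens'[OF sequentially_bot])
  then show ?thesis by (simp add: core_def)
qed

lemma idx_le_iff: "x \<in> unit_cube \<Longrightarrow> idx x \<le> m \<longleftrightarrow> x \<in> core m"
proof
  assume "x \<in> unit_cube" "idx x \<le> m"
  then have "x \<in> core (idx x)" unfolding idx_def using core_covers by (auto intro: LeastI_ex)
  then show "x \<in> core m" using core_mono[OF \<open>idx x \<le> m\<close>] by blast
next
  assume "x \<in> core m" then show "idx x \<le> m" unfolding idx_def by (rule Least_le)
qed

lemma beyond_idx: "x \<in> unit_cube \<Longrightarrow> x \<in> beyond m \<Longrightarrow> m \<le> idx x"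
proof (rule ccontr)
  assume x: "x \<in> unit_cube" "x \<in> beyond m" "\<not> m \<le> idx x"
  then have "idx x \<le> m - 1" by linarith
  then have "x \<in> core (m - 1)" using idx_le_iff[OF x(1)] by blast
  then have "\<not> (\<exists>i. rad (m - 1) < \<bar>x $ i\<bar>)" by (auto simp: core_def not_less intro: less_imp_le)
  then show False using x by (auto simp: beyond_def)
qed

lemma norm_unit_cube: "(x :: real^'n) \<in> unit_cube \<Longrightarrow> norm x \<le> real CARD('n)"
proof -
  assume "x \<in> unit_cube"
  have "(\<Sum>i\<in>UNIV. \<bar>x $ i\<bar>) \<le> (\<Sum>i\<in>(UNIV::'n set). 1)"
  proof (rule sum_mono)
    fix i
    have "\<bar>x $ i\<bar> < 1/2" using \<open>x \<in> unit_cube\<close> unfolding mem_unit_cube by blast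
    then show "\<bar>x $ i\<bar> \<le> 1" by linarith
  qed
  then show ?thesis using norm_le_l1_cart[of x] by simp
qed

lemma floor_scale: "0 < (c::real) \<Longrightarrow> \<bar>c * of_int \<lfloor>t / c\<rfloor> - t\<bar> \<le> c"
proof -
  assume c: "0 < c"
  have "\<bar>of_int \<lfloor>t / c\<rfloor> - t / c\<bar> \<le> 1" by linarith
  then have "c * \<bar>of_int \<lfloor>t / c\<rfloor> - t / c\<bar> \<le> c * 1" using c by (intro mult_left_mono) auto
  moreover have "\<bar>c * of_int \<lfloor>t / c\<rfloor> - t\<bar> = c * \<bar>of_int \<lfloor>t / c\<rfloor> - t / c\<bar>"
  proof -
    have "c * of_int \<lfloor>t / c\<rfloor> - t = c * (of_int \<lfloor>t / c\<rfloor> - t / c)" using c by (simp add: right_diff_distrib)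
    then show ?thesis using c by (simp add: abs_mult)
  qed
  ultimately show ?thesis by simp
qed

lemma stair_close:
  assumes "x \<in> unit_cube" shows "norm (stair x - (C - G) *v x) \<le> AA * eps (idx x)"
proof -
  have "stair x - (C - G) *v x = (\<Sum>k\<in>I. (eps (idx x) * of_int \<lfloor>b k \<bullet> x / eps (idx x)\<rfloor> - b k \<bullet> x) *\<^sub>R a k)"
    using assms by (simp add: stair_def decomp[symmetric] sum_subtractf scaleR_left_diff_distrib)
  also have "norm \<dots> \<le> (\<Sum>k\<in>I. norm ((eps (idx x) * of_int \<lfloor>b k \<bullet> x / eps (idx x)\<rfloor> - b k \<bullet> x) *\<^sub>R a k))"
    by (rule norm_sum)
  also have "\<dots> \<le> (\<Sum>k\<in>I. norm (a k) * eps (idx x))"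
    using floor_scale[OF eps_pos] by (intro sum_mono) (simp add: mult.commute mult_left_mono)
  finally show ?thesis by (simp add: AA_def sum_distrib_right)
qed

lemma stair_bdd: "norm (stair x) \<le> bnd"
proof (cases "x \<in> unit_cube")
  case True
  have "norm (stair x) \<le> (\<Sum>k\<in>I. norm ((eps (idx x) * of_int \<lfloor>b k \<bullet> x / eps (idx x)\<rfloor>) *\<^sub>R a k))"
    using True unfolding stair_def by (simp only: if_True norm_sum)
  also have "\<dots> \<le> bnd" unfolding bnd_def
  proof (rule sum_mono)
    fix k
    have "\<bar>b k \<bullet> x\<bar> \<le> norm (b k) * norm x" by (rule Cauchy_Schwarz_ineq2)
    also have "\<dots> \<le> norm (b k) * real CARD('n)" by (intro mult_left_mono norm_unit_cube True) auto
    finally have "\<bar>eps (idx x) * of_int \<lfloor>b k \<bullet> x / eps (idx x)\<rfloor>\<bar> \<le> norm (b k) * real CARD('n) + 1"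
      using floor_scale[OF eps_pos, of "idx x" "b k \<bullet> x"] eps_le(2)[of "idx x"] by linarith
    from mult_right_mono[OF this norm_ge_zero[of "a k"]]
    show "norm ((eps (idx x) * of_int \<lfloor>b k \<bullet> x / eps (idx x)\<rfloor>) *\<^sub>R a k) \<le> (norm (b k) * real CARD('n) + 1) * norm (a k)"
      by (simp add: abs_mult)
  qed
  finally show ?thesis .
next
  case False
  then show ?thesis by (simp add: stair_def bnd_def sum_nonneg)
qed

lemma idx_measurable [measurable]: "idx \<in> borel \<rightarrow>\<^sub>M count_space UNIV"
proof -
  have "Measurable.pred borel (\<lambda>x. x \<in> core m)" for m using borel_open[OF core_open[of m]] by simp
  then show ?thesis unfolding idx_def[abs_def] by (rule measurable_Least)
qed

lemma stair_borel: "stair \<in> borel_measurable borel"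
proof -
  have "(\<lambda>x. \<Sum>k\<in>I. (eps m * of_int \<lfloor>b k \<bullet> x / eps m\<rfloor>) *\<^sub>R a k) \<in> borel_measurable borel" for m by measurable
  from measurable_compose_countable[OF this idx_measurable] show ?thesis
    unfolding stair_def[abs_def] by (intro measurable_If) auto
qed

lemma nrm_unit: "k \<in> I \<Longrightarrow> norm (nrm k) = 1"
  using b1[of k] by (auto simp: nrm_def)

lemma mem_plane: "k \<in> I \<Longrightarrow> x \<in> hyper (nrm k) (of_int z * (eps m / norm (b k))) \<longleftrightarrow> b k \<bullet> x / eps m = of_int z"
  using b1[of k] eps_pos[of m] by (auto simp: hyper_def nrm_def field_simps)

text \<open>All normals lie in one open half space, so no two of them are opposite.\<close>

lemma planes_inner_pos: "h \<in> faces \<union> planes \<Longrightarrow> 0 < \<kappa> \<bullet> fst h"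
  using lb li b1 by (auto simp: faces_def planes_def nrm_def inner_axis intro!: divide_pos_pos) (force intro: less_le_trans[of 0 1])+

lemma compact_in_core:
  assumes "compact K" "K \<subseteq> unit_cube" obtains m where "K \<subseteq> core m"
proof -
  have "K \<subseteq> (\<Union>m. core m)" using assms(2) core_covers by blast
  then obtain D where D: "D \<subseteq> UNIV" "finite D" "K \<subseteq> (\<Union>m\<in>D. core m)"
    using compactE_image[OF assms(1), of UNIV core] core_open by metis
  have "K \<subseteq> core (Max (insert 0 D))"
  proof
    fix x assume "x \<in> K"
    then obtain m where m: "m \<in> D" "x \<in> core m" using D by blast
    then have "m \<le> Max (insert 0 D)" using D(2) by (intro Max_ge) auto
    then show "x \<in> core (Max (insert 0 D))" using core_mono m by blast
  qed
  then show ?thesis by (rule that)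
qed

text \<open>The sign of \<open>p\<close> minus its floor is 0 or 1; the same sign for
  \<open>q\<close> places \<open>q\<close> at or above that floor. Used in both directions, this
  equates floors.\<close>

lemma floor_le_of_sgn: "sgn (p - of_int \<lfloor>p\<rfloor>) = sgn (q - of_int \<lfloor>p\<rfloor>) \<Longrightarrow> \<lfloor>p\<rfloor> \<le> \<lfloor>q :: real\<rfloor>"
  by (auto simp: sgn_if le_floor_iff split: if_splits) linarith+

text \<open>A compact subset lies in one \<open>core\<close> and so meets finitely many shells, and
  in them finitely many lattice planes. Signs relative to the faces determine \<open>idx\<close>,
  signs relative to the planes determine the rounded values.\<close>

lemma determined_staircase:
  assumes K: "compact K" "K \<subseteq> unit_cube"
  shows "\<exists>F\<subseteq>faces \<union> planes. finite F \<and>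
      (\<forall>y\<in>K. \<forall>z\<in>K. (\<forall>h\<in>F. sgn (fst h \<bullet> y - snd h) = sgn (fst h \<bullet> z - snd h)) \<longrightarrow> stair y = stair z)"
proof -
  obtain M where M: "K \<subseteq> core M" using K by (rule compact_in_core)
  \<comment> \<open>\<open>BB\<close> bounds all quotients \<open>b k \<bullet> x / eps m\<close>
    with \<open>m \<le> M\<close>; one more covers their floors.\<close>
  define BB where "BB = (\<Sum>k\<in>I. norm (b k)) * real CARD('n) / eps M"
  obtain Z :: nat where Z: "BB + 1 \<le> real Z" using real_arch_simple by blast
  define F where "F = (\<lambda>(i, s, m). (axis i 1, s * rad m)) ` (UNIV \<times> {1, -1} \<times> {..M}) \<union>
    (\<lambda>(k, m, z). (nrm k, of_int z * (eps m / norm (b k)))) ` (I \<times> {..M} \<times> {- int Z..int Z})"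
  have "F \<subseteq> faces \<union> planes" unfolding F_def faces_def planes_def by (intro Un_mono image_mono) auto
  moreover have "finite F" unfolding F_def using I by auto
  moreover have "stair y = stair z" if y: "y \<in> K" and z: "z \<in> K"
    and s: "\<forall>h\<in>F. sgn (fst h \<bullet> y - snd h) = sgn (fst h \<bullet> z - snd h)" for y z
  proof -
    have Q: "y \<in> unit_cube" "z \<in> unit_cube" using y z K by auto
    have iM: "idx y \<le> M" "idx z \<le> M" using y z M Q idx_le_iff by blast+
    have "y \<in> core m \<longleftrightarrow> z \<in> core m" if "m \<le> M" for m
    proof -
      have "\<bar>y $ i\<bar> < rad m \<longleftrightarrow> \<bar>z $ i\<bar> < rad m" for i
      proof -
        have "(axis i 1, c * rad m) \<in> F" if "c = 1 \<or> c = -1" for c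
        proof -
          have "(i, c, m) \<in> UNIV \<times> {1, -1} \<times> {..M}" using that \<open>m \<le> M\<close> by auto
          then show ?thesis unfolding F_def by (intro UnI1) (rule rev_image_eqI, auto)
        qed
        then have "sgn (y $ i - c * rad m) = sgn (z $ i - c * rad m)" if "c = 1 \<or> c = -1" for c
          using s that by (force simp: inner_axis' inner_axis)
        from this[of 1] this[of "-1"] show ?thesis by (auto simp: sgn_if abs_if split: if_splits)
      qed
      then show ?thesis by (simp add: core_def)
    qed
    then have i: "idx y = idx z"
      using idx_le_iff Q iM by (metis order_antisym order_refl)
    define m where "m = idx y"
    have fl: "\<lfloor>b k \<bullet> y / eps m\<rfloor> = \<lfloor>b k \<bullet> z / eps m\<rfloor>" if k: "k \<in> I" for k
    proof -
      have sg: "sgn (b k \<bullet> y / eps m - of_int \<zeta>) = sgn (b k \<bullet> z / eps m - of_int \<zeta>)" if "\<bar>\<zeta>\<bar> \<le> int Z" for \<zeta>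
      proof -
        have "(k, m, \<zeta>) \<in> I \<times> {..M} \<times> {- int Z..int Z}" using k iM that by (auto simp: m_def)
        then have "(nrm k, of_int \<zeta> * (eps m / norm (b k))) \<in> F"
          unfolding F_def by (intro UnI2) (rule rev_image_eqI, assumption, simp)
        then have *: "sgn (nrm k \<bullet> y - of_int \<zeta> * (eps m / norm (b k))) = sgn (nrm k \<bullet> z - of_int \<zeta> * (eps m / norm (b k)))"
          using s by force
        have "b k \<bullet> x / eps m - of_int \<zeta> = (norm (b k) / eps m) * (nrm k \<bullet> x - of_int \<zeta> * (eps m / norm (b k)))" for x
          using b1[OF k] eps_pos[of m] by (auto simp: nrm_def field_simps)
        then show ?thesis using * by (simp add: sgn_mult)
      qed
      have "\<bar>\<lfloor>b k \<bullet> x / eps m\<rfloor>\<bar> \<le> int Z" if x: "x \<in> unit_cube" for x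
      proof -
        have "\<bar>b k \<bullet> x\<bar> \<le> norm (b k) * norm x" by (rule Cauchy_Schwarz_ineq2)
        also have "\<dots> \<le> (\<Sum>k\<in>I. norm (b k)) * real CARD('n)"
          using k I norm_unit_cube[OF x] by (intro mult_mono member_le_sum sum_nonneg) auto
        finally have "\<bar>b k \<bullet> x\<bar> / eps m \<le> (\<Sum>k\<in>I. norm (b k)) * real CARD('n) / eps M"
          using eps_pos eps_antimono[of m M] iM unfolding m_def
          by (intro frac_le) (auto intro!: mult_nonneg_nonneg sum_nonneg)
        then have "\<bar>b k \<bullet> x / eps m\<bar> \<le> BB" using eps_pos[of m] by (simp add: BB_def abs_divide)
        then show ?thesis using Z by linarith
      qed
      then show ?thesis using floor_le_of_sgn[OF sg] floor_le_of_sgn[OF sg[symmetric]] Q by (meson order_antisym)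
    qed
    show ?thesis unfolding stair_def using Q i fl by (simp add: m_def)
  qed
  ultimately show ?thesis by blast
qed

sublocale arrangement unit_cube stair G bnd "faces \<union> planes"
proof
  show "countable (faces \<union> planes)" unfolding faces_def planes_def
    using I by (intro countable_Un countable_image countable_SIGMA) (auto intro: countable_finite)
  show "norm (fst h) = 1" if "h \<in> faces \<union> planes" for h
    using that nrm_unit by (auto simp: faces_def planes_def norm_axis_1)
  show "fst h' \<noteq> - fst h" if "h \<in> faces \<union> planes" "h' \<in> faces \<union> planes" for h h'
    using planes_inner_pos[OF that(1)] planes_inner_pos[OF that(2)] by auto
qed (use unit_cube_open unit_cube_bounded stair_borel stair_bdd determined_staircase in auto)

end

section \<open>Size and sign of the staircase jumps\<close>

context staircase begin

definition FS :: "(real^'n) set" where "FS = (\<Union>h\<in>faces. hyper (fst h) (snd h))"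

lemma mem_FS: "x \<in> FS \<longleftrightarrow> (\<exists>i m. \<bar>x $ i\<bar> = rad m)"
proof
  assume "x \<in> FS"
  then obtain h where h: "h \<in> faces" "x \<in> hyper (fst h) (snd h)" unfolding FS_def by blast
  then obtain p where p: "p \<in> UNIV \<times> {1, -1} \<times> UNIV" "h = (\<lambda>(i, s, m). (axis i 1, s * rad m)) p"
    unfolding faces_def by blast
  obtain i s m where "p = (i, s, m)" by (cases p)
  then have "s = 1 \<or> s = -1" "x \<in> hyper (axis i 1) (s * rad m)" using h p by auto
  then have "\<bar>x $ i\<bar> = rad m" using rad_strict(3)[of m] by (auto simp: hyper_def inner_axis')
  then show "\<exists>i m. \<bar>x $ i\<bar> = rad m" by blast
next
  assume "\<exists>i m. \<bar>x $ i\<bar> = rad m"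
  then obtain i m where "\<bar>x $ i\<bar> = rad m" by blast
  then obtain s where s: "s = 1 \<or> s = -1" "x $ i = s * rad m" by (metis abs_eq_iff' mult_1 mult_minus1)
  have "(axis i 1, s * rad m) \<in> faces"
    unfolding faces_def by (rule rev_image_eqI[of "(i, s, m)"]) (use s in auto)
  moreover have "x \<in> hyper (axis i 1) (s * rad m)" using s by (simp add: hyper_def inner_axis')
  ultimately show "x \<in> FS" unfolding FS_def by force
qed

lemma FS_borel [measurable]: "FS \<in> sets borel"
  unfolding FS_def
proof (rule sets.countable_UN')
  show "countable faces" using countable_Hy by (rule countable_subset[rotated]) auto
  show "(\<lambda>h. hyper (fst h) (snd h)) ` faces \<subseteq> sets borel" by auto
qed

lemma beyond_of_idx:
  assumes x: "x \<in> unit_cube" "x \<notin> FS" shows "x \<in> beyond (idx x)"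
proof (cases "idx x = 0")
  case False
  then have "\<not> idx x \<le> idx x - 1" by linarith
  then have "x \<notin> core (idx x - 1)" using idx_le_iff[OF x(1)] by blast
  then obtain i where "rad (idx x - 1) \<le> \<bar>x $ i\<bar>" unfolding core_def by (auto simp: not_less)
  moreover have "\<bar>x $ i\<bar> \<noteq> rad (idx x - 1)" using x(2) unfolding mem_FS by blast
  ultimately have "rad (idx x - 1) < \<bar>x $ i\<bar>" by simp
  then show ?thesis unfolding beyond_def by blast
qed (simp add: beyond_def)

lemma idx_locally_constant:
  assumes x: "x \<in> unit_cube" "x \<notin> FS"
  obtains r where "0 < r" "ball x r \<subseteq> unit_cube" "\<forall>y\<in>ball x r. idx y = idx x"
proof -
  have "open (unit_cube \<inter> core (idx x) \<inter> beyond (idx x))" using unit_cube_open core_open beyond_open by blast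
  moreover have "x \<in> unit_cube \<inter> core (idx x) \<inter> beyond (idx x)"
    using x beyond_of_idx idx_le_iff by blast
  ultimately obtain r where r: "0 < r" "ball x r \<subseteq> unit_cube \<inter> core (idx x) \<inter> beyond (idx x)"
    by (rule openE)
  show ?thesis
  proof (rule that[OF r(1)])
    show "ball x r \<subseteq> unit_cube" using r(2) by blast
  next
    show "\<forall>y\<in>ball x r. idx y = idx x"
    proof
    fix y assume "y \<in> ball x r"
    then have y: "y \<in> unit_cube" "y \<in> core (idx x)" "y \<in> beyond (idx x)" using r(2) by blast+
    show "idx y = idx x" using idx_le_iff[OF y(1)] y(2) beyond_idx[OF y(1,3)] by (intro order_antisym) auto
    qed
  qed
qed

lemma AA_nonneg: "0 \<le> AA" by (simp add: AA_def sum_nonneg)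

text \<open>Near such a point all indices are at least \<open>m\<close>, so the staircase stays
  within \<open>AA * eps m\<close> of a linear map.\<close>

lemma T_beyond:
  assumes x: "x \<in> unit_cube" "x \<in> beyond m" shows "norm (T x) \<le> 2 * (AA * eps m)"
proof -
  have "open (unit_cube \<inter> beyond m)" using unit_cube_open beyond_open by blast
  then obtain r where r: "0 < r" "ball x r \<subseteq> unit_cube \<inter> beyond m" using x by (auto elim: openE)
  show ?thesis
  proof (rule T_norm_le[OF x(1) r(1)])
    show "bounded_linear (\<lambda>x. (C - G) *v x)" by (rule matrix_vector_mul_bounded_linear)
    fix y assume "y \<in> ball x r"
    then have y: "y \<in> unit_cube" "y \<in> beyond m" using r by auto
    have "AA * eps (idx y) \<le> AA * eps m" by (intro mult_left_mono eps_antimono beyond_idx y AA_nonneg)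
    then show "norm (stair y - (C - G) *v y) \<le> AA * eps m" using stair_close[OF y(1)] by linarith
  qed
qed

lemma eventually_same_floor:
  fixes \<beta> c :: real
  assumes f: "(f \<longlongrightarrow> \<beta>) F" and \<beta>: "\<beta> \<noteq> of_int \<lfloor>\<beta>\<rfloor>"
  shows "\<forall>\<^sub>F t in F. \<lfloor>f t\<rfloor> = \<lfloor>\<beta>\<rfloor>"
proof -
  have "of_int \<lfloor>\<beta>\<rfloor> < \<beta>" "\<beta> < of_int \<lfloor>\<beta>\<rfloor> + 1" using \<beta> by linarith+
  from order_tendstoD(1)[OF f this(1)] order_tendstoD(2)[OF f this(2)] show ?thesis
    by eventually_elim (simp add: floor_eq_iff)
qed

lemma T_off_lattice:
  assumes x: "x \<in> unit_cube" "x \<notin> FS" and off: "\<And>k. k \<in> I \<Longrightarrow> b k \<bullet> x / eps (idx x) \<noteq> of_int \<lfloor>b k \<bullet> x / eps (idx x)\<rfloor>"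
  shows "T x = 0"
proof -
  obtain r where r: "0 < r" "ball x r \<subseteq> unit_cube" "\<forall>y\<in>ball x r. idx y = idx x"
    using x by (rule idx_locally_constant)
  have "\<forall>\<^sub>F y in nhds x. \<lfloor>b k \<bullet> y / eps (idx x)\<rfloor> = \<lfloor>b k \<bullet> x / eps (idx x)\<rfloor>" if "k \<in> I" for k
  proof (rule eventually_same_floor[OF _ off[OF that]])
    show "((\<lambda>y. b k \<bullet> y / eps (idx x)) \<longlongrightarrow> b k \<bullet> x / eps (idx x)) (nhds x)"
      using eps_pos[of "idx x"] by (intro tendsto_intros) (auto intro: filterlim_ident)
  qed
  then have "\<forall>\<^sub>F y in nhds x. \<forall>k\<in>I. \<lfloor>b k \<bullet> y / eps (idx x)\<rfloor> = \<lfloor>b k \<bullet> x / eps (idx x)\<rfloor>"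
    using I by (simp add: eventually_ball_finite_distrib)
  then obtain d where d: "0 < d" "\<And>y k. dist y x < d \<Longrightarrow> k \<in> I \<Longrightarrow> \<lfloor>b k \<bullet> y / eps (idx x)\<rfloor> = \<lfloor>b k \<bullet> x / eps (idx x)\<rfloor>"
    unfolding eventually_nhds_metric by blast
  have "stair y = stair x" if "dist x y < min d r" for y
  proof -
    have y: "y \<in> ball x r" "dist y x < d" using that by (auto simp: dist_commute)
    then have "y \<in> unit_cube" using r by blast
    then show ?thesis unfolding stair_def bspec[OF r(3) y(1)] using x(1) d(2)[OF y(2)] by simp
  qed
  then have "two_valued x (min d r) (stair x) (stair x) (axis undefined 1)"
    unfolding two_valued_def by (intro AE_I2) (auto simp: half_ball_def)
  then show ?thesis by (rule T_zero) (use d(1) r(1) in \<open>auto simp: norm_axis_1\<close>)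
qed

text \<open>At most one plane passes through such a point. Summands whose floor jumps there share
  its normal, and their floor increases in that direction; all others are locally constant. The leap
  is thus a nonnegative combination of vectors \<open>a k\<close> for which
  \<open>sg * (a k \<bullet> n)\<close> is nonnegative.\<close>

lemma trace_sign:
  assumes x: "x \<in> unit_cube" "x \<notin> FS"
    and single: "\<forall>h\<in>faces \<union> planes. \<forall>h'\<in>faces \<union> planes. h \<noteq> h' \<longrightarrow> \<not> (x \<in> hyper (fst h) (snd h) \<and> x \<in> hyper (fst h') (snd h'))"
  shows "0 \<le> sg * trace (T x)"
proof (cases "\<exists>h\<in>faces \<union> planes. x \<in> hyper (fst h) (snd h)")
  case False
  have "T x = 0"
  proof (rule T_off_hyper)
    fix h assume "h \<in> faces \<union> planes"
    then show "x \<notin> hyper (fst h) (snd h)" using False by blast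
  qed
  then show ?thesis by (simp add: trace_def)
next
  case True
  then obtain h where h: "h \<in> faces \<union> planes" "x \<in> hyper (fst h) (snd h)" by blast
  define n where "n = fst h"
  have "h \<notin> faces" using h(2) x(2) unfolding FS_def by blast
  then have "h \<in> planes" using h(1) by blast
  then obtain p where p: "p \<in> I \<times> UNIV \<times> UNIV" "h = (\<lambda>(k, m, z). (nrm k, of_int z * (eps m / norm (b k)))) p"
    unfolding planes_def by blast
  obtain k0 m0 z0 where "p = (k0, m0, z0)" by (cases p)
  then have k0: "k0 \<in> I" "n = nrm k0" using p by (auto simp: n_def)
  have n1: "norm n = 1" using nrm_unit k0 by simp
  obtain r where r: "0 < r" "ball x r \<subseteq> unit_cube" "\<forall>y\<in>ball x r. idx y = idx x"
    using x by (rule idx_locally_constant)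
  obtain F r' where F: "finite F" "F \<subseteq> faces \<union> planes" "fan x F r'" "ball x r' \<subseteq> unit_cube"
    using x(1) by (rule fan_exists)
  define m where "m = idx x"
  define fl where "fl k s = \<lfloor>b k \<bullet> (x + s *\<^sub>R n) / eps m\<rfloor>" for k s
  have "\<forall>\<^sub>F t in at_right 0. 0 \<le> (of_int (fl k t - fl k (- t)) :: real) * (sg * (a k \<bullet> n))" if k: "k \<in> I" for k
  proof (cases "b k \<bullet> x / eps m = of_int \<lfloor>b k \<bullet> x / eps m\<rfloor>")
    case True
    \<comment> \<open>If a lattice plane of \<open>k\<close> passes through \<open>x\<close>,
      uniqueness identifies it with \<open>h\<close>, including the choice of the unit
      normal.\<close>
    define hk where "hk = (nrm k, of_int \<lfloor>b k \<bullet> x / eps m\<rfloor> * (eps m / norm (b k)))"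
    have "hk \<in> planes" unfolding planes_def hk_def
      by (rule rev_image_eqI[of "(k, m, \<lfloor>b k \<bullet> x / eps m\<rfloor>)"]) (use k in auto)
    moreover have "x \<in> hyper (fst hk) (snd hk)" unfolding hk_def fst_conv snd_conv mem_plane[OF k] using True .
    ultimately have "hk = h" using single h by blast
    then have nk: "n = nrm k" by (auto simp: hk_def n_def)
    have bn: "0 < norm (b k)" using b1[OF k] by linarith
    have "b k \<bullet> n = norm (b k)" using bn by (simp add: nk nrm_def power2_norm_eq_inner[symmetric] power2_eq_square)
    have "0 \<le> sg * (a k \<bullet> n)" using sign[OF k] bn by (simp add: nk nrm_def zero_le_divide_iff)
    moreover have "fl k (- t) \<le> fl k t" if "0 < t" for t
    proof -
      have "- t * norm (b k) \<le> t * norm (b k)" using that by (intro mult_right_mono) auto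
      then show ?thesis
      unfolding fl_def using eps_pos[of m] \<open>b k \<bullet> n = norm (b k)\<close>
      by (intro floor_mono divide_right_mono) (auto simp: inner_add_right inner_diff_right)
    qed
    ultimately show ?thesis by (intro eventually_at_rightI[of 0 1]) (auto intro!: mult_nonneg_nonneg)
  next
    case False
    have l: "((\<lambda>t. b k \<bullet> (x + c t *\<^sub>R n) / eps m) \<longlongrightarrow> b k \<bullet> (x + 0 *\<^sub>R n) / eps m) (at_right 0)"
      if "(c \<longlongrightarrow> 0) (at_right 0)" for c
      using eps_pos[of m] that by (intro tendsto_intros) auto
    have f: "b k \<bullet> (x + 0 *\<^sub>R n) / eps m \<noteq> of_int \<lfloor>b k \<bullet> (x + 0 *\<^sub>R n) / eps m\<rfloor>" using False by simp
    have 1: "((\<lambda>t. t) \<longlongrightarrow> 0) (at_right (0::real))" by (intro tendsto_intros)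
    have "((\<lambda>t. - t) \<longlongrightarrow> - 0) (at_right (0::real))" by (intro tendsto_intros)
    then have 2: "((\<lambda>t. - t) \<longlongrightarrow> 0) (at_right (0::real))" by simp
    from eventually_same_floor[OF l[OF 1] f] eventually_same_floor[OF l[OF 2] f] show ?thesis
      by eventually_elim (simp add: fl_def)
  qed
  then have "\<forall>\<^sub>F t in at_right 0. \<forall>k\<in>I. 0 \<le> (of_int (fl k t - fl k (- t)) :: real) * (sg * (a k \<bullet> n))"
    using I by (simp add: eventually_ball_finite_distrib)
  moreover have "\<forall>\<^sub>F t in at_right (0::real). 0 < t" by (intro eventually_at_rightI[of 0 1]) auto
  moreover have "\<forall>\<^sub>F t in at_right (0::real). t < min r r'"
    by (rule eventually_at_rightI[of 0 "min r r'"]) (use r(1) fan_pos[OF F(3)] in auto)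
  ultimately have "\<forall>\<^sub>F t in at_right 0. 0 < t \<and> t < min r r' \<and> (\<forall>k\<in>I. 0 \<le> (of_int (fl k t - fl k (- t)) :: real) * (sg * (a k \<bullet> n)))"
    by eventually_elim blast
  then have "\<exists>t. 0 < t \<and> t < min r r' \<and> (\<forall>k\<in>I. 0 \<le> (of_int (fl k t - fl k (- t)) :: real) * (sg * (a k \<bullet> n)))"
    by (rule eventually_happens'[rotated]) simp
  then obtain t where t: "0 < t" "t < min r r'" "\<And>k. k \<in> I \<Longrightarrow> 0 \<le> (of_int (fl k t - fl k (- t)) :: real) * (sg * (a k \<bullet> n))"
    by blast
  have val: "stair (x + s *\<^sub>R n) = (\<Sum>k\<in>I. (eps m * of_int (fl k s)) *\<^sub>R a k)" if "s = t \<or> s = - t" for s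
  proof -
    have y: "x + s *\<^sub>R n \<in> ball x r" using that t n1 by (auto simp: dist_norm)
    then have "x + s *\<^sub>R n \<in> unit_cube" using r by blast
    then show ?thesis unfolding stair_def bspec[OF r(3) y] fl_def m_def by simp
  qed
  have "side n x = stair (x + t *\<^sub>R n)" "side (- n) x = stair (x + t *\<^sub>R (- n))"
    using side_eq[OF F(3), of t n] side_eq[OF F(3), of t "- n"] t n1 by auto
  then have "leap n x = (\<Sum>k\<in>I. (eps m * of_int (fl k t - fl k (- t))) *\<^sub>R a k)"
    unfolding leap_def using val[of t] val[of "- t"]
    by (simp add: sum_subtractf[symmetric] scaleR_left_diff_distrib[symmetric] right_diff_distrib)
  moreover have "T x = outer (leap n x) n" unfolding n_def by (rule T_on_hyper[OF x(1) single h])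
  ultimately have "sg * trace (T x) = (\<Sum>k\<in>I. eps m * (of_int (fl k t - fl k (- t)) * (sg * (a k \<bullet> n))))"
    by (simp add: trace_outer inner_sum_left sum_distrib_left mult_ac)
  also have "0 \<le> \<dots>" by (rule sum_nonneg, rule mult_nonneg_nonneg[OF less_imp_le[OF eps_pos] t(3)])
  finally show ?thesis .
qed

definition \<beta>N :: real where "\<beta>N = measure lborel (ball 0 (real CARD('n) + 2) :: (real^'n) set)"

lemma hyper_cube: "norm n = 1 \<Longrightarrow> emeasure H (unit_cube \<inter> hyper n s) \<le> ennreal \<beta>N"
proof -
  assume "norm n = 1"
  then have "emeasure H (unit_cube \<inter> hyper n s) \<le> emeasure lborel (ball 0 (real CARD('n) + 2) :: (real^'n) set)"
    using hausdorff_hyper_bounded[of n unit_cube "real CARD('n)" s] norm_unit_cube by simp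
  also have "\<dots> = ennreal \<beta>N" unfolding \<beta>N_def
    by (rule emeasure_eq_ennreal_measure) (use emeasure_lborel_ball_finite in \<open>simp add: less_top[symmetric]\<close>)
  finally show ?thesis .
qed

lemma suminf_eps: "(\<Sum>m. ennreal (eps m)) = ennreal (e / 4)"
proof -
  have "(\<lambda>m. (e * (1/2)^2) * (1/2) ^ Suc m) sums ((e * (1/2)^2) * 1)"
    by (intro sums_mult power_half_series)
  then have "eps sums (e / 4)" unfolding eps_def[abs_def] by (simp add: power2_eq_square power3_eq_cube power_add mult_ac)
  from suminf_ennreal_eq[OF _ this] show ?thesis using eps_pos by (auto intro: less_imp_le)
qed

text \<open>On the faces at \<open>rad m\<close> the jump is at most \<open>2 * (AA * eps m)\<close>
  and the area inside the cube at most \<open>\<beta>N\<close>; there are two such hyperplanes per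
  axis. As the step widths add up to \<open>e / 4\<close>, the total is proportional to
  \<open>e\<close>.\<close>

lemma faces_bound: "(\<integral>\<^sup>+x. ennreal (norm (T x)) * indicator FS x \<partial>H) \<le> ennreal (real CARD('n) * (AA * \<beta>N) * e)"
proof -
  let ?h = "\<lambda>i s m. hyper (axis i (1::real)) (s * rad m) :: (real^'n) set"
  have "ennreal (norm (T x)) * indicator FS x
      \<le> (\<Sum>i\<in>UNIV. \<Sum>s\<in>{1, -1}. \<Sum>m. ennreal (2 * (AA * eps m)) * indicator (unit_cube \<inter> ?h i s m) x)" for x
  proof (cases "x \<in> FS \<and> x \<in> unit_cube")
    case True
    then obtain i m where im: "\<bar>x $ i\<bar> = rad m" unfolding mem_FS by blast
    then obtain s where s: "s \<in> {1, -1::real}" "x $ i = s * rad m" by (metis abs_eq_iff' insertCI mult_1 mult_minus1)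
    \<comment> \<open>A face at \<open>rad m\<close> lies strictly outside the preceding core, so
      all step widths nearby are at most \<open>eps m\<close>.\<close>
    have "x \<in> beyond m"
    proof (cases m)
      case (Suc m')
      then have "rad (m - 1) < \<bar>x $ i\<bar>" using im rad_strict(1)[of m'] by simp
      then show ?thesis unfolding beyond_def by blast
    qed (simp add: beyond_def)
    then have "norm (T x) \<le> 2 * (AA * eps m)" using T_beyond True by blast
    then have "ennreal (norm (T x)) * indicator FS x \<le> ennreal (2 * (AA * eps m)) * indicator (unit_cube \<inter> ?h i s m) x"
      using True s by (simp add: hyper_def inner_axis' ennreal_leI)
    also have "\<dots> \<le> (\<Sum>m. ennreal (2 * (AA * eps m)) * indicator (unit_cube \<inter> ?h i s m) x)"
    proof -
      define fm where "fm m = ennreal (2 * (AA * eps m)) * indicator (unit_cube \<inter> ?h i s m) x" for m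
      have "sum fm {m} \<le> suminf fm" by (rule sum_le_suminf) auto
      then have "fm m \<le> suminf fm" by simp
      then show ?thesis unfolding fm_def .
    qed
    also have "\<dots> \<le> (\<Sum>s\<in>{1, -1}. \<Sum>m. ennreal (2 * (AA * eps m)) * indicator (unit_cube \<inter> ?h i s m) x)"
      by (rule member_le_sum[OF s(1)]) auto
    also have "\<dots> \<le> (\<Sum>i\<in>UNIV. \<Sum>s\<in>{1, -1}. \<Sum>m. ennreal (2 * (AA * eps m)) * indicator (unit_cube \<inter> ?h i s m) x)"
      by (rule member_le_sum) auto
    finally show ?thesis .
  next
    case False
    then show ?thesis using T_outside by (auto simp: indicator_def)
  qed
  then have "(\<integral>\<^sup>+x. ennreal (norm (T x)) * indicator FS x \<partial>H)
      \<le> (\<integral>\<^sup>+x. (\<Sum>i\<in>UNIV. \<Sum>s\<in>{1, -1}. \<Sum>m. ennreal (2 * (AA * eps m)) * indicator (unit_cube \<inter> ?h i s m) x) \<partial>H)"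
    by (intro nn_integral_mono) auto
  also have "\<dots> = (\<Sum>i\<in>UNIV. \<Sum>s\<in>{1, -1}. \<Sum>m. ennreal (2 * (AA * eps m)) * emeasure H (unit_cube \<inter> ?h i s m))"
  proof -
    have "unit_cube \<inter> ?h i s m \<in> sets H" for i s m by simp
    then show ?thesis
      by (subst nn_integral_sum, simp, intro sum.cong refl, subst nn_integral_sum, simp, intro sum.cong refl,
          subst nn_integral_suminf, simp, intro suminf_cong nn_integral_cmult_indicator)
  qed
  also have "\<dots> \<le> (\<Sum>i\<in>(UNIV::'n set). \<Sum>s\<in>{1, -1::real}. \<Sum>m. ennreal (2 * (AA * \<beta>N)) * ennreal (eps m))"
  proof (intro sum_mono suminf_le allI)
    fix i s m
    have "ennreal (2 * (AA * eps m)) * emeasure H (unit_cube \<inter> ?h i s m) \<le> ennreal (2 * (AA * eps m)) * ennreal \<beta>N"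
      by (intro mult_left_mono hyper_cube) (auto simp: norm_axis_1)
    also have "\<dots> = ennreal (2 * (AA * \<beta>N)) * ennreal (eps m)"
      using AA_nonneg eps_pos[of m] by (simp add: ennreal_mult[symmetric] \<beta>N_def mult_ac)
    finally show "ennreal (2 * (AA * eps m)) * emeasure H (unit_cube \<inter> ?h i s m) \<le> ennreal (2 * (AA * \<beta>N)) * ennreal (eps m)" .
  qed auto
  also have "\<dots> = (\<Sum>i\<in>(UNIV::'n set). \<Sum>s\<in>{1, -1::real}. ennreal (2 * (AA * \<beta>N) * (e / 4)))"
    using AA_nonneg e01 by (simp add: suminf_eps ennreal_mult[symmetric] \<beta>N_def)
  also have "\<dots> = ennreal (real CARD('n) * (AA * \<beta>N) * e)"
  proof -
    define X where "X = 2 * (AA * \<beta>N) * (e / 4)"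
    have X: "0 \<le> X" using AA_nonneg e01 by (simp add: X_def \<beta>N_def)
    have "(\<Sum>s\<in>{1, -1::real}. ennreal X) = ennreal X + ennreal X" by (subst sum.insert) auto
    also have "\<dots> = ennreal (X + X)" by (rule ennreal_plus[OF X X, symmetric])
    finally have "(\<Sum>s\<in>{1, -1::real}. ennreal X) = ennreal (X + X)" .
    then have "(\<Sum>i\<in>(UNIV::'n set). \<Sum>s\<in>{1, -1::real}. ennreal X) = ennreal (real CARD('n)) * ennreal (X + X)"
      by (simp only: sum_constant ennreal_of_nat_eq_real_of_nat)
    also have "\<dots> = ennreal (real CARD('n) * (X + X))" using X by (simp only: ennreal_mult add_nonneg_nonneg of_nat_0_le_iff)
    also have "real CARD('n) * (X + X) = real CARD('n) * (AA * \<beta>N) * e" by (simp add: X_def)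
    finally show ?thesis unfolding X_def .
  qed
  finally show ?thesis .
qed

end

section \<open>Finite total variation inside the shells\<close>

context staircase begin

text \<open>The part of a lattice plane inside its own shell; off the faces, the staircase jumps
  only on such pieces.\<close>

definition cell :: "'k \<Rightarrow> nat \<Rightarrow> int \<Rightarrow> (real^'n) set" where
  "cell k m z = {x \<in> unit_cube. x \<notin> FS \<and> idx x = m} \<inter> hyper (nrm k) (of_int z * (eps m / norm (b k)))"

text \<open>The layer of one step over the cell. Through it, adding up areas of cells becomes
  measuring volume.\<close>

definition slab :: "'k \<Rightarrow> nat \<Rightarrow> int \<Rightarrow> (real^'n) set" where
  "slab k m z = {y. of_int z * (eps m / norm (b k)) \<le> nrm k \<bullet> y \<and> nrm k \<bullet> y < of_int z * (eps m / norm (b k)) + eps m / norm (b k) \<and>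
     onto_hyper (nrm k) (of_int z * (eps m / norm (b k))) y \<in> cell k m z}"

lemma cell_borel [measurable]: "cell k m z \<in> sets borel"
proof -
  have "{x \<in> unit_cube. x \<notin> FS \<and> idx x = m} = unit_cube \<inter> - FS \<inter> (idx -` {m} \<inter> space borel)" by auto
  moreover have "idx -` {m} \<inter> space borel \<in> sets borel" by (rule measurable_sets[OF idx_measurable]) simp
  ultimately have "{x \<in> unit_cube. x \<notin> FS \<and> idx x = m} \<in> sets borel"
    using FS_borel unit_cube_borel by (metis borel_comp sets.Int)
  then show ?thesis unfolding cell_def by (intro sets.Int hyper_borel)
qed

lemma slab_borel [measurable]: "slab k m z \<in> sets borel"
proof -
  have "onto_hyper (nrm k) s -` cell k m z \<inter> space borel \<in> sets borel" for s
    by (rule measurable_sets[OF onto_hyper_measurable cell_borel])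
  then have [measurable]: "{y. onto_hyper (nrm k) s y \<in> cell k m z} \<in> sets borel" for s by (simp add: vimage_def)
  show ?thesis unfolding slab_def by measurable
qed

lemma emeasure_slab:
  assumes k: "k \<in> I"
  shows "emeasure lborel (slab k m z) = ennreal (eps m / norm (b k)) * emeasure H (cell k m z)"
proof -
  define s d where "s = of_int z * (eps m / norm (b k))" and "d = eps m / norm (b k)"
  have d: "0 \<le> d" using eps_pos[of m] by (simp add: d_def)
  note n1 = nrm_unit[OF k]
  have nn: "nrm k \<bullet> nrm k = 1" using n1 by (simp add: norm_eq_1)
  define f where "f y = (indicator (cell k m z) (onto_hyper (nrm k) s y) :: ennreal)" for y
  have f: "f \<in> borel_measurable borel" unfolding f_def[abs_def]
    by (rule measurable_compose[OF onto_hyper_measurable]) simp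
  have inv: "f (x + t *\<^sub>R nrm k) = f x" for x t
  proof -
    have "onto_hyper (nrm k) s (x + t *\<^sub>R nrm k) = onto_hyper (nrm k) s x"
      by (simp add: onto_hyper_def inner_add_right nn algebra_simps)
    then show ?thesis by (simp add: f_def)
  qed
  have "emeasure lborel (slab k m z) = (\<integral>\<^sup>+y. indicator (slab k m z) y \<partial>lborel)" by simp
  also have "\<dots> = (\<integral>\<^sup>+y. f y * indicator {y. s \<le> nrm k \<bullet> y \<and> nrm k \<bullet> y < s + d} y \<partial>lborel)"
    by (intro nn_integral_cong) (auto simp: f_def slab_def s_def d_def indicator_def)
  also have "\<dots> = ennreal (s + d - s) * (\<integral>\<^sup>+y. f y * indicator (strip (nrm k) s) y \<partial>lborel)"
    by (rule nn_integral_slab[OF f inv nn nn]) (use d in simp)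
  also have "(\<integral>\<^sup>+y. f y * indicator (strip (nrm k) s) y \<partial>lborel) = (\<integral>\<^sup>+y. indicator (cyl (nrm k) s (cell k m z)) y \<partial>lborel)"
    by (intro nn_integral_cong) (auto simp: f_def cyl_def indicator_def)
  also have "\<dots> = emeasure lborel (cyl (nrm k) s (cell k m z))" by simp
  also have "\<dots> = emeasure H (cell k m z)"
    using emeasure_hausdorff_hyper[OF n1 cell_borel, of k m z s] by (simp add: cell_def s_def)
  finally show ?thesis by (simp add: d_def)
qed

lemma cells_disjoint: "k \<in> I \<Longrightarrow> disjoint_family (cell k m)"
proof -
  assume k: "k \<in> I"
  have "b k \<bullet> x / eps m = of_int z" if "x \<in> cell k m z" for x z
    using that unfolding cell_def mem_plane[OF k] Int_iff by blast
  then have "z = z'" if "x \<in> cell k m z" "x \<in> cell k m z'" for x z z' using that by (metis of_int_eq_iff)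
  then show ?thesis unfolding disjoint_family_on_def by blast
qed

lemma slabs_disjoint: "k \<in> I \<Longrightarrow> disjoint_family (slab k m)"
proof -
  assume k: "k \<in> I"
  define d where "d = eps m / norm (b k)"
  have d: "0 < d" using eps_pos[of m] b1[OF k] by (auto simp: d_def intro!: divide_pos_pos)
  have "z \<le> z'" if y: "y \<in> slab k m z" "y \<in> slab k m z'" for y z z'
  proof -
    have "of_int z * d < of_int z' * d + d" using y by (auto simp: slab_def d_def)
    then have "of_int z * d < (of_int z' + 1) * d" by (simp add: distrib_right)
    then have "of_int z < (of_int z' + 1 :: real)" using d by (simp add: mult_less_cancel_right)
    then show ?thesis by linarith
  qed
  then show ?thesis unfolding disjoint_family_on_def by (metis IntE antisym ex_in_conv)
qed

text \<open>Step width times area is volume up to the factor \<open>norm (b k)\<close>, and the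
  slabs over different lattice planes are disjoint.\<close>

lemma emeasure_cells:
  assumes k: "k \<in> I"
  shows "ennreal (eps m) * emeasure H (\<Union>z. cell k m z) = ennreal (norm (b k)) * emeasure lborel (\<Union>z. slab k m z)"
proof -
  have c: "ennreal (eps m) = ennreal (norm (b k)) * ennreal (eps m / norm (b k))"
    using b1[OF k] eps_pos[of m] by (subst ennreal_mult[symmetric]) (auto intro!: arg_cong[of _ _ ennreal] simp: field_simps)
  have "emeasure H (\<Union>z. cell k m z) = (\<integral>\<^sup>+z. emeasure H (cell k m z) \<partial>count_space UNIV)"
    by (rule emeasure_UN_countable) (use cells_disjoint[OF k] in auto)
  then have "ennreal (eps m) * emeasure H (\<Union>z. cell k m z)
      = ennreal (norm (b k)) * (\<integral>\<^sup>+z. ennreal (eps m / norm (b k)) * emeasure H (cell k m z) \<partial>count_space UNIV)"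
    unfolding c by (simp add: nn_integral_cmult mult.assoc)
  also have "(\<integral>\<^sup>+z. ennreal (eps m / norm (b k)) * emeasure H (cell k m z) \<partial>count_space UNIV)
      = (\<integral>\<^sup>+z. emeasure lborel (slab k m z) \<partial>count_space UNIV)" unfolding emeasure_slab[OF k] ..
  also have "\<dots> = emeasure lborel (\<Union>z. slab k m z)"
    by (rule emeasure_UN_countable[symmetric]) (use slabs_disjoint[OF k] in auto)
  finally show ?thesis .
qed

text \<open>The slabs of the \<open>m\<close>-th shell stay within the adjacent shells, so that they overlap at most
  three times as \<open>m\<close> varies.\<close>

lemma slab_near:
  assumes k: "k \<in> I" and y: "y \<in> slab k m z"
  shows "y \<in> unit_cube \<and> (m = idx y \<or> m = Suc (idx y) \<or> Suc m = idx y)"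
proof -
  define s where "s = of_int z * (eps m / norm (b k))"
  define x where "x = onto_hyper (nrm k) s y"
  have x: "x \<in> unit_cube" "x \<notin> FS" "idx x = m" using y by (auto simp: slab_def cell_def x_def s_def)
  have "\<bar>nrm k \<bullet> y - s\<bar> \<le> eps m / norm (b k)" using y by (auto simp: slab_def s_def)
  also have "\<dots> \<le> eps m" using b1[OF k] eps_pos[of m] by (simp add: divide_le_eq mult_le_cancel_left1)
  also have "\<dots> \<le> (1/2) ^ (m + 3)" by (rule eps_le)
  finally have d: "norm (x - y) \<le> (1/2) ^ (m + 3)" using nrm_unit[OF k] by (simp add: x_def onto_hyper_def abs_minus_commute)
  have di: "\<bar>\<bar>x $ i\<bar> - \<bar>y $ i\<bar>\<bar> \<le> (1/2) ^ (m + 3)" for i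
    using component_le_norm_cart[of "x - y" i] d by (simp add: abs_le_iff) linarith
  have "y \<in> core (Suc m)"
    unfolding core_def
  proof (intro CollectI allI)
    fix i
    have "\<bar>x $ i\<bar> < rad m" using idx_le_iff[OF x(1), of m] x(3) by (auto simp: core_def)
    then have "\<bar>y $ i\<bar> < rad m + (1/2) ^ (m + 3)" using di[of i] by linarith
    also have "\<dots> = rad (Suc m)" by (simp add: rad_def power_add power3_eq_cube power2_eq_square)
    finally show "\<bar>y $ i\<bar> < rad (Suc m)" .
  qed
  then have y1: "y \<in> unit_cube" "idx y \<le> Suc m" using core_subset idx_le_iff by blast+
  have "m \<le> Suc (idx y)"
  proof (rule ccontr)
    assume "\<not> m \<le> Suc (idx y)"
    then obtain m' where m': "m = Suc (Suc m')" "idx y \<le> m'" by (metis Suc_leI less_imp_Suc_add not_less le_add1 add_Suc)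
    have "y \<in> core m'" using idx_le_iff[OF y1(1)] m' by blast
    have "x \<in> core (Suc m')"
      unfolding core_def
    proof (intro CollectI allI)
      fix i
      have "\<bar>x $ i\<bar> < rad m' + (1/2) ^ (m + 3)" using di[of i] \<open>y \<in> core m'\<close> by (auto simp: core_def abs_le_iff)
          (metis add.commute add_less_le_mono diff_add_cancel)
      also have "\<dots> \<le> rad (Suc m')"
      proof -
        \<comment> \<open>With \<open>z\<close> as unit the claim reads
          \<open>- z/4 + z/32 \<le> - z/8\<close>.\<close>
        define z :: real where "z = (1/2) ^ m'"
        have "(1/2) ^ (m + 3) = z / 32" "rad m' = 1/2 - z / 4" "rad (Suc m') = 1/2 - z / 8" "0 \<le> z"
          by (simp_all add: m'(1) rad_def z_def power_add power_one_over)
        then show ?thesis by linarith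
      qed
      finally show "\<bar>x $ i\<bar> < rad (Suc m')" .
    qed
    then have "m \<le> Suc m'" using idx_le_iff[OF x(1)] x(3) by blast
    then show False using m' by simp
  qed
  then show ?thesis using y1 by linarith
qed

text \<open>For each point at most three values of \<open>m\<close> have a slab through it, so the
  total volume is at most three times that of the cube.\<close>

lemma slabs_bound:
  assumes k: "k \<in> I"
  shows "(\<Sum>m. emeasure lborel (\<Union>z. slab k m z)) \<le> 3"
proof -
  have one: "(\<Sum>m. if m = j then 1 else 0 :: ennreal) = 1" for j :: nat
    using suminf_finite[of "{j}" "\<lambda>m. if m = j then 1 else 0 :: ennreal"] by simp
  have le1: "(\<Sum>m. if Suc m = j then 1 else 0 :: ennreal) \<le> 1" for j :: nat
  proof (cases j)
    case 0 then show ?thesis by simp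
  next
    case (Suc j') then show ?thesis using one[of j'] by simp
  qed
  have "(\<Sum>m. indicator (\<Union>z. slab k m z) y) \<le> (3 * indicator unit_cube y :: ennreal)" for y
  proof (cases "y \<in> unit_cube")
    case True
    have "(\<Sum>m. indicator (\<Union>z. slab k m z) y :: ennreal)
        \<le> (\<Sum>m. (if m = idx y then 1 else 0) + ((if m = Suc (idx y) then 1 else 0) + (if Suc m = idx y then 1 else 0)))"
    proof (intro suminf_le allI)
      fix m
      show "(indicator (\<Union>z. slab k m z) y :: ennreal)
        \<le> (if m = idx y then 1 else 0) + ((if m = Suc (idx y) then 1 else 0) + (if Suc m = idx y then 1 else 0))"
      proof (cases "y \<in> (\<Union>z. slab k m z)")
        case True
        then have "m = idx y \<or> m = Suc (idx y) \<or> Suc m = idx y" using slab_near[OF k] by blast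
        then show ?thesis using True by auto
      qed simp
    qed auto
    also have "\<dots> = (\<Sum>m. if m = idx y then 1 else 0 :: ennreal) +
        ((\<Sum>m. if m = Suc (idx y) then 1 else 0) + (\<Sum>m. if Suc m = idx y then 1 else 0))"
      by (subst suminf_add[symmetric]; (intro summableI)?) (subst suminf_add[symmetric]; (intro summableI)?; simp)
    also have "\<dots> \<le> 1 + (1 + 1)" using one le1 by (intro add_mono) auto
    finally show ?thesis using True by simp
  next
    case False
    then have "y \<notin> (\<Union>z. slab k m z)" for m using slab_near[OF k] by blast
    then show ?thesis by simp
  qed
  then have "(\<integral>\<^sup>+y. (\<Sum>m. indicator (\<Union>z. slab k m z) y) \<partial>lborel) \<le> (\<integral>\<^sup>+y. 3 * indicator (unit_cube :: (real^'n) set) y \<partial>lborel)"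
    by (intro nn_integral_mono)
  also have "\<dots> = 3" using emeasure_unit_cube[where ?'n='n] by (simp add: nn_integral_cmult)
  also have "(\<integral>\<^sup>+y. (\<Sum>m. indicator (\<Union>z. slab k m z) y) \<partial>lborel) = (\<Sum>m. \<integral>\<^sup>+y. indicator (\<Union>z. slab k m z) y \<partial>lborel)"
    by (rule nn_integral_suminf) simp
  finally show ?thesis by simp
qed

text \<open>A jump in shell \<open>m\<close> is at most \<open>2 * AA * eps m\<close>, and step
  width times area of the cells is a volume. Only finiteness is claimed: the number of steps
  balances their height, so the bound does not shrink with \<open>e\<close>.\<close>

lemma interior_bound: "(\<integral>\<^sup>+x. ennreal (norm (T x)) * indicator (- FS) x \<partial>H) < \<infinity>"
proof -
  have "ennreal (norm (T x)) * indicator (- FS) x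
      \<le> (\<Sum>k\<in>I. \<Sum>m. ennreal (2 * AA) * ennreal (eps m) * indicator (\<Union>z. cell k m z) x)" for x
  proof (cases "x \<in> unit_cube \<and> x \<notin> FS \<and> T x \<noteq> 0")
    case True
    then obtain k where k: "k \<in> I" "b k \<bullet> x / eps (idx x) = of_int \<lfloor>b k \<bullet> x / eps (idx x)\<rfloor>"
      using T_off_lattice[of x] by blast
    have "x \<in> cell k (idx x) \<lfloor>b k \<bullet> x / eps (idx x)\<rfloor>"
      unfolding cell_def mem_plane[OF k(1)] Int_iff using True k(2) by blast
    then have xm: "x \<in> (\<Union>z. cell k (idx x) z)" by blast
    define fm where "fm m = ennreal (2 * AA) * ennreal (eps m) * indicator (\<Union>z. cell k m z) x" for m
    have "norm (T x) \<le> 2 * (AA * eps (idx x))" using True beyond_of_idx by (intro T_beyond) auto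
    then have "ennreal (norm (T x)) \<le> ennreal (2 * AA) * ennreal (eps (idx x))"
      using AA_nonneg eps_pos[of "idx x"] by (simp add: ennreal_mult[symmetric] ennreal_leI mult.assoc)
    then have "ennreal (norm (T x)) * indicator (- FS) x \<le> fm (idx x)" using True xm by (simp add: fm_def)
    also have "fm (idx x) = sum fm {idx x}" by simp
    also have "\<dots> \<le> suminf fm" by (rule sum_le_suminf) auto
    also have "\<dots> \<le> (\<Sum>k\<in>I. \<Sum>m. ennreal (2 * AA) * ennreal (eps m) * indicator (\<Union>z. cell k m z) x)"
      unfolding fm_def by (rule member_le_sum[OF k(1)]) (use I in auto)
    finally show ?thesis .
  next
    case False
    then show ?thesis using T_outside[of x] by (auto simp: indicator_def)
  qed
  then have "(\<integral>\<^sup>+x. ennreal (norm (T x)) * indicator (- FS) x \<partial>H)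
      \<le> (\<integral>\<^sup>+x. (\<Sum>k\<in>I. \<Sum>m. ennreal (2 * AA) * ennreal (eps m) * indicator (\<Union>z. cell k m z) x) \<partial>H)"
    by (intro nn_integral_mono)
  also have "\<dots> = (\<Sum>k\<in>I. \<Sum>m. ennreal (2 * AA) * ennreal (eps m) * emeasure H (\<Union>z. cell k m z))"
  proof -
    have "(\<Union>z. cell k m z) \<in> sets H" for k m by simp
    then show ?thesis
      by (subst nn_integral_sum, simp, intro sum.cong refl, subst nn_integral_suminf, simp,
          intro suminf_cong nn_integral_cmult_indicator)
  qed
  also have "\<dots> = (\<Sum>k\<in>I. \<Sum>m. ennreal (2 * AA) * ennreal (norm (b k)) * emeasure lborel (\<Union>z. slab k m z))"
    by (intro sum.cong refl suminf_cong) (simp only: mult.assoc emeasure_cells)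
  also have "\<dots> \<le> (\<Sum>k\<in>I. ennreal (2 * AA) * ennreal (norm (b k)) * 3)"
    by (intro sum_mono) (simp add: mult_left_mono slabs_bound)
  also have "\<dots> < \<infinity>" using I by (simp add: ennreal_mult_less_top less_top[symmetric] ennreal_mult_eq_top_iff)
  finally show ?thesis .
qed

lemma T_split: "(\<integral>\<^sup>+x. ennreal (norm (T x)) \<partial>H)
  = (\<integral>\<^sup>+x. ennreal (norm (T x)) * indicator FS x \<partial>H) + (\<integral>\<^sup>+x. ennreal (norm (T x)) * indicator (- FS) x \<partial>H)"
  by (subst nn_integral_add[symmetric]) (auto intro!: nn_integral_cong simp: indicator_def)

lemma conical_SBV_stair: "conical_SBV unit_cube stair G bnd"
proof (rule conical_SBV_I)
  have "(\<integral>\<^sup>+x. ennreal (norm (T x)) * indicator FS x \<partial>H) < \<infinity>" using faces_bound by (rule le_less_trans) simp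
  then show "(\<integral>\<^sup>+x. ennreal (norm (T x)) \<partial>H) < \<infinity>" unfolding T_split using interior_bound by simp
qed

end

sublocale staircase \<subseteq> conical_SBV unit_cube stair G bnd by (rule conical_SBV_stair)

section \<open>Trace and energy of the staircase\<close>

context staircase begin

text \<open>A point of the cube within \<open>r\<close> of a boundary point satisfies
  \<open>1/2 - rad (idx y) \<le> r\<close>, so its step width is at most \<open>r\<close>, and
  \<open>u\<close> is within a multiple of \<open>r\<close> of the datum. The trace is thus attained
  at every boundary point.\<close>

lemma trace_u: "has_trace unit_cube u (\<lambda>x. C *v x)"
proof -
  define L where "L = onorm (\<lambda>x. C *v x)"
  have bl: "bounded_linear (\<lambda>x. C *v x)" by (rule matrix_vector_mul_bounded_linear)
  have L: "norm (C *v x) \<le> L * norm x" for x unfolding L_def by (rule onorm[OF bl])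
  have L0: "0 \<le> L" unfolding L_def by (rule onorm_pos_le[OF bl])
  have "((\<lambda>r. (LINT y:unit_cube \<inter> ball x r|lebesgue. norm (u y - C *v x)) / r ^ CARD('n)) \<longlongrightarrow> 0) (at_right 0)"
    if x: "x \<in> frontier unit_cube" for x
  proof -
    have "x \<notin> unit_cube" using x by (simp add: frontier_def interior_open[OF unit_cube_open])
    then obtain i where i: "1/2 \<le> \<bar>x $ i\<bar>" by (auto simp: mem_unit_cube not_less)
    define c where "c = (AA + L) * measure lborel (ball (0::real^'n) 1)"
    have near: "norm (u y - C *v x) \<le> (AA + L) * r" if y: "y \<in> unit_cube" "y \<in> ball x r" for y r
    proof -
      have r: "dist x y < r" using y by simp
      have "\<bar>x $ i - y $ i\<bar> \<le> dist x y" using component_le_norm_cart[of "x - y" i] by (simp add: dist_norm)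
      then have "1/2 - \<bar>y $ i\<bar> \<le> r" using i r by linarith
      moreover have "\<bar>y $ i\<bar> < rad (idx y)" using idx_le_iff[OF y(1), of "idx y"] by (auto simp: core_def)
      ultimately have "(1/2) ^ (idx y + 2) \<le> r" by (simp add: rad_def)
      moreover have "eps (idx y) \<le> (1/2) ^ (idx y + 2)"
        using eps_le(1)[of "idx y"] power_decreasing[of "idx y + 2" "idx y + 3" "1/2 :: real"] by simp
      ultimately have "AA * eps (idx y) \<le> AA * r" using AA_nonneg by (intro mult_left_mono) auto
      then have 1: "norm (stair y - (C - G) *v y) \<le> AA * r" using stair_close[OF y(1)] by linarith
      have "norm (C *v (y - x)) \<le> L * norm (y - x)" by (rule L)
      also have "\<dots> \<le> L * r" using r L0 by (intro mult_left_mono) (auto simp: dist_norm norm_minus_commute)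
      finally have 2: "norm (C *v (y - x)) \<le> L * r" .
      have "u y - C *v x = (stair y - (C - G) *v y) + C *v (y - x)"
        by (simp add: u_def matrix_vector_mult_diff_rdistrib matrix_vector_mult_diff_distrib)
      then show ?thesis using norm_triangle_ineq[of "stair y - (C - G) *v y" "C *v (y - x)"] 1 2
        by (simp add: distrib_right)
    qed
    have bnd: "0 \<le> (LINT y:unit_cube \<inter> ball x r|lebesgue. norm (u y - C *v x)) / r ^ CARD('n) \<and>
        (LINT y:unit_cube \<inter> ball x r|lebesgue. norm (u y - C *v x)) / r ^ CARD('n) \<le> c * r" if r: "0 < r" for r
    proof -
      have m: "(\<lambda>y. indicator (unit_cube \<inter> ball x r) y *\<^sub>R norm (u y - C *v x)) \<in> borel_measurable borel"
      proof -
        note [measurable] = u_borel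
        have [measurable]: "ball x r \<in> sets borel" by simp
        show ?thesis by measurable
      qed
      have fin: "emeasure lborel (ball x r) < \<infinity>" by (rule emeasure_lborel_ball_finite)
      have eq: "(LINT y:unit_cube \<inter> ball x r|lebesgue. norm (u y - C *v x))
          = (\<integral>y. indicator (unit_cube \<inter> ball x r) y *\<^sub>R norm (u y - C *v x) \<partial>lborel)"
        unfolding set_lebesgue_integral_def by (rule integral_completion) (use m in simp)
      have "(\<integral>y. indicator (unit_cube \<inter> ball x r) y *\<^sub>R norm (u y - C *v x) \<partial>lborel)
          \<le> (\<integral>y. ((AA + L) * r) * indicator (ball x r) y \<partial>lborel)"
      proof (rule integral_mono')
        show "integrable lborel (\<lambda>y. ((AA + L) * r) * indicator (ball x r) y)"
          using fin by (intro integrable_mult_right integrable_real_indicator) auto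
        fix y
        show "indicator (unit_cube \<inter> ball x r) y *\<^sub>R norm (u y - C *v x) \<le> ((AA + L) * r) * indicator (ball x r) y"
          using near[of y r] r AA_nonneg L0 by (auto simp: indicator_def)
        show "0 \<le> ((AA + L) * r) * indicator (ball x r) y" using r AA_nonneg L0 by simp
      qed
      also have "\<dots> = (AA + L) * r * measure lborel (ball x r)" by simp
      also have "measure lborel (ball x r) = r ^ CARD('n) * measure lborel (ball (0::real^'n) 1)"
        using r by (simp add: content_ball mult.commute)
      finally have "(\<integral>y. indicator (unit_cube \<inter> ball x r) y *\<^sub>R norm (u y - C *v x) \<partial>lborel) \<le> c * r * r ^ CARD('n)"
        by (simp add: c_def mult_ac)
      moreover have "0 \<le> (\<integral>y. indicator (unit_cube \<inter> ball x r) y *\<^sub>R norm (u y - C *v x) \<partial>lborel)"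
        by (intro Bochner_Integration.integral_nonneg) auto
      ultimately show ?thesis unfolding eq using r by (simp add: divide_le_eq)
    qed
    have "((\<lambda>r. c * r) \<longlongrightarrow> c * 0) (at_right 0)" by (intro tendsto_intros)
    then have cr: "((\<lambda>r. c * r) \<longlongrightarrow> 0) (at_right 0)" by simp
    define \<Phi> where "\<Phi> r = (LINT y:unit_cube \<inter> ball x r|lebesgue. norm (u y - C *v x)) / r ^ CARD('n)" for r
    have \<Phi>: "0 \<le> \<Phi> r \<and> \<Phi> r \<le> c * r" if "0 < r" for r unfolding \<Phi>_def by (rule bnd[OF that])
    have lo: "\<forall>\<^sub>F r in at_right 0. 0 \<le> \<Phi> r" by (rule eventually_at_rightI[of 0 1]) (use \<Phi> in auto)
    have hi: "\<forall>\<^sub>F r in at_right 0. \<Phi> r \<le> c * r" by (rule eventually_at_rightI[of 0 1]) (use \<Phi> in auto)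
    have "(\<Phi> \<longlongrightarrow> 0) (at_right 0)" by (rule tendsto_sandwich[OF lo hi tendsto_const cr])
    then show ?thesis unfolding \<Phi>_def[abs_def] .
  qed
  then show ?thesis unfolding has_trace_def by (intro AE_I2) auto
qed

text \<open>Off the faces the trace of the jump tensor has the sign \<open>sg\<close>, so its
  absolute value integrates to \<open>sg * trace (C - G)\<close> up to the faces. The factor
  \<open>2 * CARD('n)\<close> covers both the absolute value and a wrongly signed trace on a
  face.\<close>

lemma energy_le:
  "jump_energy unit_cube u \<le> ennreal (\<bar>trace (C - G)\<bar> + 2 * real CARD('n) * (real CARD('n) * (AA * \<beta>N)) * e)"
proof -
  have bl: "bounded_linear (trace :: real^'n^'n \<Rightarrow> real)"
    by (rule linear_conv_bounded_linear[THEN iffD1]) (auto simp: linear_iff trace_def sum.distrib sum_distrib_left)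
  have it: "integrable H (\<lambda>x. trace (T x))" by (rule integrable_bounded_linear[OF bl T_integrable])
  have iF: "integrable H (\<lambda>x. norm (T x) * indicator FS x)"
    using integrable_mult_indicator[OF _ integrable_norm[OF T_integrable], of FS] by (simp add: mult.commute)
  have AE: "AE x in H. \<bar>trace (T x)\<bar> \<le> sg * trace (T x) + 2 * real CARD('n) * (norm (T x) * indicator FS x)"
    using AE_single
  proof eventually_elim
    case (elim x)
    show ?case
    proof (cases "x \<in> FS")
      case True
      then show ?thesis using abs_trace_le[of "T x"] sg by auto
    next
      case False
      have "0 \<le> sg * trace (T x)"
      proof (cases "x \<in> unit_cube")
        case True then show ?thesis using trace_sign[OF True False elim] by simp
      qed (simp add: T_outside trace_def)
      then show ?thesis using sg False by auto
    qed
  qed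
  have "(\<integral>x. norm (T x) * indicator FS x \<partial>H) \<le> real CARD('n) * (AA * \<beta>N) * e"
  proof -
    have "ennreal (\<integral>x. norm (T x) * indicator FS x \<partial>H) = (\<integral>\<^sup>+x. ennreal (norm (T x) * indicator FS x) \<partial>H)"
      by (rule nn_integral_eq_integral[symmetric, OF iF]) auto
    also have "\<dots> = (\<integral>\<^sup>+x. ennreal (norm (T x)) * indicator FS x \<partial>H)"
      by (intro nn_integral_cong) (auto simp: indicator_def)
    also note faces_bound
    finally show ?thesis using AA_nonneg e01 by (subst (asm) ennreal_le_iff) (auto simp: \<beta>N_def)
  qed
  then have "(2 * real CARD('n)) * (\<integral>x. norm (T x) * indicator FS x \<partial>H) \<le> (2 * real CARD('n)) * (real CARD('n) * (AA * \<beta>N) * e)"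
    by (intro mult_left_mono) auto
  also have "\<dots> = 2 * real CARD('n) * (real CARD('n) * (AA * \<beta>N)) * e" by (simp only: mult.assoc)
  finally have F: "2 * real CARD('n) * (\<integral>x. norm (T x) * indicator FS x \<partial>H) \<le> 2 * real CARD('n) * (real CARD('n) * (AA * \<beta>N)) * e" .
  have "(\<integral>x. trace (T x) \<partial>H) = trace (C - G)"
    using integral_bounded_linear[OF bl T_integrable] integral_T[OF refl trace_u] by simp
  then have tr: "sg * (\<integral>x. trace (T x) \<partial>H) \<le> \<bar>trace (C - G)\<bar>" using sg by auto
  have "jump_energy unit_cube u = ennreal (\<integral>x. \<bar>trace (T x)\<bar> \<partial>H)"
    unfolding jump_energy_T by (rule nn_integral_eq_integral) (use it in auto)
  also have "(\<integral>x. \<bar>trace (T x)\<bar> \<partial>H) \<le> (\<integral>x. sg * trace (T x) + 2 * real CARD('n) * (norm (T x) * indicator FS x) \<partial>H)"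
    by (rule integral_mono_AE) (use it iF AE in auto)
  also have "\<dots> = sg * (\<integral>x. trace (T x) \<partial>H) + 2 * real CARD('n) * (\<integral>x. norm (T x) * indicator FS x \<partial>H)"
    using it iF by simp
  also have "\<dots> \<le> \<bar>trace (C - G)\<bar> + 2 * real CARD('n) * (real CARD('n) * (AA * \<beta>N)) * e"
    using tr F by linarith
  finally show ?thesis by (simp add: ennreal_leI)
qed

end

section \<open>The relaxation formula\<close>

text \<open>In the decomposition of \<open>C - G\<close> into rank-one matrices, the identity
  \<open>e\<^sub>i \<otimes> e\<^sub>i - e\<^sub>o \<otimes> e\<^sub>o = 1/2 (e\<^sub>i - e\<^sub>o) \<otimes> (e\<^sub>i + e\<^sub>o) + 1/2 (e\<^sub>i + e\<^sub>o) \<otimes> (e\<^sub>i - e\<^sub>o)\<close>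
  turns the diagonal into summands with orthogonal factors, except for \<open>trace (C - G) e\<^sub>o \<otimes> e\<^sub>o\<close>.\<close>

lemma exists_recovery:
  fixes C G :: "real^'n^'n"
  assumes \<epsilon>: "0 < \<epsilon>"
  shows "\<exists>u\<in>SBV unit_cube. has_trace unit_cube u (\<lambda>x. C *v x) \<and>
    (AE x in lebesgue. x \<in> unit_cube \<longrightarrow> ac_gradient unit_cube u x = G) \<and>
    jump_energy unit_cube u \<le> ennreal (\<bar>trace (C - G)\<bar> + \<epsilon>)"
proof -
  define j0 :: 'n where "j0 = undefined"
  define K where "K = C - G"
  define t where "t = trace K"
  define I :: "('n \<times> int) set" where "I = UNIV \<times> {-1, 0, 1}"
  \<comment> \<open>For \<open>i\<close> other than \<open>j0\<close> the three values of
    \<open>s\<close> give the directions \<open>e_i - e_0\<close>, \<open>e_i\<close> and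
    \<open>e_i + e_0\<close>, where \<open>e_0\<close> is the axis of \<open>j0\<close>. For
    \<open>i = j0\<close> all three coincide, and \<open>a\<close> vanishes unless
    \<open>s = 0\<close>.\<close>
  define b :: "'n \<times> int \<Rightarrow> real^'n" where
    "b = (\<lambda>(i, s). if i = j0 then axis j0 1 else axis i 1 + of_int s *\<^sub>R axis j0 1)"
  \<comment> \<open>\<open>s = 0\<close> carries column \<open>i\<close> of \<open>K\<close> without
    its diagonal entry, and for \<open>i = j0\<close> the full trace \<open>t\<close> in its place;
    \<open>s = -1\<close> and \<open>s = 1\<close> carry the two halves of the diagonal identity,
    scaled by \<open>K $ i $ i\<close>.\<close>
  define a :: "'n \<times> int \<Rightarrow> real^'n" where
    "a = (\<lambda>(i, s). if s = 0 then (\<chi> l. if l = i then (if i = j0 then t else 0) else K $ l $ i)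
       else if i = j0 then 0 else (K $ i $ i / 2) *\<^sub>R (axis i 1 - of_int s *\<^sub>R axis j0 1))"
  \<comment> \<open>Weight 2 against 1 keeps \<open>e_i - e_0\<close> on the positive side as
    well.\<close>
  define \<kappa> :: "real^'n" where "\<kappa> = (\<chi> i. if i = j0 then 1 else 2)"
  define sg :: real where "sg = (if 0 \<le> t then 1 else -1)"
  \<comment> \<open>The constant in front of \<open>e\<close> in the energy bound; \<open>e\<close>
    is then chosen to make the product at most \<open>\<epsilon>\<close>.\<close>
  define c where "c = 2 * real CARD('n) * (real CARD('n) * ((\<Sum>k\<in>I. norm (a k)) * measure lborel (ball 0 (real CARD('n) + 2) :: (real^'n) set)))"
  have c: "0 \<le> c" by (simp add: c_def sum_nonneg)
  define e where "e = min 1 (\<epsilon> / (c + 1))"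
  have e: "0 < e" "e \<le> 1" using c \<epsilon> by (auto simp: e_def)
  have ce: "c * e \<le> \<epsilon>"
  proof -
    have "c * e \<le> c * (\<epsilon> / (c + 1))" using c by (intro mult_left_mono) (auto simp: e_def)
    also have "\<dots> = (c / (c + 1)) * \<epsilon>" by simp
    also have "\<dots> \<le> 1 * \<epsilon>" using c \<epsilon> by (intro mult_right_mono) auto
    finally show ?thesis by simp
  qed
  interpret st: staircase a b I C G \<kappa> e sg
  proof
    show "finite I" by (simp add: I_def)
    show "1 \<le> norm (b k)" if "k \<in> I" for k
    proof -
      obtain i s where k: "k = (i, s)" by (cases k)
      have "b k $ i = 1" by (simp add: k b_def axis_def)
      then show ?thesis using component_le_norm_cart[of "b k" i] by simp
    qed
    show "0 < \<kappa> \<bullet> b k" if "k \<in> I" for k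
      using that by (auto simp: I_def b_def \<kappa>_def inner_add_right inner_diff_right inner_axis)
    show "0 < \<kappa> $ i" for i by (simp add: \<kappa>_def)
    show "0 \<le> sg * (a k \<bullet> b k)" if "k \<in> I" for k
    proof -
      obtain i s where "k = (i, s)" by (cases k)
      with that have k: "k = (i, s)" "s \<in> {-1, 0, 1}" by (auto simp: I_def)
      have "a k \<bullet> b k = (if s = 0 \<and> i = j0 then t else 0)"
      proof (cases "s = 0")
        case True
        then show ?thesis by (simp add: k a_def b_def inner_axis)
      next
        case False
        then have "s = -1 \<or> s = 1" using k by auto
        then show ?thesis
          by (auto simp: k a_def b_def inner_add_right inner_add_left inner_diff_left inner_diff_right inner_axis_axis)
      qed
      then show ?thesis by (simp add: sg_def)
    qed
    show "sg = 1 \<or> sg = -1" by (simp add: sg_def)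
    show "(\<Sum>k\<in>I. (b k \<bullet> x) *\<^sub>R a k) = (C - G) *v x" for x
    proof (unfold vec_eq_iff, rule allI)
      fix l
      let ?\<delta> = "if l = j0 then 1 else 0 :: real"
      have bx: "b (i, s) \<bullet> x = (if i = j0 then x $ j0 else x $ i + of_int s * x $ j0)" for i s
        by (simp add: b_def inner_add_left inner_axis' )
      have summand: "(\<Sum>s\<in>{-1, 0, 1}. (b (i, s) \<bullet> x) * a (i, s) $ l)
          = K $ l $ i * x $ i - ?\<delta> * x $ j0 * K $ i $ i + (if i = j0 then ?\<delta> * x $ j0 * t else 0)" for i
        unfolding bx by (auto simp: a_def axis_def field_simps)
      have "(\<Sum>k\<in>I. (b k \<bullet> x) *\<^sub>R a k) $ l = (\<Sum>i\<in>UNIV. \<Sum>s\<in>{-1, 0, 1}. (b (i, s) \<bullet> x) * a (i, s) $ l)"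
        unfolding I_def sum.cartesian_product sum_component by (intro sum.cong) (auto split: prod.splits)
      also have "\<dots> = (\<Sum>i\<in>UNIV. K $ l $ i * x $ i) - ?\<delta> * x $ j0 * (\<Sum>i\<in>UNIV. K $ i $ i) + ?\<delta> * x $ j0 * t"
        unfolding summand by (simp add: sum.distrib sum_subtractf sum_distrib_left)
      also have "\<dots> = (K *v x) $ l" by (simp add: t_def trace_def matrix_vector_mult_def)
      finally show "(\<Sum>k\<in>I. (b k \<bullet> x) *\<^sub>R a k) $ l = ((C - G) *v x) $ l" by (simp add: K_def)
    qed
  qed (use e in auto)
  have "jump_energy unit_cube st.u \<le> ennreal (\<bar>trace (C - G)\<bar> + c * e)"
    using st.energy_le unfolding st.AA_def st.\<beta>N_def c_def .
  also have "\<dots> \<le> ennreal (\<bar>trace (C - G)\<bar> + \<epsilon>)" using ce by (intro ennreal_leI) simp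
  finally show ?thesis
    using st.SBV_u st.trace_u st.ac_gradient_AE by (intro bexI[of _ st.u]) auto
qed

text \<open>The vanishing Cantor part is evaluated on the whole cube, where
  \<open>total_derivative\<close> gives \<open>C\<close>; what remains is the integral of the jump
  tensor. Its integrability, part of \<open>SBV\<close>, lets the trace pass inside.\<close>

lemma jump_energy_ge:
  fixes u :: "real^'n \<Rightarrow> real^'n"
  assumes u: "u \<in> SBV unit_cube" and tr: "has_trace unit_cube u (\<lambda>x. C *v x)"
  shows "ennreal \<bar>trace (C - (LINT x:unit_cube|lebesgue. ac_gradient unit_cube u x))\<bar> \<le> jump_energy unit_cube u"
proof -
  let ?H = "hausdorff_measure (CARD('n) - 1) :: (real^'n) measure"
  let ?J = "jump_set unit_cube u"
  have BV: "u \<in> BV unit_cube" using u by (simp add: SBV_def)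
  then have "\<exists>D. has_distributional_derivative unit_cube u D" by (simp add: BV_def)
  then have "has_distributional_derivative unit_cube u (distr_deriv unit_cube u)"
    unfolding distr_deriv_def by (rule someI_ex)
  then obtain M \<sigma> where M: "finite_measure M" "sets M = sets (restrict_space borel unit_cube)" "integrable M \<sigma>"
      "\<forall>E\<in>sets M. distr_deriv unit_cube u E = (LINT x:E|M. \<sigma> x)"
      "\<forall>\<phi>\<in>test_functions unit_cube. \<forall>i j.
           (LINT x:unit_cube|lebesgue. u x $ i * frechet_derivative \<phi> (at x) (axis j 1))
             = - (LINT x|M. \<phi> x * \<sigma> x $ i $ j)"
    unfolding has_distributional_derivative_def by blast
  have sp: "space M = unit_cube" using sets_eq_imp_space_eq[OF M(2)] by (simp add: space_restrict_space)
  then have QM: "unit_cube \<in> sets M" using sets.top[of M] by simp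
  have "distr_deriv unit_cube u unit_cube $ i $ j = C $ i $ j" for i j
  proof -
    interpret cd: cube_derivative u C M \<sigma> i j
    proof (rule cube_derivative.intro)
      show "set_integrable lebesgue unit_cube u" using BV by (simp add: BV_def)
    qed (use M tr in blast)+
    have "distr_deriv unit_cube u unit_cube $ i $ j = (LINT x:unit_cube|M. \<sigma> x) $ i $ j" using M(4) QM by simp
    also have "\<dots> = (LINT x:unit_cube|M. \<sigma> x $ i $ j)" by (rule set_lebesgue_integral_component[OF M(3) QM])
    also have "\<dots> = (\<integral>x. \<sigma> x $ i $ j \<partial>M)"
      unfolding set_lebesgue_integral_def by (intro Bochner_Integration.integral_cong) (auto simp: sp)
    finally show ?thesis using cd.total_derivative by (simp add: cd.\<tau>_def)
  qed
  then have D: "distr_deriv unit_cube u unit_cube = C" by (simp add: vec_eq_iff)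
  have "cantor_part unit_cube u unit_cube = 0" using u by (auto simp: SBV_def)
  moreover have "unit_cube \<inter> ?J = ?J" by (auto simp: jump_set_def)
  ultimately have eq: "C - (LINT x:unit_cube|lebesgue. ac_gradient unit_cube u x) = (LINT x:?J|?H. jump_tensor u x)"
    unfolding cantor_part_def D by simp
  have int: "integrable ?H (\<lambda>x. indicator ?J x *\<^sub>R jump_tensor u x)"
    using u by (simp add: SBV_def set_integrable_def)
  have bl: "bounded_linear (trace :: real^'n^'n \<Rightarrow> real)"
    by (rule linear_conv_bounded_linear[THEN iffD1]) (auto simp: linear_iff trace_def sum.distrib sum_distrib_left)
  have "trace (LINT x:?J|?H. jump_tensor u x) = (\<integral>x. trace (indicator ?J x *\<^sub>R jump_tensor u x) \<partial>?H)"
    unfolding set_lebesgue_integral_def using integral_bounded_linear[OF bl int] by simp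
  moreover have "ennreal (norm (\<integral>x. trace (indicator ?J x *\<^sub>R jump_tensor u x) \<partial>?H))
      \<le> (\<integral>\<^sup>+x. ennreal (norm (trace (indicator ?J x *\<^sub>R jump_tensor u x))) \<partial>?H)"
    by (rule integral_norm_bound_ennreal[OF integrable_bounded_linear[OF bl int]])
  moreover have "(\<integral>\<^sup>+x. ennreal (norm (trace (indicator ?J x *\<^sub>R jump_tensor u x))) \<partial>?H) = jump_energy unit_cube u"
    unfolding jump_energy_def
    by (intro nn_integral_cong) (auto simp: indicator_def jump_tensor_outer trace_outer trace_def[of 0])
  ultimately show ?thesis unfolding eq by simp
qed

text \<open>Lebesgue measure is complete, so preimages may change by subsets of null sets.\<close>

lemma borel_measurable_lebesgue_AE:
  fixes f g :: "'a::euclidean_space \<Rightarrow> 'b::topological_space"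
  assumes g: "g \<in> borel_measurable lebesgue" and AE: "AE x in lebesgue. g x = f x"
  shows "f \<in> borel_measurable lebesgue"
proof (rule borel_measurableI)
  fix S :: "'b set" assume "open S"
  then have "g -` S \<in> sets lebesgue" using measurable_sets[OF g, of S] by simp
  then have "f -` S \<in> sets lebesgue"
    by (rule completion.in_sets_AE[rotated]) (use AE in \<open>auto elim: eventually_mono\<close>)
  then show "f -` S \<inter> space lebesgue \<in> sets lebesgue" by simp
qed

text \<open>\<open>ac_gradient\<close> is known only up to null sets; completeness supplies
  measurability, and volume one makes the integral equal to the constant.\<close>

lemma set_integral_unit_cube_AE:
  fixes f :: "real^'n \<Rightarrow> 'b::{banach, second_countable_topology}"
  assumes AE: "AE x in lebesgue. x \<in> unit_cube \<longrightarrow> f x = c"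
  shows "set_integrable lebesgue unit_cube f" "(LINT x:unit_cube|lebesgue. f x) = c"
proof -
  have m: "emeasure lebesgue (unit_cube :: (real^'n) set) = 1" using emeasure_unit_cube by simp
  let ?g = "\<lambda>x. indicator (unit_cube :: (real^'n) set) x *\<^sub>R c"
  have ig: "integrable lebesgue ?g" using m by (intro integrable_scaleR_left integrable_real_indicator) auto
  have ae: "AE x in lebesgue. ?g x = indicator unit_cube x *\<^sub>R f x"
    using AE by eventually_elim (auto simp: indicator_def)
  have meas: "(\<lambda>x. indicator unit_cube x *\<^sub>R f x) \<in> borel_measurable lebesgue"
    by (rule borel_measurable_lebesgue_AE[OF borel_measurable_integrable[OF ig] ae])
  show "set_integrable lebesgue unit_cube f"
    unfolding set_integrable_def by (rule integrable_cong_AE_imp[OF ig meas]) (use ae in \<open>auto elim: eventually_mono\<close>)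
  have "(LINT x:unit_cube|lebesgue. f x) = (\<integral>x. ?g x \<partial>lebesgue)"
    unfolding set_lebesgue_integral_def
    by (rule integral_cong_AE[OF meas borel_measurable_integrable[OF ig]]) (use ae in \<open>auto elim: eventually_mono\<close>)
  also have "\<dots> = measure lebesgue (unit_cube :: (real^'n) set) *\<^sub>R c" using m by simp
  also have "measure lebesgue (unit_cube :: (real^'n) set) = 1" using m unfolding measure_def by simp
  finally show "(LINT x:unit_cube|lebesgue. f x) = c" by simp
qed

theorem mainTheorem1:
  fixes A B :: "real^'n^'n" and p :: real
  assumes "p > 1"
  shows "(INF u\<in>admissible_pointwise A B. jump_energy unit_cube u) \<le> ennreal \<bar>trace (A - B)\<bar> \<and>
         (INF u\<in>admissible_average p A B. jump_energy unit_cube u)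
           = (INF u\<in>admissible_pointwise A B. jump_energy unit_cube u) \<and>
         (INF u\<in>admissible_pointwise A B. jump_energy unit_cube u) = ennreal \<bar>trace (A - B)\<bar>"
proof -
  have upper: "(INF u\<in>X. jump_energy unit_cube u) \<le> ennreal \<bar>trace (A - B)\<bar>"
    if X: "\<And>\<epsilon>. 0 < \<epsilon> \<Longrightarrow> \<exists>u\<in>X. jump_energy unit_cube u \<le> ennreal (\<bar>trace (A - B)\<bar> + \<epsilon>)" for X :: "(real^'n \<Rightarrow> real^'n) set"
  proof (rule ennreal_le_epsilon)
    fix \<epsilon> :: real assume "0 < \<epsilon>"
    then obtain u where "u \<in> X" "jump_energy unit_cube u \<le> ennreal (\<bar>trace (A - B)\<bar> + \<epsilon>)" using X by blast
    then show "(INF u\<in>X. jump_energy unit_cube u) \<le> ennreal \<bar>trace (A - B)\<bar> + ennreal \<epsilon>"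
      using \<open>0 < \<epsilon>\<close> by (intro INF_lower2) auto
  qed
  \<comment> \<open>The pointwise class is the recovery problem with zero trace and gradient
    \<open>B - A\<close>, so \<open>C - G\<close> becomes \<open>A - B\<close>.\<close>
  have tr: "trace (0 - (B - A)) = trace (A - B)" by simp
  have z: "(\<lambda>x. 0 *v x) = (\<lambda>x :: real^'n. 0 :: real^'n)" by (simp add: fun_eq_iff)
  have "(INF u\<in>admissible_pointwise A B. jump_energy unit_cube u) \<le> ennreal \<bar>trace (A - B)\<bar>"
  proof (rule upper)
    fix \<epsilon> :: real assume "0 < \<epsilon>"
    from exists_recovery[OF this, of 0 "B - A"] obtain u where u: "u \<in> SBV unit_cube"
      "has_trace unit_cube u (\<lambda>x. 0 *v x)" "AE x in lebesgue. x \<in> unit_cube \<longrightarrow> ac_gradient unit_cube u x = B - A"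
      "jump_energy unit_cube u \<le> ennreal (\<bar>trace (0 - (B - A))\<bar> + \<epsilon>)" by blast
    have "u \<in> admissible_pointwise A B" using u(1-3) unfolding admissible_pointwise_def z mem_Collect_eq by (intro conjI)
    then show "\<exists>u\<in>admissible_pointwise A B. jump_energy unit_cube u \<le> ennreal (\<bar>trace (A - B)\<bar> + \<epsilon>)"
      using u(4) unfolding tr by blast
  qed
  moreover have "ennreal \<bar>trace (A - B)\<bar> \<le> (INF u\<in>admissible_pointwise A B. jump_energy unit_cube u)"
  proof (rule INF_greatest)
    fix u assume "u \<in> admissible_pointwise A B"
    then have u: "u \<in> SBV unit_cube" "has_trace unit_cube u (\<lambda>x. 0 *v x)"
      "AE x in lebesgue. x \<in> unit_cube \<longrightarrow> ac_gradient unit_cube u x = B - A"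
      unfolding admissible_pointwise_def z by blast+
    from jump_energy_ge[OF u(1,2)] show "ennreal \<bar>trace (A - B)\<bar> \<le> jump_energy unit_cube u"
      unfolding set_integral_unit_cube_AE(2)[OF u(3)] tr .
  qed
  moreover have "(INF u\<in>admissible_average p A B. jump_energy unit_cube u) \<le> ennreal \<bar>trace (A - B)\<bar>"
  proof (rule upper)
    fix \<epsilon> :: real assume "0 < \<epsilon>"
    from exists_recovery[OF this, of A B] obtain u where u: "u \<in> SBV unit_cube"
      "has_trace unit_cube u (\<lambda>x. A *v x)" "AE x in lebesgue. x \<in> unit_cube \<longrightarrow> ac_gradient unit_cube u x = B"
      "jump_energy unit_cube u \<le> ennreal (\<bar>trace (A - B)\<bar> + \<epsilon>)" by blast
    \<comment> \<open>The recovery function has the gradient \<open>B\<close> almost everywhere, so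
      the \<open>p\<close>-th power of its norm is integrable and its mean over the cube of volume
      one is \<open>B\<close>.\<close>
    have "AE x in lebesgue. x \<in> unit_cube \<longrightarrow> norm (ac_gradient unit_cube u x) powr p = norm B powr p"
      using u(3) by eventually_elim simp
    then have "set_integrable lebesgue unit_cube (\<lambda>x. norm (ac_gradient unit_cube u x) powr p)"
      by (rule set_integral_unit_cube_AE(1))
    then have "u \<in> admissible_average p A B"
      unfolding admissible_average_def mem_Collect_eq
      by (intro conjI u(1,2) set_integral_unit_cube_AE(2)[OF u(3)])
    then show "\<exists>u\<in>admissible_average p A B. jump_energy unit_cube u \<le> ennreal (\<bar>trace (A - B)\<bar> + \<epsilon>)"
      using u(4) by blast
  qed
  moreover have "ennreal \<bar>trace (A - B)\<bar> \<le> (INF u\<in>admissible_average p A B. jump_energy unit_cube u)"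
  proof (rule INF_greatest)
    fix u assume "u \<in> admissible_average p A B"
    then have u: "u \<in> SBV unit_cube" "has_trace unit_cube u (\<lambda>x. A *v x)"
      "(LINT x:unit_cube|lebesgue. ac_gradient unit_cube u x) = B"
      unfolding admissible_average_def by blast+
    from jump_energy_ge[OF u(1,2)] show "ennreal \<bar>trace (A - B)\<bar> \<le> jump_energy unit_cube u" unfolding u(3) .
  qed
  ultimately show ?thesis by (metis order_antisym)
qed

end
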